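(* Assume that $U_2$ is not integrable at $0^+$ and that $\int_{-\varepsilon}^0a(\xi)\,d\xi>0$ for every $\varepsilon>0$. Let $\eta\in H_{++}$ and consider the closed-loop delay state equation $$\begin{cases} x'(t)=rx(t)+f_0\left(x(t),\int_{-T}^0a(\xi)x(t+\xi)\,d\xi\right)-C\left((x(t),x(t+\xi)|_{\xi\in[-T,0]})\right),\\ x(0)=\eta_0,\quad x(s)=\eta_1(s),\ s\in[-T,0). \end{cases}$$ Then this equation admits a solution $x^*(\cdot)\in C^1([0,+\infty);\mathbb{R})$. Moreover, for all $t\ge0$, $$x^*(t)>0,\qquad (x^*(t),x^*(t+\xi)|_{\xi\in[-T,0]})\in\mathcal{D}(V).$$ In particular the feedback strategy $c^*(t):=C\left((x^*(t),x^*(t+\xi)|_{\xi\in[-T,0]})\right)$, $t\ge 0$, is admissible, i.e. $c^*(\cdot)\in\mathcal{C}(\eta)$.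
   Context: Setting. Fix $T>0$, $\rho>0$, $r>0$. Put $L^2_{-T}=L^2([-T,0];\mathbb{R})$, $W^{1,2}_{-T}=W^{1,2}([-T,0];\mathbb{R})$, $H=\mathbb{R}\times L^2_{-T}$ with its Hilbert product norm $\|\cdot\|$, elements $\eta=(\eta_0,\eta_1(\cdot))$, $H_+=(0,+\infty)\times L^2_{-T}$, and $H_{++}=(0,+\infty)\times\{\eta_1\in L^2_{-T}:\eta_1\ge0 \text{ a.e.}\}$. $\mathbb{R}^+=[0,+\infty)$. Assumptions on $a,f_0$: $a\in W^{1,2}_{-T}$, $a\ge 0$, $a(-T)=0$; $f_0:[0,\infty)\times\mathbb{R}\to\mathbb{R}$ is jointly concave, nondecreasing in the second variable, Lipschitz continuous with constant $C_{f_0}$, and $f_0(0,y)>0$ for all $y>0$. To make sense of trajectories that become negative, $f_0$ is extended by $f_0(x,y)=f_0(0,y)$ for $x<0$. Assumptions on utilities: $U_1\in C([0,\infty))\cap C^2((0,\infty))$ is bounded, $U_1'>0$, $U_1'(0^+)=+\infty$, $U_1''<0$; $U_2\in C((0,\infty))$ is increasing (not necessarily strictly), concave, bounded from above, and $\int_0^{\infty}e^{-\rho t}U_2(e^{-C_{f_0}t})\,dt>-\infty$. "$U_2$ not integrable at $0^+$" means $\int_0^\delta U_2(x)\,dx=-\infty$ for $\delta>0$. For $\eta\in H_+$ and $c\in L^1_{loc}([0,\infty);\mathbb{R}^+)$, $x(\cdot;\eta,c)$ is the unique solution, absolutely continuous on $[0,\infty)$, of $x(t)=\eta_0+\int_0^t\big[rx(s)+f_0(x(s),\int_{-T}^0a(\xi)x(s+\xi)d\xi)-c(s)\big]ds$,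 $t\ge0$, with $x=\eta_1$ on $[-T,0)$. Admissible controls: $\mathcal{C}(\eta)=\{c\in L^1_{loc}([0,\infty);\mathbb{R}^+): x(t;\eta,c)>0\ \forall t\ge0\}$. Objective: $J(\eta;c)=\int_0^\infty e^{-\rho t}[U_1(c(t))+U_2(x(t;\eta,c))]dt$. Value function: $V(\eta)=\sup_{c\in\mathcal{C}(\eta)}J(\eta;c)$ (with $\sup\emptyset=-\infty$), with domain $\mathcal{D}(V)=\{\eta\in H_+: V(\eta)>-\infty\}$. Known facts making the feedback map well defined: $H_{++}\subset\mathcal{D}(V)$, $\mathcal{D}(V)$ is an open convex subset of $H$, $V$ is concave on $\mathcal{D}(V)$ and strictly increasing in $\eta_0$, and $V$ is differentiable at every point of $\mathcal{D}(V)$ in the direction $(1,0)$, with derivative $V_{\eta_0}:\mathcal{D}(V)\to(0,\infty)$ continuous. The feedback map is $C(\eta)=\mathrm{argmax}_{c\ge0}\,(U_1(c)-c\,V_{\eta_0}(\eta))$, $\eta\in\mathcal{D}(V)$ (single-valued and continuous). *)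

theory Defs
  imports "HOL-Analysis.Analysis"
begin

text \<open>
  Elements of \<open>L\<^sup>2([-T,0])\<close> and controls are represented by Lebesgue measurable functions
  \<open>real \<Rightarrow> real\<close>; their values outside the domain are irrelevant below. An element
  \<open>(\<eta>\<^sub>0, \<eta>\<^sub>1)\<close> of \<open>H\<close> is a pair of type \<open>real \<times> (real \<Rightarrow> real)\<close>.
\<close>

definition L2 :: "real \<Rightarrow> (real \<Rightarrow> real) set" where
  "L2 T = {u. u \<in> borel_measurable (lebesgue_on {-T..0}) \<and>
              integrable (lebesgue_on {-T..0}) (\<lambda>\<xi>. (u \<xi>)\<^sup>2)}"

text \<open>
  In dimension one, a \<open>W\<^sup>1\<^sup>,\<^sup>2\<close> class is identified with its continuous representative,
  which is the indefinite integral of the weak derivative. This representative is what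
  gives pointwise conditions such as \<open>a (-T) = 0\<close> their meaning.
\<close>

definition W12 :: "real \<Rightarrow> (real \<Rightarrow> real) set" where
  "W12 T = {u. \<exists>w \<in> L2 T. \<forall>\<xi>\<in>{-T..0}. u \<xi> = u (-T) + integral\<^sup>L (lebesgue_on {-T..\<xi>}) w}"

definition H_plus :: "real \<Rightarrow> (real \<times> (real \<Rightarrow> real)) set" where
  "H_plus T = {0<..} \<times> L2 T"

definition H_plus_plus :: "real \<Rightarrow> (real \<times> (real \<Rightarrow> real)) set" where
  "H_plus_plus T = {0<..} \<times> {u \<in> L2 T. AE \<xi> in lebesgue_on {-T..0}. 0 \<le> u \<xi>}"

text \<open>
  Lebesgue integral with values in the extended reals. It is only applied to measurable
  integrands with finite positive part, so that no \<open>\<infinity> - \<infinity>\<close> occurs.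
\<close>

definition ext_integral :: "real set \<Rightarrow> (real \<Rightarrow> real) \<Rightarrow> ereal" where
  "ext_integral A g =
     enn2ereal (\<integral>\<^sup>+ t. ennreal (g t) \<partial>lebesgue_on A)
     - enn2ereal (\<integral>\<^sup>+ t. ennreal (- g t) \<partial>lebesgue_on A)"

definition extend_f0 :: "(real \<Rightarrow> real \<Rightarrow> real) \<Rightarrow> real \<Rightarrow> real \<Rightarrow> real" where
  "extend_f0 f0 x y = (if x < 0 then f0 0 y else f0 x y)"

definition segment :: "(real \<Rightarrow> real) \<Rightarrow> real \<Rightarrow> real \<times> (real \<Rightarrow> real)" where
  "segment x t = (x t, \<lambda>\<xi>. x (t + \<xi>))"

text \<open>The right-hand side of the state equation without the control term.\<close>

definition drift ::
  "real \<Rightarrow> real \<Rightarrow> (real \<Rightarrow> real) \<Rightarrow> (real \<Rightarrow> real \<Rightarrow> real) \<Rightarrow> (real \<Rightarrow> real) \<Rightarrow> real \<Rightarrow> real" where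
  "drift T r a f0 x s =
     r * x s + extend_f0 f0 (x s) (integral\<^sup>L (lebesgue_on {-T..0}) (\<lambda>\<xi>. a \<xi> * x (s + \<xi>)))"

text \<open>
  A solution is the indefinite integral of a locally integrable function, hence it is
  absolutely continuous on \<open>[0,\<infinity>)\<close>.
\<close>

definition is_state ::
  "real \<Rightarrow> real \<Rightarrow> (real \<Rightarrow> real) \<Rightarrow> (real \<Rightarrow> real \<Rightarrow> real) \<Rightarrow> real \<times> (real \<Rightarrow> real) \<Rightarrow> (real \<Rightarrow> real)
    \<Rightarrow> (real \<Rightarrow> real) \<Rightarrow> bool" where
  "is_state T r a f0 \<eta> c x \<longleftrightarrow>
     (\<forall>s. -T \<le> s \<and> s < 0 \<longrightarrow> x s = snd \<eta> s) \<and>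
     (\<forall>t\<ge>0. integrable (lebesgue_on {0..t}) (\<lambda>s. drift T r a f0 x s - c s) \<and>
            x t = fst \<eta> + integral\<^sup>L (lebesgue_on {0..t}) (\<lambda>s. drift T r a f0 x s - c s))"

text \<open>
  The trajectory \<open>x(\<cdot>; \<eta>, c)\<close>. Prescribing the irrelevant values before time \<open>-T\<close> makes the
  solution unique as a function on the whole real line.
\<close>

definition state ::
  "real \<Rightarrow> real \<Rightarrow> (real \<Rightarrow> real) \<Rightarrow> (real \<Rightarrow> real \<Rightarrow> real) \<Rightarrow> real \<times> (real \<Rightarrow> real) \<Rightarrow> (real \<Rightarrow> real)
    \<Rightarrow> real \<Rightarrow> real" where
  "state T r a f0 \<eta> c = (THE x. is_state T r a f0 \<eta> c x \<and> (\<forall>t < -T. x t = 0))"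

definition admissible ::
  "real \<Rightarrow> real \<Rightarrow> (real \<Rightarrow> real) \<Rightarrow> (real \<Rightarrow> real \<Rightarrow> real) \<Rightarrow> real \<times> (real \<Rightarrow> real)
    \<Rightarrow> (real \<Rightarrow> real) set" where
  "admissible T r a f0 \<eta> =
     {c. (\<forall>t\<ge>0. 0 \<le> c t) \<and> (\<forall>t\<ge>0. integrable (lebesgue_on {0..t}) c) \<and>
         (\<forall>t\<ge>0. state T r a f0 \<eta> c t > 0)}"

definition objective ::
  "real \<Rightarrow> real \<Rightarrow> real \<Rightarrow> (real \<Rightarrow> real) \<Rightarrow> (real \<Rightarrow> real \<Rightarrow> real) \<Rightarrow> (real \<Rightarrow> real) \<Rightarrow> (real \<Rightarrow> real)
    \<Rightarrow> real \<times> (real \<Rightarrow> real) \<Rightarrow> (real \<Rightarrow> real) \<Rightarrow> ereal" where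
  "objective T \<rho> r a f0 U1 U2 \<eta> c =
     ext_integral {0..} (\<lambda>t. exp (- \<rho> * t) * (U1 (c t) + U2 (state T r a f0 \<eta> c t)))"

definition value_fun ::
  "real \<Rightarrow> real \<Rightarrow> real \<Rightarrow> (real \<Rightarrow> real) \<Rightarrow> (real \<Rightarrow> real \<Rightarrow> real) \<Rightarrow> (real \<Rightarrow> real) \<Rightarrow> (real \<Rightarrow> real)
    \<Rightarrow> real \<times> (real \<Rightarrow> real) \<Rightarrow> ereal" where
  "value_fun T \<rho> r a f0 U1 U2 \<eta> =
     (SUP c \<in> admissible T r a f0 \<eta>. objective T \<rho> r a f0 U1 U2 \<eta> c)"

definition value_dom ::
  "real \<Rightarrow> real \<Rightarrow> real \<Rightarrow> (real \<Rightarrow> real) \<Rightarrow> (real \<Rightarrow> real \<Rightarrow> real) \<Rightarrow> (real \<Rightarrow> real) \<Rightarrow> (real \<Rightarrow> real)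
    \<Rightarrow> (real \<times> (real \<Rightarrow> real)) set" where
  "value_dom T \<rho> r a f0 U1 U2 = {\<eta> \<in> H_plus T. value_fun T \<rho> r a f0 U1 U2 \<eta> > -\<infinity>}"

text \<open>
  The derivative of the value function in the direction \<open>(1,0)\<close>. The value function is
  finite on the open set \<open>value_dom\<close>, so \<open>real_of_ereal\<close> is harmless there.
\<close>

definition value_deriv ::
  "real \<Rightarrow> real \<Rightarrow> real \<Rightarrow> (real \<Rightarrow> real) \<Rightarrow> (real \<Rightarrow> real \<Rightarrow> real) \<Rightarrow> (real \<Rightarrow> real) \<Rightarrow> (real \<Rightarrow> real)
    \<Rightarrow> real \<times> (real \<Rightarrow> real) \<Rightarrow> real" where
  "value_deriv T \<rho> r a f0 U1 U2 \<eta> =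
     deriv (\<lambda>z. real_of_ereal (value_fun T \<rho> r a f0 U1 U2 (z, snd \<eta>))) (fst \<eta>)"

definition feedback ::
  "real \<Rightarrow> real \<Rightarrow> real \<Rightarrow> (real \<Rightarrow> real) \<Rightarrow> (real \<Rightarrow> real \<Rightarrow> real) \<Rightarrow> (real \<Rightarrow> real) \<Rightarrow> (real \<Rightarrow> real)
    \<Rightarrow> real \<times> (real \<Rightarrow> real) \<Rightarrow> real" where
  "feedback T \<rho> r a f0 U1 U2 \<eta> =
     arg_max (\<lambda>c. U1 c - c * value_deriv T \<rho> r a f0 U1 U2 \<eta>) (\<lambda>c. 0 \<le> c)"

text \<open>Classical solutions of the closed-loop equation; the derivative at \<open>0\<close> is one-sided.\<close>

definition closed_loop_solution ::
  "real \<Rightarrow> real \<Rightarrow> real \<Rightarrow> (real \<Rightarrow> real) \<Rightarrow> (real \<Rightarrow> real \<Rightarrow> real) \<Rightarrow> (real \<Rightarrow> real) \<Rightarrow> (real \<Rightarrow> real)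
    \<Rightarrow> real \<times> (real \<Rightarrow> real) \<Rightarrow> (real \<Rightarrow> real) \<Rightarrow> bool" where
  "closed_loop_solution T \<rho> r a f0 U1 U2 \<eta> x \<longleftrightarrow>
     x 0 = fst \<eta> \<and>
     (\<forall>s. -T \<le> s \<and> s < 0 \<longrightarrow> x s = snd \<eta> s) \<and>
     (\<forall>t\<ge>0. (x has_real_derivative
               drift T r a f0 x t - feedback T \<rho> r a f0 U1 U2 (segment x t)) (at t within {0..}))"

definition C1_half_line :: "(real \<Rightarrow> real) \<Rightarrow> bool" where
  "C1_half_line x \<longleftrightarrow>
     (\<exists>x'. (\<forall>t\<ge>0. (x has_real_derivative x' t) (at t within {0..})) \<and> continuous_on {0..} x')"

definition C2_pos :: "(real \<Rightarrow> real) \<Rightarrow> bool" where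
  "C2_pos u \<longleftrightarrow>
     (\<forall>x>0. u field_differentiable at x) \<and>
     (\<forall>x>0. deriv u field_differentiable at x) \<and>
     continuous_on {0<..} (deriv (deriv u))"

end

theory Submission
  imports Defs "HOL-Probability.Helly_Selection"
begin

text \<open>
  No dynamic programming equation is used. Instead an optimal pair is produced by compactness and
  its control is shown to be the feedback control.

  Controls of a maximizing sequence converge almost everywhere since \<open>U1\<close> is strictly concave, and
  the states converge by Helly's selection theorem. The limit state is positive because \<open>U2\<close> is not
  integrable at zero. Comparing an optimal control \<open>c\<close> with perturbations that move consumption
  between two times shows that \<open>U1' (c t)\<close> is locally Lipschitz and positive, so that \<open>c\<close> has a
  continuous positive version. Shifting the initial state and returning to the optimal state within
  a short time shows that \<open>V\<close> is differentiable in the first variable at the initial datum with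
  derivative \<open>U1' (c 0)\<close>. Tails of optimal pairs are optimal, hence the derivative of \<open>V\<close> along the
  optimal trajectory at time \<open>t\<close> is \<open>U1' (c t)\<close>, and \<open>c t\<close> maximizes \<open>U1 z - z * U1' (c t)\<close>.
\<close>

subsection \<open>Preliminaries on integrals\<close>

text \<open>Admissible controls are bounded only in \<open>L1\<close> on bounded intervals, so they
  may concentrate, and the drift is nonlinear, so weak limits would not pass through the state
  equation. This is why convergence almost everywhere is extracted from strict concavity, and why
  mass lost by concentration needs a separate treatment. A trajectory is described by the density
  \<open>g\<close> of its derivative instead of its control: since the drift is concave, the
  constraint "\<open>g\<close> is at most \<open>D x\<close>" survives convex combinations, whereas
  the state equation for pairs of state and control does not. \<open>f0\<close> may have kinks, and
  the delay passes every change of the state on for a further time \<open>T\<close>. Perturbations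
  are therefore taken with small positive size only, end a time \<open>T\<close> before the horizon,
  and yield first-order inequalities instead of an adjoint equation. Raising the state by \<phi>
  lowers \<open>f0\<close> by at most \<open>Cf * \<phi>\<close>, because \<open>f0\<close> is
  monotone in the delayed variable; this is why \<open>Cf\<close> is the rate in the exponential
  weights.\<close>

lemma integrable_lebesgue_on_iff:
  fixes f :: "real \<Rightarrow> real"
  assumes "S \<in> sets lebesgue"
  shows "integrable (lebesgue_on S) f \<longleftrightarrow> f absolutely_integrable_on S"
  using assms by (simp add: integrable_restrict_space set_integrable_def)

lemma absolutely_integrable_shift:
  fixes f :: "real \<Rightarrow> real"
  shows "(\<lambda>x. f (x + p)) absolutely_integrable_on {c..d} \<longleftrightarrow> f absolutely_integrable_on {c + p..d + p}"
proof -
  have "(\<lambda>x. indicator {c + p..d + p} (p + 1 * x) *\<^sub>R f (p + 1 * x)) = (\<lambda>x. indicator {c..d} x *\<^sub>R f (x + p))"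
    by (auto simp: fun_eq_iff indicator_def add.commute)
  then show ?thesis
    using lebesgue_integrable_real_affine_iff[of 1 "\<lambda>x. indicator {c + p..d + p} x *\<^sub>R f x" p]
    unfolding set_integrable_def by simp
qed

lemma absolutely_integrable_mult_continuous:
  fixes f b :: "real \<Rightarrow> real"
  assumes "continuous_on {c..d} b" "f absolutely_integrable_on {c..d}"
  shows "(\<lambda>x. b x * f x) absolutely_integrable_on {c..d}"
  using assms
  by (intro absolutely_integrable_bounded_measurable_product_real)
     (auto intro: continuous_imp_measurable_on_sets_lebesgue compact_imp_bounded compact_continuous_image)

lemma absolutely_integrable_bounded:
  fixes f :: "real \<Rightarrow> real"
  assumes "f \<in> borel_measurable (lebesgue_on {c..d})" "\<And>x. x \<in> {c..d} \<Longrightarrow> \<bar>f x\<bar> \<le> B"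
  shows "f absolutely_integrable_on {c..d}"
  by (rule measurable_bounded_by_integrable_imp_absolutely_integrable[where g = "\<lambda>_. B"])
     (use assms in auto)

lemma integral_abs_le:
  fixes f g :: "real \<Rightarrow> real"
  assumes "f absolutely_integrable_on S" "g integrable_on S" "\<And>x. x \<in> S \<Longrightarrow> \<bar>f x\<bar> \<le> g x"
  shows "\<bar>integral S f\<bar> \<le> integral S g"
  using integral_norm_bound_integral[of f S g] assms
  by (auto simp: absolutely_integrable_on_def)

lemma AE_lebesgue_negligible:
  "(AE x in lebesgue. P x) \<longleftrightarrow> (\<exists>Z. negligible Z \<and> (\<forall>x. x \<notin> Z \<longrightarrow> P x))"
  unfolding completion.AE_iff_null_sets negligible_iff_null_sets
  by (auto intro: completion.complete2 elim!: bexI[rotated])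

lemma integral_exp_le:
  assumes "0 \<le> t" "0 < K"
  shows "integral {0..t} (\<lambda>s. exp (K * s)) = (exp (K * t) - 1) / (K :: real)"
    "(\<lambda>s. exp (K * s)) integrable_on {0..t}"
proof -
  have "((\<lambda>s. exp (K * s)) has_integral (exp (K * t) / K - exp (K * 0) / K)) {0..t}"
    by (rule fundamental_theorem_of_calculus)
       (use assms in \<open>auto intro!: derivative_eq_intros simp: has_real_derivative_iff_has_vector_derivative[symmetric]\<close>)
  then show "integral {0..t} (\<lambda>s. exp (K * s)) = (exp (K * t) - 1) / K"
    "(\<lambda>s. exp (K * s)) integrable_on {0..t}"
    by (auto simp: integral_unique diff_divide_distrib has_integral_integrable)
qed

text \<open>Every difference quotient of \<open>h\<close> is at most \<open>C\<close> times an
  increment of \<open>G\<close>, so continuity of \<open>G\<close> makes the derivative of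
  \<open>h\<close> vanish. This stands in for the product rule for indefinite integrals, which need
  not be differentiable at every point.\<close>

lemma constant_of_superlinear_increments:
  fixes h G :: "real \<Rightarrow> real"
  assumes N: "0 \<le> N" and C: "0 \<le> C" and G: "continuous_on {0..N} G"
    and h: "\<And>s t. 0 \<le> s \<Longrightarrow> s \<le> t \<Longrightarrow> t \<le> N \<Longrightarrow> \<bar>h t - h s\<bar> \<le> C * (t - s) * (G t - G s)"
  shows "h N = h 0"
proof -
  have h': "\<bar>h t - h s\<bar> \<le> C * \<bar>t - s\<bar> * \<bar>G t - G s\<bar>" if "s \<in> {0..N}" "t \<in> {0..N}" for s t
  proof (cases "s \<le> t")
    case True
    have "\<bar>h t - h s\<bar> \<le> C * (t - s) * (G t - G s)" using h[of s t] True that by auto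
    also have "\<dots> \<le> C * (t - s) * \<bar>G t - G s\<bar>"
      by (intro mult_left_mono) (use True C in auto)
    finally show ?thesis using True by simp
  next
    case False
    have "\<bar>h s - h t\<bar> \<le> C * (s - t) * (G s - G t)" using h[of t s] False that by auto
    also have "\<dots> \<le> C * (s - t) * \<bar>G s - G t\<bar>"
      by (intro mult_left_mono) (use False C in auto)
    finally show ?thesis using False by (simp add: abs_minus_commute)
  qed
  have "(h has_real_derivative 0) (at s within {0..N})" if s: "s \<in> {0..N}" for s
  proof -
    have "((\<lambda>t. C * \<bar>G t - G s\<bar>) \<longlongrightarrow> C * \<bar>G s - G s\<bar>) (at s within {0..N})"
      using G s unfolding continuous_on_def by (intro tendsto_intros) auto
    then have *: "((\<lambda>t. C * \<bar>G t - G s\<bar>) \<longlongrightarrow> 0) (at s within {0..N})" by simp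
    have "((\<lambda>t. (h t - h s) / (t - s)) \<longlongrightarrow> 0) (at s within {0..N})"
    proof (rule tendsto_rabs_zero_cancel, rule tendsto_sandwich[OF _ _ tendsto_const *])
      show "\<forall>\<^sub>F t in at s within {0..N}. \<bar>(h t - h s) / (t - s)\<bar> \<le> C * \<bar>G t - G s\<bar>"
        unfolding eventually_at_filter
      proof (rule always_eventually, intro allI impI)
        fix t assume "t \<noteq> s" "t \<in> {0..N}"
        then show "\<bar>(h t - h s) / (t - s)\<bar> \<le> C * \<bar>G t - G s\<bar>"
          using h'[of s t] s by (simp add: abs_divide divide_le_eq mult.commute mult.left_commute)
      qed
    qed simp
    then show ?thesis by (simp add: has_field_derivative_iff)
  qed
  then have "\<exists>c. \<forall>x\<in>{0..N}. h x = c"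
    by (intro has_field_derivative_zero_constant) auto
  then show ?thesis using N by auto
qed

text \<open>Variation of constants: the solution of u' = p - k u with u(0) = 0. For negative times
  the interval of integration is empty and the value is 0.\<close>

definition linear_response :: "real \<Rightarrow> (real \<Rightarrow> real) \<Rightarrow> real \<Rightarrow> real" where
  "linear_response k p t = exp (- k * t) * integral {0..t} (\<lambda>s. exp (k * s) * p s)"

lemma absolutely_integrable_exp_mult:
  assumes "p absolutely_integrable_on {c..d}"
  shows "(\<lambda>s. exp (k * s) * p s) absolutely_integrable_on {c..(d::real)}"
  using assms by (intro absolutely_integrable_mult_continuous continuous_intros)

lemma continuous_on_half_line:
  fixes f :: "real \<Rightarrow> real"
  assumes "\<And>N. continuous_on {0..N} f"
  shows "continuous_on {0..} f"
  unfolding continuous_on_eq_continuous_within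
proof
  fix t :: real assume t: "t \<in> {0..}"
  have "continuous (at t within {0..t + 1}) f"
    using assms[of "t + 1"] t by (auto simp: continuous_on_eq_continuous_within)
  moreover have "at t within {0..t + 1} = at t within {0..}"
    by (rule at_within_nhd[of _ "{..<t + 1}"]) auto
  ultimately show "continuous (at t within {0..}) f" by simp
qed

text \<open>The second claim is the equation u' = p - k u in integrated form. As \<open>p\<close> is
  merely integrable, the defect \<open>h\<close> between the two sides is shown to be constant by
  estimating its increments.\<close>

lemma
  assumes p: "\<And>t. p absolutely_integrable_on {0..t}"
  shows continuous_on_linear_response: "continuous_on {0..} (linear_response k p)"
    and integral_linear_response:
      "0 \<le> t \<Longrightarrow> linear_response k p t = integral {0..t} (\<lambda>s. p s - k * linear_response k p s)"
proof -
  define w where "w s = exp (k * s) * p s" for s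
  define W where "W t = integral {0..t} w" for t
  have w: "w absolutely_integrable_on {c..d}" if "0 \<le> c" for c d
    unfolding w_def using absolutely_integrable_exp_mult[OF p]
      absolutely_integrable_on_subinterval[where S = "{0..d}" and a = c and b = d] that by auto
  then have wi: "w integrable_on {c..d}" if "0 \<le> c" for c d
    using that by (auto simp: absolutely_integrable_on_def)
  have wa: "(\<lambda>s. \<bar>w s\<bar>) integrable_on {c..d}" if "0 \<le> c" for c d
    using w[OF that] by (auto simp: absolutely_integrable_on_def)
  have Wc: "continuous_on {0..N} W" for N
    unfolding W_def by (rule indefinite_integral_continuous_1[OF wi]) simp
  define u where "u t = exp (- k * t) * W t" for t
  have u: "u = linear_response k p"
    by (auto simp: fun_eq_iff u_def W_def linear_response_def w_def[abs_def])
  have uc: "continuous_on {0..N} u" for N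
    unfolding u_def by (intro continuous_intros Wc)
  then show "continuous_on {0..} (linear_response k p)"
    unfolding u by (intro continuous_on_half_line)
  show "linear_response k p t = integral {0..t} (\<lambda>s. p s - k * linear_response k p s)" if t: "0 \<le> t"
  proof -
    define f where "f s = p s - k * u s" for s
    have f: "f integrable_on {c..d}" if "0 \<le> c" for c d
    proof -
      have "p integrable_on {c..d}"
        using absolutely_integrable_on_subinterval[OF p[of d], of c d] that
        by (auto simp: absolutely_integrable_on_def)
      moreover have "(\<lambda>s. k * u s) integrable_on {c..d}"
        using continuous_on_subset[OF uc[of d], of "{c..d}"] that
        by (intro integrable_continuous_real continuous_intros) auto
      ultimately show ?thesis unfolding f_def by (rule integrable_diff)
    qed
    define G where "G t = integral {0..t} (\<lambda>s. \<bar>w s\<bar>)" for t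
    define E where "E = exp (\<bar>k\<bar> * t)"
    have E0: "0 \<le> E" by (simp add: E_def)
    define h where "h t = u t - integral {0..t} f" for t
    have Exp: "exp (- k * s) \<le> E" if "0 \<le> s" "s \<le> t" for s
    proof -
      have "- k * s \<le> \<bar>k\<bar> * s" using that by (intro mult_right_mono) auto
      also have "\<dots> \<le> \<bar>k\<bar> * t" using that by (intro mult_left_mono) auto
      finally show ?thesis unfolding E_def by simp
    qed
    have lip: "\<bar>exp (- k * b) - exp (- k * s)\<bar> \<le> \<bar>k\<bar> * E * (b - s)" if "0 \<le> s" "s \<le> b" "b \<le> t" for s b
    proof (cases "s = b")
      case False
      then have "s < b" using that by simp
      have der: "((\<lambda>x. exp (- k * x)) has_real_derivative (- k * exp (- k * x))) (at x)" for x
        by (auto intro!: derivative_eq_intros)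
      from MVT2[OF \<open>s < b\<close>, of "\<lambda>x. exp (- k * x)" "\<lambda>x. - k * exp (- k * x)", OF der]
      obtain z where z: "s < z" "z < b" "exp (- k * b) - exp (- k * s) = (b - s) * (- k * exp (- k * z))"
        by blast
      then have "\<bar>exp (- k * b) - exp (- k * s)\<bar> = (b - s) * \<bar>k\<bar> * exp (- k * z)"
        using that by (simp add: abs_mult)
      also have "\<dots> \<le> (b - s) * \<bar>k\<bar> * E"
        using Exp[of z] z that by (intro mult_left_mono) auto
      finally show ?thesis by (simp add: mult.commute mult.left_commute)
    qed simp
    have "h t = h 0"
    proof (rule constant_of_superlinear_increments[where G = G and C = "2 * \<bar>k\<bar> * E"])
      show "continuous_on {0..t} G"
        unfolding G_def by (rule indefinite_integral_continuous_1[OF wa]) simp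
      fix s b assume sb: "0 \<le> s" "s \<le> b" "b \<le> t"
      have Gd: "G b - G s = integral {s..b} (\<lambda>s. \<bar>w s\<bar>)"
        using Henstock_Kurzweil_Integration.integral_combine[of 0 s b "\<lambda>s. \<bar>w s\<bar>"] sb wa
        by (simp add: G_def)
      have Wd: "W x - W s = integral {s..x} w" if "s \<le> x" for x
        using Henstock_Kurzweil_Integration.integral_combine[of 0 s x w] sb wi that
        by (simp add: W_def)
      have Wb: "\<bar>W x - W s\<bar> \<le> G b - G s" if "s \<le> x" "x \<le> b" for x
      proof -
        have "\<bar>W x - W s\<bar> \<le> integral {s..x} (\<lambda>s. \<bar>w s\<bar>)"
          unfolding Wd[OF that(1)] using sb by (intro integral_abs_le w wa) auto
        also have "\<dots> \<le> integral {s..b} (\<lambda>s. \<bar>w s\<bar>)"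
          using sb that by (intro integral_subset_le wa) auto
        finally show ?thesis unfolding Gd .
      qed
      have i1: "(\<lambda>x. (exp (- k * b) - exp (- k * x)) * w x) absolutely_integrable_on {s..b}"
        using sb by (intro absolutely_integrable_mult_continuous w continuous_intros) auto
      have i2c: "continuous_on {s..b} (\<lambda>x. k * (exp (- k * x) * (W x - W s)))"
        using continuous_on_subset[OF Wc[of b], of "{s..b}"] sb by (intro continuous_intros) auto
      then have i2: "(\<lambda>x. k * (exp (- k * x) * (W x - W s))) absolutely_integrable_on {s..b}"
        by (rule absolutely_integrable_continuous_real)
      have he: "((\<lambda>x. - k * exp (- k * x)) has_integral (exp (- k * b) - exp (- k * s))) {s..b}"
        using sb by (intro fundamental_theorem_of_calculus)
           (auto intro!: derivative_eq_intros simp: has_real_derivative_iff_has_vector_derivative[symmetric])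
      have j1: "(\<lambda>x. exp (- k * b) * w x) integrable_on {s..b}"
        using wi[OF sb(1)] by (rule integrable_on_mult_right)
      have j2: "(\<lambda>x. - k * exp (- k * x) * W s) integrable_on {s..b}"
        using has_integral_mult_left[OF he, of "W s"] by (rule has_integral_integrable)
      \<comment> \<open>Subtracting the integral of \<open>f\<close> cancels all terms of first
        order in \<open>b - s\<close>. What survives pairs an increment of the exponential with
        \<open>w\<close>, or an increment of \<open>W\<close> with the length of the interval; both
        are bounded by \<open>b - s\<close> times an increment of \<open>G\<close>.\<close>
      have "h b - h s = (u b - u s) - integral {s..b} f"
        using Henstock_Kurzweil_Integration.integral_combine[of 0 s b f] sb f by (simp add: h_def)
      also have "u b - u s = exp (- k * b) * (W b - W s) + (exp (- k * b) - exp (- k * s)) * W s"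
        by (simp add: u_def algebra_simps)
      also have "exp (- k * b) * (W b - W s) = integral {s..b} (\<lambda>x. exp (- k * b) * w x)"
        using sb by (simp add: Wd)
      also have "(exp (- k * b) - exp (- k * s)) * W s = integral {s..b} (\<lambda>x. - k * exp (- k * x) * W s)"
        using integral_unique[OF has_integral_mult_left[OF he, of "W s"]] by simp
      finally have "h b - h s = integral {s..b} (\<lambda>x. exp (- k * b) * w x)
          + integral {s..b} (\<lambda>x. - k * exp (- k * x) * W s) - integral {s..b} f" .
      also have "\<dots> = integral {s..b} (\<lambda>x. exp (- k * b) * w x + - k * exp (- k * x) * W s - f x)"
        by (simp only: Henstock_Kurzweil_Integration.integral_add[OF j1 j2, symmetric]
            Henstock_Kurzweil_Integration.integral_diff[OF integrable_add[OF j1 j2] f[OF sb(1)], symmetric])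
      also have "\<dots> = integral {s..b} (\<lambda>x. (exp (- k * b) - exp (- k * x)) * w x + k * (exp (- k * x) * (W x - W s)))"
      proof (rule Henstock_Kurzweil_Integration.integral_cong)
        fix x
        have "p x = exp (- k * x) * w x" by (simp add: w_def mult.assoc[symmetric] exp_add[symmetric])
        then show "exp (- k * b) * w x + - k * exp (- k * x) * W s - f x
           = (exp (- k * b) - exp (- k * x)) * w x + k * (exp (- k * x) * (W x - W s))"
          by (simp add: f_def u_def algebra_simps)
      qed
      also have "\<dots> = integral {s..b} (\<lambda>x. (exp (- k * b) - exp (- k * x)) * w x)
          + integral {s..b} (\<lambda>x. k * (exp (- k * x) * (W x - W s)))"
        using i1 i2 by (intro Henstock_Kurzweil_Integration.integral_add) (auto simp: absolutely_integrable_on_def)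
      finally have "\<bar>h b - h s\<bar> \<le> \<bar>integral {s..b} (\<lambda>x. (exp (- k * b) - exp (- k * x)) * w x)\<bar>
          + \<bar>integral {s..b} (\<lambda>x. k * (exp (- k * x) * (W x - W s)))\<bar>" by linarith
      also have "\<bar>integral {s..b} (\<lambda>x. (exp (- k * b) - exp (- k * x)) * w x)\<bar>
          \<le> integral {s..b} (\<lambda>x. \<bar>k\<bar> * E * (b - s) * \<bar>w x\<bar>)"
      proof (rule integral_abs_le[OF i1])
        show "(\<lambda>x. \<bar>k\<bar> * E * (b - s) * \<bar>w x\<bar>) integrable_on {s..b}"
          using wa[OF sb(1)] by (rule integrable_on_mult_right)
        fix x assume x: "x \<in> {s..b}"
        have "\<bar>(exp (- k * b) - exp (- k * x)) * w x\<bar> \<le> (\<bar>k\<bar> * E * (b - x)) * \<bar>w x\<bar>"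
          unfolding abs_mult using x sb by (intro mult_right_mono lip) auto
        also have "\<dots> \<le> (\<bar>k\<bar> * E * (b - s)) * \<bar>w x\<bar>"
          using x by (intro mult_right_mono mult_left_mono) (auto simp: E_def)
        finally show "\<bar>(exp (- k * b) - exp (- k * x)) * w x\<bar> \<le> \<bar>k\<bar> * E * (b - s) * \<bar>w x\<bar>" .
      qed
      also have "\<dots> = \<bar>k\<bar> * E * (b - s) * (G b - G s)" by (simp add: Gd)
      also have "\<bar>integral {s..b} (\<lambda>x. k * (exp (- k * x) * (W x - W s)))\<bar>
          \<le> integral {s..b} (\<lambda>x. \<bar>k\<bar> * (E * (G b - G s)))"
      proof (rule integral_abs_le[OF i2])
        fix x assume x: "x \<in> {s..b}"
        show "\<bar>k * (exp (- k * x) * (W x - W s))\<bar> \<le> \<bar>k\<bar> * (E * (G b - G s))"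
          unfolding abs_mult using x sb Exp[of x] Wb[of x] E0 by (intro mult_mono) auto
      qed (rule integrable_const_ivl)
      also have "\<dots> = \<bar>k\<bar> * E * (b - s) * (G b - G s)" using sb by simp
      finally show "\<bar>h b - h s\<bar> \<le> 2 * \<bar>k\<bar> * E * (b - s) * (G b - G s)"
        by (simp add: algebra_simps)
    qed (use t in \<open>auto simp: E_def\<close>)
    then show ?thesis by (simp add: h_def u_def W_def f_def[abs_def] u[symmetric])
  qed
qed

subsection \<open>The delay equation\<close>

lemma integral_mono_negligible:
  fixes f g :: "real \<Rightarrow> real"
  assumes "f integrable_on S" "g integrable_on S" "negligible Z" "\<And>x. x \<in> S - Z \<Longrightarrow> f x \<le> g x"
  shows "integral S f \<le> integral S g"
proof -
  have "integral S f = integral S (\<lambda>x. if x \<in> Z then g x else f x)"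
    by (rule integral_spike[OF assms(3)]) auto
  also have "\<dots> \<le> integral S g"
    by (intro integral_le integrable_spike[OF assms(1,3)] assms(2)) (use assms(4) in auto)
  finally show ?thesis .
qed

lemma L2_absolutely_integrable:
  assumes "u \<in> L2 T"
  shows "u absolutely_integrable_on {-T..0}"
proof (rule measurable_bounded_by_integrable_imp_absolutely_integrable)
  show "u \<in> borel_measurable (lebesgue_on {-T..0})" using assms by (simp add: L2_def)
  have "(\<lambda>\<xi>. (u \<xi>)\<^sup>2) integrable_on {-T..0}"
    using assms by (intro integrable_on_lebesgue_on) (auto simp: L2_def)
  then show "(\<lambda>\<xi>. 1 + (u \<xi>)\<^sup>2) integrable_on {-T..0}"
    by (intro integrable_add) auto
  show "norm (u x) \<le> 1 + (u x)\<^sup>2" for x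
  proof -
    have "0 \<le> (\<bar>u x\<bar> - 1)\<^sup>2" by simp
    then have "2 * \<bar>u x\<bar> \<le> 1 + (u x)\<^sup>2" by (simp add: power2_diff)
    then show ?thesis by simp
  qed
qed simp

text \<open>\<open>f0_zero\<close> is the limit as y tends to 0 of the positivity of f0(0, y). It
  yields the lower bound on the drift that keeps the reference state positive.\<close>

locale delay_equation =
  fixes T r Cf :: real and a :: "real \<Rightarrow> real" and f0 :: "real \<Rightarrow> real \<Rightarrow> real"
  assumes T_pos: "0 < T" and r_pos: "0 < r"
    and a_cont: "continuous_on {-T..0} a" and a_nonneg: "\<And>\<xi>. \<xi> \<in> {-T..0} \<Longrightarrow> 0 \<le> a \<xi>"
    and f0_concave: "concave_on ({0..} \<times> UNIV) (\<lambda>(x, y). f0 x y)"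
    and f0_mono: "\<And>x. 0 \<le> x \<Longrightarrow> mono (f0 x)"
    and f0_Lipschitz: "Cf-lipschitz_on ({0..} \<times> UNIV) (\<lambda>(x, y). f0 x y)"
    and f0_zero: "0 \<le> f0 0 0"
begin

abbreviation F :: "real \<Rightarrow> real \<Rightarrow> real" where "F \<equiv> extend_f0 f0"
abbreviation D :: "(real \<Rightarrow> real) \<Rightarrow> real \<Rightarrow> real" where "D \<equiv> drift T r a f0"

definition A where "A = (SUP \<xi>\<in>{-T..0}. a \<xi>)"
definition hist :: "(real \<Rightarrow> real) \<Rightarrow> bool" where "hist x \<longleftrightarrow> (\<forall>t. x absolutely_integrable_on {-T..t})"
definition delay :: "(real \<Rightarrow> real) \<Rightarrow> real \<Rightarrow> real" where
  "delay x s = integral {-T..0} (\<lambda>\<xi>. a \<xi> * x (s + \<xi>))"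
text \<open>The Lipschitz constant of the drift for the supremum norm on the window from
  \<open>s - T\<close> to \<open>s\<close>: \<open>r\<close> from the linear term, \<open>Cf\<close>
  from the current state, \<open>Cf * A * T\<close> from the delayed average.\<close>

definition L where "L = r + Cf * (1 + A * T)"

lemma Cf_nonneg: "0 \<le> Cf" using f0_Lipschitz by (rule lipschitz_on_nonneg)

lemma a_le_A: "\<xi> \<in> {-T..0} \<Longrightarrow> a \<xi> \<le> A"
  unfolding A_def
  by (intro cSUP_upper bounded_imp_bdd_above compact_imp_bounded compact_continuous_image a_cont) auto

lemma A_nonneg: "0 \<le> A"
  using a_le_A[of 0] a_nonneg[of 0] T_pos by auto

lemma L_pos: "0 < L"
  unfolding L_def using r_pos Cf_nonneg A_nonneg T_pos by (simp add: add_pos_nonneg)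

lemma F_eq: "F x y = f0 (max x 0) y" by (simp add: extend_f0_def max_def)

lemma F_lipschitz: "\<bar>F x y - F x' y'\<bar> \<le> Cf * (\<bar>x - x'\<bar> + \<bar>y - y'\<bar>)"
proof -
  have "\<bar>F x y - F x' y'\<bar> \<le> Cf * dist (max x 0, y) (max x' 0, y')"
    using lipschitz_onD[OF f0_Lipschitz, of "(max x 0, y)" "(max x' 0, y')"]
    by (simp add: F_eq dist_real_def)
  also have "dist (max x 0, y) (max x' 0, y') \<le> \<bar>max x 0 - max x' 0\<bar> + \<bar>y - y'\<bar>"
    by (simp add: dist_prod_def dist_real_def sqrt_sum_squares_le_sum_abs)
  also have "\<dots> \<le> \<bar>x - x'\<bar> + \<bar>y - y'\<bar>" by auto
  finally show ?thesis using Cf_nonneg by (simp add: mult_left_mono)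
qed

lemma F_mono: "y \<le> y' \<Longrightarrow> F x y \<le> F x y'"
  unfolding F_eq using f0_mono[of "max x 0"] by (auto dest: monoD)

lemma F_concave:
  assumes "0 \<le> x" "0 \<le> x'" "0 \<le> u" "0 \<le> v" "u + v = 1"
  shows "u * F x y + v * F x' y' \<le> F (u * x + v * x') (u * y + v * y')"
proof -
  have "u * (\<lambda>(x, y). f0 x y) (x, y) + v * (\<lambda>(x, y). f0 x y) (x', y')
      \<le> (\<lambda>(x, y). f0 x y) (u *\<^sub>R (x, y) + v *\<^sub>R (x', y'))"
    using assms f0_concave unfolding concave_on_iff by blast
  then show ?thesis using assms by (simp add: F_eq)
qed

text \<open>At x = 0 the value is nonnegative by monotonicity and \<open>f0_zero\<close>, and moving
  to \<open>x\<close> costs at most \<open>Cf * x\<close>. Hence an uncontrolled state with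
  nonnegative history decays no faster than at rate \<open>Cf\<close>.\<close>

lemma F_ge: "0 \<le> x \<Longrightarrow> 0 \<le> y \<Longrightarrow> - Cf * x \<le> F x y"
  using F_lipschitz[of x y 0 y] F_mono[of 0 y 0] f0_zero by (auto simp: F_eq)

lemma continuous_on_F: "continuous_on UNIV (\<lambda>z. F (fst z) (snd z))"
proof (rule lipschitz_on_continuous_on)
  show "(2 * Cf)-lipschitz_on UNIV (\<lambda>z. F (fst z) (snd z))"
  proof (rule lipschitz_onI)
    fix z z' :: "real \<times> real"
    have "dist (F (fst z) (snd z)) (F (fst z') (snd z')) \<le> Cf * (dist (fst z) (fst z') + dist (snd z) (snd z'))"
      using F_lipschitz by (simp add: dist_real_def)
    also have "\<dots> \<le> Cf * (dist z z' + dist z z')"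
      by (intro mult_left_mono add_mono Cf_nonneg dist_fst_le dist_snd_le)
    finally show "dist (F (fst z) (snd z)) (F (fst z') (snd z')) \<le> 2 * Cf * dist z z'" by simp
  qed (use Cf_nonneg in simp)
qed

lemma hist_subset: "hist x \<Longrightarrow> -T \<le> c \<Longrightarrow> x absolutely_integrable_on {c..d}"
  unfolding hist_def by (rule absolutely_integrable_on_subinterval[where S = "{-T..d}"]) auto

lemma hist_segment: "hist x \<Longrightarrow> 0 \<le> s \<Longrightarrow> (\<lambda>\<xi>. x (s + \<xi>)) absolutely_integrable_on {-T..0}"
  using absolutely_integrable_shift[where f = x and p = s and c = "-T" and d = 0] hist_subset[of x "-T + s" s]
  by (simp add: add.commute)

lemma delay_integrand: "hist x \<Longrightarrow> 0 \<le> s \<Longrightarrow> (\<lambda>\<xi>. a \<xi> * x (s + \<xi>)) absolutely_integrable_on {-T..0}"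
  by (intro absolutely_integrable_mult_continuous a_cont hist_segment)

lemma hist_add: "hist x \<Longrightarrow> hist y \<Longrightarrow> hist (\<lambda>s. x s + y s)"
  by (auto simp: hist_def)

lemma hist_diff: "hist x \<Longrightarrow> hist y \<Longrightarrow> hist (\<lambda>s. x s - y s)"
  by (auto simp: hist_def)

lemma hist_cmult: "hist x \<Longrightarrow> hist (\<lambda>s. c * x s)"
  by (auto simp: hist_def)

lemma drift_eq: "hist x \<Longrightarrow> 0 \<le> s \<Longrightarrow> D x s = r * x s + F (x s) (delay x s)"
  unfolding drift_def delay_def
  using lebesgue_integral_eq_integral[of "{-T..0}" "\<lambda>\<xi>. a \<xi> * x (s + \<xi>)"] delay_integrand[of x s]
  by (simp add: integrable_lebesgue_on_iff)

lemma delay_mono: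
  assumes "hist x" "hist y" "0 \<le> s" "negligible Z" "\<And>u. -T \<le> u \<Longrightarrow> u \<le> s \<Longrightarrow> u \<notin> Z \<Longrightarrow> x u \<le> y u"
  shows "delay x s \<le> delay y s"
  unfolding delay_def
proof (rule integral_mono_negligible)
  show "negligible ((\<lambda>u. - s + u) ` Z)" by (rule negligible_translation[OF assms(4)])
  fix \<xi> assume \<xi>: "\<xi> \<in> {- T..0} - (\<lambda>u. - s + u) ` Z"
  have "s + \<xi> \<notin> Z"
  proof
    assume "s + \<xi> \<in> Z"
    then have "- s + (s + \<xi>) \<in> (\<lambda>u. - s + u) ` Z" by blast
    with \<xi> show False by simp
  qed
  with \<xi> assms show "a \<xi> * x (s + \<xi>) \<le> a \<xi> * y (s + \<xi>)"
    by (intro mult_left_mono a_nonneg) auto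
qed (use delay_integrand assms in \<open>auto simp: absolutely_integrable_on_def\<close>)

lemma delay_linear:
  assumes "hist x" "hist y" "0 \<le> s"
  shows "delay (\<lambda>u. c * x u + d * y u) s = c * delay x s + d * delay y s"
proof -
  have "(\<lambda>\<xi>. a \<xi> * x (s + \<xi>)) integrable_on {-T..0}" "(\<lambda>\<xi>. a \<xi> * y (s + \<xi>)) integrable_on {-T..0}"
    using delay_integrand assms by (auto simp: absolutely_integrable_on_def)
  then have "integral {-T..0} (\<lambda>\<xi>. c * (a \<xi> * x (s + \<xi>)) + d * (a \<xi> * y (s + \<xi>)))
      = c * delay x s + d * delay y s"
    unfolding delay_def by (subst Henstock_Kurzweil_Integration.integral_add) (auto intro: integrable_on_mult_right)
  then show ?thesis unfolding delay_def by (simp add: algebra_simps)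
qed

lemma delay_diff: "hist x \<Longrightarrow> hist y \<Longrightarrow> 0 \<le> s \<Longrightarrow> delay (\<lambda>u. x u - y u) s = delay x s - delay y s"
  using delay_linear[of x y s 1 "-1"] by simp

lemma delay_abs_le:
  assumes "hist x" "0 \<le> s" "g absolutely_integrable_on {s - T..s}" "\<And>u. s - T \<le> u \<Longrightarrow> u \<le> s \<Longrightarrow> \<bar>x u\<bar> \<le> g u"
  shows "\<bar>delay x s\<bar> \<le> A * integral {s - T..s} g"
proof -
  have g: "(\<lambda>\<xi>. g (\<xi> + s)) absolutely_integrable_on {-T..0}"
    using absolutely_integrable_shift[where f = g and p = s and c = "-T" and d = 0] assms(3) by simp
  have "\<bar>delay x s\<bar> \<le> integral {-T..0} (\<lambda>\<xi>. A * g (\<xi> + s))"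
    unfolding delay_def
  proof (rule integral_abs_le[OF delay_integrand[OF assms(1,2)]])
    show "(\<lambda>\<xi>. A * g (\<xi> + s)) integrable_on {-T..0}"
      using g by (auto simp: absolutely_integrable_on_def intro: integrable_on_mult_right)
    fix \<xi> assume \<xi>: "\<xi> \<in> {-T..0}"
    show "\<bar>a \<xi> * x (s + \<xi>)\<bar> \<le> A * g (\<xi> + s)"
      unfolding abs_mult using a_le_A[OF \<xi>] a_nonneg[OF \<xi>] assms(4)[of "s + \<xi>"] \<xi>
      by (intro mult_mono) (auto simp: add.commute)
  qed
  also have "\<dots> = A * integral {s - T..s} g"
    using integral_shift_real_ivl[of "s - T" s s g] by simp
  finally show ?thesis .
qed

lemma delay_abs_le_const:
  assumes "hist x" "0 \<le> s" "\<And>u. s - T \<le> u \<Longrightarrow> u \<le> s \<Longrightarrow> \<bar>x u\<bar> \<le> B"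
  shows "\<bar>delay x s\<bar> \<le> A * T * B"
  using delay_abs_le[OF assms(1,2), of "\<lambda>_. B"] assms(3) T_pos by (simp add: mult.assoc)

text \<open>The state is merely integrable on the history, so continuity cannot come from shifting
  \<open>x\<close>. After a change of variable \<open>s\<close> occurs only in the kernel, extended
  by zero to \<open>b\<close>; the extension is continuous away from its two end points, and
  dominated convergence applies once \<open>u = s\<close> and \<open>u = s - T\<close> are
  removed.\<close>

lemma continuous_on_delay:
  assumes x: "hist x"
  shows "continuous_on {0..} (delay x)"
proof (rule continuous_on_half_line)
  fix N :: real
  define b where "b v = (if v \<in> {-T..0} then a v else 0)" for v
  have rep: "delay x s = integral {-T..N} (\<lambda>u. b (u - s) * x u)" if s: "s \<in> {0..N}" for s
  proof -
    have "delay x s = integral {s - T..s} (\<lambda>u. a (u - s) * x u)"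
      using integral_shift_real_ivl[of "s - T" s s "\<lambda>u. a (u - s) * x u"]
      by (simp add: delay_def add.commute)
    also have "\<dots> = integral {s - T..s} (\<lambda>u. b (u - s) * x u)"
      by (rule Henstock_Kurzweil_Integration.integral_cong) (auto simp: b_def)
    also have "\<dots> = integral {-T..N} (\<lambda>u. b (u - s) * x u)"
      by (rule integral_spike_set) (use s in \<open>auto simp: b_def intro!: empty_imp_negligible\<close>)
    finally show ?thesis .
  qed
  have bx: "(\<lambda>u. b (u - s) * x u) absolutely_integrable_on {-T..N}" if s: "s \<in> {0..N}" for s
  proof -
    have "(\<lambda>u. a (u - s) * x u) absolutely_integrable_on {s - T..s}"
      by (intro absolutely_integrable_mult_continuous continuous_on_compose2[OF a_cont] continuous_intros hist_subset[OF x])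
         (use s in auto)
    then have "(\<lambda>u. b (u - s) * x u) absolutely_integrable_on {s - T..s}"
      by (rule absolutely_integrable_spike[OF _ negligible_empty]) (auto simp: b_def)
    then show ?thesis
      by (rule absolutely_integrable_spike_set) (use s in \<open>auto simp: b_def intro!: empty_imp_negligible\<close>)
  qed
  have b_le: "\<bar>b v\<bar> \<le> A" for v
    using a_le_A[of v] a_nonneg[of v] A_nonneg by (auto simp: b_def)
  have b_cont: "isCont b v" if "v \<noteq> -T" "v \<noteq> 0" for v
  proof -
    consider "v < -T" | "0 < v" | "v \<in> {-T<..<0}"
      using \<open>v \<noteq> -T\<close> \<open>v \<noteq> 0\<close> by (metis greaterThanLessThan_iff linorder_neqE_linordered_idom)
    then show ?thesis
    proof cases
      case 1
      then have "\<forall>\<^sub>F w in nhds v. b w = 0"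
        by (intro eventually_nhds[THEN iffD2] exI[of _ "{..< -T}"]) (auto simp: b_def)
      then show ?thesis using isCont_cong[of b "\<lambda>_. 0" v] by simp
    next
      case 2
      then have "\<forall>\<^sub>F w in nhds v. b w = 0"
        by (intro eventually_nhds[THEN iffD2] exI[of _ "{0<..}"]) (auto simp: b_def)
      then show ?thesis using isCont_cong[of b "\<lambda>_. 0" v] by simp
    next
      case 3
      then have "\<forall>\<^sub>F w in nhds v. b w = a w"
        by (intro eventually_nhds[THEN iffD2] exI[of _ "{-T<..<0}"]) (auto simp: b_def)
      moreover have "isCont a v"
        using continuous_on_interior[OF a_cont, of v] 3 by simp
      ultimately show ?thesis using isCont_cong[of b a v] by blast
    qed
  qed
  show "continuous_on {0..N} (delay x)"
    unfolding continuous_on_sequentially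
  proof (intro allI ballI impI, elim conjE)
    fix s S assume s: "s \<in> {0..N}" and S: "\<forall>n. S n \<in> {0..N}" "S \<longlonglongrightarrow> s"
    define f where "f k u = (if u \<in> {s, s - T} then 0 else b (u - S k) * x u)" for k u
    define g where "g u = (if u \<in> {s, s - T} then 0 else b (u - s) * x u)" for u
    have "(\<lambda>k. integral {-T..N} (f k)) \<longlonglongrightarrow> integral {-T..N} g"
    proof (rule dominated_convergence)
      show "f k integrable_on {-T..N}" for k
        by (rule integrable_spike_finite[where S = "{s, s - T}" and f = "\<lambda>u. b (u - S k) * x u"])
           (use bx S in \<open>auto simp: f_def absolutely_integrable_on_def\<close>)
      show "(\<lambda>u. A * \<bar>x u\<bar>) integrable_on {-T..N}"
        using x by (intro integrable_on_mult_right) (auto simp: hist_def absolutely_integrable_on_def)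
      show "norm (f k u) \<le> A * \<bar>x u\<bar>" for k u
        using b_le A_nonneg by (auto simp: f_def abs_mult intro: mult_right_mono)
      show "(\<lambda>k. f k u) \<longlonglongrightarrow> g u" for u
      proof (cases "u \<in> {s, s - T}")
        case False
        then have "isCont b (u - s)" by (intro b_cont) auto
        then have "(\<lambda>k. b (u - S k)) \<longlonglongrightarrow> b (u - s)"
          by (rule isCont_tendsto_compose) (intro tendsto_intros S)
        then show ?thesis using False unfolding f_def g_def by (auto intro: tendsto_intros)
      qed (auto simp: f_def g_def)
    qed
    moreover have "integral {-T..N} (f k) = delay x (S k)" for k
      unfolding rep[OF S(1)[rule_format]]
      by (rule integral_spike[of "{s, s - T}"]) (auto simp: f_def)
    moreover have "integral {-T..N} g = delay x s"
      unfolding rep[OF s] by (rule integral_spike[of "{s, s - T}"]) (auto simp: g_def)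
    ultimately show "(delay x \<circ> S) \<longlonglongrightarrow> delay x s" by (simp add: comp_def)
  qed
qed

lemma continuous_on_drift:
  assumes x: "hist x" "continuous_on {0..} x"
  shows "continuous_on {0..} (D x)"
proof -
  have "continuous_on {0..} (\<lambda>s. r * x s + F (fst (x s, delay x s)) (snd (x s, delay x s)))"
    by (intro continuous_intros x continuous_on_compose2[OF continuous_on_F] continuous_on_Pair continuous_on_delay) auto
  then show ?thesis
    by (rule continuous_on_cong[THEN iffD1, rotated 2]) (auto simp: drift_eq x)
qed

lemma drift_absolutely_integrable:
  assumes x: "hist x"
  shows "D x absolutely_integrable_on {0..t}"
proof (rule measurable_bounded_by_integrable_imp_absolutely_integrable)
  have dc: "continuous_on {0..t} (delay x)"
    by (rule continuous_on_subset[OF continuous_on_delay[OF x]]) auto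
  have m: "x \<in> borel_measurable (lebesgue_on {0..t})" "delay x \<in> borel_measurable (lebesgue_on {0..t})"
    using hist_subset[OF x, of 0 t] T_pos dc
    by (auto intro: absolutely_integrable_imp_borel_measurable continuous_imp_measurable_on_sets_lebesgue)
  have "(\<lambda>s. r * x s + F (x s) (delay x s)) \<in> borel_measurable (lebesgue_on {0..t})"
    using borel_measurable_continuous_Pair[OF m continuous_on_F] m by simp
  then show "D x \<in> borel_measurable (lebesgue_on {0..t})"
    by (rule measurable_cong[THEN iffD1, rotated]) (auto simp: drift_eq x)
  show "(\<lambda>s. r * \<bar>x s\<bar> + (\<bar>F 0 0\<bar> + Cf * (\<bar>x s\<bar> + \<bar>delay x s\<bar>))) integrable_on {0..t}"
    using hist_subset[OF x, of 0 t] T_pos absolutely_integrable_continuous_real[OF dc]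
    by (intro integrable_add integrable_on_mult_right) (auto simp: absolutely_integrable_on_def)
  fix s assume s: "s \<in> {0..t}"
  have "\<bar>F (x s) (delay x s)\<bar> \<le> \<bar>F 0 0\<bar> + Cf * (\<bar>x s\<bar> + \<bar>delay x s\<bar>)"
    using F_lipschitz[of "x s" "delay x s" 0 0] by simp
  moreover have "D x s = r * x s + F (x s) (delay x s)" using s by (simp add: drift_eq x)
  moreover have "\<bar>r * x s\<bar> = r * \<bar>x s\<bar>" using r_pos by (simp add: abs_mult)
  ultimately show "norm (D x s) \<le> r * \<bar>x s\<bar> + (\<bar>F 0 0\<bar> + Cf * (\<bar>x s\<bar> + \<bar>delay x s\<bar>))"
    unfolding real_norm_def by linarith
qed simp

text \<open>The Lipschitz bound in the norm weighted by \<open>exp (- K * t)\<close>. Equal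
  histories let the bound at time \<open>s\<close> cover the whole delay window, including the part
  before time 0.\<close>

lemma drift_lipschitz_weighted:
  assumes u: "hist u" "hist v" and s: "0 \<le> s" and K: "0 \<le> K" and m: "0 \<le> m"
    and hist_eq: "\<And>\<tau>. \<tau> < 0 \<Longrightarrow> -T \<le> \<tau> \<Longrightarrow> u \<tau> = v \<tau>"
    and le: "\<And>\<tau>. 0 \<le> \<tau> \<Longrightarrow> \<tau> \<le> s \<Longrightarrow> \<bar>u \<tau> - v \<tau>\<bar> \<le> m * exp (K * \<tau>)"
  shows "\<bar>D u s - D v s\<bar> \<le> L * m * exp (K * s)"
proof -
  have le': "\<bar>u \<tau> - v \<tau>\<bar> \<le> m * exp (K * s)" if "s - T \<le> \<tau>" "\<tau> \<le> s" for \<tau>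
  proof (cases "\<tau> < 0")
    case True
    then show ?thesis using hist_eq[of \<tau>] that s m by simp
  next
    case False
    then have "\<bar>u \<tau> - v \<tau>\<bar> \<le> m * exp (K * \<tau>)" using le that by simp
    also have "\<dots> \<le> m * exp (K * s)" using that K m by (intro mult_left_mono) (auto intro: mult_left_mono)
    finally show ?thesis .
  qed
  have d: "\<bar>delay u s - delay v s\<bar> \<le> A * T * (m * exp (K * s))"
    using delay_abs_le_const[OF hist_diff[OF u] s le'] by (simp add: delay_diff u s)
  have us: "\<bar>u s - v s\<bar> \<le> m * exp (K * s)" using le' T_pos by simp
  have "\<bar>D u s - D v s\<bar> \<le> r * \<bar>u s - v s\<bar> + Cf * (\<bar>u s - v s\<bar> + \<bar>delay u s - delay v s\<bar>)"
  proof -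
    have "D u s - D v s = r * (u s - v s) + (F (u s) (delay u s) - F (v s) (delay v s))"
      by (simp add: drift_eq u s algebra_simps)
    moreover have "\<bar>r * (u s - v s)\<bar> = r * \<bar>u s - v s\<bar>"
      unfolding abs_mult using r_pos by simp
    ultimately show ?thesis
      using F_lipschitz[of "u s" "delay u s" "v s" "delay v s"] by linarith
  qed
  also have "\<dots> \<le> r * (m * exp (K * s)) + Cf * (m * exp (K * s) + A * T * (m * exp (K * s)))"
    using us d r_pos Cf_nonneg by (intro add_mono mult_left_mono) auto
  also have "\<dots> = L * m * exp (K * s)" by (simp add: L_def algebra_simps)
  finally show ?thesis .
qed

text \<open>A trajectory \<open>x\<close> with prescribed density \<open>g\<close> of its derivative; the control is then
  recovered as \<open>c = D x - g\<close>.\<close>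

definition traj :: "real \<times> (real \<Rightarrow> real) \<Rightarrow> (real \<Rightarrow> real) \<Rightarrow> (real \<Rightarrow> real) \<Rightarrow> bool" where
  "traj \<eta> x g \<longleftrightarrow> (\<forall>s. -T \<le> s \<and> s < 0 \<longrightarrow> x s = snd \<eta> s) \<and>
     (\<forall>t. g absolutely_integrable_on {0..t}) \<and> (\<forall>t\<ge>0. x t = fst \<eta> + integral {0..t} g)"

lemma trajD:
  assumes "traj \<eta> x g"
  shows "\<And>s. -T \<le> s \<Longrightarrow> s < 0 \<Longrightarrow> x s = snd \<eta> s"
    "\<And>t. g absolutely_integrable_on {0..t}" "\<And>t. g integrable_on {0..t}"
    "\<And>t. 0 \<le> t \<Longrightarrow> x t = fst \<eta> + integral {0..t} g" "x 0 = fst \<eta>"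
  using assms by (auto simp: traj_def absolutely_integrable_on_def)

lemma traj_continuous:
  assumes "traj \<eta> x g"
  shows "continuous_on {0..} x"
proof (rule continuous_on_half_line)
  fix N
  have "continuous_on {0..N} (\<lambda>t. fst \<eta> + integral {0..t} g)"
    by (intro continuous_intros indefinite_integral_continuous_1 trajD(3)[OF assms])
  then show "continuous_on {0..N} x"
    by (rule continuous_on_cong[THEN iffD1, rotated 2]) (auto simp: trajD(4)[OF assms])
qed

lemma histI:
  assumes h: "u absolutely_integrable_on {-T..0}" "\<And>s. -T \<le> s \<Longrightarrow> s < 0 \<Longrightarrow> x s = u s"
    and x: "\<And>t. x absolutely_integrable_on {0..t}"
  shows "hist x"
  unfolding hist_def
proof
  fix t
  have h': "x absolutely_integrable_on {-T..0}"
    by (rule absolutely_integrable_spike[OF h(1), of "{0}"]) (use h(2) in auto)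
  show "x absolutely_integrable_on {-T..t}"
  proof (cases "0 \<le> t")
    case True
    then show ?thesis using absolutely_integrable_on_combine[OF h' x[of t]] T_pos by simp
  next
    case False
    then show ?thesis using absolutely_integrable_on_subinterval[OF h', where a = "-T" and b = t] by auto
  qed
qed

lemma traj_hist:
  assumes "traj \<eta> x g" "snd \<eta> absolutely_integrable_on {-T..0}"
  shows "hist x"
proof (rule histI[OF assms(2)])
  show "x absolutely_integrable_on {0..t}" for t
    by (rule absolutely_integrable_continuous_real, rule continuous_on_subset[OF traj_continuous[OF assms(1)]]) auto
qed (use trajD(1)[OF assms(1)] in auto)

text \<open>The bridge from the Lebesgue integrals of the statement to trajectories with a
  density.\<close>

lemma is_state_iff:
  "is_state T r a f0 \<eta> c x \<longleftrightarrow> traj \<eta> x (\<lambda>s. D x s - c s)"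
proof -
  have *: "integrable (lebesgue_on {0..t}) f \<longleftrightarrow> f absolutely_integrable_on {0..t}" for f :: "real \<Rightarrow> real" and t :: real
    by (rule integrable_lebesgue_on_iff) simp
  have "(\<forall>t\<ge>0. f absolutely_integrable_on {0..t}) \<longleftrightarrow> (\<forall>t. f absolutely_integrable_on {0..t})" for f :: "real \<Rightarrow> real"
    by (metis absolutely_integrable_on_null content_real_eq_0 cbox_interval linorder_not_le nle_le)
  note ** = this
  show ?thesis
    unfolding is_state_def traj_def * using ** lebesgue_integral_eq_integral[of "{0.._}" "\<lambda>s. D x s - c s"]
    by (smt (verit) * atLeastAtMost_borel sets_completionI_sets sets_lborel)
qed

section \<open>Uniqueness and existence of the controlled state\<close>

lemma traj_unique:
  assumes x: "traj \<eta> x (\<lambda>s. D x s - c s)" "traj \<eta> y (\<lambda>s. D y s - c s)"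
    and \<eta>: "snd \<eta> absolutely_integrable_on {-T..0}" and N: "0 \<le> N"
  shows "x N = y N"
proof -
  \<comment> \<open>With this rate the integral of \<open>L * exp (K * s)\<close> up to
    \<open>t\<close> is less than \<open>exp (K * t) / 2\<close>, so the maximal weighted difference
    of two solutions is at most half of itself.\<close>
  define K where "K = 2 * L"
  have K: "0 < K" using L_pos by (simp add: K_def)
  have h: "hist x" "hist y" using traj_hist x \<eta> by blast+
  have cont: "continuous_on {0..N} x" "continuous_on {0..N} y"
    using traj_continuous[OF x(1)] traj_continuous[OF x(2)] by (auto intro: continuous_on_subset)
  define z where "z t = exp (- K * t) * \<bar>x t - y t\<bar>" for t
  have "continuous_on {0..N} z" unfolding z_def by (intro continuous_intros cont)
  then obtain t where t: "t \<in> {0..N}" "\<And>s. s \<in> {0..N} \<Longrightarrow> z s \<le> z t"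
    using continuous_attains_sup[of "{0..N}" z] N by auto
  have zt: "0 \<le> z t" by (simp add: z_def)
  have le: "\<bar>x s - y s\<bar> \<le> z t * exp (K * s)" if "0 \<le> s" "s \<le> N" for s
    using t(2)[of s] that by (simp add: z_def exp_minus field_simps)
  have "\<bar>x t - y t\<bar> = \<bar>integral {0..t} (\<lambda>s. D x s - c s) - integral {0..t} (\<lambda>s. D y s - c s)\<bar>"
    using trajD(4)[OF x(1), of t] trajD(4)[OF x(2), of t] t by simp
  also have "integral {0..t} (\<lambda>s. D x s - c s) - integral {0..t} (\<lambda>s. D y s - c s)
      = integral {0..t} (\<lambda>s. D x s - D y s)"
    using trajD(3)[OF x(1), of t] trajD(3)[OF x(2), of t]
    by (simp add: Henstock_Kurzweil_Integration.integral_diff[symmetric])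
  also have "\<bar>\<dots>\<bar> \<le> integral {0..t} (\<lambda>s. L * z t * exp (K * s))"
  proof (rule integral_abs_le)
    show "(\<lambda>s. D x s - D y s) absolutely_integrable_on {0..t}"
      by (intro set_integral_diff(1) drift_absolutely_integrable h)
    show "(\<lambda>s. L * z t * exp (K * s)) integrable_on {0..t}"
      using integral_exp_le(2)[of t K] t K by (intro integrable_on_mult_right) auto
    fix s assume s: "s \<in> {0..t}"
    show "\<bar>D x s - D y s\<bar> \<le> L * z t * exp (K * s)"
      by (rule drift_lipschitz_weighted[OF h])
         (use s t K zt le trajD(1)[OF x(1)] trajD(1)[OF x(2)] in auto)
  qed
  also have "\<dots> = z t * (exp (K * t) - 1) / 2"
    using integral_exp_le(1)[of t K] t K L_pos by (simp add: K_def)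
  also have "\<dots> \<le> z t * exp (K * t) / 2" using zt by (simp add: mult_left_mono)
  finally have "z t \<le> z t / 2"
    by (simp add: z_def exp_minus field_simps)
  then have "z t = 0" using zt by simp
  then show ?thesis using le[of N] N by simp
qed

text \<open>Picard iteration. In the norm weighted by \<open>exp (- K * t)\<close> with
  \<open>K = 2 * L\<close> every step halves the distance of consecutive iterates on each bounded
  interval; only the size \<open>m\<close> of the first step depends on the interval.\<close>

lemma traj_exists:
  assumes \<eta>: "snd \<eta> absolutely_integrable_on {-T..0}" and c: "\<And>t. c absolutely_integrable_on {0..t}"
  shows "\<exists>x. traj \<eta> x (\<lambda>s. D x s - c s) \<and> (\<forall>t < -T. x t = 0)"
proof -
  define K where "K = 2 * L"
  have K: "0 < K" using L_pos by (simp add: K_def)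
  define b where "b t = (if t < -T then 0 else snd \<eta> t)" for t
  define X where "X = rec_nat (\<lambda>t. if t < 0 then b t else fst \<eta>)
     (\<lambda>_ x t. if t < 0 then b t else fst \<eta> + integral {0..t} (\<lambda>s. D x s - c s))"
  have X0: "X 0 t = (if t < 0 then b t else fst \<eta>)" for t by (simp add: X_def)
  have XS: "X (Suc n) t = (if t < 0 then b t else fst \<eta> + integral {0..t} (\<lambda>s. D (X n) s - c s))" for n t
    by (simp add: X_def)
  have Xneg: "X n t = b t" if "t < 0" for n t
    using that by (cases n) (auto simp: X0 XS)
  have histc: "hist x" if "\<And>t. t < 0 \<Longrightarrow> x t = b t" "continuous_on {0..} x" for x
  proof (rule histI[OF \<eta>])
    show "x absolutely_integrable_on {0..t}" for t
      by (rule absolutely_integrable_continuous_real, rule continuous_on_subset[OF that(2)]) auto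
  qed (use that(1) in \<open>auto simp: b_def\<close>)
  have di: "(\<lambda>s. D x s - c s) absolutely_integrable_on {0..t}" if "hist x" for x t
    by (intro set_integral_diff(1) drift_absolutely_integrable that c)
  then have di': "(\<lambda>s. D x s - c s) integrable_on {0..t}" if "hist x" for x t
    using that by (auto simp: absolutely_integrable_on_def)
  have X: "continuous_on {0..} (X n) \<and> hist (X n)" for n
  proof (induction n)
    case 0
    have "continuous_on {0..} (X 0)"
      by (rule continuous_on_cong[THEN iffD1, OF refl _ continuous_on_const[of _ "fst \<eta>"]]) (auto simp: X0)
    then show ?case using histc Xneg by blast
  next
    case (Suc n)
    have "continuous_on {0..} (X (Suc n))"
    proof (rule continuous_on_half_line)
      fix N
      have "continuous_on {0..N} (\<lambda>t. fst \<eta> + integral {0..t} (\<lambda>s. D (X n) s - c s))"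
        by (intro continuous_intros indefinite_integral_continuous_1 di') (use Suc in auto)
      then show "continuous_on {0..N} (X (Suc n))"
        by (rule continuous_on_cong[THEN iffD1, rotated 2]) (auto simp: XS)
    qed
    then show ?case using histc Xneg by blast
  qed
  have hX: "hist (X n)" and cX: "continuous_on {0..} (X n)" for n using X by auto
  have step: "\<exists>m\<ge>0. \<forall>n. \<forall>t\<in>{0..N}. \<bar>X (Suc n) t - X n t\<bar> \<le> m * (1/2) ^ n * exp (K * t)" for N
  proof -
    have "continuous_on {0..N} (\<lambda>t. \<bar>X (Suc 0) t - X 0 t\<bar>)"
      by (intro continuous_intros continuous_on_subset[OF cX]) auto
    then have "compact ((\<lambda>t. \<bar>X (Suc 0) t - X 0 t\<bar>) ` {0..N})"
      by (intro compact_continuous_image) auto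
    from compact_imp_bounded[OF this] obtain m where m: "0 < m" "\<And>t. t \<in> {0..N} \<Longrightarrow> \<bar>X (Suc 0) t - X 0 t\<bar> \<le> m"
      by (auto simp: bounded_pos)
    have "\<forall>t\<in>{0..N}. \<bar>X (Suc n) t - X n t\<bar> \<le> m * (1/2) ^ n * exp (K * t)" for n
    proof (induction n)
      case 0
      show ?case
      proof
        fix t assume t: "t \<in> {0..N}"
        have "\<bar>X (Suc 0) t - X 0 t\<bar> \<le> m * 1" using m t by simp
        also have "\<dots> \<le> m * exp (K * t)" using m t K by (intro mult_left_mono) auto
        finally show "\<bar>X (Suc 0) t - X 0 t\<bar> \<le> m * (1/2) ^ 0 * exp (K * t)" by simp
      qed
    next
      case (Suc n)
      show ?case
      proof
        fix t assume t: "t \<in> {0..N}"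
        have "X (Suc (Suc n)) t - X (Suc n) t
            = integral {0..t} (\<lambda>s. D (X (Suc n)) s - c s) - integral {0..t} (\<lambda>s. D (X n) s - c s)"
          using t XS[of "Suc n" t] XS[of n t] by auto
        also have "\<dots> = integral {0..t} (\<lambda>s. D (X (Suc n)) s - D (X n) s)"
          by (subst Henstock_Kurzweil_Integration.integral_diff[symmetric]) (auto intro!: di' hX)
        finally have eq: "X (Suc (Suc n)) t - X (Suc n) t = integral {0..t} (\<lambda>s. D (X (Suc n)) s - D (X n) s)" .
        have "\<bar>X (Suc (Suc n)) t - X (Suc n) t\<bar> \<le> integral {0..t} (\<lambda>s. L * (m * (1/2) ^ n) * exp (K * s))"
          unfolding eq
        proof (rule integral_abs_le)
          show "(\<lambda>s. D (X (Suc n)) s - D (X n) s) absolutely_integrable_on {0..t}"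
            by (intro set_integral_diff(1) drift_absolutely_integrable hX)
          show "(\<lambda>s. L * (m * (1/2) ^ n) * exp (K * s)) integrable_on {0..t}"
            using integral_exp_le(2)[of t K] t K by (intro integrable_on_mult_right) auto
          fix s assume s: "s \<in> {0..t}"
          show "\<bar>D (X (Suc n)) s - D (X n) s\<bar> \<le> L * (m * (1/2) ^ n) * exp (K * s)"
            by (rule drift_lipschitz_weighted[OF hX hX]) (use s t K m Suc Xneg in auto)
        qed
        also have "\<dots> = m * (1/2) ^ Suc n * (exp (K * t) - 1)"
          using integral_exp_le(1)[of t K] t K L_pos by (simp add: K_def)
        also have "\<dots> \<le> m * (1/2) ^ Suc n * exp (K * t)"
          using m by (intro mult_left_mono) auto
        finally show "\<bar>X (Suc (Suc n)) t - X (Suc n) t\<bar> \<le> m * (1/2) ^ Suc n * exp (K * t)" .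
      qed
    qed
    then show ?thesis using m(1) by (intro exI[of _ m]) auto
  qed
  define x where "x t = lim (\<lambda>n. X n t)" for t
  have lim: "\<exists>m\<ge>0. \<forall>t\<in>{0..N}. (\<lambda>n. X n t) \<longlonglongrightarrow> x t \<and> (\<forall>n. \<bar>x t - X n t\<bar> \<le> (m * 2 * (1/2) ^ n) * exp (K * t))" for N
  proof -
    obtain m where m: "0 \<le> m" "\<And>n t. t \<in> {0..N} \<Longrightarrow> \<bar>X (Suc n) t - X n t\<bar> \<le> m * (1/2) ^ n * exp (K * t)"
      using step[of N] by auto
    have "(\<lambda>n. X n t) \<longlonglongrightarrow> x t \<and> (\<forall>n. \<bar>x t - X n t\<bar> \<le> (m * 2 * (1/2) ^ n) * exp (K * t))" if t: "t \<in> {0..N}" for t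
    proof -
      let ?C = "m * exp (K * t)"
      have C: "0 \<le> ?C" using m by simp
      \<comment> \<open>The bound is the exact partial sum of the geometric series. Without the
        subtracted tail it would not be inductive in \<open>k\<close>.\<close>
      have tel: "\<bar>X (n + k) t - X n t\<bar> \<le> 2 * ?C * (1/2) ^ n - 2 * ?C * (1/2) ^ (n + k)" for n k
      proof (induction k)
        case (Suc k)
        have "\<bar>X (Suc (n + k)) t - X (n + k) t\<bar> \<le> ?C * (1/2) ^ (n + k)"
          using m(2)[OF t, of "n + k"] by (simp add: mult_ac)
        with Suc show ?case by simp
      qed simp
      have tel': "\<bar>X (n + k) t - X n t\<bar> \<le> 2 * ?C * (1/2) ^ n" for n k
      proof -
        have "0 \<le> 2 * ?C * (1/2) ^ (n + k)" using C by simp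
        then show ?thesis using tel[of n k] by linarith
      qed
      have "Cauchy (\<lambda>n. X n t)"
      proof (rule metric_CauchyI)
        fix e :: real assume e: "0 < e"
        have "(\<lambda>n. 2 * ?C * (1/2) ^ n) \<longlonglongrightarrow> 2 * ?C * 0"
          by (intro tendsto_intros LIMSEQ_realpow_zero) auto
        then have "\<forall>\<^sub>F n in sequentially. 2 * ?C * (1/2) ^ n < e / 2"
          using e by (intro order_tendstoD(2)[where y = "2 * ?C * 0"]) auto
        then obtain M where M: "2 * ?C * (1/2) ^ M < e / 2" by (auto simp: eventually_sequentially)
        show "\<exists>M. \<forall>i\<ge>M. \<forall>j\<ge>M. dist (X i t) (X j t) < e"
        proof (intro exI allI impI)
          fix i j assume "M \<le> i" "M \<le> j"
          then show "dist (X i t) (X j t) < e"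
            using tel'[of M "i - M"] tel'[of M "j - M"] M unfolding dist_real_def by simp
        qed
      qed
      then have conv: "(\<lambda>n. X n t) \<longlonglongrightarrow> x t"
        unfolding x_def by (simp add: Cauchy_convergent_iff convergent_LIMSEQ_iff)
      have "\<bar>x t - X n t\<bar> \<le> 2 * ?C * (1/2) ^ n" for n
      proof (rule tendsto_upperbound)
        show "(\<lambda>k. \<bar>X (k + n) t - X n t\<bar>) \<longlonglongrightarrow> \<bar>x t - X n t\<bar>"
          by (intro tendsto_intros LIMSEQ_ignore_initial_segment conv)
      qed (use tel'[of n] in \<open>auto simp: add.commute\<close>)
      then show ?thesis using conv by (auto simp: mult_ac)
    qed
    then show ?thesis using m(1) by blast
  qed
  have conv: "(\<lambda>n. X n t) \<longlonglongrightarrow> x t" for t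
  proof (cases "t < 0")
    case True
    then show ?thesis unfolding x_def by (simp add: Xneg)
  next
    case False
    then show ?thesis using lim[of t] by force
  qed
  have xneg: "x t = b t" if "t < 0" for t using that by (simp add: x_def Xneg)
  have cx: "continuous_on {0..} x"
  proof (rule continuous_on_half_line)
    fix N
    obtain m where m: "0 \<le> m" "\<And>t n. t \<in> {0..N} \<Longrightarrow> \<bar>x t - X n t\<bar> \<le> (m * 2 * (1/2) ^ n) * exp (K * t)"
      using lim[of N] by auto
    have "uniform_limit {0..N} X x sequentially"
    proof (rule uniform_limitI)
      fix e :: real assume e: "0 < e"
      have "(\<lambda>n. (m * 2 * (1/2) ^ n) * exp (K * N)) \<longlonglongrightarrow> (m * 2 * 0) * exp (K * N)"
        by (intro tendsto_intros LIMSEQ_realpow_zero) auto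
      then have "\<forall>\<^sub>F n in sequentially. (m * 2 * (1/2) ^ n) * exp (K * N) < e"
        using e by (intro order_tendstoD(2)[where y = "(m * 2 * 0) * exp (K * N)"]) auto
      then show "\<forall>\<^sub>F n in sequentially. \<forall>t\<in>{0..N}. dist (X n t) (x t) < e"
      proof eventually_elim
        case (elim n)
        show ?case
        proof
          fix t assume t: "t \<in> {0..N}"
          have "\<bar>x t - X n t\<bar> \<le> (m * 2 * (1/2) ^ n) * exp (K * t)" by (rule m(2)[OF t])
          also have "\<dots> \<le> (m * 2 * (1/2) ^ n) * exp (K * N)"
            using m(1) t K by (intro mult_left_mono) auto
          finally show "dist (X n t) (x t) < e" using elim by (simp add: dist_real_def abs_minus_commute)
        qed
      qed
    qed
    then show "continuous_on {0..N} x"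
      by (rule uniform_limit_theorem[rotated]) (auto intro!: always_eventually continuous_on_subset[OF cX])
  qed
  have hx: "hist x" using histc xneg cx by blast
  have "x t = fst \<eta> + integral {0..t} (\<lambda>s. D x s - c s)" if t: "0 \<le> t" for t
  proof -
    obtain m where m: "0 \<le> m" "\<And>s n. s \<in> {0..t} \<Longrightarrow> \<bar>x s - X n s\<bar> \<le> (m * 2 * (1/2) ^ n) * exp (K * s)"
      using lim[of t] by auto
    have "(\<lambda>n. integral {0..t} (\<lambda>s. D (X n) s - c s)) \<longlonglongrightarrow> integral {0..t} (\<lambda>s. D x s - c s)"
    proof (rule LIM_zero_cancel, rule tendsto_rabs_zero_cancel, rule tendsto_sandwich[OF _ _ tendsto_const])
      show "\<forall>\<^sub>F n in sequentially. \<bar>integral {0..t} (\<lambda>s. D (X n) s - c s) - integral {0..t} (\<lambda>s. D x s - c s)\<bar>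
          \<le> m * exp (K * t) * (1/2) ^ n"
      proof (rule always_eventually, rule allI)
        fix n
        have eq: "integral {0..t} (\<lambda>s. D (X n) s - c s) - integral {0..t} (\<lambda>s. D x s - c s)
            = integral {0..t} (\<lambda>s. D (X n) s - D x s)"
          by (subst Henstock_Kurzweil_Integration.integral_diff[symmetric]) (auto intro!: di' hX hx)
        have "\<bar>integral {0..t} (\<lambda>s. D (X n) s - c s) - integral {0..t} (\<lambda>s. D x s - c s)\<bar>
            \<le> integral {0..t} (\<lambda>s. L * (m * 2 * (1/2) ^ n) * exp (K * s))"
          unfolding eq
        proof (rule integral_abs_le)
          show "(\<lambda>s. D (X n) s - D x s) absolutely_integrable_on {0..t}"
            by (intro set_integral_diff(1) drift_absolutely_integrable hX hx)
          show "(\<lambda>s. L * (m * 2 * (1/2) ^ n) * exp (K * s)) integrable_on {0..t}"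
            using integral_exp_le(2)[of t K] t K by (intro integrable_on_mult_right) auto
          fix s assume s: "s \<in> {0..t}"
          show "\<bar>D (X n) s - D x s\<bar> \<le> L * (m * 2 * (1/2) ^ n) * exp (K * s)"
            by (rule drift_lipschitz_weighted[OF hX hx])
               (use s t K m Xneg xneg in \<open>auto simp: abs_minus_commute\<close>)
        qed
        also have "\<dots> = m * (1/2) ^ n * (exp (K * t) - 1)"
          using integral_exp_le(1)[of t K] t K L_pos by (simp add: K_def)
        also have "\<dots> \<le> m * (1/2) ^ n * exp (K * t)"
          using m by (intro mult_left_mono) auto
        finally show "\<bar>integral {0..t} (\<lambda>s. D (X n) s - c s) - integral {0..t} (\<lambda>s. D x s - c s)\<bar>
          \<le> m * exp (K * t) * (1/2) ^ n" by (simp add: mult_ac)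
      qed
      have "(\<lambda>n. m * exp (K * t) * (1/2) ^ n) \<longlonglongrightarrow> m * exp (K * t) * 0"
        by (intro tendsto_intros LIMSEQ_realpow_zero) auto
      then show "(\<lambda>n. m * exp (K * t) * (1/2) ^ n) \<longlonglongrightarrow> 0" by simp
    qed simp
    then have "(\<lambda>n. X (Suc n) t) \<longlonglongrightarrow> fst \<eta> + integral {0..t} (\<lambda>s. D x s - c s)"
      using t by (auto simp: XS intro!: tendsto_intros)
    then show ?thesis using LIMSEQ_Suc[OF conv[of t]] LIMSEQ_unique by blast
  qed
  then have "traj \<eta> x (\<lambda>s. D x s - c s)"
    unfolding traj_def using di[OF hx] xneg by (auto simp: b_def)
  moreover have "\<forall>t < -T. x t = 0" using xneg T_pos by (auto simp: b_def)
  ultimately show ?thesis by blast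
qed

text \<open>The description that defines \<open>state\<close> also fixes the values before
  \<open>-T\<close>. A trajectory with other values there is first set to zero on that range, which
  its drift at nonnegative times cannot see.\<close>

lemma
  assumes \<eta>: "snd \<eta> absolutely_integrable_on {-T..0}"
  shows traj_state: "(\<And>t. c absolutely_integrable_on {0..t}) \<Longrightarrow>
      traj \<eta> (state T r a f0 \<eta> c) (\<lambda>s. D (state T r a f0 \<eta> c) s - c s)"
    and state_eq: "traj \<eta> x (\<lambda>s. D x s - c s) \<Longrightarrow> -T \<le> t \<Longrightarrow> state T r a f0 \<eta> c t = x t"
proof -
  have uniq: "u = v" if "is_state T r a f0 \<eta> c u \<and> (\<forall>t < -T. u t = 0)" "is_state T r a f0 \<eta> c v \<and> (\<forall>t < -T. v t = 0)" for u v
  proof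
    fix t
    have uv: "traj \<eta> u (\<lambda>s. D u s - c s)" "traj \<eta> v (\<lambda>s. D v s - c s)" using that is_state_iff by auto
    show "u t = v t"
      using traj_unique[OF uv \<eta>, of t] trajD(1)[OF uv(1), of t] trajD(1)[OF uv(2), of t] that
      by (cases "t < -T"; cases "t < 0") auto
  qed
  have st: "is_state T r a f0 \<eta> c (state T r a f0 \<eta> c)" if "is_state T r a f0 \<eta> c u" "\<forall>t < -T. u t = 0" for u
    unfolding state_def using that uniq theI[of "\<lambda>x. is_state T r a f0 \<eta> c x \<and> (\<forall>t < -T. x t = 0)" u] by blast
  show "traj \<eta> (state T r a f0 \<eta> c) (\<lambda>s. D (state T r a f0 \<eta> c) s - c s)" if "\<And>t. c absolutely_integrable_on {0..t}"
    using traj_exists[OF \<eta> that] st is_state_iff by blast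
  show "state T r a f0 \<eta> c t = x t" if x: "traj \<eta> x (\<lambda>s. D x s - c s)" "-T \<le> t"
  proof -
    define x' where "x' s = (if s < -T then 0 else x s)" for s
    have dx: "D x' s = D x s" if "0 \<le> s" for s
      unfolding drift_def x'_def using that T_pos
      by (auto intro!: arg_cong2[where f = "extend_f0 f0"] Bochner_Integration.integral_cong)
    have "traj \<eta> x' (\<lambda>s. D x' s - c s)"
      unfolding traj_def
    proof (intro conjI allI impI)
      show "x' s = snd \<eta> s" if "-T \<le> s \<and> s < 0" for s
        using that trajD(1)[OF x(1)] by (simp add: x'_def)
      show "(\<lambda>s. D x' s - c s) absolutely_integrable_on {0..t}" for t
        by (rule absolutely_integrable_spike[OF trajD(2)[OF x(1)] negligible_empty]) (simp add: dx)
      have "integral {0..t} (\<lambda>s. D x s - c s) = integral {0..t} (\<lambda>s. D x' s - c s)" for t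
        by (rule Henstock_Kurzweil_Integration.integral_cong) (simp add: dx)
      then show "x' t = fst \<eta> + integral {0..t} (\<lambda>s. D x' s - c s)" if "0 \<le> t" for t
        using that trajD(4)[OF x(1), of t] T_pos by (simp add: x'_def)
    qed
    then have x': "is_state T r a f0 \<eta> c x' \<and> (\<forall>t < -T. x' t = 0)" by (simp add: is_state_iff x'_def)
    then have "state T r a f0 \<eta> c = x'"
      unfolding state_def by (intro the_equality x' uniq[OF _ x'])
    then show ?thesis using x(2) by (simp add: x'_def)
  qed
qed

end

subsection \<open>The control problem\<close>

abbreviation half_line :: "real measure" where "half_line \<equiv> lebesgue_on {0..}"

lemma AE_half_line:
  "(AE t in half_line. P t) \<longleftrightarrow> (\<exists>Z. negligible Z \<and> (\<forall>t\<ge>0. t \<notin> Z \<longrightarrow> P t))"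
proof -
  have "(AE t in half_line. P t) \<longleftrightarrow> (AE t in lebesgue. 0 \<le> t \<longrightarrow> P t)"
    by (subst AE_restrict_space_iff) auto
  then show ?thesis unfolding AE_lebesgue_negligible by (simp add: imp_conjL[symmetric] conj_commute)
qed

lemma borel_measurable_half_line:
  fixes g :: "real \<Rightarrow> real"
  assumes "\<And>t. g \<in> borel_measurable (lebesgue_on {0..t})"
  shows "g \<in> borel_measurable half_line"
proof -
  have "(\<lambda>s. if s \<in> {0..} then g s else 0) \<in> borel_measurable lebesgue"
  proof (rule borel_measurable_LIMSEQ_real)
    fix s :: real
    obtain n :: nat where n: "s \<le> real n" using real_arch_simple by blast
    show "(\<lambda>n. if s \<in> {0..real n} then g s else 0) \<longlonglongrightarrow> (if s \<in> {0..} then g s else 0)"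
    proof (rule tendsto_eventually)
      show "\<forall>\<^sub>F i in sequentially. (if s \<in> {0..real i} then g s else 0) = (if s \<in> {0..} then g s else 0)"
        unfolding eventually_sequentially using n by (intro exI[of _ n]) auto
    qed
    show "(\<lambda>s. if s \<in> {0..real n} then g s else 0) \<in> borel_measurable lebesgue" for n :: nat
      using assms by (intro borel_measurable_if_I) auto
  qed
  then show ?thesis by (rule borel_measurable_if_D)
qed

lemma exp_integrable_half_line: "0 < k \<Longrightarrow> integrable half_line (\<lambda>t. exp (- k * t))"
  by (subst integrable_lebesgue_on_iff, simp,
      intro nonnegative_absolutely_integrable_1 integrable_on_exp_minus_to_infinity) auto

section \<open>The integral with values in the extended reals\<close>

lemma ext_integral_integrable:
  assumes "integrable (lebesgue_on S) f"
  shows "ext_integral S f = ereal (integral\<^sup>L (lebesgue_on S) f)"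
proof -
  have "(\<integral>\<^sup>+ t. ennreal (f t) \<partial>lebesgue_on S) \<noteq> \<infinity>" "(\<integral>\<^sup>+ t. ennreal (- f t) \<partial>lebesgue_on S) \<noteq> \<infinity>"
    using assms by (auto simp: real_integrable_def)
  then obtain b c where "0 \<le> b" "(\<integral>\<^sup>+ t. ennreal (f t) \<partial>lebesgue_on S) = ennreal b"
    "0 \<le> c" "(\<integral>\<^sup>+ t. ennreal (- f t) \<partial>lebesgue_on S) = ennreal c"
    by (metis ennreal_cases infinity_ennreal_def)
  then show ?thesis
    unfolding ext_integral_def real_lebesgue_integral_def[OF assms] by simp
qed

text \<open>The integrable majorant keeps the positive part finite, so integrability can fail only
  through an infinite negative part.\<close>

lemma ext_integral_not_integrable:
  assumes "\<not> integrable (lebesgue_on S) f" "f \<in> borel_measurable (lebesgue_on S)"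
    "integrable (lebesgue_on S) w" "\<And>t. t \<in> S \<Longrightarrow> f t \<le> w t" "S \<in> sets lebesgue"
  shows "ext_integral S f = -\<infinity>"
proof -
  have "(\<integral>\<^sup>+ t. ennreal (f t) \<partial>lebesgue_on S) \<le> (\<integral>\<^sup>+ t. ennreal (w t) \<partial>lebesgue_on S)"
    using assms(4,5) by (intro nn_integral_mono ennreal_leI) (auto simp: space_restrict_space)
  then have fin: "(\<integral>\<^sup>+ t. ennreal (f t) \<partial>lebesgue_on S) \<noteq> \<infinity>"
    using assms(3) by (auto simp: real_integrable_def top_unique)
  then have "(\<integral>\<^sup>+ t. ennreal (- f t) \<partial>lebesgue_on S) = \<infinity>"
    using assms(1,2) by (auto simp: real_integrable_def)
  then show ?thesis
    unfolding ext_integral_def using fin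
    by (cases "\<integral>\<^sup>+ t. ennreal (f t) \<partial>lebesgue_on S") (auto simp: minus_ereal_def)
qed

lemma ext_integral_greater_iff:
  assumes "f \<in> borel_measurable (lebesgue_on S)"
    "integrable (lebesgue_on S) w" "\<And>t. t \<in> S \<Longrightarrow> f t \<le> w t" "S \<in> sets lebesgue"
  shows "- \<infinity> < ext_integral S f \<longleftrightarrow> integrable (lebesgue_on S) f"
proof (cases "integrable (lebesgue_on S) f")
  case True
  then show ?thesis by (simp add: ext_integral_integrable)
next
  case False
  then show ?thesis using ext_integral_not_integrable[OF False assms] by simp
qed

locale control_problem = delay_equation T r Cf a f0 for T r Cf a f0 +
  fixes \<rho> :: real and U1 U2 :: "real \<Rightarrow> real"
  assumes rho_pos: "0 < \<rho>"
    and U1_cont: "continuous_on {0..} U1"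
    and U1_C2: "C2_pos U1"
    and U1_bounded: "bounded (U1 ` {0..})"
    and U1_deriv_pos: "\<And>x. 0 < x \<Longrightarrow> 0 < deriv U1 x"
    and U1_deriv_0: "filterlim (deriv U1) at_top (at_right 0)"
    and U1_deriv2_neg: "\<And>x. 0 < x \<Longrightarrow> deriv (deriv U1) x < 0"
    and U2_cont: "continuous_on {0<..} U2"
    and U2_mono: "mono_on {0<..} U2"
    and U2_concave: "concave_on {0<..} U2"
    and U2_bdd: "bdd_above (U2 ` {0<..})"
    and U2_int: "- \<infinity> < ext_integral {0..} (\<lambda>t. exp (- \<rho> * t) * U2 (exp (- Cf * t)))"
    and U2_not_int: "\<And>\<delta>. 0 < \<delta> \<Longrightarrow> ext_integral {0<..\<delta>} U2 = - \<infinity>"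
begin

abbreviation p :: "real \<Rightarrow> real" where "p \<equiv> deriv U1"

section \<open>Consequences of the assumptions on the utilities\<close>

lemma DERIV_U1: "0 < x \<Longrightarrow> (U1 has_real_derivative p x) (at x)"
  using U1_C2 by (simp add: C2_pos_def DERIV_deriv_iff_field_differentiable)

lemma DERIV_p: "0 < x \<Longrightarrow> (p has_real_derivative deriv p x) (at x)"
  using U1_C2 by (simp add: C2_pos_def DERIV_deriv_iff_field_differentiable)

lemma p_cont: "continuous_on {0<..} p"
  by (rule DERIV_continuous_on) (auto intro: DERIV_p DERIV_subset)

lemma p_less: "0 < x \<Longrightarrow> x < y \<Longrightarrow> p y < p x"
  using DERIV_p U1_deriv2_neg by (intro DERIV_neg_imp_decreasing[of x y p]) (auto, meson order_less_le_trans)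

lemma p_le: "0 < x \<Longrightarrow> x \<le> y \<Longrightarrow> p y \<le> p x"
  using p_less[of x y] by (cases "x = y") auto

text \<open>The left end point may be 0, where \<open>U1\<close> is continuous but has infinite
  slope; the derivative is evaluated strictly inside.\<close>

lemma U1_MVT:
  assumes "0 \<le> x" "x < y"
  obtains z where "x < z" "z < y" "U1 y - U1 x = (y - x) * p z"
proof -
  have "\<exists>l z. x < z \<and> z < y \<and> DERIV U1 z :> l \<and> U1 y - U1 x = (y - x) * l"
  proof (rule MVT)
    show "continuous_on {x..y} U1" using assms by (auto intro: continuous_on_subset[OF U1_cont])
    show "U1 differentiable at z" if "x < z" "z < y" for z
      using DERIV_U1[of z] that assms by (auto simp: has_field_derivative_def differentiable_def)
  qed (rule assms)
  then obtain l z where z: "x < z" "z < y" "DERIV U1 z :> l" "U1 y - U1 x = (y - x) * l" by blast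
  have "l = p z" using DERIV_unique[OF z(3) DERIV_U1] z(1) assms by simp
  then show ?thesis using that z by blast
qed

lemma U1_less: "0 \<le> x \<Longrightarrow> x < y \<Longrightarrow> U1 x < U1 y"
proof -
  assume xy: "0 \<le> x" "x < y"
  then obtain z where z: "x < z" "z < y" "U1 y - U1 x = (y - x) * p z" by (rule U1_MVT)
  have "0 < (y - x) * p z" using xy z U1_deriv_pos[of z] by simp
  then show ?thesis using z by simp
qed

lemma U1_mono: "0 \<le> x \<Longrightarrow> x \<le> y \<Longrightarrow> U1 x \<le> U1 y"
  using U1_less[of x y] by (cases "x = y") auto

text \<open>Compare the mean slopes on the two sides of the convex combination: \<open>p\<close> is
  strictly decreasing, so the left slope is larger. The mean value form admits
  \<open>x = 0\<close>.\<close>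

lemma U1_strictly_concave:
  assumes "0 \<le> x" "x < y" "0 < u" "0 < v" "u + v = 1"
  shows "u * U1 x + v * U1 y < U1 (u * x + v * y)"
proof -
  define z where "z = u * x + v * y"
  have u: "u = 1 - v" using assms by simp
  have zx: "z - x = v * (y - x)" and yz: "y - z = u * (y - x)" by (simp_all add: z_def u algebra_simps)
  have z: "x < z" "z < y" using zx yz assms by (smt (verit) mult_pos_pos)+
  obtain z1 where z1: "x < z1" "z1 < z" "U1 z - U1 x = (z - x) * p z1"
    using U1_MVT[of x z] assms z by auto
  obtain z2 where z2: "z < z2" "z2 < y" "U1 y - U1 z = (y - z) * p z2"
    using U1_MVT[of z y] assms z by auto
  have "p z2 < p z1" using p_less[of z1 z2] z1 z2 assms by auto
  then have "0 < u * v * (y - x) * (p z1 - p z2)" using assms by simp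
  also have "\<dots> = u * (U1 z - U1 x) - v * (U1 y - U1 z)" by (simp add: z1 z2 zx yz algebra_simps)
  also have "\<dots> = U1 z - (u * U1 x + v * U1 y)" by (simp add: u algebra_simps)
  finally show ?thesis by (simp add: z_def)
qed

lemma U1_concave:
  assumes "0 \<le> x" "0 \<le> y" "0 \<le> u" "0 \<le> v" "u + v = 1"
  shows "u * U1 x + v * U1 y \<le> U1 (u * x + v * y)"
proof -
  consider "x = y" | "u = 0" | "v = 0" | "x < y" "0 < u" "0 < v" | "y < x" "0 < u" "0 < v" using assms by linarith
  then show ?thesis
  proof cases
    case 1 then show ?thesis using assms(5) by (simp add: distrib_right[symmetric])
  next
    case 4 then show ?thesis using U1_strictly_concave[of x y u v] assms by simp
  next
    case 5 then show ?thesis using U1_strictly_concave[of y x v u] assms by (simp add: add.commute)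
  qed (use assms in auto)
qed

lemma U2_concave':
  assumes "0 < x" "0 < y" "0 \<le> u" "0 \<le> v" "u + v = 1"
  shows "u * U2 x + v * U2 y \<le> U2 (u * x + v * y)"
  using U2_concave assms unfolding concave_on_iff by auto

lemma U2_mono': "0 < x \<Longrightarrow> x \<le> y \<Longrightarrow> U2 x \<le> U2 y"
  using U2_mono by (auto simp: mono_on_def)

text \<open>One constant serves both utilities: a two-sided bound for \<open>U1\<close>, and for
  \<open>U2\<close> an upper bound only.\<close>

definition B where "B = (SOME b. 0 < b \<and> (\<forall>c\<ge>0. \<bar>U1 c\<bar> \<le> b) \<and> (\<forall>x>0. U2 x \<le> b))"

lemma B: "0 < B" "0 \<le> c \<Longrightarrow> \<bar>U1 c\<bar> \<le> B" "0 < x \<Longrightarrow> U2 x \<le> B"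
proof -
  obtain b1 where b1: "\<And>c. 0 \<le> c \<Longrightarrow> \<bar>U1 c\<bar> \<le> b1" using U1_bounded by (auto simp: bounded_iff)
  obtain b2 where b2: "\<And>x. 0 < x \<Longrightarrow> U2 x \<le> b2" using U2_bdd by (auto simp: bdd_above_def)
  have "\<exists>b. 0 < b \<and> (\<forall>c\<ge>0. \<bar>U1 c\<bar> \<le> b) \<and> (\<forall>x>0. U2 x \<le> b)"
  proof (intro exI[of _ "\<bar>b1\<bar> + \<bar>b2\<bar> + 1"] conjI allI impI)
    show "\<bar>U1 c\<bar> \<le> \<bar>b1\<bar> + \<bar>b2\<bar> + 1" if "0 \<le> c" for c using b1[OF that] by linarith
    show "U2 x \<le> \<bar>b1\<bar> + \<bar>b2\<bar> + 1" if "0 < x" for x using b2[OF that] by linarith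
  qed simp
  from someI_ex[OF this] show "0 < B" "0 \<le> c \<Longrightarrow> \<bar>U1 c\<bar> \<le> B" "0 < x \<Longrightarrow> U2 x \<le> B"
    unfolding B_def by blast+
qed

text \<open>For an admissible pair \<open>D x - g\<close> is nonnegative almost everywhere. The
  truncation makes the control nonnegative at every time, as \<open>admissible\<close> demands,
  without changing the trajectory.\<close>

definition ctrl :: "(real \<Rightarrow> real) \<Rightarrow> (real \<Rightarrow> real) \<Rightarrow> real \<Rightarrow> real" where
  "ctrl x g t = max 0 (D x t - g t)"

definition payoff :: "(real \<Rightarrow> real) \<Rightarrow> (real \<Rightarrow> real) \<Rightarrow> real \<Rightarrow> real" where
  "payoff x g t = exp (- \<rho> * t) * (U1 (ctrl x g t) + U2 (x t))"

definition J :: "(real \<Rightarrow> real) \<Rightarrow> (real \<Rightarrow> real) \<Rightarrow> real" where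
  "J x g = integral\<^sup>L half_line (payoff x g)"

text \<open>Nonnegativity of the control is written as an inequality for \<open>g\<close>, which is
  stable under convex combinations by concavity of the drift on positive states.\<close>

definition adm :: "real \<times> (real \<Rightarrow> real) \<Rightarrow> (real \<Rightarrow> real) \<Rightarrow> (real \<Rightarrow> real) \<Rightarrow> bool" where
  "adm \<eta> x g \<longleftrightarrow> traj \<eta> x g \<and> snd \<eta> absolutely_integrable_on {-T..0} \<and> (\<forall>t\<ge>0. 0 < x t)
     \<and> (AE t in half_line. g t \<le> D x t)"

definition fin :: "(real \<Rightarrow> real) \<Rightarrow> (real \<Rightarrow> real) \<Rightarrow> bool" where
  "fin x g \<longleftrightarrow> integrable half_line (payoff x g)"

abbreviation VF :: "real \<times> (real \<Rightarrow> real) \<Rightarrow> ereal" where "VF \<equiv> value_fun T \<rho> r a f0 U1 U2"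

section \<open>Admissible pairs, their payoffs and the value function\<close>

lemma ctrl_nonneg: "0 \<le> ctrl x g t" by (simp add: ctrl_def)

lemma adm_D:
  assumes "adm \<eta> x g"
  shows "traj \<eta> x g" "\<And>t. 0 \<le> t \<Longrightarrow> 0 < x t" "AE t in half_line. g t \<le> D x t" "hist x" "continuous_on {0..} x"
    "snd \<eta> absolutely_integrable_on {-T..0}"
proof -
  have *: "traj \<eta> x g" "snd \<eta> absolutely_integrable_on {-T..0}" using assms by (simp_all add: adm_def)
  show "hist x" "continuous_on {0..} x" by (fact traj_hist[OF *] traj_continuous[OF *(1)])+
qed (use assms in \<open>simp_all add: adm_def\<close>)

lemma adm_ctrl_AE: "adm \<eta> x g \<Longrightarrow> AE t in half_line. ctrl x g t = D x t - g t"
  by (auto simp: ctrl_def dest: adm_D(3))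

lemma U1_ctrl_measurable:
  assumes "c \<in> borel_measurable M" "\<And>t. 0 \<le> c t"
  shows "(\<lambda>t. U1 (c t)) \<in> borel_measurable M"
proof -
  have "continuous_on UNIV (\<lambda>c. U1 (max 0 c))"
    by (intro continuous_on_compose2[OF U1_cont] continuous_intros) auto
  then have "(\<lambda>t. U1 (max 0 (c t))) \<in> borel_measurable M"
    using assms(1) by (rule borel_measurable_continuous_on)
  then show ?thesis using assms(2) by (simp add: max_def)
qed

lemma continuous_measurable_half_line: "continuous_on {0..} (f :: real \<Rightarrow> real) \<Longrightarrow> f \<in> borel_measurable half_line"
  by (rule continuous_imp_measurable_on_sets_lebesgue) auto

lemma traj_g_measurable: "traj \<eta> x g \<Longrightarrow> g \<in> borel_measurable half_line"
  by (rule borel_measurable_half_line) (auto intro: absolutely_integrable_imp_borel_measurable trajD(2))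

lemma ctrl_measurable:
  assumes "adm \<eta> x g" shows "ctrl x g \<in> borel_measurable half_line"
  unfolding ctrl_def[abs_def]
  using continuous_measurable_half_line[OF continuous_on_drift[OF adm_D(4,5)[OF assms]]] traj_g_measurable[OF adm_D(1)[OF assms]]
  by simp

lemma U2_state_measurable:
  assumes "continuous_on {0..} x" "\<And>t. 0 \<le> t \<Longrightarrow> 0 < x t"
  shows "(\<lambda>t. U2 (x t)) \<in> borel_measurable half_line"
  by (intro continuous_measurable_half_line continuous_on_compose2[OF U2_cont assms(1)]) (use assms(2) in auto)

lemma payoff_measurable:
  assumes "adm \<eta> x g" shows "payoff x g \<in> borel_measurable half_line"
proof -
  have "(\<lambda>t. exp (- \<rho> * t)) \<in> borel_measurable half_line"
    by (intro continuous_measurable_half_line continuous_intros)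
  then show ?thesis
    unfolding payoff_def[abs_def]
    using U1_ctrl_measurable[OF ctrl_measurable[OF assms] ctrl_nonneg]
      U2_state_measurable[OF adm_D(5,2)[OF assms]] by simp
qed

lemma payoff_le: "0 < x t \<Longrightarrow> payoff x g t \<le> 2 * B * exp (- \<rho> * t)"
proof -
  assume "0 < x t"
  then have "U1 (ctrl x g t) + U2 (x t) \<le> 2 * B"
    using B(2)[OF ctrl_nonneg[of x g t]] B(3)[of "x t"] by linarith
  then show ?thesis unfolding payoff_def by (simp add: mult.commute)
qed

lemma bound_integrable: "integrable half_line (\<lambda>t. C * exp (- \<rho> * t))"
  using exp_integrable_half_line[OF rho_pos] by simp

text \<open>Payoffs of admissible pairs have the integrable majorant 2 B exp(-\<rho> t), so a
  minorant is all that has to be found.\<close>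

lemma fin_of_lower:
  assumes x: "adm \<eta> x g" and w: "integrable half_line w" and le: "AE t in half_line. w t \<le> payoff x g t"
  shows "fin x g"
  unfolding fin_def
proof (rule Bochner_Integration.integrable_bound)
  show "integrable half_line (\<lambda>t. \<bar>w t\<bar> + 2 * B * exp (- \<rho> * t))"
    using w bound_integrable[of "2 * B"] by simp
  show "payoff x g \<in> borel_measurable half_line" by (rule payoff_measurable[OF x])
  have "AE t in half_line. 0 \<le> t" by (rule AE_I2) (simp add: space_restrict_space)
  then show "AE t in half_line. norm (payoff x g t) \<le> norm (\<bar>w t\<bar> + 2 * B * exp (- \<rho> * t))"
    using le
  proof eventually_elim
    case (elim t)
    have "payoff x g t \<le> 2 * B * exp (- \<rho> * t)" using elim adm_D(2)[OF x] by (intro payoff_le) auto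
    moreover have "0 \<le> 2 * B * exp (- \<rho> * t)" using B(1) by simp
    ultimately show ?case using elim by simp
  qed
qed

lemma AE_half_line_nonneg: "AE t in half_line. 0 \<le> t"
  by (rule AE_I2) (simp add: space_restrict_space)

lemma J_le:
  assumes "adm \<eta> x g" "fin x g"
  shows "J x g \<le> integral\<^sup>L half_line (\<lambda>t. 2 * B * exp (- \<rho> * t))"
  unfolding J_def
proof (intro integral_mono_AE bound_integrable)
  show "AE t in half_line. payoff x g t \<le> 2 * B * exp (- \<rho> * t)"
    using AE_half_line_nonneg by eventually_elim (rule payoff_le[where x = x, OF adm_D(2)[OF assms(1)]])
qed (use assms(2) in \<open>simp add: fin_def\<close>)

lemma ctrl_absolutely_integrable:
  assumes "adm \<eta> x g" shows "ctrl x g absolutely_integrable_on {0..t}"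
proof -
  obtain Z where Z: "negligible Z" "\<And>t. 0 \<le> t \<Longrightarrow> t \<notin> Z \<Longrightarrow> ctrl x g t = D x t - g t"
    using adm_ctrl_AE[OF assms] by (auto simp: AE_half_line)
  have "(\<lambda>t. D x t - g t) absolutely_integrable_on {0..t}"
    by (intro set_integral_diff(1) drift_absolutely_integrable adm_D[OF assms] trajD(2)[OF adm_D(1)[OF assms]])
  then show ?thesis by (rule absolutely_integrable_spike[OF _ Z(1)]) (use Z(2) in auto)
qed

lemma traj_cong_AE:
  assumes x: "traj \<eta> x g" and h: "AE t in half_line. h t = g t"
  shows "traj \<eta> x h"
proof -
  obtain Z where Z: "negligible Z" "\<And>t. 0 \<le> t \<Longrightarrow> t \<notin> Z \<Longrightarrow> h t = g t"
    using h by (auto simp: AE_half_line)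
  have "h absolutely_integrable_on {0..t}" for t
    by (rule absolutely_integrable_spike[OF trajD(2)[OF x] Z(1)]) (use Z(2) in auto)
  moreover have "integral {0..t} g = integral {0..t} h" for t
    by (rule integral_spike[OF Z(1)]) (use Z(2) in auto)
  ultimately show ?thesis using x unfolding traj_def by auto
qed

lemma traj_ctrl: "adm \<eta> x g \<Longrightarrow> traj \<eta> x (\<lambda>t. D x t - ctrl x g t)"
  by (rule traj_cong_AE[OF adm_D(1)]) (auto dest: adm_ctrl_AE)

lemma adm_admissible:
  assumes x: "adm \<eta> x g"
  shows "ctrl x g \<in> admissible T r a f0 \<eta>" "-T \<le> t \<Longrightarrow> state T r a f0 \<eta> (ctrl x g) t = x t"
proof -
  show st: "state T r a f0 \<eta> (ctrl x g) t = x t" if "-T \<le> t" for t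
    by (rule state_eq[OF adm_D(6)[OF x] traj_ctrl[OF x] that])
  have "integrable (lebesgue_on {0..t}) (ctrl x g)" for t
    using ctrl_absolutely_integrable[OF x] by (simp add: integrable_lebesgue_on_iff)
  then show "ctrl x g \<in> admissible T r a f0 \<eta>"
    unfolding admissible_def using adm_D(2)[OF x] st T_pos ctrl_nonneg by auto
qed

lemma J_le_VF:
  assumes x: "adm \<eta> x g" and f: "fin x g"
  shows "ereal (J x g) \<le> VF \<eta>"
proof -
  have "objective T \<rho> r a f0 U1 U2 \<eta> (ctrl x g) = ext_integral {0..} (payoff x g)"
    unfolding objective_def ext_integral_def payoff_def using adm_admissible(2)[OF x] T_pos
    by (intro arg_cong2[where f = "(-)"] arg_cong[where f = enn2ereal] nn_integral_cong)
       (auto simp: space_restrict_space)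
  also have "\<dots> = ereal (J x g)"
    using f unfolding fin_def J_def by (rule ext_integral_integrable)
  finally show ?thesis
    unfolding value_fun_def using adm_admissible(1)[OF x] by (metis SUP_upper)
qed

text \<open>Every admissible control comes from an admissible pair, and pairs whose payoff is not
  integrable contribute minus infinity. The supremum may thus be taken over pairs with
  \<open>fin\<close>.\<close>

lemma VF_le:
  assumes \<eta>: "snd \<eta> absolutely_integrable_on {-T..0}" and le: "\<And>x g. adm \<eta> x g \<Longrightarrow> fin x g \<Longrightarrow> J x g \<le> z"
  shows "VF \<eta> \<le> ereal z"
  unfolding value_fun_def
proof (rule SUP_least)
  fix c assume c: "c \<in> admissible T r a f0 \<eta>"
  define x where "x = state T r a f0 \<eta> c"
  define g where "g t = D x t - c t" for t
  have ci: "c absolutely_integrable_on {0..t}" for t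
  proof (cases "0 \<le> t")
    case True
    then show ?thesis using c by (simp add: admissible_def integrable_lebesgue_on_iff)
  qed (auto intro: absolutely_integrable_on_null simp: content_real_eq_0)
  have "traj \<eta> x g" unfolding x_def g_def using traj_state[OF \<eta> ci] by simp
  moreover have "\<forall>t\<ge>0. 0 < x t" using c by (auto simp: admissible_def x_def)
  moreover have "AE t in half_line. g t \<le> D x t"
    using AE_half_line_nonneg by eventually_elim (use c in \<open>auto simp: g_def admissible_def\<close>)
  ultimately have x: "adm \<eta> x g" using \<eta> by (simp add: adm_def)
  have "objective T \<rho> r a f0 U1 U2 \<eta> c = ext_integral {0..} (payoff x g)"
    unfolding objective_def ext_integral_def payoff_def x_def[symmetric] using c
    by (intro arg_cong2[where f = "(-)"] arg_cong[where f = enn2ereal] nn_integral_cong)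
       (auto simp: space_restrict_space ctrl_def g_def admissible_def)
  also have "\<dots> \<le> ereal z"
  proof (cases "fin x g")
    case True
    then show ?thesis using le[OF x True] unfolding fin_def J_def by (simp add: ext_integral_integrable)
  next
    case False
    then have "ext_integral {0..} (payoff x g) = -\<infinity>"
      using ext_integral_not_integrable[OF _ payoff_measurable[OF x] bound_integrable[of "2 * B"] payoff_le[where x = x, OF adm_D(2)[OF x]]]
      by (simp add: fin_def)
    then show ?thesis by simp
  qed
  finally show "objective T \<rho> r a f0 U1 U2 \<eta> c \<le> ereal z" .
qed

lemma VF_real:
  assumes "adm \<eta> x g" "fin x g"
  shows "VF \<eta> = ereal (real_of_ereal (VF \<eta>))" "J x g \<le> real_of_ereal (VF \<eta>)"
    "0 < e \<Longrightarrow> \<exists>x g. adm \<eta> x g \<and> fin x g \<and> real_of_ereal (VF \<eta>) - e < J x g"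
proof -
  let ?z = "integral\<^sup>L half_line (\<lambda>t. 2 * B * exp (- \<rho> * t))"
  have "VF \<eta> \<le> ereal ?z" by (rule VF_le[OF adm_D(6)[OF assms(1)] J_le])
  then show *: "VF \<eta> = ereal (real_of_ereal (VF \<eta>))"
    using J_le_VF[OF assms] by (cases "VF \<eta>") auto
  show "J x g \<le> real_of_ereal (VF \<eta>)" using J_le_VF[OF assms] * by (metis ereal_less_eq(3))
  show "\<exists>x g. adm \<eta> x g \<and> fin x g \<and> real_of_ereal (VF \<eta>) - e < J x g" if e: "0 < e"
  proof (rule ccontr)
    assume "\<not> ?thesis"
    then have "VF \<eta> \<le> ereal (real_of_ereal (VF \<eta>) - e)"
      by (intro VF_le[OF adm_D(6)[OF assms(1)]]) force
    then show False using e * by (cases "VF \<eta>") auto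
  qed
qed

lemma drift_mix:
  assumes x: "hist x" "hist y" and t: "0 \<le> t" "0 \<le> x t" "0 \<le> y t" and u: "0 \<le> u" "0 \<le> v" "u + v = 1"
  shows "u * D x t + v * D y t \<le> D (\<lambda>s. u * x s + v * y s) t"
proof -
  have h: "hist (\<lambda>s. u * x s + v * y s)" by (intro hist_add hist_cmult x)
  show ?thesis
    using F_concave[OF t(2,3) u, of "delay x t" "delay y t"]
    by (simp add: drift_eq[OF _ t(1)] x h delay_linear[OF x t(1)] algebra_simps)
qed

text \<open>Concavity of the drift leaves the mixed trajectory with a control that is at least the
  mixture of the controls; monotonicity and concavity of \<open>U1\<close> and \<open>U2\<close>
  then compare the payoffs. The initial states may differ, which later gives concavity of the value
  function. \<open>payoff_mix\<close> keeps the mixture inside \<open>U1\<close>, so that strict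
  concavity can still be exploited.\<close>

lemma
  assumes x: "adm (z1, \<eta>1) x1 g1" "adm (z2, \<eta>1) x2 g2" and u: "0 \<le> u" "0 \<le> v" "u + v = 1"
  defines "x \<equiv> \<lambda>t. u * x1 t + v * x2 t" and "g \<equiv> \<lambda>t. u * g1 t + v * g2 t"
  shows adm_mix: "adm (u * z1 + v * z2, \<eta>1) x g"
    and payoff_mix: "AE t in half_line. exp (- \<rho> * t) * (U1 (u * ctrl x1 g1 t + v * ctrl x2 g2 t)
        + (u * U2 (x1 t) + v * U2 (x2 t))) \<le> payoff x g t"
    and fin_mix: "fin x1 g1 \<Longrightarrow> fin x2 g2 \<Longrightarrow> fin x g"
    and J_mix: "fin x1 g1 \<Longrightarrow> fin x2 g2 \<Longrightarrow> u * J x1 g1 + v * J x2 g2 \<le> J x g"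
proof -
  note a1 = adm_D[OF x(1)] and a2 = adm_D[OF x(2)]
  note t1 = trajD[OF a1(1)] and t2 = trajD[OF a2(1)]
  have D: "u * D x1 t + v * D x2 t \<le> D x t" if "0 \<le> t" for t
    unfolding x_def using a1(2)[OF that] a2(2)[OF that] by (intro drift_mix a1 a2 that u) auto
  have pos: "0 < x t" if "0 \<le> t" for t
  proof -
    have x0: "0 < x1 t" "0 < x2 t" by (rule a1(2)[OF that], rule a2(2)[OF that])
    show ?thesis
    proof (cases "0 < u")
      case True
      then show ?thesis unfolding x_def using x0 u by (intro add_pos_nonneg mult_nonneg_nonneg mult_pos_pos) auto
    next
      case False
      then have "u = 0" "v = 1" using u by auto
      then show ?thesis using x0 by (simp add: x_def)
    qed
  qed
  have "traj (u * z1 + v * z2, \<eta>1) x g"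
    unfolding traj_def
  proof (intro conjI allI impI)
    show "x s = snd (u * z1 + v * z2, \<eta>1) s" if "-T \<le> s \<and> s < 0" for s
      using t1(1)[of s] t2(1)[of s] that u by (simp add: x_def distrib_right[symmetric])
    show "g absolutely_integrable_on {0..t}" for t
      unfolding g_def by (intro set_integral_add(1) set_integrable_mult_right) (use t1(2) t2(2) in auto)
    show "x t = fst (u * z1 + v * z2, \<eta>1) + integral {0..t} g" if "0 \<le> t" for t
    proof -
      have "integral {0..t} g = u * integral {0..t} g1 + v * integral {0..t} g2"
        unfolding g_def using t1(3) t2(3)
        by (subst Henstock_Kurzweil_Integration.integral_add) (auto intro: integrable_on_mult_right)
      then show ?thesis using t1(4)[OF that] t2(4)[OF that] by (simp add: x_def algebra_simps)
    qed
  qed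
  moreover have "AE t in half_line. g t \<le> D x t"
    using AE_half_line_nonneg a1(3) a2(3)
  proof eventually_elim
    case (elim t)
    have "g t \<le> u * D x1 t + v * D x2 t" unfolding g_def using elim u by (intro add_mono mult_left_mono) auto
    then show ?case using D[OF elim(1)] by linarith
  qed
  ultimately show adm: "adm (u * z1 + v * z2, \<eta>1) x g"
    using pos a1(6) by (auto simp: adm_def)
  have c: "AE t in half_line. u * ctrl x1 g1 t + v * ctrl x2 g2 t \<le> ctrl x g t"
    using AE_half_line_nonneg adm_ctrl_AE[OF x(1)] adm_ctrl_AE[OF x(2)] adm_ctrl_AE[OF adm]
  proof eventually_elim
    case (elim t)
    have "u * ctrl x1 g1 t + v * ctrl x2 g2 t = u * D x1 t + v * D x2 t - g t"
      unfolding elim(2,3) g_def by (simp add: algebra_simps)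
    then show ?case using D[of t] elim by linarith
  qed
  show p1: "AE t in half_line. exp (- \<rho> * t) * (U1 (u * ctrl x1 g1 t + v * ctrl x2 g2 t)
        + (u * U2 (x1 t) + v * U2 (x2 t))) \<le> payoff x g t"
    using c AE_half_line_nonneg
  proof eventually_elim
    case (elim t)
    have "U1 (u * ctrl x1 g1 t + v * ctrl x2 g2 t) \<le> U1 (ctrl x g t)"
      using elim u ctrl_nonneg by (intro U1_mono add_nonneg_nonneg mult_nonneg_nonneg) auto
    moreover have "u * U2 (x1 t) + v * U2 (x2 t) \<le> U2 (x t)"
      unfolding x_def using a1(2) a2(2) elim u by (intro U2_concave') auto
    ultimately show ?case unfolding payoff_def by (intro mult_left_mono) auto
  qed
  have p2: "AE t in half_line. u * payoff x1 g1 t + v * payoff x2 g2 t \<le> payoff x g t"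
    using p1
  proof eventually_elim
    case (elim t)
    have "u * U1 (ctrl x1 g1 t) + v * U1 (ctrl x2 g2 t) \<le> U1 (u * ctrl x1 g1 t + v * ctrl x2 g2 t)"
      by (intro U1_concave ctrl_nonneg u)
    then have "exp (- \<rho> * t) * (u * U1 (ctrl x1 g1 t) + v * U1 (ctrl x2 g2 t) + (u * U2 (x1 t) + v * U2 (x2 t)))
        \<le> exp (- \<rho> * t) * (U1 (u * ctrl x1 g1 t + v * ctrl x2 g2 t) + (u * U2 (x1 t) + v * U2 (x2 t)))"
      by (intro mult_left_mono) auto
    with elim show ?case by (simp add: payoff_def algebra_simps)
  qed
  show f: "fin x g" if "fin x1 g1" "fin x2 g2"
    using that by (intro fin_of_lower[OF adm _ p2]) (auto simp: fin_def)
  show "u * J x1 g1 + v * J x2 g2 \<le> J x g" if "fin x1 g1" "fin x2 g2"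
  proof -
    have "u * J x1 g1 + v * J x2 g2 = integral\<^sup>L half_line (\<lambda>t. u * payoff x1 g1 t + v * payoff x2 g2 t)"
      using that by (simp add: J_def fin_def)
    also have "\<dots> \<le> J x g"
      unfolding J_def using that f[OF that] p2 by (intro integral_mono_AE) (auto simp: fin_def)
    finally show ?thesis .
  qed
qed

end

subsection \<open>A priori bounds and a reference control\<close>

lemma exp_integral_neg:
  fixes k :: real
  assumes "0 \<le> t"
  shows "((\<lambda>s. k * exp (- k * s)) has_integral (1 - exp (- k * t))) {0..t}"
proof -
  have "((\<lambda>s. k * exp (- k * s)) has_integral (- exp (- k * t) - (- exp (- k * 0)))) {0..t}"
    by (rule fundamental_theorem_of_calculus[where f = "\<lambda>s. - exp (- k * s)"])
       (use assms in \<open>auto intro!: derivative_eq_intros simp: has_real_derivative_iff_has_vector_derivative[symmetric]\<close>)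
  then show ?thesis by simp
qed

context delay_equation
begin

text \<open>Compare with the path \<open>v\<close> that follows the history and is zero afterwards.
  The history need not be bounded, so it enters through its \<open>L1\<close> norm; the difference
  from \<open>v\<close> is handled by the weighted Lipschitz bound.\<close>

lemma drift_bound:
  assumes x: "hist x" and t: "0 \<le> t" "0 \<le> K" "0 \<le> m"
    and u: "u absolutely_integrable_on {-T..0}" "\<And>s. -T \<le> s \<Longrightarrow> s < 0 \<Longrightarrow> x s = u s"
    and le: "\<And>s. 0 \<le> s \<Longrightarrow> s \<le> t \<Longrightarrow> \<bar>x s\<bar> \<le> m * exp (K * s)"
  shows "\<bar>D x t\<bar> \<le> (\<bar>F 0 0\<bar> + Cf * A * integral {-T..0} (\<lambda>s. \<bar>u s\<bar>)) + L * m * exp (K * t)"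
proof -
  define v where "v s = (if s < 0 then u s else 0)" for s
  have v0: "v absolutely_integrable_on {0..s}" for s
    by (rule absolutely_integrable_spike[OF absolutely_integrable_zero negligible_empty]) (auto simp: v_def)
  have v: "hist v" by (rule histI[OF u(1)]) (use v0 in \<open>auto simp: v_def\<close>)
  have ua: "(\<lambda>s. \<bar>u s\<bar>) integrable_on {-T..0}" using u(1) by (auto simp: absolutely_integrable_on_def)
  have va: "(\<lambda>s. \<bar>v s\<bar>) absolutely_integrable_on {t - T..t}"
    using absolutely_integrable_norm[OF hist_subset[OF v, of "t - T" t]] t by (simp add: comp_def)
  have "\<bar>delay v t\<bar> \<le> A * integral {t - T..t} (\<lambda>s. \<bar>v s\<bar>)"
    by (rule delay_abs_le[OF v t(1) va]) simp
  also have "integral {t - T..t} (\<lambda>s. \<bar>v s\<bar>) \<le> integral {-T..0} (\<lambda>s. \<bar>u s\<bar>)"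
  proof -
    have va': "(\<lambda>s. \<bar>v s\<bar>) integrable_on {-T..t}"
      using v by (auto simp: hist_def absolutely_integrable_on_def)
    have "integral {t - T..t} (\<lambda>s. \<bar>v s\<bar>) \<le> integral {-T..t} (\<lambda>s. \<bar>v s\<bar>)"
      using va va' t by (intro integral_subset_le) (auto simp: absolutely_integrable_on_def)
    also have "\<dots> = integral {-T..0} (\<lambda>s. \<bar>v s\<bar>) + integral {0..t} (\<lambda>s. \<bar>v s\<bar>)"
      using Henstock_Kurzweil_Integration.integral_combine[of "-T" 0 t "\<lambda>s. \<bar>v s\<bar>"] va' t T_pos by simp
    also have "integral {0..t} (\<lambda>s. \<bar>v s\<bar>) = integral {0..t} (\<lambda>s. 0)"
      by (rule Henstock_Kurzweil_Integration.integral_cong) (simp add: v_def)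
    also have "integral {-T..0} (\<lambda>s. \<bar>v s\<bar>) = integral {-T..0} (\<lambda>s. \<bar>u s\<bar>)"
      by (rule integral_spike[of "{0}"]) (auto simp: v_def)
    finally show ?thesis by simp
  qed
  finally have dv: "\<bar>delay v t\<bar> \<le> A * integral {-T..0} (\<lambda>s. \<bar>u s\<bar>)"
    using A_nonneg by (simp add: mult_left_mono)
  have "D v t = F 0 (delay v t)" using t by (simp add: drift_eq v v_def)
  moreover have "\<bar>F 0 (delay v t) - F 0 0\<bar> \<le> Cf * (\<bar>0 - 0\<bar> + \<bar>delay v t - 0\<bar>)"
    by (rule F_lipschitz)
  moreover have "Cf * \<bar>delay v t\<bar> \<le> Cf * (A * integral {-T..0} (\<lambda>s. \<bar>u s\<bar>))"
    by (intro mult_left_mono dv Cf_nonneg)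
  ultimately have "\<bar>D v t\<bar> \<le> \<bar>F 0 0\<bar> + Cf * A * integral {-T..0} (\<lambda>s. \<bar>u s\<bar>)" by simp
  moreover have "\<bar>D x t - D v t\<bar> \<le> L * m * exp (K * t)"
    by (rule drift_lipschitz_weighted[OF x v t]) (use u(2) le in \<open>auto simp: v_def\<close>)
  ultimately show ?thesis by linarith
qed

end

context control_problem
begin

definition history_const where
  "history_const \<eta> = \<bar>F 0 0\<bar> + Cf * A * integral {-T..0} (\<lambda>s. \<bar>snd \<eta> s\<bar>)"

text \<open>The value that results from solving an inequality of the form z \<le> (initial size +
  history / (2 L)) + z / 2 for z; the summand 1 makes it positive.\<close>

definition growth_const where "growth_const \<eta> = 2 * (\<bar>fst \<eta>\<bar> + history_const \<eta> / (2 * L) + 1)"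

lemma history_const_nonneg: 
  assumes "snd \<eta> absolutely_integrable_on {-T..0}" shows "0 \<le> history_const \<eta>"
  unfolding history_const_def using Cf_nonneg A_nonneg assms
  by (intro add_nonneg_nonneg mult_nonneg_nonneg Henstock_Kurzweil_Integration.integral_nonneg)
     (auto simp: absolutely_integrable_on_def)

lemma growth_const_pos:
  assumes "snd \<eta> absolutely_integrable_on {-T..0}" shows "0 < growth_const \<eta>"
  unfolding growth_const_def using history_const_nonneg[OF assms] L_pos
  by (intro mult_pos_pos add_nonneg_pos add_nonneg_nonneg divide_nonneg_pos) auto

text \<open>Consumption only lowers the state, so the bound is uniform over all admissible pairs
  from \<open>\<eta>\<close>. At the maximum of the state weighted by the rate \<open>2 * L\<close>,
  the Lipschitz part of the drift accounts for at most half of that maximum and is absorbed.\<close>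

lemma state_growth:
  assumes x: "adm \<eta> x g" and N: "0 \<le> N"
  shows "x N \<le> growth_const \<eta> * exp (2 * L * N)"
proof -
  let ?P = "history_const \<eta>"
  define K where "K = 2 * L"
  have K: "0 < K" using L_pos by (simp add: K_def)
  note ax = adm_D[OF x] and tx = trajD[OF adm_D(1)[OF x]]
  have P: "0 \<le> ?P" by (rule history_const_nonneg[OF ax(6)])
  define z where "z t = exp (- K * t) * x t" for t
  have "continuous_on {0..N} z" unfolding z_def
    by (intro continuous_intros continuous_on_subset[OF ax(5)]) auto
  then obtain t where t: "t \<in> {0..N}" "\<And>s. s \<in> {0..N} \<Longrightarrow> z s \<le> z t"
    using continuous_attains_sup[of "{0..N}" z] N by auto
  have zt: "0 \<le> z t" using ax(2)[of t] t by (simp add: z_def)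
  have le: "x s \<le> z t * exp (K * s)" if "0 \<le> s" "s \<le> N" for s
    using t(2)[of s] that by (simp add: z_def exp_minus field_simps)
  have le': "\<bar>D x s\<bar> \<le> ?P + L * z t * exp (K * s)" if "0 \<le> s" "s \<le> N" for s
    unfolding history_const_def
  proof (rule drift_bound[OF ax(4) that(1) _ zt ax(6) tx(1)])
    show "\<bar>x \<sigma>\<bar> \<le> z t * exp (K * \<sigma>)" if "0 \<le> \<sigma>" "\<sigma> \<le> s" for \<sigma>
      using le[of \<sigma>] ax(2)[of \<sigma>] that \<open>s \<le> N\<close> by simp
  qed (use K in auto)
  obtain Z where Z: "negligible Z" "\<And>t. 0 \<le> t \<Longrightarrow> t \<notin> Z \<Longrightarrow> g t \<le> D x t"
    using ax(3) by (auto simp: AE_half_line)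
  have "x t = fst \<eta> + integral {0..t} g" using tx(4) t by simp
  also have "integral {0..t} g \<le> integral {0..t} (\<lambda>s. ?P + L * z t * exp (K * s))"
  proof (rule integral_mono_negligible[OF tx(3) _ Z(1)])
    show "(\<lambda>s. ?P + L * z t * exp (K * s)) integrable_on {0..t}"
      using integral_exp_le(2)[of t K] t K by (intro integrable_add integrable_on_mult_right) auto
    show "g s \<le> ?P + L * z t * exp (K * s)" if "s \<in> {0..t} - Z" for s
      using Z(2)[of s] le'[of s] that t by fastforce
  qed
  also have "\<dots> = ?P * t + L * z t * ((exp (K * t) - 1) / K)"
    using integral_exp_le[of t K] t K
    by (subst Henstock_Kurzweil_Integration.integral_add) (auto intro: integrable_on_mult_right)
  also have "L * z t * ((exp (K * t) - 1) / K) = z t * (exp (K * t) - 1) / 2"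
    using L_pos by (simp add: K_def)
  also have "\<dots> \<le> z t * exp (K * t) / 2" using zt by (simp add: mult_left_mono)
  finally have xt: "x t \<le> fst \<eta> + ?P * t + z t * exp (K * t) / 2" by simp
  have e1: "1 \<le> exp (K * t)" using K t by simp
  \<comment> \<open>The linear growth caused by the history is traded for exponential growth, so
    that all terms carry the factor \<open>exp (K * t)\<close>, which the weight cancels.\<close>
  have "K * t \<le> exp (K * t)" using exp_ge_add_one_self[of "K * t"] by linarith
  then have "t \<le> exp (K * t) / K" using K by (simp add: field_simps)
  then have "?P * t \<le> ?P * (exp (K * t) / K)" using P by (rule mult_left_mono)
  moreover have "fst \<eta> \<le> \<bar>fst \<eta>\<bar> * exp (K * t)"
  proof -
    have "\<bar>fst \<eta>\<bar> * 1 \<le> \<bar>fst \<eta>\<bar> * exp (K * t)" using e1 by (intro mult_left_mono) auto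
    then show ?thesis by linarith
  qed
  ultimately have "x t \<le> \<bar>fst \<eta>\<bar> * exp (K * t) + ?P * (exp (K * t) / K) + z t * exp (K * t) / 2"
    using xt by linarith
  also have "\<dots> = (\<bar>fst \<eta>\<bar> + ?P / K + z t / 2) * exp (K * t)" by (simp add: algebra_simps)
  finally have "z t \<le> exp (- K * t) * ((\<bar>fst \<eta>\<bar> + ?P / K + z t / 2) * exp (K * t))"
    unfolding z_def by (intro mult_left_mono) auto
  also have "\<dots> = \<bar>fst \<eta>\<bar> + ?P / K + z t / 2" by (simp add: exp_minus)
  finally have "z t \<le> \<bar>fst \<eta>\<bar> + ?P / K + z t / 2" .
  then have "z t \<le> growth_const \<eta>" unfolding growth_const_def K_def by simp
  have "x N \<le> z t * exp (K * N)" using le[of N] N by simp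
  also have "\<dots> \<le> growth_const \<eta> * exp (K * N)"
    using \<open>z t \<le> growth_const \<eta>\<close> by (intro mult_right_mono) auto
  finally show ?thesis by (simp add: K_def)
qed

lemma drift_growth:
  assumes x: "adm \<eta> x g" and t: "0 \<le> t"
  shows "\<bar>D x t\<bar> \<le> history_const \<eta> + L * growth_const \<eta> * exp (2 * L * t)"
  unfolding history_const_def
proof (rule drift_bound[OF adm_D(4)[OF x] t])
  show "0 \<le> growth_const \<eta>" using growth_const_pos[OF adm_D(6)[OF x]] by simp
  show "\<bar>x s\<bar> \<le> growth_const \<eta> * exp (2 * L * s)" if "0 \<le> s" for s
    using state_growth[OF x that] adm_D(2)[OF x that] by simp
qed (use L_pos adm_D(6)[OF x] trajD(1)[OF adm_D(1)[OF x]] in auto)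

lemma integral_ctrl:
  assumes x: "adm \<eta> x g" and t: "0 \<le> t"
  shows "x t = fst \<eta> + integral {0..t} (D x) - integral {0..t} (ctrl x g)"
proof -
  have i: "D x integrable_on {0..t}" "ctrl x g integrable_on {0..t}"
    using drift_absolutely_integrable[OF adm_D(4)[OF x], of t] ctrl_absolutely_integrable[OF x, of t]
    by (auto simp: absolutely_integrable_on_def)
  show ?thesis
    using trajD(4)[OF traj_ctrl[OF x] t] by (simp add: Henstock_Kurzweil_Integration.integral_diff[OF i])
qed

definition ctrl_const where
  "ctrl_const \<eta> t = \<bar>fst \<eta>\<bar> + (history_const \<eta> + L * growth_const \<eta> * exp (2 * L * t)) * t"

text \<open>The state stays positive, so total consumption cannot exceed the initial state plus the
  accumulated drift. This is the uniform \<open>L1\<close> bound on controls.\<close>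

lemma integral_ctrl_le:
  assumes x: "adm \<eta> x g" and t: "0 \<le> t"
  shows "integral {0..t} (ctrl x g) \<le> ctrl_const \<eta> t"
proof -
  have "\<bar>integral {0..t} (D x)\<bar> \<le> integral {0..t} (\<lambda>s. history_const \<eta> + L * growth_const \<eta> * exp (2 * L * t))"
  proof (rule integral_abs_le[OF drift_absolutely_integrable[OF adm_D(4)[OF x]]])
    fix s assume s: "s \<in> {0..t}"
    have "\<bar>D x s\<bar> \<le> history_const \<eta> + L * growth_const \<eta> * exp (2 * L * s)"
      using drift_growth[OF x, of s] s by simp
    also have "\<dots> \<le> history_const \<eta> + L * growth_const \<eta> * exp (2 * L * t)"
      using s L_pos growth_const_pos[OF adm_D(6)[OF x]] by (intro add_left_mono mult_left_mono) auto
    finally show "\<bar>D x s\<bar> \<le> history_const \<eta> + L * growth_const \<eta> * exp (2 * L * t)" .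
  qed (rule integrable_const_ivl)
  then show ?thesis
    using integral_ctrl[OF x t] adm_D(2)[OF x t] t by (simp add: ctrl_const_def mult.commute)
qed

text \<open>The hypothesis is the case z = 1. Larger z follow by monotonicity of \<open>U2\<close>.
  For smaller z and positive \<open>Cf\<close>, write z = exp(- Cf s): the curve is then the one of
  the hypothesis started at time s, and a time shift only changes the discount by a constant
  factor.\<close>

lemma U2_discounted_integrable:
  assumes z: "0 < z"
  shows "integrable half_line (\<lambda>t. exp (- \<rho> * t) * U2 (z * exp (- Cf * t)))"
proof -
  have meas: "(\<lambda>t. exp (- \<rho> * t) * U2 (z * exp (- Cf * t))) \<in> borel_measurable half_line" if "0 < z" for z
    using that by (intro continuous_measurable_half_line continuous_intros continuous_on_compose2[OF U2_cont]) auto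
  have ub: "exp (- \<rho> * t) * U2 (z * exp (- Cf * t)) \<le> B * exp (- \<rho> * t)" if "0 < z" for z t
    using B(3)[of "z * exp (- Cf * t)"] that by (simp add: mult.commute)
  have lower: "integrable half_line (\<lambda>t. exp (- \<rho> * t) * U2 (z * exp (- Cf * t)))"
    if z: "0 < z" and w: "integrable half_line w" "\<And>t. 0 \<le> t \<Longrightarrow> w t \<le> exp (- \<rho> * t) * U2 (z * exp (- Cf * t))" for z w
  proof (rule Bochner_Integration.integrable_bound[OF _ meas[OF z]])
    show "integrable half_line (\<lambda>t. \<bar>w t\<bar> + B * exp (- \<rho> * t))"
      using w(1) bound_integrable[of B] by simp
    show "AE t in half_line. norm (exp (- \<rho> * t) * U2 (z * exp (- Cf * t))) \<le> norm (\<bar>w t\<bar> + B * exp (- \<rho> * t))"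
      using AE_half_line_nonneg
    proof eventually_elim
      case (elim t)
      have "0 \<le> B * exp (- \<rho> * t)" using B(1) by simp
      then show ?case using ub[OF z, of t] w(2)[OF elim] unfolding real_norm_def by linarith
    qed
  qed
  define h where "h t = exp (- \<rho> * t) * U2 (exp (- Cf * t))" for t
  have h: "integrable half_line h"
  proof -
    have "(\<lambda>t. exp (- \<rho> * t) * U2 (exp (- Cf * t))) \<in> borel_measurable half_line"
      using meas[of 1] by simp
    then show ?thesis
      using U2_int ext_integral_greater_iff[OF _ bound_integrable[of B], of "\<lambda>t. exp (- \<rho> * t) * U2 (exp (- Cf * t))"] ub[of 1]
      unfolding h_def by simp
  qed
  show ?thesis
  proof (cases "1 \<le> z")
    case True
    show ?thesis
    proof (rule lower[OF z h])
      fix t :: real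
      have "U2 (exp (- Cf * t)) \<le> U2 (z * exp (- Cf * t))" using True by (intro U2_mono') auto
      then show "h t \<le> exp (- \<rho> * t) * U2 (z * exp (- Cf * t))" by (simp add: h_def)
    qed
  next
    case z1: False
    show ?thesis
    proof (cases "Cf = 0")
      case True
      have "integrable half_line (\<lambda>t. U2 z * exp (- \<rho> * t))" by (rule bound_integrable)
      then show ?thesis using True by (simp add: mult.commute)
    next
      case False
      then have Cf: "0 < Cf" using Cf_nonneg by simp
      define s where "s = - ln z / Cf"
      have s: "0 < s" using Cf z1 z ln_less_zero[of z] by (simp add: s_def divide_neg_pos)
      have zs: "z = exp (- Cf * s)" using Cf z by (simp add: s_def)
      have "integrable lebesgue (\<lambda>t. indicator {0..} t *\<^sub>R h t)"
        using h by (simp add: integrable_restrict_space)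
      then have "integrable lebesgue (\<lambda>t. indicator {0..} (s + 1 * t) *\<^sub>R h (s + 1 * t))"
        by (subst lebesgue_integrable_real_affine_iff[of 1 "\<lambda>t. indicator {0..} t *\<^sub>R h t" s]) simp_all
      then have "integrable half_line (\<lambda>t. indicator {0..} (s + 1 * t) *\<^sub>R h (s + 1 * t))"
        using integrable_mult_indicator[of "{0..}" lebesgue "\<lambda>t. indicator {0..} (s + 1 * t) *\<^sub>R h (s + 1 * t)"]
        by (simp add: integrable_restrict_space)
      then have "integrable half_line (\<lambda>t. exp (\<rho> * s) * (indicator {0..} (s + 1 * t) *\<^sub>R h (s + 1 * t)))"
        by (rule integrable_mult_right)
      then show ?thesis
      proof (rule Bochner_Integration.integrable_cong[THEN iffD1, rotated 2, OF _ refl])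
        fix t assume "t \<in> space half_line"
        then have t: "0 \<le> t" by (simp add: space_restrict_space)
        have "exp (\<rho> * s) * exp (- \<rho> * (s + t)) = exp (- \<rho> * t)"
          by (simp add: exp_add[symmetric] algebra_simps)
        moreover have "exp (- Cf * (s + t)) = z * exp (- Cf * t)"
          by (simp add: zs exp_add[symmetric] algebra_simps)
        ultimately show "exp (\<rho> * s) * (indicator {0..} (s + 1 * t) *\<^sub>R h (s + 1 * t)) = exp (- \<rho> * t) * U2 (z * exp (- Cf * t))"
          using t s by (simp add: h_def mult.assoc[symmetric] indicator_def)
      qed
    qed
  qed
qed

text \<open>The exponential decay rate \<open>Cf\<close> is exactly what the Lipschitz bound on \<open>f0\<close> can compensate,
  so that all of \<open>r x\<close>, and the extra consumption on \<open>E\<close>, remain available as a control.\<close>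

lemma reference_pair:
  assumes \<eta>0: "0 < fst \<eta>" and \<eta>: "snd \<eta> absolutely_integrable_on {-T..0}"
    and \<eta>1: "AE \<xi> in lebesgue_on {-T..0}. 0 \<le> snd \<eta> \<xi>"
    and E: "E \<in> sets lebesgue" "E \<subseteq> {0..N}" and e: "measure lebesgue E \<le> e" "0 < e"
  defines "\<kappa> \<equiv> fst \<eta> / 2 * exp (- Cf * N)"
  shows "\<exists>x g. adm \<eta> x g \<and> fin x g \<and> (\<forall>t\<ge>0. t \<in> E \<longrightarrow> \<kappa> / e \<le> ctrl x g t)
     \<and> (\<forall>t\<ge>0. fst \<eta> / 2 * exp (- Cf * t) \<le> x t)"
proof -
  \<comment> \<open>Extra consumption of total mass at most \<open>\<kappa>\<close>. Discounted back
    to time 0 at rate \<open>Cf\<close> it weighs at most \<open>exp (Cf * N) * \<kappa>\<close>,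
    which is half of the initial state; the other half is the lower bound left for
    \<open>x\<close>.\<close>
  define q where "q t = \<kappa> / e * indicat_real E t" for t
  have \<kappa>: "0 < \<kappa>" using \<eta>0 by (simp add: \<kappa>_def)
  have q0: "0 \<le> q t" for t using \<kappa> e by (simp add: q_def)
  have Em: "E \<in> lmeasurable"
    by (rule bounded_set_imp_lmeasurable[OF bounded_subset[OF _ E(2)] E(1)]) simp
  have qi: "q absolutely_integrable_on {0..t}" for t
    unfolding q_def using E \<kappa> e
    by (intro absolutely_integrable_bounded[where B = "\<kappa> / e"])
       (auto simp: indicator_def intro!: borel_measurable_times borel_measurable_indicator' measurable_restrict_space1)
  define u where "u = linear_response Cf q"
  have u0: "0 \<le> u t" for t
    unfolding u_def linear_response_def using absolutely_integrable_exp_mult[OF qi] \<kappa> e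
    by (intro mult_nonneg_nonneg Henstock_Kurzweil_Integration.integral_nonneg)
       (auto simp: q_def absolutely_integrable_on_def)
  have u_le: "u t \<le> fst \<eta> / 2 * exp (- Cf * t)" for t
  proof -
    have "integral {0..t} (\<lambda>s. exp (Cf * s) * q s) \<le> integral {0..t} (\<lambda>s. exp (Cf * N) * q s)"
    proof (rule integral_le)
      show "(\<lambda>s. exp (Cf * s) * q s) integrable_on {0..t}"
        using absolutely_integrable_exp_mult[OF qi] by (auto simp: absolutely_integrable_on_def)
      show "(\<lambda>s. exp (Cf * N) * q s) integrable_on {0..t}"
        using qi by (intro integrable_on_mult_right) (auto simp: absolutely_integrable_on_def)
      show "exp (Cf * s) * q s \<le> exp (Cf * N) * q s" for s
      proof (cases "s \<in> E")
        case True
        then have "Cf * s \<le> Cf * N" using E(2) Cf_nonneg by (intro mult_left_mono) auto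
        then show ?thesis using q0[of s] by (intro mult_right_mono) auto
      qed (simp add: q_def)
    qed
    also have "\<dots> = exp (Cf * N) * (\<kappa> / e * integral {0..t} (indicat_real E))"
      by (simp add: q_def)
    finally have 1: "integral {0..t} (\<lambda>s. exp (Cf * s) * q s) \<le> exp (Cf * N) * (\<kappa> / e * integral {0..t} (indicat_real E))" .
    have "integral {0..t} (indicat_real E) = measure lebesgue (E \<inter> {0..t})"
      using Em by (intro integral_indicator) auto
    also have "measure lebesgue (E \<inter> {0..t}) \<le> measure lebesgue E"
      using Em by (intro measure_mono_fmeasurable) auto
    also note e(1)
    finally have "exp (Cf * N) * (\<kappa> / e * integral {0..t} (indicat_real E)) \<le> exp (Cf * N) * (\<kappa> / e * e)"
      using \<kappa> e by (intro mult_left_mono) auto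
    also have "exp (Cf * N) * (\<kappa> / e * e) = fst \<eta> / 2"
      using e(2) by (simp add: \<kappa>_def exp_minus)
    finally have "integral {0..t} (\<lambda>s. exp (Cf * s) * q s) \<le> fst \<eta> / 2" using 1 by linarith
    then have "exp (- Cf * t) * integral {0..t} (\<lambda>s. exp (Cf * s) * q s) \<le> exp (- Cf * t) * (fst \<eta> / 2)"
      by (intro mult_left_mono) auto
    then show ?thesis by (simp add: u_def linear_response_def mult.commute)
  qed
  define x where "x t = (if t < 0 then snd \<eta> t else fst \<eta> * exp (- Cf * t) - u t)" for t
  define g where "g t = - Cf * x t - q t" for t
  have uc: "continuous_on {0..} u" unfolding u_def by (rule continuous_on_linear_response[OF qi])
  have xc: "continuous_on {0..} x"
  proof -
    have "continuous_on {0..} (\<lambda>t. fst \<eta> * exp (- Cf * t) - u t)" by (intro continuous_intros uc)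
    then show ?thesis by (rule continuous_on_cong[THEN iffD1, rotated 2]) (auto simp: x_def)
  qed
  have xi: "x absolutely_integrable_on {0..t}" for t
    by (rule absolutely_integrable_continuous_real, rule continuous_on_subset[OF xc]) auto
  have gi: "g absolutely_integrable_on {0..t}" for t
    unfolding g_def by (intro set_integral_diff(1) set_integrable_mult_right qi xi)
  have hx: "hist x" by (rule histI[OF \<eta> _ xi]) (simp add: x_def)
  have xge: "fst \<eta> / 2 * exp (- Cf * t) \<le> x t" if "0 \<le> t" for t
    using u_le[of t] that by (simp add: x_def)
  have xpos: "0 < x t" if "0 \<le> t" for t
    using xge[OF that] \<eta>0 by (smt (verit) exp_gt_zero half_gt_zero mult_pos_pos)
  have traj: "traj \<eta> x g"
    unfolding traj_def
  proof (intro conjI allI impI gi)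
    show "x s = snd \<eta> s" if "-T \<le> s \<and> s < 0" for s using that by (simp add: x_def)
    fix t :: real assume t: "0 \<le> t"
    have qu: "(\<lambda>s. q s - Cf * u s) integrable_on {0..t}"
    proof (rule integrable_diff)
      show "q integrable_on {0..t}" using qi by (auto simp: absolutely_integrable_on_def)
      show "(\<lambda>s. Cf * u s) integrable_on {0..t}"
        by (intro integrable_continuous_real continuous_intros continuous_on_subset[OF uc]) auto
    qed
    have "((\<lambda>s. fst \<eta> * (- (Cf * exp (- Cf * s))) - (q s - Cf * u s))
        has_integral (fst \<eta> * (- (1 - exp (- Cf * t))) - integral {0..t} (\<lambda>s. q s - Cf * u s))) {0..t}"
      by (intro has_integral_diff has_integral_mult_right has_integral_neg exp_integral_neg t integrable_integral qu)
    then have "(g has_integral (fst \<eta> * (- (1 - exp (- Cf * t))) - integral {0..t} (\<lambda>s. q s - Cf * u s))) {0..t}"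
      by (rule has_integral_eq[rotated]) (auto simp: g_def x_def algebra_simps)
    then have "integral {0..t} g = fst \<eta> * (- (1 - exp (- Cf * t))) - u t"
      using integral_linear_response[OF qi t, of Cf] by (simp add: u_def integral_unique)
    then show "x t = fst \<eta> + integral {0..t} g" using t by (simp add: x_def algebra_simps)
  qed
  have Dx: "r * x t + q t \<le> D x t - g t" if t: "0 \<le> t" for t
  proof -
    have "(AE \<xi> in lebesgue. \<xi> \<in> {-T..0} \<longrightarrow> 0 \<le> snd \<eta> \<xi>)"
      using \<eta>1 by (subst (asm) AE_restrict_space_iff) auto
    then obtain Z where Z: "negligible Z" "\<And>\<xi>. \<xi> \<notin> Z \<Longrightarrow> \<xi> \<in> {-T..0} \<Longrightarrow> 0 \<le> snd \<eta> \<xi>"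
      by (auto simp: AE_lebesgue_negligible)
    have h0: "hist (\<lambda>_. 0)" by (simp add: hist_def)
    have "delay (\<lambda>_. 0) t \<le> delay x t"
    proof (rule delay_mono[OF h0 hx t Z(1)])
      show "0 \<le> x s" if "-T \<le> s" "s \<le> t" "s \<notin> Z" for s
        using that Z(2)[of s] xpos[of s] by (cases "s < 0") (auto simp: x_def)
    qed
    then have "0 \<le> delay x t" by (simp add: delay_def)
    then have "- Cf * x t \<le> F (x t) (delay x t)" using xpos[OF t] by (intro F_ge) auto
    then show ?thesis by (simp add: drift_eq hx t g_def)
  qed
  have g_le: "g t \<le> D x t" if "0 \<le> t" for t
  proof -
    have "0 \<le> r * x t" using r_pos xpos[OF that] by simp
    then show ?thesis using Dx[OF that] q0[of t] by linarith
  qed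
  have "AE t in half_line. g t \<le> D x t"
    using AE_half_line_nonneg by eventually_elim (rule g_le)
  then have adm: "adm \<eta> x g" using traj \<eta> xpos by (simp add: adm_def)
  have "fin x g"
  proof (rule fin_of_lower[OF adm])
    show "integrable half_line (\<lambda>t. (- B) * exp (- \<rho> * t) + exp (- \<rho> * t) * U2 (fst \<eta> / 2 * exp (- Cf * t)))"
      using \<eta>0 by (intro Bochner_Integration.integrable_add bound_integrable U2_discounted_integrable) auto
    show "AE t in half_line. (- B) * exp (- \<rho> * t) + exp (- \<rho> * t) * U2 (fst \<eta> / 2 * exp (- Cf * t)) \<le> payoff x g t"
      using AE_half_line_nonneg
    proof eventually_elim
      case (elim t)
      have "- B \<le> U1 (ctrl x g t)" using B(2)[OF ctrl_nonneg[of x g t]] by linarith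
      moreover have "U2 (fst \<eta> / 2 * exp (- Cf * t)) \<le> U2 (x t)"
        using xge[OF elim] \<eta>0 by (intro U2_mono') auto
      ultimately have "exp (- \<rho> * t) * (- B + U2 (fst \<eta> / 2 * exp (- Cf * t))) \<le> payoff x g t"
        unfolding payoff_def by (intro mult_left_mono) auto
      then show ?case by (simp add: algebra_simps)
    qed
  qed
  moreover have "\<kappa> / e \<le> ctrl x g t" if "0 \<le> t" "t \<in> E" for t
  proof -
    have "0 \<le> r * x t" using r_pos xpos[OF that(1)] by simp
    then have "q t \<le> D x t - g t" using Dx[OF that(1)] by linarith
    then show ?thesis using that by (simp add: ctrl_def q_def)
  qed
  ultimately show ?thesis using adm xge by blast
qed

lemma U2_not_integrable:
  assumes "0 < \<delta>" shows "\<not> integrable (lebesgue_on {0<..\<delta>}) U2"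
  using U2_not_int[OF assms] ext_integral_integrable[of "{0<..\<delta>}" U2] by auto

text \<open>By monotonicity \<open>U2\<close> would otherwise be bounded below on all positive
  states; being bounded above too, it would be integrable near 0.\<close>

lemma U2_at_0: "filterlim U2 at_bot (at_right 0)"
proof (rule ccontr)
  assume "\<not> ?thesis"
  then obtain K where K: "\<not> (\<forall>\<^sub>F x in at_right 0. U2 x \<le> K)" by (auto simp: filterlim_at_bot)
  have "K \<le> U2 x" if x: "0 < x" for x
  proof (rule ccontr)
    assume "\<not> K \<le> U2 x"
    then have "U2 y \<le> K" if "0 < y" "y < x" for y using U2_mono'[of y x] that by linarith
    then have "\<forall>\<^sub>F y in at_right 0. U2 y \<le> K"
      unfolding eventually_at_right_field using x by blast
    then show False using K by blast
  qed
  then have bd: "\<bar>U2 x\<bar> \<le> \<bar>K\<bar> + B" if "0 < x" for x using B(1) B(3)[of x] that by force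
  have "U2 absolutely_integrable_on {0<..1}"
  proof (rule measurable_bounded_by_integrable_imp_absolutely_integrable)
    show "U2 \<in> borel_measurable (lebesgue_on {0<..1})"
      by (rule continuous_imp_measurable_on_sets_lebesgue[OF continuous_on_subset[OF U2_cont]]) auto
    show "(\<lambda>_. \<bar>K\<bar> + B) integrable_on {0<..1::real}" by (intro integrable_on_const bounded_set_imp_lmeasurable) auto
  qed (use bd in auto)
  then show False using U2_not_integrable[of 1] by (simp add: integrable_lebesgue_on_iff)
qed

end

subsection \<open>Existence of an optimal control\<close>

lemma dominated_convergence_negligible:
  fixes f :: "nat \<Rightarrow> real \<Rightarrow> real"
  assumes f: "\<And>k. f k integrable_on S" and h: "h integrable_on S" and Z: "negligible Z"
    and le: "\<And>k x. x \<in> S \<Longrightarrow> x \<notin> Z \<Longrightarrow> \<bar>f k x\<bar> \<le> h x"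
    and conv: "\<And>x. x \<in> S \<Longrightarrow> x \<notin> Z \<Longrightarrow> (\<lambda>k. f k x) \<longlonglongrightarrow> g x"
  shows "g integrable_on S" "(\<lambda>k. integral S (f k)) \<longlonglongrightarrow> integral S g"
proof -
  define f' where "f' k x = (if x \<in> Z then 0 else f k x)" for k x
  define g' where "g' x = (if x \<in> Z then 0 else g x)" for x
  define h' where "h' x = (if x \<in> Z then 0 else h x)" for x
  have f': "f' k integrable_on S" for k
    by (rule integrable_spike[OF f Z]) (simp add: f'_def)
  have h': "h' integrable_on S"
    by (rule integrable_spike[OF h Z]) (simp add: h'_def)
  have le': "norm (f' k x) \<le> h' x" if "x \<in> S" for k x
    using le that by (simp add: f'_def h'_def)
  have conv': "(\<lambda>k. f' k x) \<longlonglongrightarrow> g' x" if "x \<in> S" for x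
    using conv that by (simp add: f'_def g'_def)
  have g': "g' integrable_on S" "(\<lambda>k. integral S (f' k)) \<longlonglongrightarrow> integral S g'"
    using dominated_convergence[OF f' h' le' conv'] by blast+
  show "g integrable_on S"
    by (rule integrable_spike[OF g'(1) Z]) (simp add: g'_def)
  have "integral S (f' k) = integral S (f k)" for k
    by (rule integral_spike[OF Z]) (simp add: f'_def)
  moreover have "integral S g' = integral S g"
    by (rule integral_spike[OF Z]) (simp add: g'_def)
  ultimately show "(\<lambda>k. integral S (f k)) \<longlonglongrightarrow> integral S g" using g'(2) by simp
qed

text \<open>Helly's theorem asks for a bound uniform in time, while \<open>C n t\<close> is bounded
  only by \<open>b t\<close>. The map y \<mapsto> 1 - exp(- y) sends the functions into [0, 1],
  keeps monotonicity, and can be inverted in the limit.\<close>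

lemma helly_half_line:
  fixes C :: "nat \<Rightarrow> real \<Rightarrow> real"
  assumes cont: "\<And>n. continuous_on {0..} (C n)"
    and mono: "\<And>n s t. 0 \<le> s \<Longrightarrow> s \<le> t \<Longrightarrow> C n s \<le> C n t"
    and nonneg: "\<And>n. 0 \<le> C n 0" and le: "\<And>n t. 0 \<le> t \<Longrightarrow> C n t \<le> b t"
  shows "\<exists>s Z. strict_mono s \<and> negligible Z \<and> (\<forall>t\<ge>0. t \<notin> Z \<longrightarrow> convergent (\<lambda>n. C (s n) t))"
proof -
  define f where "f n t = 1 - exp (- C n (max 0 t))" for n t
  have fc: "continuous_on UNIV (f n)" for n
    unfolding f_def by (intro continuous_intros continuous_on_compose2[OF cont]) auto
  have C0: "0 \<le> C n t" if "0 \<le> t" for n t using mono[of 0 t n] nonneg[of n] that by simp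
  have "\<exists>s. strict_mono (s::nat \<Rightarrow> nat) \<and> (\<exists>F. (\<forall>x. continuous (at_right x) F) \<and> mono F \<and> (\<forall>x. \<bar>F x\<bar> \<le> 1) \<and>
    (\<forall>x. continuous (at x) F \<longrightarrow> (\<lambda>n. f (s n) x) \<longlonglongrightarrow> F x))"
  proof (rule Helly_selection)
    show "continuous (at_right x) (f n)" for n x
      using fc[of n] by (auto simp: continuous_on_eq_continuous_at intro: continuous_at_imp_continuous_at_within)
    show "mono_on UNIV (f n)" for n by (auto simp: f_def mono_on_def intro!: mono)
    show "\<bar>f n x\<bar> \<le> 1" for n x using C0[of "max 0 x" n] by (simp add: f_def abs_le_iff)
  qed
  then obtain s F where s: "strict_mono s" "mono F" "\<And>x. isCont F x \<Longrightarrow> (\<lambda>n. f (s n) x) \<longlonglongrightarrow> F x"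
    by blast
  define Z where "Z = {x. \<not> isCont F x}"
  have "negligible Z"
    unfolding Z_def negligible_iff_null_sets
    by (intro null_sets_completionI countable_imp_null_set_lborel mono_ctble_discont s(2))
  moreover have "convergent (\<lambda>n. C (s n) t)" if t: "0 \<le> t" "t \<notin> Z" for t
  proof -
    have lim: "(\<lambda>n. 1 - f (s n) t) \<longlonglongrightarrow> 1 - F t" using t s(3) by (intro tendsto_intros) (simp add: Z_def)
    \<comment> \<open>The bound \<open>b t\<close> keeps the limit away from 0, where the logarithm
      would fail to be continuous.\<close>
    have "exp (- b t) \<le> 1 - F t"
      by (rule tendsto_lowerbound[OF lim]) (use t le in \<open>auto simp: f_def\<close>)
    then have "1 - F t \<noteq> 0" using exp_gt_zero[of "- b t"] by linarith
    then have "(\<lambda>n. - ln (1 - f (s n) t)) \<longlonglongrightarrow> - ln (1 - F t)" by (intro tendsto_intros lim)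
    moreover have "- ln (1 - f (s n) t) = C (s n) t" for n using t by (simp add: f_def)
    ultimately show ?thesis by (auto simp: convergent_def)
  qed
  ultimately show ?thesis using s(1) by blast
qed

lemma AE_summable_of_summable_integrals:
  fixes d :: "nat \<Rightarrow> 'a \<Rightarrow> real"
  assumes d: "\<And>n. integrable M (d n)" "\<And>n t. t \<in> space M \<Longrightarrow> 0 \<le> d n t" and s: "summable (\<lambda>n. integral\<^sup>L M (d n))"
  shows "AE t in M. summable (\<lambda>n. d n t)"
proof -
  have m: "(\<lambda>t. ennreal (d n t)) \<in> borel_measurable M" for n using d(1) by simp
  have "(\<integral>\<^sup>+ t. (\<Sum>n. ennreal (d n t)) \<partial>M) = (\<Sum>n. \<integral>\<^sup>+ t. ennreal (d n t) \<partial>M)"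
    by (rule nn_integral_suminf[OF m])
  also have "\<dots> = (\<Sum>n. ennreal (integral\<^sup>L M (d n)))"
    using d by (subst nn_integral_eq_integral) auto
  also have "\<dots> \<noteq> \<infinity>"
    using s d(2) by (subst suminf_ennreal2) (auto intro!: Bochner_Integration.integral_nonneg)
  finally have "AE t in M. (\<Sum>n. ennreal (d n t)) \<noteq> \<infinity>"
    by (intro nn_integral_PInf_AE) (auto intro: borel_measurable_suminf_order m)
  then show ?thesis
    using AE_space
  proof eventually_elim
    case (elim t)
    then show ?case by (intro summable_suminf_not_top d(2)) auto
  qed
qed

text \<open>Truncating the increments at 1 keeps their integrals under control. Summable terms tend
  to zero, so the truncation is eventually inactive.\<close>

lemma convergent_of_summable_increments:
  fixes c :: "nat \<Rightarrow> real"
  assumes "summable (\<lambda>n. min 1 \<bar>c (Suc n) - c n\<bar>)"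
  shows "convergent c"
proof -
  have "(\<lambda>n. min 1 \<bar>c (Suc n) - c n\<bar>) \<longlonglongrightarrow> 0" by (rule summable_LIMSEQ_zero[OF assms])
  then have "\<forall>\<^sub>F n in sequentially. min 1 \<bar>c (Suc n) - c n\<bar> < 1" by (rule order_tendstoD) simp
  then have "\<forall>\<^sub>F n in sequentially. min 1 \<bar>c (Suc n) - c n\<bar> = \<bar>c (Suc n) - c n\<bar>"
    by eventually_elim auto
  then have "summable (\<lambda>n. \<bar>c (Suc n) - c n\<bar>)" using assms by (simp add: summable_cong)
  then have "summable (\<lambda>n. c (Suc n) - c n)" by (rule summable_rabs_cancel)
  then have "convergent (\<lambda>n. \<Sum>i<n. c (Suc i) - c i)" by (simp add: summable_iff_convergent)
  then have "convergent (\<lambda>n. c n - c 0)" by (simp add: sum_lessThan_telescope)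
  then obtain l where "(\<lambda>n. c n - c 0) \<longlonglongrightarrow> l" by (auto simp: convergent_def)
  then have "(\<lambda>n. (c n - c 0) + c 0) \<longlonglongrightarrow> l + c 0" by (intro tendsto_intros)
  then show ?thesis by (auto simp: convergent_def)
qed

lemma continuous_AE_nonneg:
  assumes f: "continuous_on {0..} f" and ae: "AE t in half_line. 0 \<le> (f t :: real)" and t: "0 \<le> t"
  shows "0 \<le> f t"
proof (rule ccontr)
  assume "\<not> 0 \<le> f t"
  then have "f t < 0" by simp
  moreover have "(f \<longlongrightarrow> f t) (at t within {0..})" using f t by (auto simp: continuous_on_def)
  ultimately have "\<forall>\<^sub>F s in at t within {0..}. f s < 0" by (intro order_tendstoD) 
  then obtain d where d: "0 < d" "\<And>s. 0 \<le> s \<Longrightarrow> s \<noteq> t \<Longrightarrow> dist s t < d \<Longrightarrow> f s < 0"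
    by (auto simp: eventually_at)
  obtain Z where Z: "negligible Z" "\<And>s. 0 \<le> s \<Longrightarrow> s \<notin> Z \<Longrightarrow> 0 \<le> f s" using ae by (auto simp: AE_half_line)
  have "{t<..<t + d} \<subseteq> Z"
  proof
    fix s assume s: "s \<in> {t<..<t + d}"
    then have "f s < 0" using t by (intro d) (auto simp: dist_real_def)
    then show "s \<in> Z" using Z(2)[of s] s t by force
  qed
  then have "negligible {t<..<t + d}" using Z(1) negligible_subset by blast
  then show False using d(1) by (simp add: negligible_interval(2)[of t "t + d", simplified])
qed

context control_problem
begin

definition pos_history :: "real \<times> (real \<Rightarrow> real) \<Rightarrow> bool" where
  "pos_history \<eta> \<longleftrightarrow> 0 < fst \<eta> \<and> snd \<eta> absolutely_integrable_on {-T..0}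
     \<and> (AE \<xi> in lebesgue_on {-T..0}. 0 \<le> snd \<eta> \<xi>)"

definition optimal :: "real \<times> (real \<Rightarrow> real) \<Rightarrow> (real \<Rightarrow> real) \<Rightarrow> (real \<Rightarrow> real) \<Rightarrow> bool" where
  "optimal \<eta> x g \<longleftrightarrow> adm \<eta> x g \<and> fin x g \<and> VF \<eta> = ereal (J x g)"

text \<open>The midpoint Jensen defect of \<open>U1\<close>: the gain in utility from averaging two
  consumption levels.\<close>

definition gap :: "real \<Rightarrow> real \<Rightarrow> real" where "gap u v = U1 (1/2 * u + 1/2 * v) - (1/2 * U1 u + 1/2 * U1 v)"

lemma gap_nonneg: "0 \<le> u \<Longrightarrow> 0 \<le> v \<Longrightarrow> 0 \<le> gap u v"
  using U1_concave[of u v "1/2" "1/2"] by (simp add: gap_def)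

lemma gap_pos: "0 \<le> u \<Longrightarrow> 0 \<le> v \<Longrightarrow> u \<noteq> v \<Longrightarrow> 0 < gap u v"
  using U1_strictly_concave[of u v "1/2" "1/2"] U1_strictly_concave[of v u "1/2" "1/2"]
  by (cases u v rule: linorder_cases) (simp_all add: gap_def add.commute)

text \<open>Compactness of the set of pairs that are at least \<open>d\<close> apart. The bound
  \<open>R\<close> matters: \<open>U1\<close> is bounded, so the defect has no positive lower bound
  at large consumption.\<close>

lemma gap_modulus:
  assumes d: "0 < d"
  shows "\<exists>k>0. \<forall>u v. 0 \<le> u \<longrightarrow> u \<le> R \<longrightarrow> 0 \<le> v \<longrightarrow> v \<le> R \<longrightarrow> d \<le> \<bar>u - v\<bar> \<longrightarrow> k \<le> gap u v"
proof -
  define S where "S = ({0..R} \<times> {0..R}) \<inter> {z. d \<le> \<bar>fst z - snd z\<bar>}"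
  have S: "compact S"
    unfolding S_def by (intro compact_Int_closed compact_Times closed_Collect_le continuous_intros) auto
  show ?thesis
  proof (cases "S = {}")
    case True
    then show ?thesis by (intro exI[of _ 1]) (fastforce simp: S_def)
  next
    case False
    have c: "continuous_on S (\<lambda>z. gap (fst z) (snd z))"
      unfolding gap_def
      by (intro continuous_intros continuous_on_compose2[OF U1_cont]) (auto simp: S_def)
    obtain z where z: "z \<in> S" "\<And>w. w \<in> S \<Longrightarrow> gap (fst z) (snd z) \<le> gap (fst w) (snd w)"
      using continuous_attains_inf[OF S False c] by blast
    have "0 < gap (fst z) (snd z)" using z(1) d by (intro gap_pos) (auto simp: S_def)
    then show ?thesis using z(2) by (intro exI[of _ "gap (fst z) (snd z)"]) (force simp: S_def)
  qed
qed

text \<open>The averaged pair earns at least the mean of the two payoffs plus the integrated defect,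
  yet at most \<open>V\<close>; as both payoffs are at least \<open>V - e\<close>, the defect
  integrates to at most \<open>e\<close>.\<close>

lemma gap_integral_le:
  assumes x: "adm \<eta> x1 g1" "adm \<eta> x2 g2" and f: "fin x1 g1" "fin x2 g2"
    and V: "\<And>x g. adm \<eta> x g \<Longrightarrow> fin x g \<Longrightarrow> J x g \<le> V" and e: "V - e \<le> J x1 g1" "V - e \<le> J x2 g2"
  shows "integrable half_line (\<lambda>t. exp (- \<rho> * t) * gap (ctrl x1 g1 t) (ctrl x2 g2 t))"
    "integral\<^sup>L half_line (\<lambda>t. exp (- \<rho> * t) * gap (ctrl x1 g1 t) (ctrl x2 g2 t)) \<le> e"
proof -
  have x': "adm (fst \<eta>, snd \<eta>) x1 g1" "adm (fst \<eta>, snd \<eta>) x2 g2" using x by simp_all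
  define x g where "x t = 1/2 * x1 t + 1/2 * x2 t" and "g t = 1/2 * g1 t + 1/2 * g2 t" for t
  have adm: "adm \<eta> x g" and fin: "fin x g"
    using adm_mix[OF x', of "1/2" "1/2"] fin_mix[OF x', of "1/2" "1/2"] f
    by (simp_all add: x_def[abs_def] g_def[abs_def])
  define w where "w t = payoff x g t - (1/2 * payoff x1 g1 t + 1/2 * payoff x2 g2 t)" for t
  have w: "integrable half_line w" unfolding w_def using f fin
    by (intro Bochner_Integration.integrable_diff Bochner_Integration.integrable_add integrable_mult_right) (auto simp: fin_def)
  have le: "AE t in half_line. exp (- \<rho> * t) * gap (ctrl x1 g1 t) (ctrl x2 g2 t) \<le> w t"
  proof -
    have "AE t in half_line. exp (- \<rho> * t) * (U1 (1/2 * ctrl x1 g1 t + 1/2 * ctrl x2 g2 t)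
        + (1/2 * U2 (x1 t) + 1/2 * U2 (x2 t))) \<le> payoff x g t"
      unfolding x_def[abs_def] g_def[abs_def] by (rule payoff_mix[OF x']) simp_all
    then show ?thesis by eventually_elim (simp add: w_def gap_def payoff_def algebra_simps)
  qed
  have nn: "0 \<le> exp (- \<rho> * t) * gap (ctrl x1 g1 t) (ctrl x2 g2 t)" for t
    using gap_nonneg[OF ctrl_nonneg ctrl_nonneg] by simp
  have mc: "(\<lambda>t. U1 (1/2 * ctrl x1 g1 t + 1/2 * ctrl x2 g2 t)) \<in> borel_measurable half_line"
    using ctrl_measurable[OF x(1)] ctrl_measurable[OF x(2)]
    by (intro U1_ctrl_measurable borel_measurable_add borel_measurable_times borel_measurable_const
         add_nonneg_nonneg mult_nonneg_nonneg ctrl_nonneg) auto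
  have "(\<lambda>t. exp (- \<rho> * t)) \<in> borel_measurable half_line"
    by (intro continuous_measurable_half_line continuous_intros)
  then have meas: "(\<lambda>t. exp (- \<rho> * t) * gap (ctrl x1 g1 t) (ctrl x2 g2 t)) \<in> borel_measurable half_line"
    unfolding gap_def
    using U1_ctrl_measurable[OF ctrl_measurable[OF x(1)] ctrl_nonneg]
      U1_ctrl_measurable[OF ctrl_measurable[OF x(2)] ctrl_nonneg] mc
    by (intro borel_measurable_times borel_measurable_diff borel_measurable_add borel_measurable_const) auto
  show i: "integrable half_line (\<lambda>t. exp (- \<rho> * t) * gap (ctrl x1 g1 t) (ctrl x2 g2 t))"
  proof (rule Bochner_Integration.integrable_bound[OF w meas])
    show "AE t in half_line. norm (exp (- \<rho> * t) * gap (ctrl x1 g1 t) (ctrl x2 g2 t)) \<le> norm (w t)"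
      using le
    proof eventually_elim
      case (elim t)
      then show ?case using nn[of t] unfolding real_norm_def by linarith
    qed
  qed
  have "integral\<^sup>L half_line (\<lambda>t. exp (- \<rho> * t) * gap (ctrl x1 g1 t) (ctrl x2 g2 t)) \<le> integral\<^sup>L half_line w"
    by (rule integral_mono_AE[OF i w le])
  also have "\<dots> = J x g - (1/2 * J x1 g1 + 1/2 * J x2 g2)"
    unfolding w_def J_def using f fin unfolding fin_def by simp
  also have "\<dots> \<le> e" using V[OF adm fin] e by simp
  finally show "integral\<^sup>L half_line (\<lambda>t. exp (- \<rho> * t) * gap (ctrl x1 g1 t) (ctrl x2 g2 t)) \<le> e" .
qed

text \<open>Strict concavity of \<open>U1\<close> makes the controls of a fast maximizing sequence converge almost
  everywhere: two nearly optimal controls that differ could be improved by averaging.\<close>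

lemma maximizing_sequence:
  assumes \<eta>: "pos_history \<eta>"
  shows "\<exists>x g V. VF \<eta> = ereal V \<and> (\<forall>n. adm \<eta> (x n) (g n) \<and> fin (x n) (g n)) \<and>
     (\<lambda>n. J (x n) (g n)) \<longlonglongrightarrow> V \<and> (AE t in half_line. convergent (\<lambda>n. ctrl (x n) (g n) t))"
proof -
  obtain x0 g0 where 0: "adm \<eta> x0 g0" "fin x0 g0"
    using reference_pair[of \<eta> "{}" 0 1] \<eta> by (auto simp: pos_history_def)
  define V where "V = real_of_ereal (VF \<eta>)"
  have V: "VF \<eta> = ereal V" "\<And>x g. adm \<eta> x g \<Longrightarrow> fin x g \<Longrightarrow> J x g \<le> V"
    using VF_real(1)[OF 0] VF_real(2) by (auto simp: V_def)
  obtain k where k: "\<And>n. 0 < k n"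
    "\<And>n u v. 0 \<le> u \<Longrightarrow> u \<le> 2 ^ n \<Longrightarrow> 0 \<le> v \<Longrightarrow> v \<le> 2 ^ n \<Longrightarrow> (1/2) ^ n \<le> \<bar>u - v\<bar> \<Longrightarrow> k n \<le> gap u v"
  proof -
    have "\<exists>k>0. \<forall>u v. 0 \<le> u \<longrightarrow> u \<le> 2 ^ n \<longrightarrow> 0 \<le> v \<longrightarrow> v \<le> 2 ^ n \<longrightarrow> (1/2) ^ n \<le> \<bar>u - v\<bar> \<longrightarrow> k \<le> gap u v" for n :: nat
      by (rule gap_modulus) simp
    then show ?thesis using that by metis
  qed
  define \<epsilon> where "\<epsilon> n = (1/2) ^ n * Min (k ` {..n})" for n
  have Mk: "0 < Min (k ` {..n})" for n using k(1) by (subst Min_gr_iff) auto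
  have \<epsilon>0: "0 < \<epsilon> n" for n using Mk by (simp add: \<epsilon>_def)
  have \<epsilon>k: "\<epsilon> n \<le> (1/2) ^ n * k n" for n unfolding \<epsilon>_def by (intro mult_left_mono Min_le) auto
  have \<epsilon>S: "\<epsilon> (Suc n) \<le> \<epsilon> n" for n
  proof -
    have "Min (k ` {..Suc n}) \<le> Min (k ` {..n})" by (intro Min_antimono) auto
    then show ?thesis unfolding \<epsilon>_def using Mk[of "Suc n"] by (intro mult_mono) (auto intro: less_imp_le k(1))
  qed
  have "\<exists>x g. adm \<eta> x g \<and> fin x g \<and> V - \<epsilon> n < J x g" for n
    using VF_real(3)[OF 0 \<epsilon>0[of n]] by (simp add: V_def)
  then obtain x g where x: "\<And>n. adm \<eta> (x n) (g n)" "\<And>n. fin (x n) (g n)" "\<And>n. V - \<epsilon> n < J (x n) (g n)"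
    by metis
  define c where "c n = ctrl (x n) (g n)" for n
  have c0: "0 \<le> c n t" for n t by (simp add: c_def ctrl_nonneg)
  define G where "G n t = exp (- \<rho> * t) * gap (c n t) (c (Suc n) t)" for n t
  have G: "integrable half_line (G n)" "integral\<^sup>L half_line (G n) \<le> \<epsilon> n" for n
  proof -
    have "V - \<epsilon> n \<le> J (x n) (g n)" "V - \<epsilon> n \<le> J (x (Suc n)) (g (Suc n))"
      using x(3)[of n] x(3)[of "Suc n"] \<epsilon>S[of n] by linarith+
    note le = gap_integral_le[OF x(1,1,2,2) V(2) this]
    show "integrable half_line (G n)" "integral\<^sup>L half_line (G n) \<le> \<epsilon> n"
      unfolding G_def[abs_def] c_def by (rule le; assumption)+
  qed
  have G0: "0 \<le> G n t" for n t using gap_nonneg[OF c0 c0] by (simp add: G_def)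
  define d where "d n t = min 1 \<bar>c (Suc n) t - c n t\<bar>" for n t
  have d_le: "d n t \<le> (1/2) ^ n + exp (\<rho> * N) / k n * G n t + (1/2) ^ n * (c n t + c (Suc n) t)"
    if t: "0 \<le> t" "t \<le> N" for n t N
  proof -
    have e1: "gap (c n t) (c (Suc n) t) \<le> exp (\<rho> * N) * G n t"
    proof -
      have "gap (c n t) (c (Suc n) t) = exp (\<rho> * t) * G n t"
        by (simp add: G_def mult.assoc[symmetric] exp_add[symmetric])
      also have "\<dots> \<le> exp (\<rho> * N) * G n t" using t G0 rho_pos by (intro mult_right_mono) auto
      finally show ?thesis .
    qed
    have p1: "0 \<le> exp (\<rho> * N) / k n * G n t" using k(1)[of n] G0[of n t] by simp
    have p2: "0 \<le> (1/2) ^ n * (c n t + c (Suc n) t)" using c0[of n t] c0[of "Suc n" t] by simp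
    have p3: "(0::real) \<le> (1/2) ^ n" by simp
    \<comment> \<open>The increment is small, or consumption is large, which is rare by the
      \<open>L1\<close> bound, or the defect is at least \<open>k n\<close>, which is rare by near
      optimality. Each case is paid for by one summand of the claim.\<close>
    consider "\<bar>c (Suc n) t - c n t\<bar> \<le> (1/2) ^ n" | "2 ^ n \<le> c n t + c (Suc n) t"
      | "(1/2) ^ n \<le> \<bar>c n t - c (Suc n) t\<bar>" "c n t \<le> 2 ^ n" "c (Suc n) t \<le> 2 ^ n"
      using c0[of n t] c0[of "Suc n" t] by linarith
    then show ?thesis
    proof cases
      case 1
      then show ?thesis using p1 p2 by (simp add: d_def)
    next
      case 2
      have "(1/2) ^ n * 2 ^ n \<le> (1/2) ^ n * (c n t + c (Suc n) t)" using 2 by (intro mult_left_mono) auto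
      then have "1 \<le> (1/2) ^ n * (c n t + c (Suc n) t)" by (simp add: power_one_over)
      then show ?thesis using p1 p3 unfolding d_def by linarith
    next
      case 3
      then have "k n \<le> exp (\<rho> * N) * G n t" using k(2)[of "c n t" n "c (Suc n) t"] c0 e1 by force
      then have "1 \<le> exp (\<rho> * N) / k n * G n t" using k(1)[of n] by (simp add: field_simps)
      then show ?thesis using p2 p3 unfolding d_def by linarith
    qed
  qed
  have sum: "AE t in lebesgue_on {0..real N}. summable (\<lambda>n. d n t)" for N :: nat
  proof (rule AE_summable_of_summable_integrals)
    have cm: "c n \<in> borel_measurable (lebesgue_on {0..real N})" for n
      unfolding c_def using ctrl_absolutely_integrable[OF x(1)] by (auto intro: absolutely_integrable_imp_borel_measurable)
    have ci: "integrable (lebesgue_on {0..real N}) (c n)" for n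
      unfolding c_def using ctrl_absolutely_integrable[OF x(1)] by (simp add: integrable_lebesgue_on_iff)
    have Gi: "integrable (lebesgue_on {0..real N}) (G n)" for n
    proof -
      have "G n absolutely_integrable_on {0..}" using G(1) by (simp add: integrable_lebesgue_on_iff)
      then show ?thesis using absolutely_integrable_on_subinterval[where f = "G n" and S = "{0..}" and a = 0 and b = "real N"]
        by (simp add: integrable_lebesgue_on_iff)
    qed
    have Gle: "integral\<^sup>L (lebesgue_on {0..real N}) (G n) \<le> \<epsilon> n" for n
    proof -
      have "integral\<^sup>L (lebesgue_on {0..real N}) (G n) = integral {0..real N} (G n)"
        using Gi by (simp add: lebesgue_integral_eq_integral)
      also have "\<dots> \<le> integral {0..} (G n)"
        using Gi[of n] G(1)[of n] G0 by (intro integral_subset_le) (auto intro: integrable_on_lebesgue_on)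
      also have "\<dots> = integral\<^sup>L half_line (G n)" using G(1) by (simp add: lebesgue_integral_eq_integral)
      finally show ?thesis using G(2)[of n] by simp
    qed
    have Cle: "integral\<^sup>L (lebesgue_on {0..real N}) (c n) \<le> ctrl_const \<eta> (real N)" for n
      using integral_ctrl_le[OF x(1), of "real N" n] ci[of n]
      by (simp add: c_def lebesgue_integral_eq_integral)
    show di: "integrable (lebesgue_on {0..real N}) (d n)" for n
      unfolding d_def using cm
      by (simp add: integrable_lebesgue_on_iff) (rule absolutely_integrable_bounded[where B = 1], auto)
    show "0 \<le> d n t" for n t by (simp add: d_def)
    let ?K = "real N + exp (\<rho> * real N) + 2 * ctrl_const \<eta> (real N)"
    have le: "integral\<^sup>L (lebesgue_on {0..real N}) (d n) \<le> ?K * (1/2) ^ n" for n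
    proof -
      have "integral\<^sup>L (lebesgue_on {0..real N}) (d n) \<le> integral\<^sup>L (lebesgue_on {0..real N})
          (\<lambda>t. (1/2) ^ n + exp (\<rho> * real N) / k n * G n t + (1/2) ^ n * (c n t + c (Suc n) t))"
        using ci Gi d_le
        by (intro integral_mono di Bochner_Integration.integrable_add integrable_mult_right)
           (auto simp: space_restrict_space integrable_lebesgue_on_iff)
      also have "\<dots> = (1/2) ^ n * real N + exp (\<rho> * real N) / k n * integral\<^sup>L (lebesgue_on {0..real N}) (G n)
          + (1/2) ^ n * (integral\<^sup>L (lebesgue_on {0..real N}) (c n) + integral\<^sup>L (lebesgue_on {0..real N}) (c (Suc n)))"
        using ci Gi by (simp add: integrable_lebesgue_on_iff measure_restrict_space)
      also have "\<dots> \<le> (1/2) ^ n * real N + exp (\<rho> * real N) / k n * ((1/2) ^ n * k n)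
          + (1/2) ^ n * (ctrl_const \<eta> (real N) + ctrl_const \<eta> (real N))"
        using Gle[of n] \<epsilon>k[of n] k(1)[of n] Cle[of n] Cle[of "Suc n"]
        by (intro add_mono mult_left_mono) auto
      also have "\<dots> = ?K * (1/2) ^ n" using k(1)[of n] by (simp add: field_simps)
      finally show ?thesis .
    qed
    have nn: "0 \<le> integral\<^sup>L (lebesgue_on {0..real N}) (d n)" for n
      by (rule Bochner_Integration.integral_nonneg) (simp add: d_def)
    show "summable (\<lambda>n. integral\<^sup>L (lebesgue_on {0..real N}) (d n))"
    proof (rule summable_comparison_test'[where N = 0])
      show "summable (\<lambda>n. ?K * (1/2) ^ n)" by (intro summable_mult summable_geometric) simp
      show "norm (integral\<^sup>L (lebesgue_on {0..real N}) (d n)) \<le> ?K * (1/2) ^ n" for n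
        unfolding real_norm_def abs_of_nonneg[OF nn] by (rule le)
    qed
  qed
  have "AE t in lebesgue. \<forall>N::nat. t \<in> {0..real N} \<longrightarrow> summable (\<lambda>n. d n t)"
    unfolding AE_all_countable
  proof
    fix N :: nat
    show "AE t in lebesgue. t \<in> {0..real N} \<longrightarrow> summable (\<lambda>n. d n t)"
      using sum[of N] by (subst (asm) AE_restrict_space_iff) auto
  qed
  then have "AE t in half_line. \<forall>N::nat. t \<in> {0..real N} \<longrightarrow> summable (\<lambda>n. d n t)"
    by (subst AE_restrict_space_iff) (auto elim: AE_mp)
  then have "AE t in half_line. convergent (\<lambda>n. c n t)"
    using AE_half_line_nonneg
  proof eventually_elim
    case (elim t)
    obtain N :: nat where "t \<le> real N" using real_arch_simple by blast
    then have "summable (\<lambda>n. d n t)" using elim by auto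
    then show ?case unfolding d_def by (rule convergent_of_summable_increments)
  qed
  moreover have "(\<lambda>n. J (x n) (g n)) \<longlonglongrightarrow> V"
  proof (rule tendsto_sandwich)
    have "(\<lambda>n. V - (1/2) ^ n * k 0) \<longlonglongrightarrow> V - 0 * k 0"
      by (intro tendsto_intros LIMSEQ_realpow_zero) auto
    then show "(\<lambda>n. V - (1/2) ^ n * k 0) \<longlonglongrightarrow> V" by simp
    show "\<forall>\<^sub>F n in sequentially. V - (1/2) ^ n * k 0 \<le> J (x n) (g n)"
    proof (rule always_eventually, rule allI)
      fix n
      have "\<epsilon> n \<le> (1/2) ^ n * k 0" unfolding \<epsilon>_def by (intro mult_left_mono Min_le) auto
      then show "V - (1/2) ^ n * k 0 \<le> J (x n) (g n)" using x(3)[of n] by linarith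
    qed
    show "\<forall>\<^sub>F n in sequentially. J (x n) (g n) \<le> V" using V(2) x by simp
  qed simp
  ultimately show ?thesis using V(1) x unfolding c_def by blast
qed

end

section \<open>Passage to the limit along a maximizing sequence\<close>

lemma negligible_avoid:
  fixes Z :: "real set"
  assumes "negligible Z" "s < t"
  shows "\<exists>u. s < u \<and> u < t \<and> u \<notin> Z"
proof (rule ccontr)
  assume "\<not> ?thesis"
  then have "{s<..<t} \<subseteq> Z" by auto
  then have "negligible {s<..<t}" using assms(1) negligible_subset by blast
  then show False using assms(2) by (simp add: negligible_interval(2)[of s t, simplified])
qed

lemma borel_measurable_AE_limit:
  fixes f :: "nat \<Rightarrow> real \<Rightarrow> real"
  assumes S: "S \<in> sets lebesgue" and f: "\<And>n. f n \<in> borel_measurable (lebesgue_on S)"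
    and conv: "AE u in lebesgue_on S. (\<lambda>n. f n u) \<longlonglongrightarrow> d u"
  shows "d \<in> borel_measurable (lebesgue_on S)"
proof -
  obtain Z where Z: "negligible Z" "\<And>u. u \<in> S \<Longrightarrow> u \<notin> Z \<Longrightarrow> (\<lambda>n. f n u) \<longlonglongrightarrow> d u"
    using conv S by (subst (asm) AE_restrict_space_iff) (auto simp: AE_lebesgue_negligible)
  define f' where "f' n u = (if u \<in> S - Z then f n u else 0)" for n u
  define d' where "d' u = (if u \<in> S - Z then d u else 0)" for u
  have "f' n \<in> borel_measurable lebesgue" for n
  proof (rule borel_measurable_AE[OF borel_measurable_if_I[OF f S]])
    show "AE u in lebesgue. (if u \<in> S then f n u else 0) = f' n u"
      unfolding AE_lebesgue_negligible using Z by (intro exI[of _ Z]) (auto simp: f'_def)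
  qed
  moreover have "(\<lambda>n. f' n u) \<longlonglongrightarrow> d' u" for u using Z(2) by (auto simp: f'_def d'_def)
  ultimately have "d' \<in> borel_measurable lebesgue" by (rule borel_measurable_LIMSEQ_real[rotated])
  then have "(\<lambda>u. if u \<in> S then d u else 0) \<in> borel_measurable lebesgue"
  proof (rule borel_measurable_AE)
    show "AE u in lebesgue. d' u = (if u \<in> S then d u else 0)"
      unfolding AE_lebesgue_negligible using Z by (intro exI[of _ Z]) (auto simp: d'_def)
  qed
  then show ?thesis by (rule borel_measurable_if_D)
qed

text \<open>Only an inequality can be expected: mass of the \<open>c n\<close> may concentrate on
  null sets in the limit.\<close>

lemma fatou_interval:
  fixes c :: "nat \<Rightarrow> real \<Rightarrow> real"
  assumes cn: "\<And>n. c n absolutely_integrable_on {s..t}" "\<And>n u. 0 \<le> c n u" and Z: "negligible Z"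
    and conv: "\<And>u. s \<le> u \<Longrightarrow> u \<le> t \<Longrightarrow> u \<notin> Z \<Longrightarrow> (\<lambda>n. c n u) \<longlonglongrightarrow> d u"
    and d: "\<And>u. s \<le> u \<Longrightarrow> u \<le> t \<Longrightarrow> 0 \<le> d u" and l: "(\<lambda>n. integral {s..t} (c n)) \<longlonglongrightarrow> l"
  shows "d absolutely_integrable_on {s..t}" "integral {s..t} d \<le> l"
proof -
  let ?M = "lebesgue_on {s..t}"
  have ci: "integrable ?M (c n)" for n using cn(1) by (simp add: integrable_lebesgue_on_iff)
  have ae: "AE u in ?M. (\<lambda>n. c n u) \<longlonglongrightarrow> d u"
    using Z conv by (subst AE_restrict_space_iff) (auto simp: AE_lebesgue_negligible)
  have dm: "d \<in> borel_measurable ?M"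
    by (rule borel_measurable_AE_limit[OF _ borel_measurable_integrable[OF ci] ae]) simp
  have int: "integral\<^sup>L ?M (c n) = integral {s..t} (c n)" for n
    using ci by (simp add: lebesgue_integral_eq_integral)
  have l0: "0 \<le> l"
    by (rule tendsto_lowerbound[OF l])
       (use cn in \<open>auto intro!: always_eventually Henstock_Kurzweil_Integration.integral_nonneg simp: absolutely_integrable_on_def\<close>)
  have "(\<integral>\<^sup>+ u. ennreal (d u) \<partial>?M) = (\<integral>\<^sup>+ u. liminf (\<lambda>n. ennreal (c n u)) \<partial>?M)"
  proof (rule nn_integral_cong_AE)
    show "AE u in ?M. ennreal (d u) = liminf (\<lambda>n. ennreal (c n u))"
      using ae
    proof eventually_elim
      case (elim u)
      have "(\<lambda>n. ennreal (c n u)) \<longlonglongrightarrow> ennreal (d u)" by (intro tendsto_ennrealI elim)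
      then show ?case by (simp add: lim_imp_Liminf)
    qed
  qed
  also have "\<dots> \<le> liminf (\<lambda>n. \<integral>\<^sup>+ u. ennreal (c n u) \<partial>?M)"
    using ci by (intro nn_integral_liminf) auto
  also have "(\<lambda>n. \<integral>\<^sup>+ u. ennreal (c n u) \<partial>?M) = (\<lambda>n. ennreal (integral {s..t} (c n)))"
    using ci cn(2) by (simp add: nn_integral_eq_integral int)
  also have "liminf (\<lambda>n. ennreal (integral {s..t} (c n))) = ennreal l"
    by (intro lim_imp_Liminf tendsto_ennrealI l) simp
  finally have le: "(\<integral>\<^sup>+ u. ennreal (d u) \<partial>?M) \<le> ennreal l" .
  have "AE u in ?M. 0 \<le> d u" using d by (intro AE_I2) (simp add: space_restrict_space)
  then have di: "integrable ?M d"
    using le dm by (intro integrableI_nonneg) (auto simp: le_less_trans)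
  then show "d absolutely_integrable_on {s..t}" by (simp add: integrable_lebesgue_on_iff)
  have "ennreal (integral\<^sup>L ?M d) \<le> ennreal l"
    using le \<open>AE u in ?M. 0 \<le> d u\<close> by (simp add: nn_integral_eq_integral[OF di])
  then have "integral\<^sup>L ?M d \<le> l" using l0 by simp
  then show "integral {s..t} d \<le> l" using di by (simp add: lebesgue_integral_eq_integral)
qed

context control_problem
begin

lemma ctrl_integral_mono:
  assumes x: "adm \<eta> x g" and s: "0 \<le> s" "s \<le> t"
  shows "integral {s..t} (ctrl x g) = integral {0..t} (ctrl x g) - integral {0..s} (ctrl x g)"
    "integral {0..s} (ctrl x g) \<le> integral {0..t} (ctrl x g)"
proof -
  have i: "ctrl x g integrable_on {0..t}"
    using ctrl_absolutely_integrable[OF x] by (auto simp: absolutely_integrable_on_def)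
  show 1: "integral {s..t} (ctrl x g) = integral {0..t} (ctrl x g) - integral {0..s} (ctrl x g)"
    using Henstock_Kurzweil_Integration.integral_combine[OF s i] by simp
  have "0 \<le> integral {s..t} (ctrl x g)"
    using integrable_subinterval_real[OF i, of s t] s
    by (intro Henstock_Kurzweil_Integration.integral_nonneg ctrl_nonneg) auto
  then show "integral {0..s} (ctrl x g) \<le> integral {0..t} (ctrl x g)" using 1 by simp
qed

definition drift_bd where "drift_bd \<eta> t = history_const \<eta> + L * growth_const \<eta> * exp (2 * L * t)"

lemma drift_bd_continuous: "continuous_on S (drift_bd \<eta>)"
  unfolding drift_bd_def by (intro continuous_intros)

text \<open>A state is, up to terms independent of \<open>n\<close>, the difference of two
  nondecreasing functions, the accumulated drift made monotone and the accumulated consumption.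
  Selecting for each of them makes the states converge off a null set.\<close>

lemma convergent_subsequence:
  assumes x: "\<And>n. adm \<eta> (x n) (g n)" and c: "AE t in half_line. convergent (\<lambda>n. ctrl (x n) (g n) t)"
  shows "\<exists>s Z X c. strict_mono (s :: nat \<Rightarrow> nat) \<and> negligible Z \<and> (\<forall>t<0. X t = snd \<eta> t) \<and>
     (\<forall>t\<ge>0. t \<in> Z \<longrightarrow> X t = 0 \<and> c t = 0) \<and>
     (\<forall>t\<ge>0. t \<notin> Z \<longrightarrow> (\<lambda>n. x (s n) t) \<longlonglongrightarrow> X t \<and> (\<lambda>n. ctrl (x (s n)) (g (s n)) t) \<longlonglongrightarrow> c t)"
proof -
  define C where "C n t = integral {0..t} (ctrl (x n) (g n))" for n t
  have ci: "ctrl (x n) (g n) integrable_on {0..t}" for n t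
    using ctrl_absolutely_integrable[OF x] by (auto simp: absolutely_integrable_on_def)
  have Di: "D (x n) integrable_on {0..t}" for n t
    using drift_absolutely_integrable[OF adm_D(4)[OF x]] by (auto simp: absolutely_integrable_on_def)
  obtain s1 Z1 where 1: "strict_mono s1" "negligible Z1" "\<And>t. 0 \<le> t \<Longrightarrow> t \<notin> Z1 \<Longrightarrow> convergent (\<lambda>n. C (s1 n) t)"
  proof -
    have "\<exists>s Z. strict_mono s \<and> negligible Z \<and> (\<forall>t\<ge>0. t \<notin> Z \<longrightarrow> convergent (\<lambda>n. C (s n) t))"
    proof (rule helly_half_line[where C = C and b = "ctrl_const \<eta>"])
      show "continuous_on {0..} (C n)" for n
        unfolding C_def by (intro continuous_on_half_line indefinite_integral_continuous_1 ci)
      show "C n s \<le> C n t" if "0 \<le> s" "s \<le> t" for n s t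
        unfolding C_def by (rule ctrl_integral_mono(2)[OF x that])
      show "C n t \<le> ctrl_const \<eta> t" if "0 \<le> t" for n t
        unfolding C_def by (rule integral_ctrl_le[OF x that])
    qed (simp add: C_def)
    then show ?thesis using that by blast
  qed
  \<comment> \<open>Adding the common bound \<open>drift_bd\<close> makes the integrand nonnegative,
    hence the integral monotone as Helly selection requires; the added integral does not depend on
    \<open>n\<close>.\<close>
  define A' where "A' n t = integral {0..t} (\<lambda>s. D (x (s1 n)) s + drift_bd \<eta> s)" for n t
  have Pi: "drift_bd \<eta> integrable_on {0..t}" for t
    by (intro integrable_continuous_real drift_bd_continuous)
  have Ai: "(\<lambda>s. D (x n) s + drift_bd \<eta> s) integrable_on {0..t}" for n t
    by (intro integrable_add Di Pi)
  have Ab: "\<bar>D (x n) s\<bar> \<le> drift_bd \<eta> s" if "0 \<le> s" for n s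
    unfolding drift_bd_def by (rule drift_growth[OF x that])
  obtain s2 Z2 where 2: "strict_mono s2" "negligible Z2" "\<And>t. 0 \<le> t \<Longrightarrow> t \<notin> Z2 \<Longrightarrow> convergent (\<lambda>n. A' (s2 n) t)"
  proof -
    have "\<exists>s Z. strict_mono s \<and> negligible Z \<and> (\<forall>t\<ge>0. t \<notin> Z \<longrightarrow> convergent (\<lambda>n. A' (s n) t))"
    proof (rule helly_half_line[where C = A' and b = "\<lambda>t. integral {0..t} (\<lambda>s. 2 * drift_bd \<eta> s)"])
      show "continuous_on {0..} (A' n)" for n
        unfolding A'_def by (intro continuous_on_half_line indefinite_integral_continuous_1 Ai)
      show "A' n s \<le> A' n t" if "0 \<le> s" "s \<le> t" for n s t
      proof -
        have "0 \<le> D (x (s1 n)) u + drift_bd \<eta> u" if "u \<in> {0..t}" for u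
          using Ab[of u "s1 n"] that by auto
        then show ?thesis unfolding A'_def using that Ai by (intro integral_subset_le) auto
      qed
      show "A' n t \<le> integral {0..t} (\<lambda>s. 2 * drift_bd \<eta> s)" if "0 \<le> t" for n t
        unfolding A'_def
      proof (rule integral_le[OF Ai])
        show "(\<lambda>s. 2 * drift_bd \<eta> s) integrable_on {0..t}" by (intro integrable_on_mult_right Pi)
        show "D (x (s1 n)) u + drift_bd \<eta> u \<le> 2 * drift_bd \<eta> u" if "u \<in> {0..t}" for u
          using Ab[of u "s1 n"] that by auto
      qed
    qed (simp add: A'_def)
    then show ?thesis using that by blast
  qed
  obtain Z3 where 3: "negligible Z3" "\<And>t. 0 \<le> t \<Longrightarrow> t \<notin> Z3 \<Longrightarrow> convergent (\<lambda>n. ctrl (x n) (g n) t)"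
    using c by (auto simp: AE_half_line)
  define s where "s n = s1 (s2 n)" for n
  have s: "strict_mono s" using 1(1) 2(1) by (auto simp: s_def strict_mono_def)
  define Z where "Z = Z1 \<union> Z2 \<union> Z3"
  \<comment> \<open>The value 0 on the exceptional set keeps \<open>X\<close> bounded by the growth
    estimate at every nonnegative time, so that it can serve as a state in the drift.\<close>
  define X where "X t = (if t < 0 then snd \<eta> t else if t \<in> Z then 0 else lim (\<lambda>n. x (s n) t))" for t
  define c where "c t = (if t \<in> Z then 0 else lim (\<lambda>n. ctrl (x (s n)) (g (s n)) t))" for t
  have "(\<lambda>n. x (s n) t) \<longlonglongrightarrow> X t \<and> (\<lambda>n. ctrl (x (s n)) (g (s n)) t) \<longlonglongrightarrow> c t" if t: "0 \<le> t" "t \<notin> Z" for t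
  proof
    have "convergent (\<lambda>n. ctrl (x (s n)) (g (s n)) t)"
      using convergent_subseq_convergent[OF 3(2)[of t] s] t by (simp add: Z_def comp_def)
    then show "(\<lambda>n. ctrl (x (s n)) (g (s n)) t) \<longlonglongrightarrow> c t" using t by (simp add: c_def convergent_LIMSEQ_iff)
    have c1: "convergent (\<lambda>n. C (s n) t)"
      using convergent_subseq_convergent[OF 1(3)[of t] 2(1)] t by (simp add: Z_def comp_def s_def)
    have c2: "convergent (\<lambda>n. A' (s2 n) t)" using 2(3)[of t] t by (simp add: Z_def)
    have "x (s n) t = fst \<eta> - integral {0..t} (drift_bd \<eta>) + A' (s2 n) t - C (s n) t" for n
      using integral_ctrl[OF x t(1), of "s n"] Henstock_Kurzweil_Integration.integral_add[OF Di[of "s n" t] Pi]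
      by (simp add: A'_def C_def s_def)
    then have "convergent (\<lambda>n. x (s n) t)"
      by (simp only:) (intro convergent_diff convergent_add convergent_const c1 c2)
    then show "(\<lambda>n. x (s n) t) \<longlonglongrightarrow> X t" using t by (simp add: X_def convergent_LIMSEQ_iff)
  qed
  moreover have "negligible Z" using 1 2 3 by (simp add: Z_def)
  ultimately show ?thesis using s
    by (intro exI[of _ s] exI[of _ Z] exI[of _ X] exI[of _ c]) (auto simp: X_def c_def)
qed

text \<open>In the limit the cumulated controls may acquire a singular part. It is given back to the
  state: \<open>E\<close> below is the state surplus obtained by not spending it, discounted at rate \<open>Cf\<close> so
  that the Lipschitz bound on \<open>f0\<close> yields a subsolution.\<close>

lemma limit_trajectory:
  assumes x: "\<And>n. adm \<eta> (x n) (g n)" and Z: "negligible Z" and X0: "\<And>t. t < 0 \<Longrightarrow> X t = snd \<eta> t"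
    and XZ: "\<And>t. 0 \<le> t \<Longrightarrow> t \<in> Z \<Longrightarrow> X t = 0" "\<And>t. 0 \<le> t \<Longrightarrow> t \<in> Z \<Longrightarrow> c t = 0"
    and Xl: "\<And>t. 0 \<le> t \<Longrightarrow> t \<notin> Z \<Longrightarrow> (\<lambda>n. x n t) \<longlonglongrightarrow> X t"
    and cl: "\<And>t. 0 \<le> t \<Longrightarrow> t \<notin> Z \<Longrightarrow> (\<lambda>n. ctrl (x n) (g n) t) \<longlonglongrightarrow> c t"
  shows "\<exists>x' g'. traj \<eta> x' g' \<and> (\<forall>t\<ge>0. t \<notin> Z \<longrightarrow> 0 \<le> c t \<and> X t \<le> x' t \<and> c t \<le> D x' t - g' t \<and> g' t \<le> drift_bd \<eta> t)"
proof -
  note ax = adm_D[OF x]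
  have \<eta>: "snd \<eta> absolutely_integrable_on {-T..0}" using ax(6) .
  define M where "M t = growth_const \<eta> * exp (2 * L * t)" for t
  have Mc: "continuous_on S M" for S unfolding M_def by (intro continuous_intros)
  have M0: "0 \<le> M t" for t using growth_const_pos[OF \<eta>] by (simp add: M_def)
  have Mi: "M integrable_on {0..t}" for t by (intro integrable_continuous_real Mc)
  have xM: "\<bar>x n t\<bar> \<le> M t" if "0 \<le> t" for n t
    using state_growth[OF x that, of n] ax(2)[OF that, of n] by (simp add: M_def)
  have XM: "\<bar>X t\<bar> \<le> M t" if t: "0 \<le> t" for t
  proof (cases "t \<in> Z")
    case False
    have "(\<lambda>n. \<bar>x n t\<bar>) \<longlonglongrightarrow> \<bar>X t\<bar>" by (intro tendsto_intros Xl t False)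
    then show ?thesis by (rule tendsto_upperbound) (use xM t in auto)
  qed (use XZ t M0 in auto)
  have xi: "x n integrable_on {0..t}" for n t
    by (intro integrable_continuous_real continuous_on_subset[OF ax(5)]) auto
  have "X integrable_on {0..t}" for t
    by (rule dominated_convergence_negligible(1)[OF xi Mi Z]) (use xM Xl in auto)
  then have Xi: "X absolutely_integrable_on {0..t}" for t
    by (intro absolutely_integrable_integrable_bound[OF _ _ Mi]) (use XM in auto)
  have hX: "hist X" by (rule histI[OF \<eta> _ Xi]) (use X0 in auto)
  have delayl: "(\<lambda>n. delay (x n) s) \<longlonglongrightarrow> delay X s" if s: "0 \<le> s" for s
  proof -
    define H where "H u = (if u < 0 then \<bar>snd \<eta> u\<bar> else M u)" for u
    have "(\<lambda>\<xi>. \<bar>snd \<eta> \<xi>\<bar>) absolutely_integrable_on {-T..0}"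
      using absolutely_integrable_norm[OF \<eta>] by (simp add: comp_def)
    moreover have "H absolutely_integrable_on {0..t}" for t
      by (rule absolutely_integrable_spike[OF absolutely_integrable_continuous_real[OF Mc] negligible_empty])
         (auto simp: H_def)
    ultimately have hH: "hist H"
      by (intro histI[where u = "\<lambda>\<xi>. \<bar>snd \<eta> \<xi>\<bar>"]) (simp_all add: H_def)
    have xH: "\<bar>x n u\<bar> \<le> H u" if "-T \<le> u" for n u
      using xM[of u n] trajD(1)[OF ax(1)[of n], of u] that by (auto simp: H_def)
    have nZ: "negligible ((\<lambda>u. - s + u) ` Z)" by (rule negligible_translation[OF Z])
    show ?thesis
      unfolding delay_def
    proof (rule dominated_convergence_negligible(2)[OF _ _ nZ])
      show "(\<lambda>\<xi>. a \<xi> * x n (s + \<xi>)) integrable_on {-T..0}" for n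
        using delay_integrand[OF ax(4) s] by (auto simp: absolutely_integrable_on_def)
      show "(\<lambda>\<xi>. A * H (s + \<xi>)) integrable_on {-T..0}"
        using hist_segment[OF hH s] by (intro integrable_on_mult_right) (auto simp: absolutely_integrable_on_def)
      fix \<xi> assume \<xi>: "\<xi> \<in> {-T..0}" "\<xi> \<notin> (\<lambda>u. - s + u) ` Z"
      show "\<bar>a \<xi> * x n (s + \<xi>)\<bar> \<le> A * H (s + \<xi>)" for n
        unfolding abs_mult using a_le_A[OF \<xi>(1)] a_nonneg[OF \<xi>(1)] xH[of "s + \<xi>"] \<xi> s
        by (intro mult_mono) auto
      have "s + \<xi> \<notin> Z"
      proof
        assume "s + \<xi> \<in> Z"
        then have "- s + (s + \<xi>) \<in> (\<lambda>u. - s + u) ` Z" by blast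
        then show False using \<xi>(2) by simp
      qed
      then have "(\<lambda>n. x n (s + \<xi>)) \<longlonglongrightarrow> X (s + \<xi>)"
        using Xl[of "s + \<xi>"] trajD(1)[OF ax(1), of "s + \<xi>"] X0[of "s + \<xi>"] \<xi> s
        by (cases "s + \<xi> < 0") auto
      then show "(\<lambda>n. a \<xi> * x n (s + \<xi>)) \<longlonglongrightarrow> a \<xi> * X (s + \<xi>)" by (intro tendsto_intros)
    qed
  qed
  have Dl: "(\<lambda>n. D (x n) t) \<longlonglongrightarrow> D X t" if t: "0 \<le> t" "t \<notin> Z" for t
  proof -
    have "(\<lambda>n. (x n t, delay (x n) t)) \<longlonglongrightarrow> (X t, delay X t)" by (intro tendsto_intros Xl t delayl)
    moreover have "isCont (\<lambda>z. F (fst z) (snd z)) (X t, delay X t)"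
      using continuous_on_F by (simp add: continuous_on_eq_continuous_at)
    ultimately have "(\<lambda>n. F (fst (x n t, delay (x n) t)) (snd (x n t, delay (x n) t))) \<longlonglongrightarrow> F (fst (X t, delay X t)) (snd (X t, delay X t))"
      by (rule isCont_tendsto_compose[rotated])
    then have "(\<lambda>n. r * x n t + F (x n t) (delay (x n) t)) \<longlonglongrightarrow> r * X t + F (X t) (delay X t)"
      by (intro tendsto_intros Xl t) simp
    then show ?thesis using t by (simp add: drift_eq ax(4) hX)
  qed
  have DP: "\<bar>D (x n) t\<bar> \<le> drift_bd \<eta> t" if "0 \<le> t" for n t
    unfolding drift_bd_def by (rule drift_growth[OF x that])
  have DXP: "\<bar>D X t\<bar> \<le> drift_bd \<eta> t" if "0 \<le> t" "t \<notin> Z" for t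
    by (rule tendsto_upperbound[OF tendsto_rabs[OF Dl[OF that]]]) (use DP that in auto)
  have DXi: "D X absolutely_integrable_on {0..t}" for t by (rule drift_absolutely_integrable[OF hX])
  have DXi': "D X integrable_on {0..t}" for t using DXi by (auto simp: absolutely_integrable_on_def)
  have Dxi: "D (x n) integrable_on {0..t}" for n t
    using drift_absolutely_integrable[OF ax(4)] by (auto simp: absolutely_integrable_on_def)
  have IDl: "(\<lambda>n. integral {0..t} (D (x n))) \<longlonglongrightarrow> integral {0..t} (D X)" for t
    by (rule dominated_convergence_negligible(2)[OF Dxi integrable_continuous_real[OF drift_bd_continuous] Z])
       (use DP Dl in auto)
  define C where "C n t = integral {0..t} (ctrl (x n) (g n))" for n t
  define K where "K t = fst \<eta> + integral {0..t} (D X) - X t" for t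
  have Cl: "(\<lambda>n. C n t) \<longlonglongrightarrow> K t" if t: "0 \<le> t" "t \<notin> Z" for t
  proof -
    have "C n t = fst \<eta> + integral {0..t} (D (x n)) - x n t" for n
      using integral_ctrl[OF x t(1), of n] by (simp add: C_def)
    then show ?thesis unfolding K_def by (simp only:) (intro tendsto_intros IDl Xl t)
  qed
  have c0: "0 \<le> c t" if t: "0 \<le> t" for t
  proof (cases "t \<in> Z")
    case False
    then show ?thesis using tendsto_lowerbound[OF cl[OF t False]] ctrl_nonneg by simp
  qed (use XZ t in auto)
  have fatou: "c absolutely_integrable_on {s..t}" "integral {s..t} c \<le> l"
    if s: "0 \<le> s" "s \<le> t" and l: "(\<lambda>n. C n t - C n s) \<longlonglongrightarrow> l" for s t l
  proof -
    have l': "(\<lambda>n. integral {s..t} (ctrl (x n) (g n))) \<longlonglongrightarrow> l"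
      using l ctrl_integral_mono(1)[OF x s] by (simp add: C_def)
    have ci: "ctrl (x n) (g n) absolutely_integrable_on {s..t}" for n
      using absolutely_integrable_on_subinterval[where a = s and b = t, OF ctrl_absolutely_integrable[OF x, of t n]] s by auto
    show "c absolutely_integrable_on {s..t}" "integral {s..t} c \<le> l"
      using fatou_interval[where d = c, OF ci ctrl_nonneg Z _ _ l'] cl c0 s by auto
  qed
  have ci: "c absolutely_integrable_on {0..t}" for t
  proof (cases "0 \<le> t")
    case True
    \<comment> \<open>Accumulated controls converge only off \<open>Z\<close>, and \<open>t\<close>
      may lie in \<open>Z\<close>; a slightly longer interval ends at a good point.\<close>
    obtain u where u: "t < u" "u \<notin> Z" using negligible_avoid[OF Z, of t "t + 1"] by auto
    have "(\<lambda>n. C n u - C n 0) \<longlonglongrightarrow> K u" using Cl[of u] u True by (simp add: C_def)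
    then have "c absolutely_integrable_on {0..u}" using fatou(1)[of 0 u] u True by auto
    then show ?thesis using absolutely_integrable_on_subinterval[where a = 0 and b = t] u by fastforce
  qed (auto intro: absolutely_integrable_on_null simp: content_real_eq_0)
  then have ci': "c integrable_on {0..t}" for t by (auto simp: absolutely_integrable_on_def)
  \<comment> \<open>The singular part: the limit of the accumulated consumption minus the
    accumulation of the limit. Off \<open>Z\<close> it is nonnegative and nondecreasing by Fatou's
    lemma.\<close>
  define S where "S t = K t - integral {0..t} c" for t
  have S0: "0 \<le> S t" if "0 \<le> t" "t \<notin> Z" for t
    using fatou(2)[of 0 t "K t"] Cl[OF that] that by (simp add: S_def C_def)
  have S_mono: "S s \<le> S t" if s: "0 \<le> s" "s \<notin> Z" and t: "s \<le> t" "t \<notin> Z" for s t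
  proof -
    have "(\<lambda>n. C n t - C n s) \<longlonglongrightarrow> K t - K s" by (intro tendsto_intros Cl) (use s t in auto)
    then have "integral {s..t} c \<le> K t - K s" using fatou(2)[of s t] s t by auto
    moreover have "integral {0..s} c + integral {s..t} c = integral {0..t} c"
      by (rule Henstock_Kurzweil_Integration.integral_combine[OF s(1) t(1) ci'])
    ultimately show ?thesis by (simp add: S_def)
  qed
  have Si: "S absolutely_integrable_on {0..t}" for t
  proof -
    have "(\<lambda>t. fst \<eta> + integral {0..t} (D X) - integral {0..t} c) absolutely_integrable_on {0..t}"
      by (intro absolutely_integrable_continuous_real continuous_intros indefinite_integral_continuous_1 DXi' ci')
    then have "(\<lambda>t. (fst \<eta> + integral {0..t} (D X) - integral {0..t} c) - X t) absolutely_integrable_on {0..t}"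
      by (rule set_integral_diff(1)[OF _ Xi])
    then show ?thesis
      by (rule absolutely_integrable_spike[OF _ negligible_empty]) (simp add: S_def K_def)
  qed
  \<comment> \<open>Chosen so that E = S - Cf u satisfies E = S - Cf (integral of E): the surplus
    collects the unspent mass \<open>S\<close> and gives up \<open>Cf * E\<close> per unit
    time.\<close>
  define u where "u = linear_response Cf S"
  have uc: "continuous_on {0..} u" unfolding u_def by (rule continuous_on_linear_response[OF Si])
  have ui: "u absolutely_integrable_on {0..t}" for t
    by (rule absolutely_integrable_continuous_real, rule continuous_on_subset[OF uc]) auto
  define E where "E t = S t - Cf * u t" for t
  have Ei: "E absolutely_integrable_on {0..t}" for t
    unfolding E_def by (intro set_integral_diff(1) set_integrable_mult_right Si ui)
  have uE: "u t = integral {0..t} E" if "0 \<le> t" for t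
    unfolding E_def u_def by (rule integral_linear_response[OF Si that])
  \<comment> \<open>\<open>S\<close> is nondecreasing, so under the integral in \<open>u\<close> it
    may be replaced by \<open>S t\<close>; then \<open>Cf * u t\<close> is at most (1 - exp(- Cf t))
    times \<open>S t\<close>.\<close>
  have E0: "0 \<le> E t" if t: "0 \<le> t" "t \<notin> Z" for t
  proof -
    have he: "((\<lambda>s. Cf * exp (Cf * s)) has_integral (exp (Cf * t) - 1)) {0..t}"
      using has_integral_neg[OF exp_integral_neg[OF t(1), of "- Cf"]] by simp
    have "integral {0..t} (\<lambda>s. Cf * (exp (Cf * s) * S s)) \<le> integral {0..t} (\<lambda>s. Cf * exp (Cf * s) * S t)"
    proof (rule integral_mono_negligible[OF _ _ Z])
      show "(\<lambda>s. Cf * (exp (Cf * s) * S s)) integrable_on {0..t}"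
        using absolutely_integrable_exp_mult[OF Si[of t], where k = Cf]
        by (intro integrable_on_mult_right) (auto simp: absolutely_integrable_on_def)
      show "(\<lambda>s. Cf * exp (Cf * s) * S t) integrable_on {0..t}"
        using has_integral_mult_left[OF he, of "S t"] by (auto simp: integrable_on_def)
      show "Cf * (exp (Cf * s) * S s) \<le> Cf * exp (Cf * s) * S t" if "s \<in> {0..t} - Z" for s
        using S_mono[of s t] that t Cf_nonneg by (simp add: mult.assoc mult_left_mono)
    qed
    also have "\<dots> = (exp (Cf * t) - 1) * S t"
      using has_integral_mult_left[OF he, of "S t"] by (rule integral_unique)
    finally have "exp (- Cf * t) * (Cf * integral {0..t} (\<lambda>s. exp (Cf * s) * S s)) \<le> exp (- Cf * t) * ((exp (Cf * t) - 1) * S t)"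
      by (intro mult_left_mono) auto
    moreover have "exp (- Cf * t) * (Cf * integral {0..t} (\<lambda>s. exp (Cf * s) * S s)) = Cf * u t"
      by (simp add: u_def linear_response_def)
    moreover have "exp (- Cf * t) * ((exp (Cf * t) - 1) * S t) = (1 - exp (- Cf * t)) * S t"
    proof -
      have "exp (- Cf * t) * exp (Cf * t) = 1" by (simp add: exp_minus)
      then have "exp (- Cf * t) * (exp (Cf * t) - 1) = 1 - exp (- Cf * t)"
        by (simp only: right_diff_distrib mult_1_right)
      then show ?thesis by (simp only: mult.assoc[symmetric])
    qed
    ultimately have "Cf * u t \<le> (1 - exp (- Cf * t)) * S t" by linarith
    also have "\<dots> \<le> 1 * S t" using S0[OF t] by (intro mult_right_mono) auto
    finally show ?thesis by (simp add: E_def)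
  qed
  \<comment> \<open>This density gives \<open>x' = X + E\<close> off \<open>Z\<close>. The term
    \<open>Cf * E\<close> compensates the loss in \<open>f0\<close> caused by the larger state, so
    the new pair can still consume at least \<open>c\<close>.\<close>
  define g' where "g' t = D X t - c t - Cf * E t" for t
  have g'i: "g' absolutely_integrable_on {0..t}" for t
    unfolding g'_def by (intro set_integral_diff(1) set_integrable_mult_right DXi ci Ei)
  define x' where "x' t = (if t < 0 then snd \<eta> t else fst \<eta> + integral {0..t} g')" for t
  have traj: "traj \<eta> x' g'" unfolding traj_def using g'i by (simp add: x'_def)
  have x'E: "x' t = X t + E t" if t: "0 \<le> t" "t \<notin> Z" for t
  proof -
    have "((\<lambda>t. D X t - c t - Cf * E t) has_integral (integral {0..t} (D X) - integral {0..t} c - Cf * integral {0..t} E)) {0..t}"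
      using Ei by (intro has_integral_diff has_integral_mult_right integrable_integral DXi' ci')
        (auto simp: absolutely_integrable_on_def)
    then have "integral {0..t} g' = integral {0..t} (D X) - integral {0..t} c - Cf * u t"
      unfolding g'_def[abs_def] using uE[OF t(1)] by (simp add: integral_unique)
    then show ?thesis using t by (simp add: x'_def E_def S_def K_def)
  qed
  have hx': "hist x'" by (rule traj_hist[OF traj \<eta>])
  have "c t \<le> D x' t - g' t" if t: "0 \<le> t" "t \<notin> Z" for t
  proof -
    have "delay X t \<le> delay x' t"
    proof (rule delay_mono[OF hX hx' t(1) Z])
      show "X s \<le> x' s" if "-T \<le> s" "s \<le> t" "s \<notin> Z" for s
        using X0[of s] x'E[of s] E0[of s] that by (cases "s < 0") (auto simp: x'_def)
    qed
    then have "F (x' t) (delay X t) \<le> F (x' t) (delay x' t)" by (rule F_mono)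
    moreover have "\<bar>F (x' t) (delay X t) - F (X t) (delay X t)\<bar> \<le> Cf * (\<bar>x' t - X t\<bar> + \<bar>delay X t - delay X t\<bar>)"
      by (rule F_lipschitz)
    moreover have "\<bar>x' t - X t\<bar> = E t" using x'E[OF t] E0[OF t] by simp
    moreover have "r * X t \<le> r * x' t" using x'E[OF t] E0[OF t] r_pos by (intro mult_left_mono) auto
    ultimately show ?thesis using t by (simp add: drift_eq hX hx' g'_def)
  qed
  moreover have "g' t \<le> drift_bd \<eta> t" if t: "0 \<le> t" "t \<notin> Z" for t
  proof -
    have "0 \<le> Cf * E t" using Cf_nonneg E0[OF t] by simp
    then show ?thesis using DXP[OF t] c0[OF t(1)] unfolding g'_def by linarith
  qed
  ultimately show ?thesis using traj x'E E0 c0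
    by (intro exI[of _ x'] exI[of _ g']) auto
qed

lemma drift_bd_mono:
  assumes "snd \<eta> absolutely_integrable_on {-T..0}" "s \<le> t"
  shows "drift_bd \<eta> s \<le> drift_bd \<eta> t"
  unfolding drift_bd_def using growth_const_pos[OF assms(1)] L_pos assms(2)
  by (intro add_left_mono mult_left_mono) auto

text \<open>A state that hits zero stays below a linear function afterwards, where \<open>U2\<close> is not
  integrable.\<close>

lemma positive_of_integrable:
  assumes t0: "0 \<le> t0" and x: "traj \<eta> x g" and x0: "x t0 = 0" and k: "0 < k"
    and g: "AE t in half_line. t \<le> t0 + 1 \<longrightarrow> g t \<le> k"
    and w: "integrable half_line w" and le: "AE t in half_line. 0 < x t \<and> w t \<le> exp (- \<rho> * t) * U2 (x t)"
  shows False
proof -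
  note tx = trajD[OF x]
  obtain Z where Z: "negligible Z" "\<And>t. 0 \<le> t \<Longrightarrow> t \<notin> Z \<Longrightarrow> t \<le> t0 + 1 \<Longrightarrow> g t \<le> k"
    using g by (auto simp: AE_half_line)
  have lin: "x t \<le> k * (t - t0)" if t: "t0 \<le> t" "t \<le> t0 + 1" for t
  proof -
    have "integral {0..t0} g + integral {t0..t} g = integral {0..t} g"
      by (rule Henstock_Kurzweil_Integration.integral_combine[OF t0 t(1) tx(3)])
    then have "x t = integral {t0..t} g" using tx(4)[of t] tx(4)[of t0] x0 t0 t by simp
    also have "\<dots> \<le> integral {t0..t} (\<lambda>_. k)"
    proof (rule integral_mono_negligible[OF _ _ Z(1)])
      show "g integrable_on {t0..t}" using integrable_subinterval_real[OF tx(3)[of t], of t0 t] t0 by auto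
    qed (use Z(2) t t0 in auto)
    finally show ?thesis using t by (simp add: mult.commute)
  qed
  define e where "e = exp (\<rho> * (t0 + 1))"
  have W: "(\<lambda>t. B + e * \<bar>w t\<bar>) absolutely_integrable_on {t0<..t0 + 1}"
  proof -
    have "w absolutely_integrable_on {0..}" using w by (simp add: integrable_lebesgue_on_iff)
    then have "w absolutely_integrable_on {t0..t0 + 1}"
      using t0 absolutely_integrable_on_subinterval[where f = w and S = "{0..}" and a = t0 and b = "t0 + 1"] by auto
    from absolutely_integrable_norm[OF this]
    have "(\<lambda>t. \<bar>w t\<bar>) absolutely_integrable_on {t0..t0 + 1}" by (simp add: comp_def)
    then have "(\<lambda>t. B + e * \<bar>w t\<bar>) absolutely_integrable_on {t0..t0 + 1}"
      by (intro set_integral_add(1) set_integrable_mult_right) auto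
    then show ?thesis by (rule set_integrable_subset) auto
  qed
  \<comment> \<open>\<open>U2\<close> along the linear majorant of \<open>x\<close> lies between an
    integrable function and \<open>B\<close>. The substitution y = k (t - t0) then makes
    \<open>U2\<close> integrable near 0, which is excluded.\<close>
  have "integrable (lebesgue_on {t0<..t0 + 1}) (\<lambda>t. U2 (k * (t - t0)))"
  proof (rule Bochner_Integration.integrable_bound)
    show "integrable (lebesgue_on {t0<..t0 + 1}) (\<lambda>t. B + e * \<bar>w t\<bar>)"
      using W by (simp add: integrable_lebesgue_on_iff)
    show "(\<lambda>t. U2 (k * (t - t0))) \<in> borel_measurable (lebesgue_on {t0<..t0 + 1})"
      using k by (intro continuous_imp_measurable_on_sets_lebesgue continuous_on_compose2[OF U2_cont] continuous_intros) auto
    obtain Z' where Z': "negligible Z'" "\<And>t. 0 \<le> t \<Longrightarrow> t \<notin> Z' \<Longrightarrow> 0 < x t \<and> w t \<le> exp (- \<rho> * t) * U2 (x t)"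
      using le unfolding AE_half_line by blast
    have "norm (U2 (k * (t - t0))) \<le> norm (B + e * \<bar>w t\<bar>)" if t: "t0 < t" "t \<le> t0 + 1" "t \<notin> Z'" for t
    proof -
      have xt: "0 < x t" "w t \<le> exp (- \<rho> * t) * U2 (x t)" using Z'(2)[of t] t t0 by auto
      have "U2 (x t) \<le> U2 (k * (t - t0))" using lin[of t] t xt by (intro U2_mono') auto
      moreover have "U2 (k * (t - t0)) \<le> B" using k t by (intro B(3)) auto
      moreover have "- (e * \<bar>w t\<bar>) \<le> U2 (x t)"
      proof -
        have "exp (\<rho> * t) * w t \<le> exp (\<rho> * t) * (exp (- \<rho> * t) * U2 (x t))"
          using xt by (intro mult_left_mono) auto
        also have "\<dots> = U2 (x t)" by (simp add: mult.assoc[symmetric] exp_minus)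
        finally have "exp (\<rho> * t) * w t \<le> U2 (x t)" .
        moreover have "exp (\<rho> * t) * \<bar>w t\<bar> \<le> e * \<bar>w t\<bar>"
          unfolding e_def using t rho_pos by (intro mult_right_mono) auto
        moreover have "- (exp (\<rho> * t) * \<bar>w t\<bar>) \<le> exp (\<rho> * t) * w t"
        proof -
          have "exp (\<rho> * t) * (- \<bar>w t\<bar>) \<le> exp (\<rho> * t) * w t" by (intro mult_left_mono) auto
          then show ?thesis by simp
        qed
        ultimately show ?thesis by linarith
      qed
      moreover have "0 \<le> e * \<bar>w t\<bar>" by (simp add: e_def)
      ultimately show ?thesis using B(1) unfolding real_norm_def by linarith
    qed
    then show "AE t in lebesgue_on {t0<..t0 + 1}. norm (U2 (k * (t - t0))) \<le> norm (B + e * \<bar>w t\<bar>)"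
      using Z'(1) by (subst AE_restrict_space_iff) (auto simp: AE_lebesgue_negligible)
  qed
  then have "integrable lebesgue (\<lambda>t. indicator {t0<..t0 + 1} t *\<^sub>R U2 (k * (t - t0)))"
    by (simp add: integrable_restrict_space)
  also have "(\<lambda>t. indicator {t0<..t0 + 1} t *\<^sub>R U2 (k * (t - t0))) = (\<lambda>t. indicator {0<..k} (- k * t0 + k * t) *\<^sub>R U2 (- k * t0 + k * t))"
  proof
    fix t
    have "- k * t0 + k * t = k * (t - t0)" by (simp add: algebra_simps)
    moreover have "t \<in> {t0<..t0 + 1} \<longleftrightarrow> k * (t - t0) \<in> {0<..k}" using k by (auto simp: zero_less_mult_iff)
    ultimately show "indicator {t0<..t0 + 1} t *\<^sub>R U2 (k * (t - t0)) = indicator {0<..k} (- k * t0 + k * t) *\<^sub>R U2 (- k * t0 + k * t)"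
      by (simp only: indicator_def)
  qed
  finally have "integrable lebesgue (\<lambda>y. indicator {0<..k} y *\<^sub>R U2 y)"
    using k by (subst (asm) lebesgue_integrable_real_affine_iff[of k "\<lambda>y. indicator {0<..k} y *\<^sub>R U2 y" "- k * t0"]) auto
  then have "integrable (lebesgue_on {0<..k}) U2" by (simp add: integrable_restrict_space)
  then show False using U2_not_integrable[OF k] by blast
qed

text \<open>Upper semicontinuity of the payoff, by Fatou's lemma for the nonnegative deficits
  \<open>w n\<close>. The pointwise limit \<open>X\<close> could vanish and accumulated consumption
  could lose mass; the pair from \<open>limit_trajectory\<close> has a state at least
  \<open>X\<close> and a control at least \<open>c\<close> almost everywhere, hence earns at least
  the limit payoff.\<close>

lemma exists_optimal:
  assumes \<eta>: "pos_history \<eta>"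
  shows "\<exists>x g. optimal \<eta> x g"
proof -
  obtain xs gs V where V: "VF \<eta> = ereal V" "\<And>n. adm \<eta> (xs n) (gs n)" "\<And>n. fin (xs n) (gs n)"
    "(\<lambda>n. J (xs n) (gs n)) \<longlonglongrightarrow> V" "AE t in half_line. convergent (\<lambda>n. ctrl (xs n) (gs n) t)"
    using maximizing_sequence[OF \<eta>] by blast
  have \<eta>i: "snd \<eta> absolutely_integrable_on {-T..0}" by (rule adm_D(6)[OF V(2)])
  obtain s Z X c where s: "strict_mono s" "negligible Z" "\<And>t. t < 0 \<Longrightarrow> X t = snd \<eta> t"
    "\<And>t. 0 \<le> t \<Longrightarrow> t \<in> Z \<Longrightarrow> X t = 0" "\<And>t. 0 \<le> t \<Longrightarrow> t \<in> Z \<Longrightarrow> c t = 0"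
    "\<And>t. 0 \<le> t \<Longrightarrow> t \<notin> Z \<Longrightarrow> (\<lambda>n. xs (s n) t) \<longlonglongrightarrow> X t"
    "\<And>t. 0 \<le> t \<Longrightarrow> t \<notin> Z \<Longrightarrow> (\<lambda>n. ctrl (xs (s n)) (gs (s n)) t) \<longlonglongrightarrow> c t"
    using convergent_subsequence[OF V(2,5)] by blast
  define x g where "x n = xs (s n)" and "g n = gs (s n)" for n
  have x: "adm \<eta> (x n) (g n)" "fin (x n) (g n)" for n using V by (simp_all add: x_def g_def)
  have Jl: "(\<lambda>n. J (x n) (g n)) \<longlonglongrightarrow> V"
    using LIMSEQ_subseq_LIMSEQ[OF V(4) s(1)] by (simp add: comp_def x_def g_def)
  have xl: "(\<lambda>n. x n t) \<longlonglongrightarrow> X t" and cl: "(\<lambda>n. ctrl (x n) (g n) t) \<longlonglongrightarrow> c t" if "0 \<le> t" "t \<notin> Z" for t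
    using s(6,7)[OF that] by (simp_all add: x_def g_def)
  obtain x' g' where x': "traj \<eta> x' g'" "\<And>t. 0 \<le> t \<Longrightarrow> t \<notin> Z \<Longrightarrow> 0 \<le> c t"
    "\<And>t. 0 \<le> t \<Longrightarrow> t \<notin> Z \<Longrightarrow> X t \<le> x' t" "\<And>t. 0 \<le> t \<Longrightarrow> t \<notin> Z \<Longrightarrow> c t \<le> D x' t - g' t"
    "\<And>t. 0 \<le> t \<Longrightarrow> t \<notin> Z \<Longrightarrow> g' t \<le> drift_bd \<eta> t"
    using limit_trajectory[OF x(1) s(2) s(3) s(4) s(5) xl cl] by blast
  have x'c: "continuous_on {0..} x'" by (rule traj_continuous[OF x'(1)])
  define W where "W = integral\<^sup>L half_line (\<lambda>t. 2 * B * exp (- \<rho> * t))"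
  define w where "w n t = 2 * B * exp (- \<rho> * t) - payoff (x n) (g n) t" for n t
  have wi: "integrable half_line (w n)" for n
    unfolding w_def using x(2)[of n] bound_integrable[of "2 * B"] by (simp add: fin_def)
  have wW: "integral\<^sup>L half_line (w n) = W - J (x n) (g n)" for n
    unfolding w_def W_def J_def using x(2)[of n] bound_integrable[of "2 * B"] by (simp add: fin_def)
  have w0: "0 \<le> w n t" if "0 \<le> t" for n t
    using payoff_le[where x = "x n" and g = "g n" and t = t] adm_D(2)[OF x(1) that] by (simp add: w_def)
  define v where "v t = exp (- \<rho> * t) * (2 * B - (U1 (c t) + U2 (X t)))" for t
  have w_eq: "w n t = exp (- \<rho> * t) * (2 * B - (U1 (ctrl (x n) (g n) t) + U2 (x n t)))" for n t
    by (simp add: w_def payoff_def algebra_simps)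
  have X0: "0 \<le> X t" if "0 \<le> t" "t \<notin> Z" for t
    by (rule tendsto_lowerbound[OF xl[OF that]]) (use adm_D(2)[OF x(1) that(1)] in \<open>auto intro!: always_eventually less_imp_le\<close>)
  have wl: "(\<lambda>n. w n t) \<longlonglongrightarrow> v t" if t: "0 \<le> t" "t \<notin> Z" "0 < X t" for t
  proof -
    have "(U1 \<longlongrightarrow> U1 (c t)) (at (c t) within {0..})"
      using U1_cont x'(2)[OF t(1,2)] by (auto simp: continuous_on_def)
    then have "continuous (at (c t) within {0..}) U1" by (simp add: continuous_within)
    then have 1: "(\<lambda>n. U1 (ctrl (x n) (g n) t)) \<longlonglongrightarrow> U1 (c t)"
      using cl[OF t(1,2)] ctrl_nonneg by (intro continuous_within_tendsto_compose'[of "c t" "{0..}" U1]) auto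
    have "isCont U2 (X t)" using U2_cont t(3) by (simp add: continuous_on_eq_continuous_at)
    then have 2: "(\<lambda>n. U2 (x n t)) \<longlonglongrightarrow> U2 (X t)" by (rule isCont_tendsto_compose[OF _ xl[OF t(1,2)]])
    show ?thesis unfolding w_eq v_def by (intro tendsto_intros 1 2)
  qed
  \<comment> \<open>Where the limit state vanishes, \<open>U2\<close> tends to minus infinity along
    the sequence and the deficit blows up; Fatou's bound makes this set null.\<close>
  have wtop: "liminf (\<lambda>n. ennreal (w n t)) = \<infinity>" if t: "0 \<le> t" "t \<notin> Z" "X t = 0" for t
  proof -
    have "filterlim (\<lambda>n. x n t) (at_right 0) sequentially"
    proof (rule tendsto_imp_filterlim_at_right)
      show "(\<lambda>n. x n t) \<longlonglongrightarrow> 0" using xl[OF t(1,2)] t(3) by simp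
    qed (use adm_D(2)[OF x(1) t(1)] in \<open>auto intro!: always_eventually\<close>)
    then have "filterlim (\<lambda>n. U2 (x n t)) at_bot sequentially" by (rule filterlim_compose[OF U2_at_0])
    then have "filterlim (\<lambda>n. - U2 (x n t)) at_top sequentially" by (simp add: filterlim_uminus_at_top)
    then have "filterlim (\<lambda>n. exp (- \<rho> * t) * (- U2 (x n t))) at_top sequentially"
      by (intro filterlim_tendsto_pos_mult_at_top[OF tendsto_const]) simp_all
    then have "filterlim (\<lambda>n. w n t) at_top sequentially"
    proof (rule filterlim_at_top_mono, intro always_eventually allI)
      fix n
      have "- U2 (x n t) \<le> 2 * B - (U1 (ctrl (x n) (g n) t) + U2 (x n t))"
        using B(2)[OF ctrl_nonneg[of "x n" "g n" t]] B(1) by linarith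
      then show "exp (- \<rho> * t) * (- U2 (x n t)) \<le> w n t" unfolding w_eq by (intro mult_left_mono) auto
    qed
    then have "(\<lambda>n. ennreal (w n t)) \<longlonglongrightarrow> top" by (simp add: ennreal_tendsto_top_eq_at_top)
    then show ?thesis by (simp add: lim_imp_Liminf)
  qed
  have fatou: "(\<integral>\<^sup>+ t. liminf (\<lambda>n. ennreal (w n t)) \<partial>half_line) \<le> ennreal (W - V)"
  proof -
    have "(\<integral>\<^sup>+ t. liminf (\<lambda>n. ennreal (w n t)) \<partial>half_line) \<le> liminf (\<lambda>n. \<integral>\<^sup>+ t. ennreal (w n t) \<partial>half_line)"
      using wi by (intro nn_integral_liminf) auto
    also have "(\<lambda>n. \<integral>\<^sup>+ t. ennreal (w n t) \<partial>half_line) = (\<lambda>n. ennreal (W - J (x n) (g n)))"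
    proof
      fix n
      have "AE t in half_line. 0 \<le> w n t" using AE_half_line_nonneg by eventually_elim (rule w0)
      then show "(\<integral>\<^sup>+ t. ennreal (w n t) \<partial>half_line) = ennreal (W - J (x n) (g n))"
        by (simp add: nn_integral_eq_integral[OF wi] wW)
    qed
    also have "liminf (\<lambda>n. ennreal (W - J (x n) (g n))) = ennreal (W - V)"
      by (intro lim_imp_Liminf tendsto_ennrealI tendsto_intros Jl) simp
    finally show ?thesis .
  qed
  have aeZ: "AE t in half_line. t \<notin> Z" using s(2) by (auto simp: AE_half_line)
  have "AE t in half_line. liminf (\<lambda>n. ennreal (w n t)) \<noteq> \<infinity>"
    using fatou wi by (intro nn_integral_PInf_AE) (auto simp: top_unique)
  then have Xpos: "AE t in half_line. 0 < X t"
    using aeZ AE_half_line_nonneg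
  proof eventually_elim
    case (elim t)
    then show ?case using X0[of t] wtop[of t] by (cases "X t = 0") auto
  qed
  have wlAE: "AE t in half_line. (\<lambda>n. w n t) \<longlonglongrightarrow> v t"
    using Xpos aeZ AE_half_line_nonneg by eventually_elim (rule wl)
  have vm: "v \<in> borel_measurable half_line"
    by (rule borel_measurable_AE_limit[OF _ borel_measurable_integrable[OF wi] wlAE]) simp
  have v0: "AE t in half_line. 0 \<le> v t"
    using wlAE AE_half_line_nonneg by eventually_elim (rule tendsto_lowerbound, auto intro!: always_eventually w0)
  have "(\<integral>\<^sup>+ t. ennreal (v t) \<partial>half_line) = (\<integral>\<^sup>+ t. liminf (\<lambda>n. ennreal (w n t)) \<partial>half_line)"
  proof (rule nn_integral_cong_AE)
    show "AE t in half_line. ennreal (v t) = liminf (\<lambda>n. ennreal (w n t))"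
      using wlAE
    proof eventually_elim
      case (elim t)
      have "(\<lambda>n. ennreal (w n t)) \<longlonglongrightarrow> ennreal (v t)" by (intro tendsto_ennrealI elim)
      then show ?case by (simp add: lim_imp_Liminf)
    qed
  qed
  then have vle: "(\<integral>\<^sup>+ t. ennreal (v t) \<partial>half_line) \<le> ennreal (W - V)" using fatou by simp
  then have vi: "integrable half_line v"
    using v0 vm by (intro integrableI_nonneg) (auto simp: le_less_trans)
  have VW: "0 \<le> W - V"
    using LIMSEQ_le_const2[OF Jl, of W] J_le[OF x] by (auto simp: W_def)
  have vW: "integral\<^sup>L half_line v \<le> W - V"
    using vle VW v0 by (simp add: nn_integral_eq_integral[OF vi])
  have X'pos: "AE t in half_line. 0 < x' t"
    using Xpos aeZ AE_half_line_nonneg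
  proof eventually_elim
    case (elim t)
    then show ?case using x'(3)[of t] by linarith
  qed
  have x'0: "0 \<le> x' t" if "0 \<le> t" for t
    by (rule continuous_AE_nonneg[OF x'c _ that]) (use X'pos in eventually_elim, simp)
  have low: "AE t in half_line. 2 * B * exp (- \<rho> * t) - v t \<le> payoff x' g' t"
    using Xpos aeZ AE_half_line_nonneg
  proof eventually_elim
    case (elim t)
    have "U1 (c t) \<le> U1 (ctrl x' g' t)" using x'(2,4)[of t] elim by (intro U1_mono) (auto simp: ctrl_def)
    moreover have "U2 (X t) \<le> U2 (x' t)" using x'(3)[of t] elim by (intro U2_mono') auto
    ultimately have "exp (- \<rho> * t) * (U1 (c t) + U2 (X t)) \<le> payoff x' g' t"
      unfolding payoff_def by (intro mult_left_mono) auto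
    then show ?case by (simp add: v_def algebra_simps)
  qed
  \<comment> \<open>So far positivity holds only almost everywhere. By continuity \<open>x'\<close>
    is nonnegative, and a zero at \<open>t0\<close> contradicts the integrable lower bound for
    \<open>U2\<close> along \<open>x'\<close>.\<close>
  have x'pos: "0 < x' t0" if t0: "0 \<le> t0" for t0
  proof (rule ccontr)
    assume "\<not> 0 < x' t0"
    then have x0: "x' t0 = 0" using x'0[OF t0] by simp
    have k: "0 < \<bar>drift_bd \<eta> (t0 + 1)\<bar> + 1" by simp
    show False
    proof (rule positive_of_integrable[OF t0 x'(1) x0 k])
      show "AE t in half_line. t \<le> t0 + 1 \<longrightarrow> g' t \<le> \<bar>drift_bd \<eta> (t0 + 1)\<bar> + 1"
        using aeZ AE_half_line_nonneg
      proof eventually_elim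
        case (elim t)
        then show ?case using x'(5)[of t] drift_bd_mono[OF \<eta>i, of t "t0 + 1"] by auto
      qed
      show "integrable half_line (\<lambda>t. B * exp (- \<rho> * t) - v t)"
        by (intro Bochner_Integration.integrable_diff bound_integrable vi)
      show "AE t in half_line. 0 < x' t \<and> B * exp (- \<rho> * t) - v t \<le> exp (- \<rho> * t) * U2 (x' t)"
        using low X'pos
      proof eventually_elim
        case (elim t)
        have "exp (- \<rho> * t) * U1 (ctrl x' g' t) \<le> exp (- \<rho> * t) * B"
          using B(2)[OF ctrl_nonneg[of x' g' t]] by (intro mult_left_mono) auto
        moreover have "payoff x' g' t = exp (- \<rho> * t) * U1 (ctrl x' g' t) + exp (- \<rho> * t) * U2 (x' t)"
          by (simp only: payoff_def distrib_left)
        moreover have "2 * B * exp (- \<rho> * t) = exp (- \<rho> * t) * B + B * exp (- \<rho> * t)" by simp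
        ultimately show ?case using elim by linarith
      qed
    qed
  qed
  have "AE t in half_line. g' t \<le> D x' t"
    using aeZ AE_half_line_nonneg
  proof eventually_elim
    case (elim t)
    then show ?case using x'(2,4)[of t] by linarith
  qed
  then have adm: "adm \<eta> x' g'" using x'(1) x'pos \<eta>i by (simp add: adm_def)
  have li: "integrable half_line (\<lambda>t. 2 * B * exp (- \<rho> * t) - v t)"
    by (intro Bochner_Integration.integrable_diff bound_integrable vi)
  have fin: "fin x' g'" by (rule fin_of_lower[OF adm li low])
  have "V \<le> W - integral\<^sup>L half_line v" using vW by simp
  also have "\<dots> = integral\<^sup>L half_line (\<lambda>t. 2 * B * exp (- \<rho> * t) - v t)"
    using vi bound_integrable[of "2 * B"] by (simp add: W_def)
  also have "\<dots> \<le> J x' g'"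
    unfolding J_def using fin li low by (intro integral_mono_AE) (auto simp: fin_def)
  finally have "V \<le> J x' g'" .
  moreover have "J x' g' \<le> V" using VF_real(2)[OF adm fin] V(1) by simp
  ultimately show ?thesis using adm fin V(1) unfolding optimal_def by (intro exI[of _ x'] exI[of _ g']) auto
qed

end

subsection \<open>Optimality of tails\<close>

lemma half_line_split:
  fixes f :: "real \<Rightarrow> real"
  assumes t0: "0 \<le> t0" and f: "f absolutely_integrable_on {0..t0}"
  shows "integrable half_line f \<longleftrightarrow> integrable half_line (\<lambda>s. f (s + t0))"
    and "integrable half_line f \<Longrightarrow>
      integral\<^sup>L half_line f = integral {0..t0} f + integral\<^sup>L half_line (\<lambda>s. f (s + t0))"
proof -
  define f1 where "f1 t = indicator {0..<t0} t *\<^sub>R f t" for t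
  define f2 where "f2 t = indicator {t0..} t *\<^sub>R f t" for t
  have sum: "indicator {0..} t *\<^sub>R f t = f1 t + f2 t" for t
    using t0 by (auto simp: f1_def f2_def indicator_def)
  have f1: "integrable lebesgue f1"
  proof -
    have "f absolutely_integrable_on {0..<t0}" using f by (rule set_integrable_subset) auto
    then show ?thesis unfolding f1_def set_integrable_def .
  qed
  have sh: "f2 (t0 + 1 * s) = indicator {0..} s *\<^sub>R f (s + t0)" for s
    by (auto simp: f2_def indicator_def add.commute)
  have h1: "integrable half_line k \<longleftrightarrow> integrable lebesgue (\<lambda>t. indicator {0..} t *\<^sub>R k t)" for k :: "real \<Rightarrow> real"
    by (simp add: integrable_restrict_space)
  have h2: "integral\<^sup>L half_line k = integral\<^sup>L lebesgue (\<lambda>t. indicator {0..} t *\<^sub>R k t)" for k :: "real \<Rightarrow> real"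
    by (simp add: integral_restrict_space)
  have "integrable half_line f \<longleftrightarrow> integrable lebesgue f2"
  proof
    assume "integrable half_line f"
    then have "integrable lebesgue (\<lambda>t. (f1 t + f2 t) - f1 t)" unfolding h1 sum using f1 by (rule Bochner_Integration.integrable_diff)
    then show "integrable lebesgue f2" by simp
  next
    assume "integrable lebesgue f2"
    then show "integrable half_line f" unfolding h1 sum using f1 by (intro Bochner_Integration.integrable_add)
  qed
  note f2 = this
  also have "\<dots> \<longleftrightarrow> integrable lebesgue (\<lambda>s. f2 (t0 + 1 * s))"
    by (subst lebesgue_integrable_real_affine_iff) simp_all
  also have "\<dots> \<longleftrightarrow> integrable half_line (\<lambda>s. f (s + t0))" unfolding h1 sh ..
  finally show "integrable half_line f \<longleftrightarrow> integrable half_line (\<lambda>s. f (s + t0))" .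
  assume i: "integrable half_line f"
  have "integral\<^sup>L half_line f = integral\<^sup>L lebesgue f1 + integral\<^sup>L lebesgue f2"
    unfolding h2 sum using f1 i f2 by simp
  also have "integral\<^sup>L lebesgue f2 = integral\<^sup>L half_line (\<lambda>s. f (s + t0))"
    unfolding h2 sh[symmetric] using lebesgue_integral_real_affine[of 1 f2 t0] by simp
  also have "integral\<^sup>L lebesgue f1 = integral {0..<t0} f"
    using set_lebesgue_integral_eq_integral(2)[of "{0..<t0}" f] f1
    unfolding f1_def set_integrable_def set_lebesgue_integral_def by simp
  also have "integral {0..<t0} f = integral {0..t0} f"
  proof (rule integral_spike_set)
    show "negligible {x \<in> {0..<t0} - {0..t0}. f x \<noteq> 0}" by (rule negligible_subset[of "{}"]) auto
    have "{x \<in> {0..t0} - {0..<t0}. f x \<noteq> 0} \<subseteq> {t0}" by auto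
    then show "negligible {x \<in> {0..t0} - {0..<t0}. f x \<noteq> 0}" by (rule negligible_subset[rotated]) simp
  qed
  finally show "integral\<^sup>L half_line f = integral {0..t0} f + integral\<^sup>L half_line (\<lambda>s. f (s + t0))" .
qed

context control_problem
begin

section \<open>Restarting and gluing trajectories\<close>

lemma drift_shift: "D (\<lambda>s. x (s + b)) s = D x (s + b)"
  by (simp add: drift_def add_ac)

lemma drift_cong: "(\<And>u. t - T \<le> u \<Longrightarrow> u \<le> t \<Longrightarrow> x u = y u) \<Longrightarrow> D x t = D y t"
  unfolding drift_def using T_pos
  by (intro arg_cong2[where f = "(+)"] arg_cong2[where f = F] arg_cong2[where f = "(*)"]
      Bochner_Integration.integral_cong refl) auto

lemma payoff_abs_integrable:
  assumes "adm \<eta> x g" "fin x g" shows "payoff x g absolutely_integrable_on {0..t}"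
proof -
  have "payoff x g absolutely_integrable_on {0..}" using assms(2) by (simp add: fin_def integrable_lebesgue_on_iff)
  then show ?thesis by (rule set_integrable_subset) auto
qed

lemma adm_tail:
  assumes x: "adm \<eta> x g" and t0: "0 \<le> t0"
  defines "x' \<equiv> \<lambda>s. x (s + t0)" and "g' \<equiv> \<lambda>s. g (s + t0)"
  shows "adm (segment x t0) x' g'" "payoff x' g' s = exp (\<rho> * t0) * payoff x g (s + t0)"
proof -
  note ax = adm_D[OF x] and tx = trajD[OF adm_D(1)[OF x]]
  have "traj (segment x t0) x' g'"
    unfolding traj_def
  proof (intro conjI allI impI)
    show "x' s = snd (segment x t0) s" for s by (simp add: x'_def segment_def add.commute)
    fix t
    have "g absolutely_integrable_on {t0..t + t0}"
      using absolutely_integrable_on_subinterval[where a = t0 and b = "t + t0", OF tx(2)[of "t + t0"]] t0 by auto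
    then show "g' absolutely_integrable_on {0..t}"
      using absolutely_integrable_shift[where f = g and p = t0 and c = 0 and d = t] by (simp add: g'_def)
    assume t: "0 \<le> t"
    have "integral {0..t} g' = integral {t0..t + t0} g"
      using integral_shift_real_ivl[of t0 t0 "t + t0" g] by (simp add: g'_def)
    moreover have "integral {0..t0} g + integral {t0..t + t0} g = integral {0..t + t0} g"
      using t t0 tx(3) by (intro Henstock_Kurzweil_Integration.integral_combine) auto
    ultimately show "x' t = fst (segment x t0) + integral {0..t} g'"
      using tx(4)[of t0] tx(4)[of "t + t0"] t t0 by (simp add: x'_def segment_def)
  qed
  moreover have "snd (segment x t0) absolutely_integrable_on {-T..0}"
    using hist_segment[OF ax(4) t0] by (simp add: segment_def)
  moreover have "\<forall>t\<ge>0. 0 < x' t" using ax(2) t0 by (simp add: x'_def)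
  moreover have "AE t in half_line. g' t \<le> D x' t"
  proof -
    obtain Z where Z: "negligible Z" "\<And>t. 0 \<le> t \<Longrightarrow> t \<notin> Z \<Longrightarrow> g t \<le> D x t"
      using ax(3) by (auto simp: AE_half_line)
    have "negligible ((\<lambda>u. - t0 + u) ` Z)" by (rule negligible_translation[OF Z(1)])
    moreover have "g' t \<le> D x' t" if "0 \<le> t" "t \<notin> (\<lambda>u. - t0 + u) ` Z" for t
    proof -
      have "t + t0 \<notin> Z"
      proof
        assume "t + t0 \<in> Z"
        then have "- t0 + (t + t0) \<in> (\<lambda>u. - t0 + u) ` Z" by blast
        with that show False by simp
      qed
      then show ?thesis using Z(2)[of "t + t0"] that t0 by (simp add: g'_def x'_def drift_shift)
    qed
    ultimately show ?thesis unfolding AE_half_line by blast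
  qed
  ultimately show "adm (segment x t0) x' g'" by (simp add: adm_def)
  show "payoff x' g' s = exp (\<rho> * t0) * payoff x g (s + t0)"
    by (simp add: payoff_def ctrl_def x'_def g'_def drift_shift mult.assoc[symmetric] exp_add[symmetric] algebra_simps)
qed

lemma fin_tail:
  assumes x: "adm \<eta> x g" "fin x g" and t0: "0 \<le> t0"
  defines "x' \<equiv> \<lambda>s. x (s + t0)" and "g' \<equiv> \<lambda>s. g (s + t0)"
  shows "fin x' g'" "J x g = integral {0..t0} (payoff x g) + exp (- \<rho> * t0) * J x' g'"
proof -
  have p: "payoff x' g' = (\<lambda>s. exp (\<rho> * t0) * payoff x g (s + t0))"
    unfolding x'_def g'_def using adm_tail(2)[OF x(1) t0] by blast
  note split = half_line_split[OF t0 payoff_abs_integrable[OF x]]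
  show "fin x' g'" using split(1) x(2) unfolding fin_def p by simp
  have "J x' g' = exp (\<rho> * t0) * integral\<^sup>L half_line (\<lambda>s. payoff x g (s + t0))"
    unfolding J_def p by simp
  then have "exp (- \<rho> * t0) * J x' g' = integral\<^sup>L half_line (\<lambda>s. payoff x g (s + t0))"
    by (simp add: mult.assoc[symmetric] exp_minus)
  then show "J x g = integral {0..t0} (payoff x g) + exp (- \<rho> * t0) * J x' g'"
    using split(2) x(2) by (simp add: J_def fin_def)
qed

text \<open>The continuation starts from the history \<open>segment x t0\<close>, so the delay
  window of the glued path is that of \<open>x\<close> before \<open>t0\<close> and that of
  \<open>y\<close> afterwards; both drifts are inherited.\<close>

lemma concatenation:
  assumes x: "adm \<eta> x g" "fin x g" and t0: "0 \<le> t0"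
    and y: "adm (segment x t0) y k" "fin y k"
  shows "\<exists>z h. adm \<eta> z h \<and> fin z h \<and> J z h = integral {0..t0} (payoff x g) + exp (- \<rho> * t0) * J y k"
proof -
  note ax = adm_D[OF x(1)] and tx = trajD[OF adm_D(1)[OF x(1)]]
  note ay = adm_D[OF y(1)] and ty = trajD[OF adm_D(1)[OF y(1)]]
  define z where "z t = (if t < t0 then x t else y (t - t0))" for t
  define h where "h t = (if t < t0 then g t else k (t - t0))" for t
  have y0: "y 0 = x t0" using ty(5) by (simp add: segment_def)
  have zx: "z t = x t" if "t \<le> t0" for t using that y0 by (simp add: z_def)
  have zy: "z (s + t0) = y s" if "-T \<le> s" for s
    using that ty(1)[of s] by (auto simp: z_def segment_def add.commute)
  have Dz1: "D z t = D x t" if "t < t0" for t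
    using that by (intro drift_cong zx) auto
  have Dz2: "D z (s + t0) = D y s" if "0 \<le> s" for s
    unfolding drift_shift[symmetric] using that by (intro drift_cong zy) auto
  have hi1: "h absolutely_integrable_on {0..t}" if "t \<le> t0" for t
    by (rule absolutely_integrable_spike[OF tx(2), of "{t0}"]) (use that in \<open>auto simp: h_def\<close>)
  have hI1: "integral {0..t} h = integral {0..t} g" if "t \<le> t0" for t
    by (rule integral_spike[of "{t0}"]) (use that in \<open>auto simp: h_def\<close>)
  have hs: "(\<lambda>s. h (s + t0)) = (\<lambda>s. if s < 0 then g (s + t0) else k s)" by (auto simp: h_def)
  have hi2: "h absolutely_integrable_on {t0..t}" for t
  proof -
    have "(\<lambda>s. h (s + t0)) absolutely_integrable_on {0..t - t0}"
      unfolding hs by (rule absolutely_integrable_spike[OF ty(2) negligible_empty]) auto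
    then show ?thesis using absolutely_integrable_shift[where f = h and p = t0 and c = 0 and d = "t - t0"] by simp
  qed
  have hI2: "integral {t0..t} h = integral {0..t - t0} k" for t
  proof -
    have "integral {t0..t} h = integral {0..t - t0} (\<lambda>s. h (s + t0))"
      using integral_shift_real_ivl[of t0 t0 t h] by simp
    also have "\<dots> = integral {0..t - t0} k"
      unfolding hs by (rule Henstock_Kurzweil_Integration.integral_cong) auto
    finally show ?thesis .
  qed
  have hi: "h absolutely_integrable_on {0..t}" for t
  proof (cases "t \<le> t0")
    case False
    then show ?thesis using absolutely_integrable_on_combine[OF hi1[of t0] hi2[of t]] t0 by auto
  qed (rule hi1)
  have traj: "traj \<eta> z h"
    unfolding traj_def
  proof (intro conjI allI impI hi)
    show "z s = snd \<eta> s" if "-T \<le> s \<and> s < 0" for s using that tx(1)[of s] t0 by (simp add: z_def)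
    fix t :: real assume t: "0 \<le> t"
    show "z t = fst \<eta> + integral {0..t} h"
    proof (cases "t \<le> t0")
      case True
      then show ?thesis using zx tx(4)[OF t] hI1 by simp
    next
      case False
      have "integral {0..t0} h + integral {t0..t} h = integral {0..t} h"
        using t0 False hi[of t] by (intro Henstock_Kurzweil_Integration.integral_combine) (auto simp: absolutely_integrable_on_def)
      then show ?thesis
        using False ty(4)[of "t - t0"] tx(4)[OF t0] hI1[of t0] hI2[of t] by (simp add: z_def segment_def)
    qed
  qed
  have "AE t in half_line. h t \<le> D z t"
  proof -
    obtain Z where Z: "negligible Z" "\<And>t. 0 \<le> t \<Longrightarrow> t \<notin> Z \<Longrightarrow> g t \<le> D x t"
      using ax(3) by (auto simp: AE_half_line)
    obtain Y where Y: "negligible Y" "\<And>t. 0 \<le> t \<Longrightarrow> t \<notin> Y \<Longrightarrow> k t \<le> D y t"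
      using ay(3) by (auto simp: AE_half_line)
    have "negligible (Z \<union> (\<lambda>u. t0 + u) ` Y)"
      by (intro negligible_Un Z(1) negligible_translation Y(1))
    moreover have "h t \<le> D z t" if t: "0 \<le> t" "t \<notin> Z \<union> (\<lambda>u. t0 + u) ` Y" for t
    proof (cases "t < t0")
      case True
      then show ?thesis using Z(2)[of t] t by (simp add: h_def Dz1)
    next
      case False
      have "t - t0 \<notin> Y"
      proof
        assume "t - t0 \<in> Y"
        then have "t0 + (t - t0) \<in> (\<lambda>u. t0 + u) ` Y" by blast
        with t show False by simp
      qed
      then show ?thesis using Y(2)[of "t - t0"] Dz2[of "t - t0"] False by (simp add: h_def)
    qed
    ultimately show ?thesis unfolding AE_half_line by blast
  qed
  then have adm: "adm \<eta> z h"
    using traj ax(2,6) ay(2) t0 by (simp add: adm_def z_def)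
  have p1: "payoff z h t = payoff x g t" if "t < t0" for t
    using that by (simp add: payoff_def ctrl_def Dz1 h_def zx)
  have p2: "payoff z h (s + t0) = exp (- \<rho> * t0) * payoff y k s" if "0 \<le> s" for s
  proof -
    have "exp (- \<rho> * (s + t0)) = exp (- \<rho> * t0) * exp (- \<rho> * s)"
      by (simp add: exp_add[symmetric] algebra_simps)
    moreover have "z (s + t0) = y s" "h (s + t0) = k s" using that zy[of s] T_pos by (simp_all add: h_def)
    ultimately show ?thesis unfolding payoff_def ctrl_def by (simp only: Dz2[OF that] mult.assoc)
  qed
  have pi: "payoff z h absolutely_integrable_on {0..t0}"
    by (rule absolutely_integrable_spike[OF payoff_abs_integrable[OF x], of "{t0}"]) (auto simp: p1)
  have pI: "integral {0..t0} (payoff z h) = integral {0..t0} (payoff x g)"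
    by (rule integral_spike[of "{t0}"]) (auto simp: p1)
  have c: "integrable half_line (\<lambda>s. payoff z h (s + t0)) \<longleftrightarrow> integrable half_line (\<lambda>s. exp (- \<rho> * t0) * payoff y k s)"
    by (rule Bochner_Integration.integrable_cong) (auto simp: p2 space_restrict_space)
  have cI: "integral\<^sup>L half_line (\<lambda>s. payoff z h (s + t0)) = integral\<^sup>L half_line (\<lambda>s. exp (- \<rho> * t0) * payoff y k s)"
    by (rule Bochner_Integration.integral_cong) (auto simp: p2 space_restrict_space)
  have fin: "fin z h"
    using half_line_split(1)[OF t0 pi] c y(2) by (simp add: fin_def)
  moreover have "J z h = integral {0..t0} (payoff x g) + exp (- \<rho> * t0) * J y k"
    using half_line_split(2)[OF t0 pi] fin by (simp add: fin_def J_def pI cI)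
  ultimately show ?thesis using adm by blast
qed

text \<open>Bellman's principle: a better continuation could be glued to the initial piece of
  \<open>x\<close> and would improve on \<open>x\<close>.\<close>

lemma optimal_tail:
  assumes x: "optimal \<eta> x g" and t0: "0 \<le> t0"
  shows "optimal (segment x t0) (\<lambda>s. x (s + t0)) (\<lambda>s. g (s + t0))"
proof -
  have ax: "adm \<eta> x g" "fin x g" and V: "VF \<eta> = ereal (J x g)" using x by (auto simp: optimal_def)
  note adm = adm_tail(1)[OF ax(1) t0] and fin = fin_tail(1)[OF ax t0]
  have "VF (segment x t0) \<le> ereal (J (\<lambda>s. x (s + t0)) (\<lambda>s. g (s + t0)))"
  proof (rule VF_le[OF adm_D(6)[OF adm]])
    fix y k assume y: "adm (segment x t0) y k" "fin y k"
    obtain z h where z: "adm \<eta> z h" "fin z h" "J z h = integral {0..t0} (payoff x g) + exp (- \<rho> * t0) * J y k"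
      using concatenation[OF ax t0 y] by blast
    have "J z h \<le> J x g" using VF_real(2)[OF z(1,2)] V by simp
    then have "exp (- \<rho> * t0) * J y k \<le> exp (- \<rho> * t0) * J (\<lambda>s. x (s + t0)) (\<lambda>s. g (s + t0))"
      using z(3) fin_tail(2)[OF ax t0] by linarith
    then show "J y k \<le> J (\<lambda>s. x (s + t0)) (\<lambda>s. g (s + t0))" by simp
  qed
  then show ?thesis using J_le_VF[OF adm fin] adm fin by (auto simp: optimal_def intro: antisym)
qed

text \<open>If consumption were small on a set \<open>E\<close>, mixing in a control that concentrates on \<open>E\<close>
  would gain more than it costs, since \<open>U1\<close> has infinite slope at zero.\<close>

lemma optimal_ctrl_lower_bound:
  assumes \<eta>: "pos_history \<eta>" and x: "optimal \<eta> x g" and N: "0 \<le> N"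
  shows "\<exists>\<delta>>0. AE t in half_line. t \<le> N \<longrightarrow> \<delta> \<le> ctrl x g t"
proof -
  have ax: "adm \<eta> x g" "fin x g" and V: "VF \<eta> = ereal (J x g)" using x by (auto simp: optimal_def)
  have ax': "adm (fst \<eta>, snd \<eta>) x g" using ax(1) by simp
  have \<eta>0: "0 < fst \<eta>" using \<eta> by (simp add: pos_history_def)
  define \<kappa> where "\<kappa> = fst \<eta> / 2 * exp (- Cf * N)"
  have \<kappa>: "0 < \<kappa>" using \<eta>0 by (simp add: \<kappa>_def)
  \<comment> \<open>Per unit of mixing weight the change of payoff is at least \<open>m\<close>:
    \<open>U2\<close> at the reference state, minus \<open>B\<close> for \<open>U2\<close> at
    \<open>x\<close>, minus \<open>2 * B\<close> for the change in \<open>U1\<close>.\<close>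
  define m where "m t = exp (- \<rho> * t) * U2 (fst \<eta> / 2 * exp (- Cf * t)) + (- (3 * B)) * exp (- \<rho> * t)" for t
  have mi: "integrable half_line m"
    unfolding m_def using \<eta>0
    by (intro Bochner_Integration.integrable_add U2_discounted_integrable bound_integrable) auto
  define K where "K = \<bar>integral\<^sup>L half_line m\<bar>"
  \<comment> \<open>The slope at which raising consumption by \<open>\<theta> * \<kappa>\<close>
    outweighs the loss \<open>K\<close> after undiscounting. The summand 1 leaves a surplus
    \<open>\<theta>\<close>, which pays for replacing \<open>U1 0\<close> by
    \<open>U1 \<delta>\<close>.\<close>
  define M where "M = (exp (\<rho> * N) * K + 1) / \<kappa>"
  obtain b where b: "0 < b" "\<And>z. 0 < z \<Longrightarrow> z < b \<Longrightarrow> M < p z"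
  proof -
    have "\<forall>\<^sub>F z in at_right 0. M < p z" using U1_deriv_0 by (simp add: filterlim_at_top_dense)
    then show ?thesis using that by (auto simp: eventually_at_right_field)
  qed
  \<comment> \<open>The first bound keeps \<open>\<theta> * \<kappa>\<close> in the range where the
    slope exceeds \<open>M\<close>; the second makes the mixing weight \<open>\<theta> * e\<close>
    less than 1, as \<open>e\<close> is at most \<open>N\<close>.\<close>
  define \<theta> where "\<theta> = min (b / \<kappa>) (1 / (N + 1)) / 2"
  have \<theta>: "0 < \<theta>" "\<theta> * \<kappa> < b" "\<theta> * N < 1"
  proof -
    show "0 < \<theta>" using b \<kappa> N by (simp add: \<theta>_def)
    have "\<theta> \<le> b / \<kappa> / 2" by (simp add: \<theta>_def)
    then show "\<theta> * \<kappa> < b" using b \<kappa> by (simp add: field_simps)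
    have "\<theta> \<le> 1 / (N + 1) / 2" unfolding \<theta>_def by (intro divide_right_mono) auto
    then have "\<theta> * N \<le> 1 / (N + 1) / 2 * N" using N by (rule mult_right_mono)
    also have "\<dots> < 1" using N by (simp add: field_simps)
    finally show "\<theta> * N < 1" .
  qed
  have gain: "\<theta> * (exp (\<rho> * N) * K + 1) < U1 (\<theta> * \<kappa>) - U1 0"
  proof -
    have pos: "0 < \<theta> * \<kappa>" using \<theta> \<kappa> by simp
    obtain z where z: "0 < z" "z < \<theta> * \<kappa>" "U1 (\<theta> * \<kappa>) - U1 0 = (\<theta> * \<kappa> - 0) * p z"
      using U1_MVT[of 0 "\<theta> * \<kappa>"] pos by auto
    have "\<theta> * \<kappa> * M < \<theta> * \<kappa> * p z" using b(2)[of z] z \<theta> pos by (intro mult_strict_left_mono) auto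
    moreover have "\<theta> * \<kappa> * M = \<theta> * (exp (\<rho> * N) * K + 1)" using \<kappa> by (simp add: M_def)
    ultimately show ?thesis using z by simp
  qed
  obtain \<delta> where \<delta>: "0 < \<delta>" "U1 \<delta> < U1 0 + \<theta>"
  proof -
    have "(U1 \<longlongrightarrow> U1 0) (at 0 within {0..})" using U1_cont by (auto simp: continuous_on_def)
    then have "\<forall>\<^sub>F z in at 0 within {0..}. U1 z < U1 0 + \<theta>" using \<theta>(1) by (intro order_tendstoD) auto
    then obtain d where d: "0 < d" "\<And>z. 0 \<le> z \<Longrightarrow> z \<noteq> 0 \<Longrightarrow> dist z 0 < d \<Longrightarrow> U1 z < U1 0 + \<theta>"
      by (auto simp: eventually_at)
    show ?thesis using that[of "d / 2"] d(1) d(2)[of "d / 2"] by (simp add: dist_real_def)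
  qed
  define E where "E = {t \<in> {0..N}. ctrl x g t < \<delta>}"
  have cm: "ctrl x g \<in> borel_measurable (lebesgue_on {0..N})"
    using ctrl_absolutely_integrable[OF ax(1)] by (auto intro: absolutely_integrable_imp_borel_measurable)
  have E: "E \<in> sets lebesgue" "E \<subseteq> {0..N}"
  proof -
    have "{t \<in> space (lebesgue_on {0..N}). ctrl x g t < \<delta>} \<in> sets (lebesgue_on {0..N})"
      using cm by (intro borel_measurable_less) auto
    then show "E \<in> sets lebesgue" by (auto simp: E_def space_restrict_space sets_restrict_space_iff)
  qed (auto simp: E_def)
  have Em: "E \<in> lmeasurable"
    by (rule bounded_set_imp_lmeasurable[OF bounded_subset[OF _ E(2)] E(1)]) simp
  have "measure lebesgue E = 0"
  proof (rule ccontr)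
    assume "measure lebesgue E \<noteq> 0"
    then have e: "0 < measure lebesgue E" by (simp add: zero_less_measure_iff)
    define e where "e = measure lebesgue E"
    have e0: "0 < e" using e by (simp add: e_def)
    have eN: "e \<le> N"
      using measure_mono_fmeasurable[of E "{0..N}" lebesgue] E N by (simp add: e_def)
    obtain y k where y: "adm \<eta> y k" "fin y k" "\<And>t. 0 \<le> t \<Longrightarrow> t \<in> E \<Longrightarrow> \<kappa> / e \<le> ctrl y k t"
      "\<And>t. 0 \<le> t \<Longrightarrow> fst \<eta> / 2 * exp (- Cf * t) \<le> y t"
      using reference_pair[OF \<eta>0 _ _ E, of e] \<eta> e0 unfolding pos_history_def \<kappa>_def e_def by auto
    have y': "adm (fst \<eta>, snd \<eta>) y k" using y(1) by simp
    \<comment> \<open>The weight is proportional to the measure \<open>e\<close> of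
      \<open>E\<close>. Then the consumption \<open>l * (\<kappa> / e)\<close> added on
      \<open>E\<close> does not depend on \<open>e\<close>, and gain and loss are both proportional
      to \<open>e\<close>, however small \<open>E\<close> is.\<close>
    define l where "l = \<theta> * e"
    have l: "0 < l" "l < 1" "0 \<le> 1 - l" "0 \<le> l" "1 - l + l = 1"
    proof -
      show "0 < l" using \<theta> e0 by (simp add: l_def)
      have "l \<le> \<theta> * N" unfolding l_def using eN \<theta> by (intro mult_left_mono) auto
      then show "l < 1" using \<theta> by linarith
      then show "0 \<le> 1 - l" by simp
      show "0 \<le> l" using \<open>0 < l\<close> by simp
    qed simp
    define z where "z t = (1 - l) * x t + l * y t" for t
    define h where "h t = (1 - l) * g t + l * k t" for t
    note mx = adm_mix[OF ax' y' l(3-5)] payoff_mix[OF ax' y' l(3-5)] fin_mix[OF ax' y' l(3-5) ax(2) y(2)]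
    have adm: "adm \<eta> z h"
    proof -
      have "(1 - l) * fst \<eta> + l * fst \<eta> = fst \<eta>" by (simp add: algebra_simps)
      then show ?thesis using mx(1) by (simp add: z_def[abs_def] h_def[abs_def])
    qed
    have fin: "fin z h" using mx(3) by (simp add: z_def[abs_def] h_def[abs_def])
    define G where "G = exp (- \<rho> * N) * (U1 (\<theta> * \<kappa>) - U1 \<delta>)"
    have G0: "0 \<le> U1 (\<theta> * \<kappa>) - U1 \<delta>"
    proof -
      have "0 \<le> \<theta> * (exp (\<rho> * N) * K)" using \<theta> by (simp add: K_def)
      then show ?thesis using gain \<delta>(2) by (simp add: algebra_simps)
    qed
    have low: "AE t in half_line. l * m t + G * indicat_real E t \<le> payoff z h t - payoff x g t"
      using mx(2) AE_half_line_nonneg unfolding z_def[abs_def, symmetric] h_def[abs_def, symmetric]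
    proof eventually_elim
      case (elim t)
      let ?c = "(1 - l) * ctrl x g t + l * ctrl y k t"
      define U where "U = U1 ?c - U1 (ctrl x g t)"
      define W where "W = U2 (y t) - U2 (x t)"
      have "exp (- \<rho> * t) * (U + l * W) = exp (- \<rho> * t) * (U1 ?c + ((1 - l) * U2 (x t) + l * U2 (y t))) - payoff x g t"
        by (simp add: U_def W_def payoff_def algebra_simps)
      then have 1: "exp (- \<rho> * t) * (U + l * W) \<le> payoff z h t - payoff x g t" using elim by linarith
      have W: "U2 (fst \<eta> / 2 * exp (- Cf * t)) - B \<le> W"
        using U2_mono'[of "fst \<eta> / 2 * exp (- Cf * t)" "y t"] y(4)[of t] B(3)[OF adm_D(2)[OF ax(1), of t]] elim \<eta>0
        by (simp add: W_def)
      have m: "m t = exp (- \<rho> * t) * (U2 (fst \<eta> / 2 * exp (- Cf * t)) - B - 2 * B)"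
        by (simp add: m_def algebra_simps)
      have U: "l * (- 2 * B) + (if t \<in> E then U1 (\<theta> * \<kappa>) - U1 \<delta> else 0) \<le> U"
      proof (cases "t \<in> E")
        case True
        have "\<theta> * \<kappa> = l * (\<kappa> / e)" using e0 by (simp add: l_def)
        also have "\<dots> \<le> l * ctrl y k t" using y(3)[OF elim(2) True] l by (intro mult_left_mono) auto
        also have "\<dots> \<le> ?c" using l ctrl_nonneg[of x g t] by simp
        finally have "U1 (\<theta> * \<kappa>) \<le> U1 ?c" using \<theta> \<kappa> by (intro U1_mono) auto
        moreover have "U1 (ctrl x g t) \<le> U1 \<delta>" using True ctrl_nonneg by (intro U1_mono) (auto simp: E_def)
        moreover have "l * (- 2 * B) \<le> 0" using l B(1) by (simp add: mult_nonneg_nonpos)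
        ultimately show ?thesis using True by (simp add: U_def)
      next
        case False
        have "(1 - l) * U1 (ctrl x g t) + l * U1 (ctrl y k t) \<le> U1 ?c"
          by (intro U1_concave ctrl_nonneg l)
        then have "l * (U1 (ctrl y k t) - U1 (ctrl x g t)) \<le> U" by (simp add: U_def algebra_simps)
        moreover have "l * (- 2 * B) \<le> l * (U1 (ctrl y k t) - U1 (ctrl x g t))"
          using B(2)[OF ctrl_nonneg[of x g t]] B(2)[OF ctrl_nonneg[of y k t]] l by (intro mult_left_mono) auto
        ultimately show ?thesis using False by simp
      qed
      have "l * (U2 (fst \<eta> / 2 * exp (- Cf * t)) - B) \<le> l * W" using W l by (intro mult_left_mono) auto
      then have "l * (U2 (fst \<eta> / 2 * exp (- Cf * t)) - B - 2 * B) + (if t \<in> E then U1 (\<theta> * \<kappa>) - U1 \<delta> else 0) \<le> U + l * W"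
        using U by (simp add: right_diff_distrib)
      then have "exp (- \<rho> * t) * (l * (U2 (fst \<eta> / 2 * exp (- Cf * t)) - B - 2 * B) + (if t \<in> E then U1 (\<theta> * \<kappa>) - U1 \<delta> else 0))
          \<le> exp (- \<rho> * t) * (U + l * W)" by (intro mult_left_mono) auto
      moreover have "G * indicat_real E t \<le> exp (- \<rho> * t) * (if t \<in> E then U1 (\<theta> * \<kappa>) - U1 \<delta> else 0)"
      proof (cases "t \<in> E")
        case True
        then have "exp (- \<rho> * N) \<le> exp (- \<rho> * t)" using E(2) rho_pos by auto
        then show ?thesis using True G0 by (simp add: G_def mult_right_mono)
      qed simp
      ultimately show ?case using 1 unfolding m by (simp only: distrib_left mult.left_commute)
    qed
    have iE: "integrable half_line (indicat_real E)" "integral\<^sup>L half_line (indicat_real E) = e"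
    proof -
      have EE: "(\<lambda>t. indicat_real {0..} t * indicat_real E t) = indicat_real E"
        using E(2) by (auto simp: indicator_def fun_eq_iff)
      have "integrable lebesgue (indicat_real E)"
        by (rule integrable_real_indicator) (use Em in \<open>auto simp: fmeasurable_def\<close>)
      then show "integrable half_line (indicat_real E)" by (simp add: integrable_restrict_space EE)
      show "integral\<^sup>L half_line (indicat_real E) = e"
        using E(1) by (subst integral_restrict_space) (simp_all add: EE e_def)
    qed
    have "l * integral\<^sup>L half_line m + G * e = integral\<^sup>L half_line (\<lambda>t. l * m t + G * indicat_real E t)"
      using mi iE by simp
    also have "\<dots> \<le> integral\<^sup>L half_line (\<lambda>t. payoff z h t - payoff x g t)"
      using mi iE fin ax(2) low by (intro integral_mono_AE) (auto simp: fin_def)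
    also have "\<dots> = J z h - J x g" using fin ax(2) by (simp add: J_def fin_def)
    also have "\<dots> \<le> 0" using VF_real(2)[OF adm fin] V by simp
    finally have "G * e \<le> - (l * integral\<^sup>L half_line m)" by simp
    also have "\<dots> = l * (- integral\<^sup>L half_line m)" by simp
    also have "\<dots> \<le> l * K" unfolding K_def using l(4) by (rule mult_left_mono[rotated]) simp
    finally have "G * e \<le> \<theta> * K * e" by (simp add: l_def mult_ac)
    then have "G \<le> \<theta> * K" using e0 by simp
    then have "exp (\<rho> * N) * G \<le> exp (\<rho> * N) * (\<theta> * K)" by (intro mult_left_mono) auto
    moreover have "exp (\<rho> * N) * G = U1 (\<theta> * \<kappa>) - U1 \<delta>"
      by (simp add: G_def mult.assoc[symmetric] exp_minus)
    moreover have "\<theta> * (exp (\<rho> * N) * K + 1) = exp (\<rho> * N) * (\<theta> * K) + \<theta>"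
      by (simp add: algebra_simps)
    ultimately show False using gain \<delta>(2) by linarith
  qed
  then have "negligible E" using Em by (simp add: negligible_iff_measure)
  then have "AE t in half_line. t \<le> N \<longrightarrow> \<delta> \<le> ctrl x g t"
    unfolding AE_half_line by (intro exI[of _ E]) (auto simp: E_def)
  then show ?thesis using \<delta>(1) by blast
qed

end

subsection \<open>Perturbations of an optimal control\<close>

lemma half_line_indicator_integral:
  fixes k :: "real \<Rightarrow> real"
  assumes "k absolutely_integrable_on {0..N}"
  shows "integrable half_line (\<lambda>t. indicat_real {0..N} t * k t)"
    "integral\<^sup>L half_line (\<lambda>t. indicat_real {0..N} t * k t) = integral {0..N} k"
proof -
  have eq: "(\<lambda>t. indicat_real {0..} t * (indicat_real {0..N} t * k t)) = (\<lambda>t. indicat_real {0..N} t *\<^sub>R k t)"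
    by (auto simp: indicator_def fun_eq_iff)
  show "integrable half_line (\<lambda>t. indicat_real {0..N} t * k t)"
    using assms by (subst integrable_restrict_space) (simp_all add: set_integrable_def eq[simplified])
  have "integral\<^sup>L half_line (\<lambda>t. indicat_real {0..N} t * k t) = integral\<^sup>L lebesgue (\<lambda>t. indicat_real {0..N} t *\<^sub>R k t)"
    unfolding eq[symmetric] by (subst integral_restrict_space) simp_all
  also have "\<dots> = integral {0..N} k"
    using set_lebesgue_integral_eq_integral(2)[OF assms] by (simp add: set_lebesgue_integral_def)
  finally show "integral\<^sup>L half_line (\<lambda>t. indicat_real {0..N} t * k t) = integral {0..N} k" .
qed

context control_problem
begin

lemma U1_lipschitz:
  assumes "0 < d" "d \<le> u" "d \<le> v"
  shows "\<bar>U1 u - U1 v\<bar> \<le> p d * \<bar>u - v\<bar>"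
proof -
  have *: "\<bar>U1 b - U1 a\<bar> \<le> p d * \<bar>b - a\<bar>" if "d \<le> a" "a < b" for a b
  proof -
    have "0 \<le> a" "a < b" using that assms(1) by auto
    then obtain z where z: "a < z" "z < b" "U1 b - U1 a = (b - a) * p z" by (rule U1_MVT)
    have "p z \<le> p d" using p_le[of d z] assms(1) z that by simp
    moreover have "0 \<le> p z" using U1_deriv_pos[of z] z that assms(1) by simp
    ultimately show ?thesis using z that by (simp add: abs_mult mult.commute mult_left_mono)
  qed
  show ?thesis using *[of u v] *[of v u] assms
    by (cases u v rule: linorder_cases) (auto simp: abs_minus_commute)
qed

lemma U2_three_points:
  assumes "0 < d" "d \<le> y" "y \<le> z" "d < z"
  shows "(z - y) * U2 d + (y - d) * U2 z \<le> (z - d) * U2 y"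
proof -
  define u v where "u = (z - y) / (z - d)" and "v = (y - d) / (z - d)"
  have uv: "0 \<le> u" "0 \<le> v" "u + v = 1"
    using assms by (auto simp: u_def v_def add_divide_distrib[symmetric])
  have "u * d + v * z = ((z - y) * d + (y - d) * z) / (z - d)" by (simp add: u_def v_def add_divide_distrib)
  also have "(z - y) * d + (y - d) * z = y * (z - d)" by (simp add: algebra_simps)
  finally have y: "u * d + v * z = y" using assms by simp
  have "u * U2 d + v * U2 z \<le> U2 y" using U2_concave'[OF assms(1) _ uv, of z] assms y by simp
  then have "(z - d) * (u * U2 d + v * U2 z) \<le> (z - d) * U2 y" using assms by (intro mult_left_mono) auto
  moreover have "(z - d) * (u * U2 d + v * U2 z) = (z - y) * U2 d + (y - d) * U2 z"
    using assms by (simp add: u_def v_def distrib_left)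
  ultimately show ?thesis by simp
qed

text \<open>To the right of \<open>d\<close> the slopes of a concave function are at most its chord
  slope between \<open>d / 2\<close> and \<open>d\<close>. Working with chords avoids any derivative
  of \<open>U2\<close>.\<close>

lemma U2_lipschitz:
  assumes d: "0 < d" "d \<le> y" "y \<le> z"
  shows "U2 z - U2 y \<le> (U2 d - U2 (d / 2)) / (d / 2) * (z - y)"
proof -
  define b where "b = d / 2"
  have b: "0 < b" "b < d" using d by (simp_all add: b_def)
  have 1: "(y - b) * (U2 z - U2 y) \<le> (z - y) * (U2 y - U2 b)"
    using U2_three_points[of b y z] d b by (simp add: algebra_simps)
  have 2: "(d - b) * (U2 y - U2 b) \<le> (y - b) * (U2 d - U2 b)"
    using U2_three_points[of b d y] d b by (simp add: algebra_simps)
  have pos: "0 < y - b" "0 < d - b" using d b by simp_all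
  have "(d - b) * ((y - b) * (U2 z - U2 y)) \<le> (d - b) * ((z - y) * (U2 y - U2 b))"
    using 1 pos by (intro mult_left_mono) auto
  also have "\<dots> = (z - y) * ((d - b) * (U2 y - U2 b))" by simp
  also have "\<dots> \<le> (z - y) * ((y - b) * (U2 d - U2 b))"
    using 2 d by (intro mult_left_mono) auto
  finally have "(y - b) * ((d - b) * (U2 z - U2 y)) \<le> (y - b) * ((z - y) * (U2 d - U2 b))"
    by (simp only: mult.left_commute mult.commute mult.assoc)
  then have "(d - b) * (U2 z - U2 y) \<le> (z - y) * (U2 d - U2 b)" using pos by simp
  moreover have "d - b = d / 2" by (simp add: b_def)
  ultimately show ?thesis using d(1) by (simp add: b_def field_simps)
qed

text \<open>The state is moved by \<open>h * \<phi>\<close>, hence the density by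
  \<open>h * q\<close>. If the drift falls by at most \<open>h * w\<close>, the control is still at
  least \<open>c - h * (q + w)\<close>; \<open>u\<close> bounds the loss in \<open>U2\<close>. As
  \<open>\<phi>\<close> vanishes from time \<open>N - T\<close> on, nothing changes after
  \<open>N\<close>. The initial state moves by \<open>h * \<phi>0\<close>.\<close>

lemma perturbation_step:
  assumes x: "adm \<eta> x g" "fin x g" and h: "0 < h"
    and c: "c \<in> borel_measurable (lebesgue_on {0..N})" "AE t in half_line. t \<le> N \<longrightarrow> c t = ctrl x g t"
      "\<And>t. t \<in> {0..N} \<Longrightarrow> 0 \<le> c t" "\<And>t. t \<in> {0..N} \<Longrightarrow> 0 \<le> c t - h * (q t + w t)"
    and q: "q \<in> borel_measurable lebesgue" "\<And>t. \<bar>q t\<bar> \<le> Q" "\<And>t. N < t \<Longrightarrow> q t = 0"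
    and \<phi>: "\<And>t. 0 \<le> t \<Longrightarrow> \<phi> t = \<phi>0 + integral {0..t} q" "\<And>t. t < 0 \<Longrightarrow> \<phi> t = 0" "\<And>t. N - T < t \<Longrightarrow> \<phi> t = 0"
    and w: "w \<in> borel_measurable lebesgue" and u: "u \<in> borel_measurable lebesgue" "\<And>t. \<bar>u t\<bar> \<le> C"
    and pos: "\<And>t. 0 \<le> t \<Longrightarrow> 0 < x t + h * \<phi> t"
    and Dw: "\<And>t. t \<in> {0..N} \<Longrightarrow> D x t - h * w t \<le> D (\<lambda>s. x s + h * \<phi> s) t"
    and U2u: "\<And>t. t \<in> {0..N} \<Longrightarrow> U2 (x t) - h * u t \<le> U2 (x t + h * \<phi> t)"
  shows "ereal (J x g + integral {0..N} (\<lambda>t. exp (- \<rho> * t) * ((U1 (c t - h * (q t + w t)) - U1 (c t)) - h * u t)))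
    \<le> VF (fst \<eta> + h * \<phi>0, snd \<eta>)"
    and "(\<lambda>t. exp (- \<rho> * t) * (U1 (c t - h * (q t + w t)) - U1 (c t))) absolutely_integrable_on {0..N}"
    and "(\<lambda>t. exp (- \<rho> * t) * u t) absolutely_integrable_on {0..N}"
proof -
  note ax = adm_D[OF x(1)] and tx = trajD[OF adm_D(1)[OF x(1)]]
  define x' where "x' t = x t + h * \<phi> t" for t
  define g' where "g' t = g t + h * q t" for t
  have qi: "q absolutely_integrable_on {0..t}" for t
    by (rule absolutely_integrable_bounded[where B = Q]) (use q measurable_restrict_space1 in auto)
  have traj: "traj (fst \<eta> + h * \<phi>0, snd \<eta>) x' g'"
    unfolding traj_def
  proof (intro conjI allI impI)
    show "x' s = snd (fst \<eta> + h * \<phi>0, snd \<eta>) s" if "-T \<le> s \<and> s < 0" for s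
      using that tx(1)[of s] \<phi>(2)[of s] by (simp add: x'_def)
    show "g' absolutely_integrable_on {0..t}" for t
      unfolding g'_def by (intro set_integral_add(1) set_integrable_mult_right tx(2)) (use qi in auto)
    show "x' t = fst (fst \<eta> + h * \<phi>0, snd \<eta>) + integral {0..t} g'" if t: "0 \<le> t" for t
    proof -
      have "integral {0..t} g' = integral {0..t} g + h * integral {0..t} q"
        unfolding g'_def using tx(3) qi[of t]
        by (subst Henstock_Kurzweil_Integration.integral_add) (auto simp: absolutely_integrable_on_def intro: integrable_on_mult_right)
      then show ?thesis using tx(4)[OF t] \<phi>(1)[OF t] by (simp add: x'_def algebra_simps)
    qed
  qed
  have Dw': "D x t - h * w t \<le> D x' t" if "t \<in> {0..N}" for t
    using Dw[OF that] by (simp add: x'_def[abs_def])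
  have D_eq: "D x' t = D x t" if "N < t" for t
    using that T_pos by (intro drift_cong) (auto simp: x'_def \<phi>(3))
  define b where "b t = q t + w t" for t
  have ctrl: "AE t in half_line. (t \<le> N \<longrightarrow> c t = ctrl x g t \<and> c t - h * b t \<le> D x' t - g' t) \<and> (N < t \<longrightarrow> g' t \<le> D x' t \<and> ctrl x' g' t = ctrl x g t)"
    using adm_ctrl_AE[OF x(1)] c(2) ax(3) AE_half_line_nonneg
  proof eventually_elim
    case (elim t)
    show ?case
    proof (intro conjI impI)
      assume t: "t \<le> N"
      show "c t = ctrl x g t" using elim t by simp
      have "c t = D x t - g t" using elim t by simp
      then show "c t - h * b t \<le> D x' t - g' t" using Dw'[of t] elim t by (simp add: b_def g'_def algebra_simps)
    next
      assume t: "N < t"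
      show "g' t \<le> D x' t" "ctrl x' g' t = ctrl x g t"
        using elim q(3)[OF t] D_eq[OF t] by (simp_all add: g'_def ctrl_def)
    qed
  qed
  have "AE t in half_line. g' t \<le> D x' t"
    using ctrl AE_half_line_nonneg
  proof eventually_elim
    case (elim t)
    then show ?case using c(4)[of t] by (cases "t \<le> N") (auto simp: b_def)
  qed
  then have adm: "adm (fst \<eta> + h * \<phi>0, snd \<eta>) x' g'"
    using traj pos ax(6) by (simp add: adm_def x'_def)
  define k0 where "k0 t = exp (- \<rho> * t) * (U1 (c t - h * b t) - U1 (c t))" for t
  define k1 where "k1 t = exp (- \<rho> * t) * u t" for t
  have expm: "(\<lambda>t. exp (- \<rho> * t)) \<in> borel_measurable (lebesgue_on {0..N})"
    by (intro continuous_imp_measurable_on_sets_lebesgue continuous_intros) auto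
  have exp1: "exp (- \<rho> * t) \<le> 1" if "0 \<le> t" for t using that rho_pos by simp
  have bm: "b \<in> borel_measurable (lebesgue_on {0..N})"
    unfolding b_def using q(1) w by (intro measurable_restrict_space1 borel_measurable_add)
  have k0i: "k0 absolutely_integrable_on {0..N}"
  proof (rule absolutely_integrable_bounded[where B = "2 * B"])
    have "(\<lambda>t. U1 (max 0 (c t - h * b t))) \<in> borel_measurable (lebesgue_on {0..N})"
      "(\<lambda>t. U1 (max 0 (c t))) \<in> borel_measurable (lebesgue_on {0..N})"
      using c(1) bm by (intro U1_ctrl_measurable; simp)+
    then have "(\<lambda>t. exp (- \<rho> * t) * (U1 (max 0 (c t - h * b t)) - U1 (max 0 (c t)))) \<in> borel_measurable (lebesgue_on {0..N})"
      using expm by simp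
    then show "k0 \<in> borel_measurable (lebesgue_on {0..N})"
      by (rule measurable_cong[THEN iffD1, rotated]) (use c(3,4) in \<open>auto simp: k0_def b_def max_def\<close>)
    fix t assume t: "t \<in> {0..N}"
    have "\<bar>U1 (c t - h * b t) - U1 (c t)\<bar> \<le> 2 * B"
      using B(2)[OF c(3)[OF t]] B(2)[OF c(4)[OF t]] unfolding b_def by linarith
    then have "exp (- \<rho> * t) * \<bar>U1 (c t - h * b t) - U1 (c t)\<bar> \<le> 1 * (2 * B)"
      using t exp1 by (intro mult_mono) auto
    then show "\<bar>k0 t\<bar> \<le> 2 * B" by (simp add: k0_def abs_mult)
  qed
  have k1i: "k1 absolutely_integrable_on {0..N}"
  proof (rule absolutely_integrable_bounded[where B = C])
    show "k1 \<in> borel_measurable (lebesgue_on {0..N})"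
      unfolding k1_def using expm measurable_restrict_space1[OF u(1)] by (intro borel_measurable_times)
    fix t assume t: "t \<in> {0..N}"
    have "exp (- \<rho> * t) * \<bar>u t\<bar> \<le> 1 * C" using t exp1 u(2) by (intro mult_mono) auto
    then show "\<bar>k1 t\<bar> \<le> C" by (simp add: k1_def abs_mult)
  qed
  show "(\<lambda>t. exp (- \<rho> * t) * (U1 (c t - h * (q t + w t)) - U1 (c t))) absolutely_integrable_on {0..N}"
    using k0i by (simp add: k0_def[abs_def] b_def)
  show "(\<lambda>t. exp (- \<rho> * t) * u t) absolutely_integrable_on {0..N}"
    using k1i by (simp add: k1_def[abs_def])
  define k where "k t = k0 t - h * k1 t" for t
  have ki: "k absolutely_integrable_on {0..N}"
    unfolding k_def by (intro set_integral_diff(1) set_integrable_mult_right k0i) (use k1i in auto)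
  note K = half_line_indicator_integral[OF ki]
  have low: "AE t in half_line. payoff x g t + indicat_real {0..N} t * k t \<le> payoff x' g' t"
    using ctrl AE_half_line_nonneg
  proof eventually_elim
    case (elim t)
    show ?case
    proof (cases "t \<le> N")
      case True
      then have t: "t \<in> {0..N}" using elim by simp
      have "U1 (c t - h * b t) \<le> U1 (ctrl x' g' t)"
        using c(4)[OF t] elim True by (intro U1_mono) (auto simp: b_def ctrl_def)
      moreover have "U2 (x t) - h * u t \<le> U2 (x' t)" using U2u[OF t] by (simp add: x'_def)
      ultimately have "exp (- \<rho> * t) * (U1 (c t - h * b t) + (U2 (x t) - h * u t)) \<le> payoff x' g' t"
        unfolding payoff_def by (intro mult_left_mono) auto
      moreover have "payoff x g t = exp (- \<rho> * t) * (U1 (c t) + U2 (x t))"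
        using elim True by (simp add: payoff_def)
      ultimately show ?thesis using t by (simp add: k_def k0_def k1_def algebra_simps)
    next
      case False
      then have "payoff x' g' t = payoff x g t" using elim T_pos \<phi>(3)[of t] by (simp add: payoff_def x'_def)
      then show ?thesis using False by simp
    qed
  qed
  have li: "integrable half_line (\<lambda>t. payoff x g t + indicat_real {0..N} t * k t)"
    using x(2) K(1) by (simp add: fin_def)
  have fin: "fin x' g'" by (rule fin_of_lower[OF adm li low])
  have "J x g + integral {0..N} k = integral\<^sup>L half_line (\<lambda>t. payoff x g t + indicat_real {0..N} t * k t)"
    using x(2) K by (simp add: fin_def J_def)
  also have "\<dots> \<le> J x' g'" unfolding J_def using fin li low by (intro integral_mono_AE) (auto simp: fin_def)
  finally have "ereal (J x g + integral {0..N} k) \<le> ereal (J x' g')" by simp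
  also have "\<dots> \<le> VF (fst \<eta> + h * \<phi>0, snd \<eta>)" by (rule J_le_VF[OF adm fin])
  finally show "ereal (J x g + integral {0..N} (\<lambda>t. exp (- \<rho> * t) * ((U1 (c t - h * (q t + w t)) - U1 (c t)) - h * u t)))
    \<le> VF (fst \<eta> + h * \<phi>0, snd \<eta>)"
    by (simp add: k_def[abs_def] k0_def k1_def b_def algebra_simps)
qed

lemma p_ctrl_measurable:
  assumes "c \<in> borel_measurable (lebesgue_on {0..N})" "\<And>t. t \<in> {0..N} \<Longrightarrow> \<delta> \<le> c t" "0 < \<delta>"
  shows "(\<lambda>t. p (c t)) \<in> borel_measurable (lebesgue_on {0..N})"
proof -
  have "continuous_on UNIV (\<lambda>z. p (max \<delta> z))"
    using assms(3) by (intro continuous_on_compose2[OF p_cont] continuous_intros) (auto simp: less_max_iff_disj)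
  then have "(\<lambda>t. p (max \<delta> (c t))) \<in> borel_measurable (lebesgue_on {0..N})"
    using assms(1) by (rule borel_measurable_continuous_on)
  then show ?thesis
    by (rule measurable_cong[THEN iffD1, rotated]) (use assms(2) in \<open>auto simp: max_def\<close>)
qed

lemma weighted_integrable:
  assumes c: "c \<in> borel_measurable (lebesgue_on {0..N})" "\<And>t. t \<in> {0..N} \<Longrightarrow> \<delta> \<le> c t" "0 < \<delta>"
    and b: "b \<in> borel_measurable lebesgue" "\<And>t. \<bar>b t\<bar> \<le> R"
  shows "(\<lambda>t. exp (- \<rho> * t) * (p (c t) * b t)) absolutely_integrable_on {0..N}"
proof (rule absolutely_integrable_bounded[where B = "p \<delta> * R"])
  have "(\<lambda>t. exp (- \<rho> * t)) \<in> borel_measurable (lebesgue_on {0..N})"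
    by (intro continuous_imp_measurable_on_sets_lebesgue continuous_intros) auto
  then show "(\<lambda>t. exp (- \<rho> * t) * (p (c t) * b t)) \<in> borel_measurable (lebesgue_on {0..N})"
    using p_ctrl_measurable[OF c] measurable_restrict_space1[OF b(1)]
    by (intro borel_measurable_times)
  fix t assume t: "t \<in> {0..N}"
  have ct: "0 < c t" using c(2)[OF t] c(3) by linarith
  have pd: "0 \<le> p (c t)" "p (c t) \<le> p \<delta>" using U1_deriv_pos[OF ct] p_le[OF c(3) c(2)[OF t]] by auto
  have "exp (- \<rho> * t) * (p (c t) * \<bar>b t\<bar>) \<le> 1 * (p \<delta> * R)"
    using t rho_pos pd b(2)[of t] by (intro mult_mono) auto
  then show "\<bar>exp (- \<rho> * t) * (p (c t) * b t)\<bar> \<le> p \<delta> * R" using pd by (simp add: abs_mult)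
qed

text \<open>The first-order form of the preceding estimate: as \<open>h\<close> tends to 0 the
  difference quotients of \<open>U1\<close> turn into the marginal utility. The slack
  \<open>e\<close> absorbs the remainder.\<close>

lemma perturbation:
  assumes x: "adm \<eta> x g" "fin x g"
    and c: "c \<in> borel_measurable (lebesgue_on {0..N})" "AE t in half_line. t \<le> N \<longrightarrow> c t = ctrl x g t"
      "\<And>t. t \<in> {0..N} \<Longrightarrow> \<delta> \<le> c t" "0 < \<delta>"
    and q: "q \<in> borel_measurable lebesgue" "\<And>t. \<bar>q t\<bar> \<le> Q" "\<And>t. N < t \<Longrightarrow> q t = 0"
    and \<phi>: "\<And>t. 0 \<le> t \<Longrightarrow> \<phi> t = \<phi>0 + integral {0..t} q" "\<And>t. t < 0 \<Longrightarrow> \<phi> t = 0" "\<And>t. N - T < t \<Longrightarrow> \<phi> t = 0"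
    and w: "w \<in> borel_measurable lebesgue" "\<And>t. \<bar>w t\<bar> \<le> C" and u: "u \<in> borel_measurable lebesgue" "\<And>t. \<bar>u t\<bar> \<le> C"
    and h0: "0 < h0"
    and pos: "\<And>h t. 0 < h \<Longrightarrow> h < h0 \<Longrightarrow> 0 \<le> t \<Longrightarrow> 0 < x t + h * \<phi> t"
    and Dw: "\<And>h t. 0 < h \<Longrightarrow> h < h0 \<Longrightarrow> t \<in> {0..N} \<Longrightarrow> D x t - h * w t \<le> D (\<lambda>s. x s + h * \<phi> s) t"
    and U2u: "\<And>h t. 0 < h \<Longrightarrow> h < h0 \<Longrightarrow> t \<in> {0..N} \<Longrightarrow> U2 (x t) - h * u t \<le> U2 (x t + h * \<phi> t)"
    and e: "0 < e"
  shows "\<exists>h1>0. \<forall>h. 0 < h \<and> h < h1 \<longrightarrow>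
    ereal (J x g - h * (integral {0..N} (\<lambda>t. exp (- \<rho> * t) * (p (c t) * (q t + w t) + u t)) + e))
      \<le> VF (fst \<eta> + h * \<phi>0, snd \<eta>)"
proof (rule ccontr)
  assume neg: "\<not> ?thesis"
  define b where "b t = q t + w t" for t
  define R where "R = \<bar>Q\<bar> + \<bar>C\<bar> + 1"
  have R: "0 < R" "\<bar>b t\<bar> \<le> R" for t
    using q(2)[of t] w(2)[of t] unfolding R_def b_def by linarith+
  have bm: "b \<in> borel_measurable lebesgue" unfolding b_def by (intro borel_measurable_add q(1) w(1))
  define I where "I = integral {0..N} (\<lambda>t. exp (- \<rho> * t) * (p (c t) * b t))"
  define Iu where "Iu = integral {0..N} (\<lambda>t. exp (- \<rho> * t) * u t)"
  \<comment> \<open>Dominated convergence works along sequences, so the negation is turned into a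
    sequence of bad step sizes tending to 0.\<close>
  define H where "H n = (SOME h. 0 < h \<and> h < 1 / real (Suc n) \<and>
     \<not> ereal (J x g - h * (integral {0..N} (\<lambda>t. exp (- \<rho> * t) * (p (c t) * (q t + w t) + u t)) + e))
      \<le> VF (fst \<eta> + h * \<phi>0, snd \<eta>))" for n
  have H: "0 < H n \<and> H n < 1 / real (Suc n) \<and>
     \<not> ereal (J x g - H n * (integral {0..N} (\<lambda>t. exp (- \<rho> * t) * (p (c t) * (q t + w t) + u t)) + e))
      \<le> VF (fst \<eta> + H n * \<phi>0, snd \<eta>)" for n
    unfolding H_def
  proof (rule someI_ex)
    have "0 < 1 / real (Suc n)" by simp
    then show "\<exists>h. 0 < h \<and> h < 1 / real (Suc n) \<and>
     \<not> ereal (J x g - h * (integral {0..N} (\<lambda>t. exp (- \<rho> * t) * (p (c t) * (q t + w t) + u t)) + e))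
      \<le> VF (fst \<eta> + h * \<phi>0, snd \<eta>)"
      using neg by blast
  qed
  have Hl: "H \<longlonglongrightarrow> 0"
  proof (rule tendsto_sandwich[OF _ _ tendsto_const lim_1_over_n])
    show "\<forall>\<^sub>F n in sequentially. H n \<le> 1 / real n"
    proof (rule eventually_sequentiallyI[of 1])
      fix n :: nat assume "1 \<le> n"
      then have "1 / real (Suc n) \<le> 1 / real n" by (simp add: field_simps)
      then show "H n \<le> 1 / real n" using H[of n] by linarith
    qed
  qed (use H in \<open>auto intro!: always_eventually less_imp_le\<close>)
  \<comment> \<open>Below this size the perturbed consumption stays above
    \<open>\<delta> / 2\<close>, so \<open>p (\<delta> / 2) * R\<close> dominates the difference
    quotients.\<close>
  define h2 where "h2 = min h0 (\<delta> / (2 * R))"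
  have h2: "0 < h2" using h0 c(4) R(1) by (simp add: h2_def)
  have half: "\<delta> / 2 \<le> c t - h * b t" if "t \<in> {0..N}" "0 < h" "h < h2" for h t
  proof -
    have "h * \<bar>b t\<bar> \<le> (\<delta> / (2 * R)) * R" using that R by (intro mult_mono) (auto simp: h2_def)
    also have "\<dots> = \<delta> / 2" using R(1) by simp
    finally have "h * \<bar>b t\<bar> \<le> \<delta> / 2" .
    moreover have "h * b t \<le> h * \<bar>b t\<bar>" using that by (intro mult_left_mono) auto
    ultimately show ?thesis using c(3)[OF that(1)] by linarith
  qed
  obtain M where M: "\<And>n. M \<le> n \<Longrightarrow> H n < h2"
    using order_tendstoD(2)[OF Hl h2] by (auto simp: eventually_sequentially)
  define h where "h n = H (n + M)" for n
  have h: "0 < h n" "h n < h2" "h n < h0" for n using H[of "n + M"] M[of "n + M"] by (auto simp: h_def h2_def)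
  have hl: "h \<longlonglongrightarrow> 0" unfolding h_def by (rule LIMSEQ_ignore_initial_segment[OF Hl])
  have step: "ereal (J x g + integral {0..N} (\<lambda>t. exp (- \<rho> * t) * ((U1 (c t - h n * b t) - U1 (c t)) - h n * u t)))
      \<le> VF (fst \<eta> + h n * \<phi>0, snd \<eta>)"
    "(\<lambda>t. exp (- \<rho> * t) * (U1 (c t - h n * b t) - U1 (c t))) absolutely_integrable_on {0..N}"
    "(\<lambda>t. exp (- \<rho> * t) * u t) absolutely_integrable_on {0..N}" for n
  proof -
    have c0: "0 \<le> c t" if "t \<in> {0..N}" for t using c(3)[OF that] c(4) by linarith
    have ch: "0 \<le> c t - h n * (q t + w t)" if "t \<in> {0..N}" for t
      using half[OF that h(1,2)[of n]] c(4) by (simp add: b_def)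
    note ps = perturbation_step[OF x h(1)[of n] c(1,2) c0 ch q \<phi> w(1) u pos[OF h(1,3)[of n]] Dw[OF h(1,3)[of n]] U2u[OF h(1,3)[of n]]]
    show "ereal (J x g + integral {0..N} (\<lambda>t. exp (- \<rho> * t) * ((U1 (c t - h n * b t) - U1 (c t)) - h n * u t)))
      \<le> VF (fst \<eta> + h n * \<phi>0, snd \<eta>)"
      "(\<lambda>t. exp (- \<rho> * t) * (U1 (c t - h n * b t) - U1 (c t))) absolutely_integrable_on {0..N}"
      "(\<lambda>t. exp (- \<rho> * t) * u t) absolutely_integrable_on {0..N}"
      unfolding b_def using ps by simp_all
  qed
  define f where "f n t = exp (- \<rho> * t) * ((U1 (c t - h n * b t) - U1 (c t)) / h n)" for n t
  have f_eq: "f n t = (1 / h n) * (exp (- \<rho> * t) * (U1 (c t - h n * b t) - U1 (c t)))" for n t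
    by (simp add: f_def)
  have fi: "f n integrable_on {0..N}" for n
    unfolding f_eq using step(2)[of n] by (intro integrable_on_mult_right) (auto simp: absolutely_integrable_on_def)
  have lim: "(\<lambda>n. integral {0..N} (f n)) \<longlonglongrightarrow> integral {0..N} (\<lambda>t. - (exp (- \<rho> * t) * (p (c t) * b t)))"
  proof (rule dominated_convergence_negligible(2)[OF fi _ negligible_empty])
    show "(\<lambda>t. p (\<delta> / 2) * R) integrable_on {0..N}" by (rule integrable_const_ivl)
    fix t assume t: "t \<in> {0..N}"
    have ct: "0 < c t" using c(3)[OF t] c(4) by linarith
    show "\<bar>f n t\<bar> \<le> p (\<delta> / 2) * R" for n
    proof -
      have "\<bar>U1 (c t - h n * b t) - U1 (c t)\<bar> \<le> p (\<delta> / 2) * \<bar>(c t - h n * b t) - c t\<bar>"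
        using half[OF t h(1,2)[of n]] c(3)[OF t] c(4) by (intro U1_lipschitz) auto
      also have "\<dots> = h n * (p (\<delta> / 2) * \<bar>b t\<bar>)" using h(1)[of n] by (simp add: abs_mult)
      finally have "\<bar>U1 (c t - h n * b t) - U1 (c t)\<bar> / h n \<le> p (\<delta> / 2) * \<bar>b t\<bar>"
        using h(1)[of n] by (simp add: divide_le_eq mult.commute)
      also have "\<dots> \<le> p (\<delta> / 2) * R" using U1_deriv_pos[of "\<delta> / 2"] c(4) R(2) by (intro mult_left_mono) auto
      finally have "\<bar>U1 (c t - h n * b t) - U1 (c t)\<bar> / h n \<le> p (\<delta> / 2) * R" .
      moreover have "exp (- \<rho> * t) \<le> 1" using t rho_pos by simp
      ultimately have "exp (- \<rho> * t) * (\<bar>U1 (c t - h n * b t) - U1 (c t)\<bar> / h n) \<le> 1 * (p (\<delta> / 2) * R)"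
        using h(1)[of n] by (intro mult_mono) auto
      then show ?thesis using h(1)[of n] by (simp add: f_def abs_mult)
    qed
    show "(\<lambda>n. f n t) \<longlonglongrightarrow> - (exp (- \<rho> * t) * (p (c t) * b t))"
    proof (cases "b t = 0")
      case True
      then show ?thesis by (simp add: f_def)
    next
      case False
      have "((\<lambda>z. (U1 (c t + z) - U1 (c t)) / z) \<longlongrightarrow> p (c t)) (at 0)"
        using DERIV_U1[OF ct] by (simp add: DERIV_def)
      moreover have "filterlim (\<lambda>n. - (h n * b t)) (at 0) sequentially"
      proof -
        have "(\<lambda>n. - (h n * b t)) \<longlonglongrightarrow> - (0 * b t)" by (intro tendsto_intros hl)
        then show ?thesis using h(1) False by (auto simp: filterlim_at intro!: always_eventually) (metis less_irrefl)
      qed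
      ultimately have "(\<lambda>n. (U1 (c t + - (h n * b t)) - U1 (c t)) / - (h n * b t)) \<longlonglongrightarrow> p (c t)"
        by (rule filterlim_compose)
      then have "(\<lambda>n. exp (- \<rho> * t) * (((U1 (c t + - (h n * b t)) - U1 (c t)) / - (h n * b t)) * (- b t)))
          \<longlonglongrightarrow> exp (- \<rho> * t) * (p (c t) * (- b t))" by (intro tendsto_intros)
      moreover have "exp (- \<rho> * t) * (((U1 (c t + - (h n * b t)) - U1 (c t)) / - (h n * b t)) * (- b t)) = f n t" for n
        using False h(1)[of n] by (simp add: f_def)
      ultimately show ?thesis by simp
    qed
  qed
  have wi: "(\<lambda>t. exp (- \<rho> * t) * (p (c t) * b t)) integrable_on {0..N}"
    using weighted_integrable[OF c(1,3,4) bm R(2)] by (auto simp: absolutely_integrable_on_def)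
  have ui: "(\<lambda>t. exp (- \<rho> * t) * u t) integrable_on {0..N}"
    using step(3) by (auto simp: absolutely_integrable_on_def)
  have "integral {0..N} (\<lambda>t. - (exp (- \<rho> * t) * (p (c t) * b t))) = - I"
    by (simp add: I_def)
  then have "\<forall>\<^sub>F n in sequentially. - I - e < integral {0..N} (f n)"
    using lim e by (intro order_tendstoD(1)[where y = "- I"]) auto
  then obtain n where n: "- I - e < integral {0..N} (f n)" by (auto simp: eventually_sequentially)
  have tot: "integral {0..N} (\<lambda>t. exp (- \<rho> * t) * (p (c t) * (q t + w t) + u t)) = I + Iu"
    using Henstock_Kurzweil_Integration.integral_add[OF wi ui] by (simp add: I_def Iu_def b_def distrib_left)
  have "integral {0..N} (\<lambda>t. exp (- \<rho> * t) * ((U1 (c t - h n * b t) - U1 (c t)) - h n * u t))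
      = integral {0..N} (\<lambda>t. h n * f n t - h n * (exp (- \<rho> * t) * u t))"
  proof (rule Henstock_Kurzweil_Integration.integral_cong)
    fix t
    have "h n * f n t = exp (- \<rho> * t) * (U1 (c t - h n * b t) - U1 (c t))"
      using h(1)[of n] by (simp add: f_def)
    then show "exp (- \<rho> * t) * ((U1 (c t - h n * b t) - U1 (c t)) - h n * u t)
        = h n * f n t - h n * (exp (- \<rho> * t) * u t)"
      by (simp only: right_diff_distrib mult.left_commute)
  qed
  also have "\<dots> = h n * integral {0..N} (f n) - h n * Iu"
    using fi[of n] ui by (subst Henstock_Kurzweil_Integration.integral_diff) (auto intro: integrable_on_mult_right simp: Iu_def)
  also have "\<dots> = h n * (integral {0..N} (f n) - Iu)" by (simp add: right_diff_distrib)
  finally have eq: "integral {0..N} (\<lambda>t. exp (- \<rho> * t) * ((U1 (c t - h n * b t) - U1 (c t)) - h n * u t))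
      = h n * (integral {0..N} (f n) - Iu)" .
  have "h n * (- (I + Iu + e)) \<le> h n * (integral {0..N} (f n) - Iu)"
    using n h(1)[of n] by (intro mult_left_mono) auto
  moreover have "h n * (- (I + Iu + e)) = - (h n * (I + Iu + e))" by (rule mult_minus_right)
  ultimately have "J x g - h n * (I + Iu + e) \<le> J x g + h n * (integral {0..N} (f n) - Iu)" by linarith
  then have "ereal (J x g - h n * (I + Iu + e)) \<le> VF (fst \<eta> + h n * \<phi>0, snd \<eta>)"
    using step(1)[of n] unfolding eq by (meson ereal_less_eq(3) order_trans)
  then show False using H[of "n + M"] unfolding tot h_def by (simp add: add.assoc)
qed

text \<open>A representative of the control that is bounded below at every time, which keeps the
  marginal utility \<open>p (c t)\<close> bounded.\<close>

definition ctrl_version :: "(real \<Rightarrow> real) \<Rightarrow> (real \<Rightarrow> real) \<Rightarrow> real \<Rightarrow> real \<Rightarrow> (real \<Rightarrow> real) \<Rightarrow> bool" where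
  "ctrl_version x g N \<delta> c \<longleftrightarrow> c \<in> borel_measurable (lebesgue_on {0..N}) \<and>
     (AE t in half_line. t \<le> N \<longrightarrow> c t = ctrl x g t) \<and> (\<forall>t\<in>{0..N}. \<delta> \<le> c t) \<and> 0 < \<delta>"

lemma ctrl_versionD:
  assumes "ctrl_version x g N \<delta> c"
  shows "c \<in> borel_measurable (lebesgue_on {0..N})" "AE t in half_line. t \<le> N \<longrightarrow> c t = ctrl x g t"
    "\<And>t. t \<in> {0..N} \<Longrightarrow> \<delta> \<le> c t" "0 < \<delta>"
  using assms by (auto simp: ctrl_version_def)

lemma positive_margin:
  assumes "adm \<eta> x g"
  shows "\<exists>\<xi>>0. \<forall>t\<in>{0..N}. \<xi> \<le> x t"
proof (cases "0 \<le> N")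
  case True
  have "continuous_on {0..N} x" by (rule continuous_on_subset[OF adm_D(5)[OF assms]]) auto
  then obtain t where t: "t \<in> {0..N}" "\<And>s. s \<in> {0..N} \<Longrightarrow> x t \<le> x s"
    using continuous_attains_inf[of "{0..N}" x] True by auto
  then show ?thesis using adm_D(2)[OF assms, of t] by (intro exI[of _ "x t"]) auto
qed (intro exI[of _ 1], auto)

text \<open>With \<open>\<phi>0 = 0\<close> the initial datum is unchanged, so the perturbed payoff
  cannot exceed the optimal one and the first-order cost must be nonnegative.\<close>

lemma perturbation_optimal:
  assumes V: "VF \<eta> = ereal (J x g)"
    and P: "\<And>e. 0 < e \<Longrightarrow> \<exists>h1>0. \<forall>h. 0 < h \<and> h < h1 \<longrightarrow> ereal (J x g - h * (I + e)) \<le> VF (fst \<eta> + h * 0, snd \<eta>)"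
  shows "0 \<le> (I :: real)"
proof (rule field_le_epsilon)
  fix e :: real assume "0 < e"
  from P[OF this] obtain h1 where h1: "0 < h1" "\<And>h. 0 < h \<Longrightarrow> h < h1 \<Longrightarrow> ereal (J x g - h * (I + e)) \<le> VF (fst \<eta> + h * 0, snd \<eta>)"
    by blast
  have "ereal (J x g - (h1 / 2) * (I + e)) \<le> ereal (J x g)" using h1(2)[of "h1 / 2"] h1(1) V by simp
  then have "0 \<le> (h1 / 2) * (I + e)" by simp
  then show "0 \<le> I + e" using h1(1) by (simp add: zero_le_mult_iff)
qed

text \<open>A perturbation that increases the state can be paid for at the rate \<open>Cf\<close>, without
  any loss coming from the delay, from \<open>f0\<close> or from \<open>U2\<close>.\<close>

lemma monotone_perturbation:
  assumes x: "optimal \<eta> x g" and c: "ctrl_version x g (N0 + T) \<delta> c" and N0: "0 \<le> N0"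
    and v: "v \<in> borel_measurable lebesgue" "\<And>t. \<bar>v t\<bar> \<le> Q" "\<And>t. N0 < t \<Longrightarrow> v t = 0"
    and v0: "\<And>t. 0 \<le> t \<Longrightarrow> 0 \<le> integral {0..t} (\<lambda>s. exp (Cf * s) * v s)" "integral {0..N0} (\<lambda>s. exp (Cf * s) * v s) = 0"
  shows "0 \<le> integral {0..N0 + T} (\<lambda>t. exp (- \<rho> * t) * (p (c t) * v t))"
proof -
  have ax: "adm \<eta> x g" "fin x g" and V: "VF \<eta> = ereal (J x g)" using x by (auto simp: optimal_def)
  note cD = ctrl_versionD[OF c]
  have vi: "v absolutely_integrable_on {0..t}" for t
    by (rule absolutely_integrable_bounded[where B = Q]) (use v measurable_restrict_space1 in auto)
  \<comment> \<open>With q = v - Cf \<phi> and drift loss at most \<open>Cf * \<phi>\<close>, the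
    net reduction of consumption is exactly \<open>v\<close>. The conditions \<open>v0\<close> say
    that the state is never lowered and that the perturbation has ended by
    \<open>N0\<close>.\<close>
  define \<phi> where "\<phi> = linear_response Cf v"
  have \<phi>0: "\<phi> t = 0" if "t \<le> 0" for t using that by (cases "t = 0") (auto simp: \<phi>_def linear_response_def)
  have \<phi>1: "\<phi> t = 0" if "N0 \<le> t" for t
  proof -
    have i: "(\<lambda>s. exp (Cf * s) * v s) integrable_on {0..t}"
      using absolutely_integrable_exp_mult[OF vi[of t], where k = Cf] by (auto simp: absolutely_integrable_on_def)
    have "integral {0..N0} (\<lambda>s. exp (Cf * s) * v s) + integral {N0..t} (\<lambda>s. exp (Cf * s) * v s) = integral {0..t} (\<lambda>s. exp (Cf * s) * v s)"
      by (rule Henstock_Kurzweil_Integration.integral_combine[OF N0 that i])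
    moreover have "integral {N0..t} (\<lambda>s. exp (Cf * s) * v s) = integral {N0..t} (\<lambda>_. 0)"
      by (rule integral_spike[of "{N0}"]) (use v(3) in auto)
    ultimately show ?thesis using v0(2) by (simp add: \<phi>_def linear_response_def)
  qed
  have \<phi>pos: "0 \<le> \<phi> t" for t
    using \<phi>0[of t] v0(1)[of t] by (cases "0 \<le> t") (auto simp: \<phi>_def linear_response_def)
  have \<phi>c: "continuous_on UNIV \<phi>"
  proof -
    have "continuous_on UNIV (\<lambda>t. \<phi> (max 0 t))"
      unfolding \<phi>_def
    proof (rule continuous_on_compose2[OF continuous_on_linear_response[OF vi]])
      show "continuous_on UNIV (\<lambda>t::real. max 0 t)" by (intro continuous_intros)
    qed auto
    moreover have "\<phi> (max 0 t) = \<phi> t" for t using \<phi>0[of t] \<phi>0[of 0] by (cases "0 \<le> t") auto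
    ultimately show ?thesis by simp
  qed
  obtain C where C: "0 \<le> C" "\<And>t. \<bar>\<phi> t\<bar> \<le> C"
  proof -
    have "compact (\<phi> ` {0..N0})" by (intro compact_continuous_image continuous_on_subset[OF \<phi>c]) auto
    then obtain C where C: "0 < C" "\<And>t. t \<in> {0..N0} \<Longrightarrow> \<bar>\<phi> t\<bar> \<le> C"
      using compact_imp_bounded[of "\<phi> ` {0..N0}"] by (auto simp: bounded_pos)
    have "\<bar>\<phi> t\<bar> \<le> C" for t
      using C(2)[of t] C(1) \<phi>0[of t] \<phi>1[of t] by (cases "t \<in> {0..N0}") auto
    with C(1) show ?thesis using that[of C] by simp
  qed
  have \<phi>m: "\<phi> \<in> borel_measurable lebesgue"
    using \<phi>c by (simp add: borel_measurable_continuous_onI measurable_completion)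
  define q where "q t = v t - Cf * \<phi> t" for t
  have qm: "q \<in> borel_measurable lebesgue" unfolding q_def using v(1) \<phi>m by simp
  have qb: "\<bar>q t\<bar> \<le> Q + Cf * C" for t
  proof -
    have "\<bar>Cf * \<phi> t\<bar> \<le> Cf * C" using Cf_nonneg C(2)[of t] by (simp add: abs_mult mult_left_mono)
    then show ?thesis using v(2)[of t] unfolding q_def by linarith
  qed
  have q0: "q t = 0" if "N0 + T < t" for t
    using v(3)[of t] \<phi>1[of t] that T_pos by (simp add: q_def)
  have \<phi>I: "\<phi> t = 0 + integral {0..t} q" if "0 \<le> t" for t
    unfolding q_def \<phi>_def using integral_linear_response[OF vi that, of Cf] by simp
  have hx: "hist x" by (rule adm_D(4)[OF ax(1)])
  have h\<phi>: "hist \<phi>"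
    unfolding hist_def by (intro allI absolutely_integrable_continuous_real continuous_on_subset[OF \<phi>c]) auto
  have D\<phi>: "D x t - h * (Cf * \<phi> t) \<le> D (\<lambda>s. x s + h * \<phi> s) t" if h: "0 < h" and t: "t \<in> {0..N0 + T}" for h t
  proof -
    have hxh: "hist (\<lambda>s. x s + h * \<phi> s)" by (intro hist_add hist_cmult hx h\<phi>)
    have t0: "0 \<le> t" using t by simp
    have "delay x t \<le> delay (\<lambda>s. x s + h * \<phi> s) t"
      by (rule delay_mono[OF hx hxh t0 negligible_empty]) (use h \<phi>pos in simp)
    then have "F (x t + h * \<phi> t) (delay x t) \<le> F (x t + h * \<phi> t) (delay (\<lambda>s. x s + h * \<phi> s) t)" by (rule F_mono)
    moreover have "\<bar>F (x t + h * \<phi> t) (delay x t) - F (x t) (delay x t)\<bar> \<le> Cf * (\<bar>x t + h * \<phi> t - x t\<bar> + \<bar>delay x t - delay x t\<bar>)"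
      by (rule F_lipschitz)
    moreover have "\<bar>x t + h * \<phi> t - x t\<bar> = h * \<phi> t" using h \<phi>pos[of t] by (simp add: abs_mult)
    moreover have "0 \<le> r * (h * \<phi> t)" using r_pos h \<phi>pos[of t] by simp
    ultimately show ?thesis
      by (simp add: drift_eq[OF _ t0] hx hxh distrib_left mult.left_commute)
  qed
  have "0 \<le> integral {0..N0 + T} (\<lambda>t. exp (- \<rho> * t) * (p (c t) * (q t + Cf * \<phi> t) + 0))"
  proof (rule perturbation_optimal[OF V])
    fix e :: real assume e: "0 < e"
    show "\<exists>h1>0. \<forall>h. 0 < h \<and> h < h1 \<longrightarrow>
      ereal (J x g - h * (integral {0..N0 + T} (\<lambda>t. exp (- \<rho> * t) * (p (c t) * (q t + Cf * \<phi> t) + 0)) + e)) \<le> VF (fst \<eta> + h * 0, snd \<eta>)"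
    proof (rule perturbation[OF ax cD qm qb q0 \<phi>I, where C = "Cf * C" and ?h0.0 = 1])
      show "\<phi> t = 0" if "t < 0" for t using \<phi>0 that by simp
      show "\<phi> t = 0" if "N0 + T - T < t" for t using \<phi>1 that by simp
      show "(\<lambda>t. Cf * \<phi> t) \<in> borel_measurable lebesgue" using \<phi>m by simp
      show "\<bar>Cf * \<phi> t\<bar> \<le> Cf * C" for t using Cf_nonneg C(2)[of t] by (simp add: abs_mult mult_left_mono)
      show "\<bar>0::real\<bar> \<le> Cf * C" using Cf_nonneg C by simp
      show "0 < x t + h * \<phi> t" if "0 < h" "0 \<le> t" for h t
        using adm_D(2)[OF ax(1) that(2)] \<phi>pos[of t] that by (simp add: add_pos_nonneg)
      show "U2 (x t) - h * 0 \<le> U2 (x t + h * \<phi> t)" if "0 < h" "t \<in> {0..N0 + T}" for h t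
        using adm_D(2)[OF ax(1), of t] \<phi>pos[of t] that by (simp add: U2_mono')
    qed (use D\<phi> e in auto)
  qed
  then show ?thesis by (simp add: q_def)
qed

text \<open>For a perturbation of either sign living on an interval from \<open>s\<close> to
  \<open>t\<close>, every side effect is proportional to the length \<open>t - s\<close>: those on
  the current state and on \<open>U2\<close> act only during the interval, and the delayed one is
  weighted by it. \<open>K\<close> is fixed before the interval, so short perturbations isolate the
  marginal utility.\<close>

lemma local_perturbation:
  assumes x: "adm \<eta> x g" "fin x g" and c: "ctrl_version x g (N0 + T) \<delta> c" and N0: "0 \<le> N0"
  shows "\<exists>K\<ge>0. \<forall>s t q Q \<phi> \<phi>0 e. 0 \<le> s \<longrightarrow> s \<le> t \<longrightarrow> t \<le> N0 \<longrightarrow> q \<in> borel_measurable lebesgue \<longrightarrow> (\<forall>\<tau>. \<bar>q \<tau>\<bar> \<le> Q) \<longrightarrow>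
     (\<forall>\<tau>. \<tau> \<notin> {s..t} \<longrightarrow> q \<tau> = 0 \<and> \<phi> \<tau> = 0) \<longrightarrow> (\<forall>\<tau>. \<bar>\<phi> \<tau>\<bar> \<le> 1) \<longrightarrow> (\<forall>\<tau>\<ge>0. \<phi> \<tau> = \<phi>0 + integral {0..\<tau>} q) \<longrightarrow> 0 < e \<longrightarrow>
     (\<exists>h1>0. \<forall>h. 0 < h \<and> h < h1 \<longrightarrow>
       ereal (J x g - h * (integral {0..N0 + T} (\<lambda>\<tau>. exp (- \<rho> * \<tau>) * (p (c \<tau>) * q \<tau>)) + K * (t - s) + e))
         \<le> VF (fst \<eta> + h * \<phi>0, snd \<eta>))"
proof -
  note cD = ctrl_versionD[OF c]
  define N where "N = N0 + T"
  have N: "0 \<le> N" using N0 T_pos by (simp add: N_def)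
  obtain \<xi> where \<xi>: "0 < \<xi>" "\<And>t. t \<in> {0..N} \<Longrightarrow> \<xi> \<le> x t" using positive_margin[OF x(1)] by blast
  \<comment> \<open>The slope bound of \<open>U2\<close> to the right of \<open>\<xi> / 2\<close>;
    here the name denotes a number. Perturbed states stay in that range for \<open>h\<close> below
    \<open>\<xi> / 2\<close>.\<close>
  define L2 where "L2 = (U2 (\<xi> / 2) - U2 (\<xi> / 2 / 2)) / (\<xi> / 2 / 2)"
  have L2: "0 \<le> L2" unfolding L2_def using \<xi>(1) by (intro divide_nonneg_pos) (auto intro!: U2_mono')
  define K where "K = p \<delta> * (r + Cf) + p \<delta> * (Cf * A) * N + L2"
  have p\<delta>: "0 < p \<delta>" by (rule U1_deriv_pos[OF cD(4)])
  have K: "0 \<le> K" unfolding K_def using p\<delta> r_pos Cf_nonneg A_nonneg N L2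
    by (intro add_nonneg_nonneg mult_nonneg_nonneg) auto
  show ?thesis
  proof (rule exI[of _ K], rule conjI[OF K], intro allI impI)
    fix s t Q \<phi>0 e :: real and q \<phi> :: "real \<Rightarrow> real"
    assume s: "0 \<le> s" "s \<le> t" "t \<le> N0" and q: "q \<in> borel_measurable lebesgue" "\<forall>\<tau>. \<bar>q \<tau>\<bar> \<le> Q"
      and supp: "\<forall>\<tau>. \<tau> \<notin> {s..t} \<longrightarrow> q \<tau> = 0 \<and> \<phi> \<tau> = 0" and \<phi>1: "\<forall>\<tau>. \<bar>\<phi> \<tau>\<bar> \<le> 1"
      and \<phi>I: "\<forall>\<tau>\<ge>0. \<phi> \<tau> = \<phi>0 + integral {0..\<tau>} q" and e: "0 < e"
    define i where "i = indicat_real {s..t}"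
    have im: "i \<in> borel_measurable lebesgue" unfolding i_def by (intro borel_measurable_indicator) simp
    have i01: "0 \<le> i \<tau>" "i \<tau> \<le> 1" for \<tau> by (auto simp: i_def indicator_def)
    have \<phi>i: "\<bar>\<phi> \<tau>\<bar> \<le> i \<tau>" for \<tau> using \<phi>1 supp by (auto simp: i_def indicator_def)
    have ii: "i absolutely_integrable_on {d..b}" for d b
    proof (rule absolutely_integrable_bounded[where B = 1])
      show "i \<in> borel_measurable (lebesgue_on {d..b})" by (rule measurable_restrict_space1[OF im])
      show "\<bar>i x\<bar> \<le> 1" for x using i01[of x] by simp
    qed
    have iI: "integral {d..b} i \<le> t - s" for d b
    proof -
      have "integral {d..b} i = measure lebesgue ({s..t} \<inter> {d..b})"
        unfolding i_def by (rule integral_indicator) (auto simp: fmeasurable.Int)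
      also have "\<dots> \<le> measure lebesgue {s..t}" by (rule measure_mono_fmeasurable) auto
      finally show ?thesis using s by simp
    qed
    have qi: "q absolutely_integrable_on {0..b}" for b
      by (rule absolutely_integrable_bounded[where B = Q]) (use q measurable_restrict_space1 in auto)
    have \<phi>c: "continuous_on {0..b} \<phi>" for b
    proof -
      have "q integrable_on {0..b}" using qi by (auto simp: absolutely_integrable_on_def)
      then have "continuous_on {0..b} (\<lambda>\<tau>. \<phi>0 + integral {0..\<tau>} q)"
        by (intro continuous_intros indefinite_integral_continuous_1)
      then show ?thesis by (rule continuous_on_cong[THEN iffD1, rotated 2]) (use \<phi>I in auto)
    qed
    have \<phi>neg: "\<phi> \<tau> = 0" if "\<tau> < 0" for \<tau> using supp that s by auto
    have h\<phi>: "hist \<phi>"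
      by (rule histI[OF absolutely_integrable_zero]) (use \<phi>neg absolutely_integrable_continuous_real[OF \<phi>c] in auto)
    have hx: "hist x" by (rule adm_D(4)[OF x(1)])
    have d\<phi>: "\<bar>delay \<phi> \<tau>\<bar> \<le> A * (t - s)" if "0 \<le> \<tau>" for \<tau>
    proof -
      have "\<bar>delay \<phi> \<tau>\<bar> \<le> A * integral {\<tau> - T..\<tau>} i" by (rule delay_abs_le[OF h\<phi> that ii]) (rule \<phi>i)
      also have "\<dots> \<le> A * (t - s)" using iI A_nonneg by (rule mult_left_mono)
      finally show ?thesis .
    qed
    \<comment> \<open>The first term is the loss through the current state, confined to the
      interval. The second bounds the delayed effect, which may last beyond it, by a constant
      proportional to \<open>t - s\<close>.\<close>
    define w where "w \<tau> = (r + Cf) * i \<tau> + Cf * A * (t - s)" for \<tau>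
    define u where "u \<tau> = L2 * i \<tau>" for \<tau>
    define C where "C = (r + Cf) + Cf * A * (t - s) + L2"
    have cs: "0 \<le> Cf * A * (t - s)" using Cf_nonneg A_nonneg s by simp
    have w0: "0 \<le> w \<tau>" "w \<tau> \<le> C" for \<tau>
    proof -
      have "(r + Cf) * i \<tau> \<le> (r + Cf) * 1" using i01[of \<tau>] r_pos Cf_nonneg by (intro mult_left_mono) auto
      then show "w \<tau> \<le> C" using L2 by (simp add: w_def C_def)
      show "0 \<le> w \<tau>" unfolding w_def using i01[of \<tau>] r_pos Cf_nonneg cs by simp
    qed
    have u0: "0 \<le> u \<tau>" "u \<tau> \<le> L2" for \<tau>
      using i01[of \<tau>] L2 by (simp_all add: u_def mult_left_le)
    have uC: "\<bar>u \<tau>\<bar> \<le> C" for \<tau>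
      using u0[of \<tau>] cs r_pos Cf_nonneg by (simp add: C_def)
    have wm: "w \<in> borel_measurable lebesgue" unfolding w_def using im by simp
    have um: "u \<in> borel_measurable lebesgue" unfolding u_def using im by simp
    have qI: "integral {0..N} (\<lambda>\<tau>. exp (- \<rho> * \<tau>) * (p (c \<tau>) * (q \<tau> + w \<tau>) + u \<tau>))
        \<le> integral {0..N} (\<lambda>\<tau>. exp (- \<rho> * \<tau>) * (p (c \<tau>) * q \<tau>)) + K * (t - s)"
    proof -
      have 1: "(\<lambda>\<tau>. exp (- \<rho> * \<tau>) * (p (c \<tau>) * q \<tau>)) integrable_on {0..N}"
        using weighted_integrable[OF cD(1,3,4) q(1), of Q] q(2) by (auto simp: absolutely_integrable_on_def N_def)
      have 2: "(\<lambda>\<tau>. exp (- \<rho> * \<tau>) * (p (c \<tau>) * w \<tau>)) integrable_on {0..N}"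
        using weighted_integrable[OF cD(1,3,4) wm, of C] w0 by (auto simp: absolutely_integrable_on_def N_def)
      have 3: "(\<lambda>\<tau>. exp (- \<rho> * \<tau>) * u \<tau>) integrable_on {0..N}"
      proof -
        have "(\<lambda>\<tau>. exp (- \<rho> * \<tau>) * i \<tau>) absolutely_integrable_on {0..N}"
          by (intro absolutely_integrable_mult_continuous ii continuous_intros)
        then have "(\<lambda>\<tau>. L2 * (exp (- \<rho> * \<tau>) * i \<tau>)) integrable_on {0..N}"
          by (intro integrable_on_mult_right) (auto simp: absolutely_integrable_on_def)
        then show ?thesis by (simp add: u_def mult_ac)
      qed
      have "integral {0..N} (\<lambda>\<tau>. exp (- \<rho> * \<tau>) * (p (c \<tau>) * (q \<tau> + w \<tau>) + u \<tau>))
        = integral {0..N} (\<lambda>\<tau>. exp (- \<rho> * \<tau>) * (p (c \<tau>) * q \<tau>) + (exp (- \<rho> * \<tau>) * (p (c \<tau>) * w \<tau>) + exp (- \<rho> * \<tau>) * u \<tau>))"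
        by (simp add: distrib_left add.assoc)
      also have "\<dots> = integral {0..N} (\<lambda>\<tau>. exp (- \<rho> * \<tau>) * (p (c \<tau>) * q \<tau>))
          + integral {0..N} (\<lambda>\<tau>. exp (- \<rho> * \<tau>) * (p (c \<tau>) * w \<tau>) + exp (- \<rho> * \<tau>) * u \<tau>)"
        by (intro Henstock_Kurzweil_Integration.integral_add 1 integrable_add 2 3)
      finally have split: "integral {0..N} (\<lambda>\<tau>. exp (- \<rho> * \<tau>) * (p (c \<tau>) * (q \<tau> + w \<tau>) + u \<tau>))
        = integral {0..N} (\<lambda>\<tau>. exp (- \<rho> * \<tau>) * (p (c \<tau>) * q \<tau>))
          + integral {0..N} (\<lambda>\<tau>. exp (- \<rho> * \<tau>) * (p (c \<tau>) * w \<tau>) + exp (- \<rho> * \<tau>) * u \<tau>)" .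
      have "integral {0..N} (\<lambda>\<tau>. exp (- \<rho> * \<tau>) * (p (c \<tau>) * w \<tau>) + exp (- \<rho> * \<tau>) * u \<tau>)
          \<le> integral {0..N} (\<lambda>\<tau>. (p \<delta> * (r + Cf) + L2) * i \<tau> + p \<delta> * (Cf * A * (t - s)))"
      proof (rule integral_le)
        show "(\<lambda>\<tau>. exp (- \<rho> * \<tau>) * (p (c \<tau>) * w \<tau>) + exp (- \<rho> * \<tau>) * u \<tau>) integrable_on {0..N}"
          by (intro integrable_add 2 3)
        show "(\<lambda>\<tau>. (p \<delta> * (r + Cf) + L2) * i \<tau> + p \<delta> * (Cf * A * (t - s))) integrable_on {0..N}"
          using ii[of 0 N] by (intro integrable_add integrable_on_mult_right integrable_const_ivl) (auto simp: absolutely_integrable_on_def)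
        fix \<tau> assume \<tau>: "\<tau> \<in> {0..N}"
        have c\<tau>: "\<delta> \<le> c \<tau>" "0 < c \<tau>" using cD(3)[of \<tau>] cD(4) \<tau> by (auto simp: N_def)
        have pc: "0 \<le> p (c \<tau>)" "p (c \<tau>) \<le> p \<delta>" using U1_deriv_pos[OF c\<tau>(2)] p_le[OF cD(4) c\<tau>(1)] by auto
        have "exp (- \<rho> * \<tau>) * (p (c \<tau>) * w \<tau> + u \<tau>) \<le> 1 * (p \<delta> * w \<tau> + u \<tau>)"
          using pc w0[of \<tau>] u0[of \<tau>] p\<delta> \<tau> rho_pos by (intro mult_mono add_mono mult_right_mono add_nonneg_nonneg mult_nonneg_nonneg) auto
        then show "exp (- \<rho> * \<tau>) * (p (c \<tau>) * w \<tau>) + exp (- \<rho> * \<tau>) * u \<tau> \<le> (p \<delta> * (r + Cf) + L2) * i \<tau> + p \<delta> * (Cf * A * (t - s))"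
          by (simp add: w_def u_def algebra_simps)
      qed
      also have "\<dots> = (p \<delta> * (r + Cf) + L2) * integral {0..N} i + p \<delta> * (Cf * A * (t - s)) * N"
        using ii[of 0 N] N by (subst Henstock_Kurzweil_Integration.integral_add)
           (auto intro: integrable_on_mult_right simp: absolutely_integrable_on_def)
      also have "\<dots> \<le> (p \<delta> * (r + Cf) + L2) * (t - s) + p \<delta> * (Cf * A * (t - s)) * N"
        using iI p\<delta> r_pos Cf_nonneg L2 by (intro add_right_mono mult_left_mono add_nonneg_nonneg mult_nonneg_nonneg) auto
      also have "\<dots> = K * (t - s)" by (simp add: K_def algebra_simps)
      finally show ?thesis using split by linarith
    qed
    have half: "\<xi> / 2 \<le> x \<tau> + h * \<phi> \<tau>" if "0 < h" "h < \<xi> / 2" "\<tau> \<in> {0..N}" for h \<tau>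
    proof -
      have "h * \<bar>\<phi> \<tau>\<bar> \<le> (\<xi> / 2) * 1" using that \<phi>1 \<xi>(1) by (intro mult_mono) auto
      moreover have "- (h * \<bar>\<phi> \<tau>\<bar>) \<le> h * \<phi> \<tau>"
      proof -
        have "h * (- \<bar>\<phi> \<tau>\<bar>) \<le> h * \<phi> \<tau>" using that by (intro mult_left_mono) auto
        then show ?thesis by simp
      qed
      ultimately show ?thesis using \<xi>(2)[OF that(3)] by linarith
    qed
    have "\<exists>h1>0. \<forall>h. 0 < h \<and> h < h1 \<longrightarrow>
       ereal (J x g - h * (integral {0..N} (\<lambda>\<tau>. exp (- \<rho> * \<tau>) * (p (c \<tau>) * (q \<tau> + w \<tau>) + u \<tau>)) + e))
         \<le> VF (fst \<eta> + h * \<phi>0, snd \<eta>)"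
    proof (rule perturbation[OF x cD(1-4)[folded N_def] q(1) _ _ _ _ _ wm _ um uC, where Q = Q and \<phi> = \<phi> and ?h0.0 = "\<xi> / 2"])
      show "\<bar>q \<tau>\<bar> \<le> Q" for \<tau> using q(2) by simp
      show "q \<tau> = 0" if "N < \<tau>" for \<tau> using supp that s T_pos by (auto simp: N_def)
      show "\<phi> \<tau> = \<phi>0 + integral {0..\<tau>} q" if "0 \<le> \<tau>" for \<tau> using \<phi>I that by simp
      show "\<phi> \<tau> = 0" if "\<tau> < 0" for \<tau> by (rule \<phi>neg[OF that])
      show "\<phi> \<tau> = 0" if "N - T < \<tau>" for \<tau> using supp that s by (auto simp: N_def)
      show "\<bar>w \<tau>\<bar> \<le> C" for \<tau> using w0[of \<tau>] by simp
      show "0 < \<xi> / 2" using \<xi> by simp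
      show "0 < e" by (rule e)
      fix h \<tau> assume h: "0 < h" "h < \<xi> / 2"
      show "0 < x \<tau> + h * \<phi> \<tau>" if "0 \<le> \<tau>"
      proof (cases "\<tau> \<le> N")
        case True
        then show ?thesis using half[OF h, of \<tau>] that \<xi>(1) by simp
      next
        case False
        then have "\<phi> \<tau> = 0" using supp s T_pos by (auto simp: N_def)
        then show ?thesis using adm_D(2)[OF x(1) that] by simp
      qed
      assume \<tau>: "\<tau> \<in> {0..N}"
      have \<tau>0: "0 \<le> \<tau>" using \<tau> by simp
      have h\<phi>\<tau>: "\<bar>h * \<phi> \<tau>\<bar> \<le> h * i \<tau>" unfolding abs_mult using h \<phi>i[of \<tau>] by (simp add: mult_left_mono)
      show "D x \<tau> - h * w \<tau> \<le> D (\<lambda>s. x s + h * \<phi> s) \<tau>"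
      proof -
        have hxh: "hist (\<lambda>s. x s + h * \<phi> s)" by (intro hist_add hist_cmult hx h\<phi>)
        have dl: "delay (\<lambda>s. x s + h * \<phi> s) \<tau> = delay x \<tau> + h * delay \<phi> \<tau>"
          using delay_linear[OF hx h\<phi> \<tau>0, of 1 h] by simp
        have "\<bar>F (x \<tau> + h * \<phi> \<tau>) (delay x \<tau> + h * delay \<phi> \<tau>) - F (x \<tau>) (delay x \<tau>)\<bar>
            \<le> Cf * (\<bar>x \<tau> + h * \<phi> \<tau> - x \<tau>\<bar> + \<bar>delay x \<tau> + h * delay \<phi> \<tau> - delay x \<tau>\<bar>)"
          by (rule F_lipschitz)
        also have "\<dots> = Cf * (\<bar>h * \<phi> \<tau>\<bar> + \<bar>h * delay \<phi> \<tau>\<bar>)" by simp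
        also have "\<dots> \<le> Cf * (h * i \<tau> + h * (A * (t - s)))"
          using h\<phi>\<tau> d\<phi>[OF \<tau>0] h Cf_nonneg by (intro mult_left_mono add_mono) (auto simp: abs_mult)
        finally have "\<bar>F (x \<tau> + h * \<phi> \<tau>) (delay x \<tau> + h * delay \<phi> \<tau>) - F (x \<tau>) (delay x \<tau>)\<bar>
            \<le> Cf * (h * i \<tau> + h * (A * (t - s)))" .
        moreover have "\<bar>r * (h * \<phi> \<tau>)\<bar> \<le> r * (h * i \<tau>)" 
          unfolding abs_mult[of r] using r_pos h\<phi>\<tau> by (simp add: mult_left_mono)
        moreover have "D (\<lambda>s. x s + h * \<phi> s) \<tau> = r * x \<tau> + r * (h * \<phi> \<tau>) + F (x \<tau> + h * \<phi> \<tau>) (delay x \<tau> + h * delay \<phi> \<tau>)"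
          by (simp add: drift_eq[OF hxh \<tau>0] dl distrib_left)
        moreover have "D x \<tau> = r * x \<tau> + F (x \<tau>) (delay x \<tau>)" by (rule drift_eq[OF hx \<tau>0])
        moreover have "h * w \<tau> = r * (h * i \<tau>) + Cf * (h * i \<tau> + h * (A * (t - s)))"
          by (simp add: w_def algebra_simps)
        ultimately show ?thesis by linarith
      qed
      show "U2 (x \<tau>) - h * u \<tau> \<le> U2 (x \<tau> + h * \<phi> \<tau>)"
      proof (cases "0 \<le> \<phi> \<tau>")
        case True
        then have "U2 (x \<tau>) \<le> U2 (x \<tau> + h * \<phi> \<tau>)" using \<xi>(1) \<xi>(2)[OF \<tau>] h by (intro U2_mono') auto
        moreover have "0 \<le> h * u \<tau>" using h u0[of \<tau>] by simp
        ultimately show ?thesis by linarith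
      next
        case False
        then have "h * \<phi> \<tau> \<le> 0" using h by (simp add: mult_nonneg_nonpos)
        then have "U2 (x \<tau>) - U2 (x \<tau> + h * \<phi> \<tau>) \<le> L2 * (x \<tau> - (x \<tau> + h * \<phi> \<tau>))"
          unfolding L2_def using \<xi>(1) half[OF h \<tau>] by (intro U2_lipschitz) auto
        also have "\<dots> \<le> L2 * (h * i \<tau>)" using L2 h\<phi>\<tau> by (intro mult_left_mono) auto
        also have "\<dots> = h * u \<tau>" by (simp add: u_def)
        finally show ?thesis by simp
      qed
    qed
    then obtain h1 where h1: "0 < h1" "\<And>h. 0 < h \<Longrightarrow> h < h1 \<Longrightarrow>
       ereal (J x g - h * (integral {0..N} (\<lambda>\<tau>. exp (- \<rho> * \<tau>) * (p (c \<tau>) * (q \<tau> + w \<tau>) + u \<tau>)) + e))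
         \<le> VF (fst \<eta> + h * \<phi>0, snd \<eta>)" by blast
    show "\<exists>h1>0. \<forall>h. 0 < h \<and> h < h1 \<longrightarrow>
       ereal (J x g - h * (integral {0..N0 + T} (\<lambda>\<tau>. exp (- \<rho> * \<tau>) * (p (c \<tau>) * q \<tau>)) + K * (t - s) + e))
         \<le> VF (fst \<eta> + h * \<phi>0, snd \<eta>)"
    proof (intro exI[of _ h1] conjI h1(1) allI impI)
      fix h assume h: "0 < h \<and> h < h1"
      have "h * (integral {0..N} (\<lambda>\<tau>. exp (- \<rho> * \<tau>) * (p (c \<tau>) * (q \<tau> + w \<tau>) + u \<tau>)) + e)
          \<le> h * (integral {0..N0 + T} (\<lambda>\<tau>. exp (- \<rho> * \<tau>) * (p (c \<tau>) * q \<tau>)) + K * (t - s) + e)"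
        using h qI unfolding N_def by (intro mult_left_mono) auto
      then have "ereal (J x g - h * (integral {0..N0 + T} (\<lambda>\<tau>. exp (- \<rho> * \<tau>) * (p (c \<tau>) * q \<tau>)) + K * (t - s) + e))
         \<le> ereal (J x g - h * (integral {0..N} (\<lambda>\<tau>. exp (- \<rho> * \<tau>) * (p (c \<tau>) * (q \<tau> + w \<tau>) + u \<tau>)) + e))"
        by simp
      also have "\<dots> \<le> VF (fst \<eta> + h * \<phi>0, snd \<eta>)" using h h1(2) by blast
      finally show "ereal (J x g - h * (integral {0..N0 + T} (\<lambda>\<tau>. exp (- \<rho> * \<tau>) * (p (c \<tau>) * q \<tau>)) + K * (t - s) + e))
         \<le> VF (fst \<eta> + h * \<phi>0, snd \<eta>)" .
    qed
  qed
qed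

end

subsection \<open>Continuity of the optimal control\<close>

lemma closure_interval_minus_negligible:
  assumes Z: "negligible Z" and N: "0 < (N::real)"
  shows "closure ({0..N} - Z) = {0..N}"
proof
  show "closure ({0..N} - Z) \<subseteq> {0..N}" by (rule closure_minimal) auto
  show "{0..N} \<subseteq> closure ({0..N} - Z)"
  proof
    fix t assume t: "t \<in> {0..N}"
    show "t \<in> closure ({0..N} - Z)"
      unfolding closure_approachable
    proof (intro allI impI)
      fix e :: real assume e: "0 < e"
      have "max 0 (t - e) < min N (t + e)" using t N e by auto
      then obtain u where "max 0 (t - e) < u" "u < min N (t + e)" "u \<notin> Z" using negligible_avoid[OF Z] by blast
      then show "\<exists>y\<in>{0..N} - Z. dist y t < e"
        by (intro bexI[of _ u]) (auto simp: dist_real_def)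
    qed
  qed
qed

lemma integral_indicator_Int:
  assumes "E \<in> lmeasurable"
  shows "integral {0..t::real} (indicat_real E) = measure lebesgue (E \<inter> {0..t})"
    "indicat_real E absolutely_integrable_on {0..t}" "measure lebesgue (E \<inter> {0..t}) \<le> measure lebesgue E"
proof -
  show "integral {0..t} (indicat_real E) = measure lebesgue (E \<inter> {0..t})"
    by (rule integral_indicator) (auto simp: fmeasurable.Int assms)
  have "indicat_real E \<in> borel_measurable lebesgue" using assms by (intro borel_measurable_indicator) auto
  then show "indicat_real E absolutely_integrable_on {0..t}"
    by (intro absolutely_integrable_bounded[where B = 1]) (auto simp: indicator_def intro: measurable_restrict_space1)
  show "measure lebesgue (E \<inter> {0..t}) \<le> measure lebesgue E"
    using assms by (intro measure_mono_fmeasurable) auto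
qed

lemma lmeasurable_sublevel:
  fixes m :: "real \<Rightarrow> real"
  assumes m: "m \<in> borel_measurable (lebesgue_on {0..N})" and S: "S \<in> sets borel" "S' \<in> sets borel"
  shows "{t \<in> {0..N}. t \<in> S \<and> m t \<in> S'} \<in> lmeasurable"
proof (rule bounded_set_imp_lmeasurable)
  have 1: "{t \<in> {0..N}. m t \<in> S'} \<in> sets lebesgue"
  proof -
    have "m -` S' \<inter> space (lebesgue_on {0..N}) \<in> sets (lebesgue_on {0..N})" by (rule measurable_sets[OF m S(2)])
    moreover have "m -` S' \<inter> space (lebesgue_on {0..N}) = {t \<in> {0..N}. m t \<in> S'}" by (auto simp: space_restrict_space)
    ultimately show ?thesis by (simp add: sets_restrict_space_iff)
  qed
  have "S \<in> sets lebesgue" using S(1) by simp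
  then have "{t \<in> {0..N}. m t \<in> S'} \<inter> S \<in> sets lebesgue" using 1 by (rule sets.Int[rotated])
  also have "{t \<in> {0..N}. m t \<in> S'} \<inter> S = {t \<in> {0..N}. t \<in> S \<and> m t \<in> S'}" by auto
  finally show "{t \<in> {0..N}. t \<in> S \<and> m t \<in> S'} \<in> sets lebesgue" .
  show "bounded {t \<in> {0..N}. t \<in> S \<and> m t \<in> S'}" by (rule bounded_subset[of "{0..N}"]) auto
qed

text \<open>A bound on level sets of positive measure becomes pointwise after discarding countably
  many null sets: for rational \<open>s\<close>, \<open>t\<close> and rational levels, those parts
  of the super- and sublevel sets that are negligible. Around a remaining point all rational level
  sets containing it have positive measure.\<close>

lemma AE_lipschitz_of_average_bound:
  fixes m :: "real \<Rightarrow> real"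
  assumes m: "m \<in> borel_measurable (lebesgue_on {0..N})" and K: "0 \<le> K"
    and osc: "\<And>s t E F \<alpha> \<beta>. 0 \<le> s \<Longrightarrow> s < t \<Longrightarrow> t \<le> N \<Longrightarrow> E \<in> lmeasurable \<Longrightarrow> F \<in> lmeasurable \<Longrightarrow>
      E \<subseteq> {s..t} \<Longrightarrow> F \<subseteq> {s..t} \<Longrightarrow> 0 < measure lebesgue E \<Longrightarrow> 0 < measure lebesgue F \<Longrightarrow>
      (\<And>\<tau>. \<tau> \<in> E \<Longrightarrow> \<alpha> \<le> m \<tau>) \<Longrightarrow> (\<And>\<tau>. \<tau> \<in> F \<Longrightarrow> m \<tau> \<le> \<beta>) \<Longrightarrow> \<alpha> - \<beta> \<le> K * (t - s)"
  shows "\<exists>Z. negligible Z \<and> (\<forall>s\<in>{0..N} - Z. \<forall>t\<in>{0..N} - Z. \<bar>m s - m t\<bar> \<le> K * \<bar>s - t\<bar>)"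
proof -
  define E where "E i = (case i of (s, t, \<alpha>) \<Rightarrow> {\<tau> \<in> {0..N}. \<tau> \<in> {s..t} \<and> m \<tau> \<in> {\<alpha><..}})" for i :: "real \<times> real \<times> real"
  define F where "F i = (case i of (s, t, \<beta>) \<Rightarrow> {\<tau> \<in> {0..N}. \<tau> \<in> {s..t} \<and> m \<tau> \<in> {..<\<beta>}})" for i :: "real \<times> real \<times> real"
  have EF: "E (s, t, \<alpha>) \<in> lmeasurable" "F (s, t, \<alpha>) \<in> lmeasurable" for s t \<alpha>
    unfolding E_def F_def prod.case by (rule lmeasurable_sublevel[OF m]; simp)+
  let ?Q = "\<rat> \<times> \<rat> \<times> (\<rat> :: real set)"
  have cQ: "countable ?Q" by (intro countable_SIGMA countable_rat)
  \<comment> \<open>The end points are removed too, so that two remaining points have a slightly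
    larger rational interval around them inside the domain.\<close>
  define Z where "Z = (\<Union>i\<in>{i \<in> ?Q. negligible (E i)}. E i) \<union> (\<Union>i\<in>{i \<in> ?Q. negligible (F i)}. F i) \<union> {0, N}"
  have Z: "negligible Z"
    unfolding Z_def by (intro negligible_Un negligible_countable_Union countable_image countable_subset[OF _ cQ]) auto
  have le: "m \<sigma> - m \<tau> \<le> K * \<bar>\<sigma> - \<tau>\<bar>" if \<sigma>: "\<sigma> \<in> {0..N} - Z" and \<tau>: "\<tau> \<in> {0..N} - Z" for \<sigma> \<tau>
  proof (rule ccontr)
    assume neg: "\<not> ?thesis"
    define d where "d = K * \<bar>\<sigma> - \<tau>\<bar>"
    define gap where "gap = m \<sigma> - m \<tau> - d"
    have gap: "0 < gap" using neg by (simp add: gap_def d_def)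
    \<comment> \<open>Widening the interval by \<open>e\<close> on both sides costs at most
      \<open>2 * K * e\<close>, which is at most half of \<open>gap\<close>; the rational levels
      give away less than the other half.\<close>
    define e where "e = gap / (4 * (K + 1))"
    have e: "0 < e" using gap K by (simp add: e_def)
    define lo hi where "lo = min \<sigma> \<tau>" and "hi = max \<sigma> \<tau>"
    have lohi: "0 < lo" "hi < N" "lo \<le> hi" "hi - lo = \<bar>\<sigma> - \<tau>\<bar>"
      using \<sigma> \<tau> by (auto simp: lo_def hi_def Z_def min_def max_def)
    obtain s where s: "s \<in> \<rat>" "max 0 (lo - e) < s" "s < lo"
      using Rats_dense_in_real[of "max 0 (lo - e)" lo] lohi e by auto
    obtain t where t: "t \<in> \<rat>" "hi < t" "t < min N (hi + e)"
      using Rats_dense_in_real[of hi "min N (hi + e)"] lohi e by auto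
    obtain \<alpha> where \<alpha>: "\<alpha> \<in> \<rat>" "m \<sigma> - gap / 4 < \<alpha>" "\<alpha> < m \<sigma>"
      using Rats_dense_in_real[of "m \<sigma> - gap / 4" "m \<sigma>"] gap by auto
    obtain \<beta> where \<beta>: "\<beta> \<in> \<rat>" "m \<tau> < \<beta>" "\<beta> < m \<tau> + gap / 4"
      using Rats_dense_in_real[of "m \<tau>" "m \<tau> + gap / 4"] gap by auto
    have "\<sigma> \<in> E (s, t, \<alpha>)" using \<sigma> s t \<alpha> by (auto simp: E_def lo_def hi_def)
    then have "\<not> negligible (E (s, t, \<alpha>))" using \<sigma> s(1) t(1) \<alpha>(1) unfolding Z_def by blast
    then have E0: "0 < measure lebesgue (E (s, t, \<alpha>))"
      using EF(1) by (simp add: negligible_iff_measure zero_less_measure_iff)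
    have "\<tau> \<in> F (s, t, \<beta>)" using \<tau> s t \<beta> by (auto simp: F_def lo_def hi_def)
    then have "\<not> negligible (F (s, t, \<beta>))" using \<tau> s(1) t(1) \<beta>(1) unfolding Z_def by blast
    then have F0: "0 < measure lebesgue (F (s, t, \<beta>))"
      using EF(2) by (simp add: negligible_iff_measure zero_less_measure_iff)
    have "\<alpha> - \<beta> \<le> K * (t - s)"
      by (rule osc[OF _ _ _ EF(1)[of s t \<alpha>] EF(2)[of s t \<beta>] _ _ E0 F0]) (use s t lohi in \<open>auto simp: E_def F_def\<close>)
    also have "\<dots> \<le> K * (\<bar>\<sigma> - \<tau>\<bar> + 2 * e)" using s t lohi K by (intro mult_left_mono) auto
    also have "\<dots> = d + 2 * (K * e)" by (simp add: d_def algebra_simps)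
    finally have "\<alpha> - \<beta> \<le> d + 2 * (K * e)" .
    then have 1: "\<alpha> - \<beta> \<le> d + 2 * y" if "y = K * e" for y using that by simp
    have 2: "K * e \<le> gap / 4"
    proof -
      have "K * e \<le> (K + 1) * e" using e by (intro mult_right_mono) auto
      also have "\<dots> = gap / 4" using K by (simp add: e_def field_simps)
      finally show ?thesis .
    qed
    have "\<alpha> - \<beta> \<le> d + gap / 2" using 1[OF refl] 2 by argo
    moreover have "gap = m \<sigma> - m \<tau> - d" by (rule gap_def)
    ultimately show False using \<alpha>(2) \<beta>(3) by argo
  qed
  show ?thesis
  proof (intro exI[of _ Z] conjI ballI Z)
    fix s t assume st: "s \<in> {0..N} - Z" "t \<in> {0..N} - Z"
    show "\<bar>m s - m t\<bar> \<le> K * \<bar>s - t\<bar>" using le[OF st] le[OF st(2,1)] by (simp add: abs_le_iff abs_minus_commute)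
  qed
qed

lemma exp_diff_le: "0 < k \<Longrightarrow> s \<le> N \<Longrightarrow> t \<le> N \<Longrightarrow> \<bar>exp (k * s) - exp (k * t)\<bar> \<le> k * exp (k * N) * \<bar>s - t :: real\<bar>"
proof -
  assume k: "0 < k" and N: "s \<le> N" "t \<le> N"
  have *: "exp (k * v) - exp (k * u) \<le> k * exp (k * N) * (v - u)" if "u \<le> v" "v \<le> N" for u v
  proof -
    have "exp (k * v) - exp (k * u) = exp (k * v) * (1 - exp (k * u - k * v))"
      by (simp add: right_diff_distrib exp_add[symmetric])
    also have "\<dots> \<le> exp (k * v) * (k * v - k * u)"
    proof (rule mult_left_mono)
      show "1 - exp (k * u - k * v) \<le> k * v - k * u"
        using exp_ge_add_one_self[of "k * u - k * v"] by linarith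
    qed simp
    also have "\<dots> \<le> exp (k * N) * (k * v - k * u)"
      using that k by (intro mult_right_mono) (auto simp: mult_left_mono)
    finally show ?thesis by (simp add: algebra_simps)
  qed
  have mono: "exp (k * u) \<le> exp (k * v)" if "u \<le> v" for u v using that k by simp
  show ?thesis
  proof (cases "s \<le> t")
    case True
    then show ?thesis using *[of s t] mono[of s t] N by simp
  next
    case False
    then show ?thesis using *[of t s] mono[of t s] N by simp
  qed
qed

context control_problem
begin

text \<open>If \<open>p (c t)\<close> were below \<open>\<kappa>\<close> on a set \<open>E\<close>
  of positive measure, saving on \<open>E\<close> and consuming the proceeds in the following unit
  interval would pay: the saving costs at most \<open>\<kappa>\<close>, the later consumption earns
  \<open>\<kappa>1\<close>, which is twice as much. Saving first keeps the state above the optimal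
  one, as \<open>monotone_perturbation\<close> requires.\<close>

lemma marginal_lower_bound:
  assumes x: "optimal \<eta> x g" and N1: "0 \<le> N1" and c: "ctrl_version x g (N1 + 1 + T) \<delta> c"
  shows "\<exists>\<kappa>>0. AE t in half_line. t \<le> N1 \<longrightarrow> \<kappa> \<le> p (c t)"
proof -
  note cD = ctrl_versionD[OF c]
  define N where "N = N1 + 1 + T"
  have N: "N1 + 1 \<le> N" using T_pos by (simp add: N_def)
  have pc: "0 < p (c t)" if "t \<in> {0..N}" for t
    using cD(3)[of t] cD(4) that by (intro U1_deriv_pos) (auto simp: N_def)
  define b where "b t = exp (- Cf * max 0 t)" for t
  have bm: "b \<in> borel_measurable lebesgue"
  proof -
    have "continuous_on UNIV b" unfolding b_def by (intro continuous_intros)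
    then show ?thesis by (simp add: borel_measurable_continuous_onI measurable_completion)
  qed
  have b: "0 < b t" "b t \<le> 1" for t using Cf_nonneg by (auto simp: b_def)
  define f where "f t = exp (- \<rho> * t) * (p (c t) * b t)" for t
  have fi: "f absolutely_integrable_on {0..N}"
    unfolding f_def N_def by (rule weighted_integrable[OF cD(1,3,4) bm, of 1]) (use b in \<open>auto simp: less_imp_le\<close>)
  have f0: "0 < f t" if "t \<in> {0..N}" for t using pc[OF that] b(1)[of t] by (simp add: f_def)
  let ?F = "{N1..N1 + 1}"
  have fF: "f absolutely_integrable_on ?F" using fi by (rule set_integrable_subset) (use N1 N in auto)
  define \<kappa>1 where "\<kappa>1 = integral ?F f"
  have \<kappa>1: "0 < \<kappa>1"
  proof (rule ccontr)
    assume "\<not> 0 < \<kappa>1"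
    moreover have "0 \<le> \<kappa>1" unfolding \<kappa>1_def using fF f0 N1 N
      by (intro Henstock_Kurzweil_Integration.integral_nonneg) (auto simp: absolutely_integrable_on_def intro!: less_imp_le)
    ultimately have z: "\<kappa>1 = 0" by simp
    have i: "integrable (lebesgue_on ?F) f" using fF by (simp add: integrable_lebesgue_on_iff)
    have nn: "AE t in lebesgue_on ?F. 0 \<le> f t"
      using f0 N1 N by (intro AE_I2) (auto simp: space_restrict_space intro!: less_imp_le)
    have "integral\<^sup>L (lebesgue_on ?F) f = 0" using z i by (simp add: \<kappa>1_def lebesgue_integral_eq_integral)
    then have "AE t in lebesgue_on ?F. f t = 0" using integral_nonneg_eq_0_iff_AE[OF i nn] by simp
    then obtain Z where Z: "negligible Z" "\<And>t. t \<notin> Z \<Longrightarrow> t \<in> ?F \<Longrightarrow> f t = 0"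
      by (subst (asm) AE_restrict_space_iff) (auto simp: AE_lebesgue_negligible)
    obtain u where "N1 < u" "u < N1 + 1" "u \<notin> Z" using negligible_avoid[OF Z(1), of N1 "N1 + 1"] by auto
    then show False using Z(2)[of u] f0[of u] N1 N by auto
  qed
  define \<kappa> where "\<kappa> = \<kappa>1 / 2"
  have \<kappa>: "0 < \<kappa>" using \<kappa>1 by (simp add: \<kappa>_def)
  define E where "E = {t \<in> {0..N}. t \<in> {0..N1} \<and> p (c t) \<in> {..<\<kappa>}}"
  have Em: "E \<in> lmeasurable"
    unfolding E_def using p_ctrl_measurable[OF cD(1,3,4)] by (intro lmeasurable_sublevel) (auto simp: N_def)
  have "measure lebesgue E = 0"
  proof (rule ccontr)
    assume "measure lebesgue E \<noteq> 0"
    define e where "e = measure lebesgue E"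
    have e: "0 < e" using \<open>measure lebesgue E \<noteq> 0\<close> by (simp add: e_def zero_less_measure_iff)
    have Fm: "?F \<in> lmeasurable" by simp
    have hF: "((\<lambda>t. if t \<in> ?F then f t else 0) has_integral \<kappa>1) {0..N}"
      unfolding \<kappa>1_def using fF N1 N
      by (subst has_integral_restrict) (auto simp: absolutely_integrable_on_def integrable_integral)
    note EI = integral_indicator_Int[OF Em] and FI = integral_indicator_Int[OF Fm]
    \<comment> \<open>Positive values mean saving. The factor \<open>b\<close> cancels the weight
      \<open>exp (Cf * s)\<close>, so the accumulated savings reduce to measures, normalized to 1 on
      \<open>E\<close> and on the unit interval.\<close>
    define v where "v t = b t * (indicat_real E t / e - indicat_real ?F t)" for t
    have ev: "integral {0..t} (\<lambda>s. exp (Cf * s) * v s) = measure lebesgue (E \<inter> {0..t}) / e - measure lebesgue (?F \<inter> {0..t})" for t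
    proof -
      have "integral {0..t} (\<lambda>s. exp (Cf * s) * v s) = integral {0..t} (\<lambda>s. indicat_real E s / e - indicat_real ?F s)"
        by (rule Henstock_Kurzweil_Integration.integral_cong) (simp add: v_def b_def mult.assoc[symmetric] exp_minus)
      also have "\<dots> = integral {0..t} (\<lambda>s. indicat_real E s / e) - integral {0..t} (indicat_real ?F)"
        using EI(2)[of t] FI(2)[of t] by (intro Henstock_Kurzweil_Integration.integral_diff integrable_on_divide)
          (auto simp: absolutely_integrable_on_def)
      also have "integral {0..t} (\<lambda>s. indicat_real E s / e) = measure lebesgue (E \<inter> {0..t}) / e"
        using EI(1)[of t] by simp
      finally show ?thesis using FI(1)[of t] by simp
    qed
    have Et: "E \<inter> {0..t} = E" if "N1 \<le> t" for t using that by (auto simp: E_def)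
    have "0 \<le> integral {0..N1 + 1 + T} (\<lambda>t. exp (- \<rho> * t) * (p (c t) * v t))"
    proof (rule monotone_perturbation[OF x c])
      have "indicat_real E \<in> borel_measurable lebesgue" "indicat_real ?F \<in> borel_measurable lebesgue"
        using Em by (auto intro!: borel_measurable_indicator)
      then show "v \<in> borel_measurable lebesgue" unfolding v_def using bm by simp
      show "\<bar>v t\<bar> \<le> 1 / e + 1" for t
      proof -
        have "\<bar>indicat_real E t / e - indicat_real ?F t\<bar> \<le> 1 / e + 1"
          using e by (auto simp: indicator_def abs_le_iff)
        then have "b t * \<bar>indicat_real E t / e - indicat_real ?F t\<bar> \<le> 1 * (1 / e + 1)"
          using b[of t] by (intro mult_mono) auto
        then show ?thesis using b[of t] by (simp add: v_def abs_mult)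
      qed
      show "v t = 0" if "N1 + 1 < t" for t using that by (auto simp: v_def E_def)
      show "0 \<le> integral {0..t} (\<lambda>s. exp (Cf * s) * v s)" for t
      proof (cases "N1 \<le> t")
        case True
        then show ?thesis using FI(3)[of t] e unfolding ev Et[OF True] e_def by simp
      next
        case False
        then have "?F \<inter> {0..t} = {}" by auto
        then show ?thesis unfolding ev using e by simp
      qed
      have "?F \<inter> {0..N1 + 1} = ?F" using N1 by auto
      then show "integral {0..N1 + 1} (\<lambda>s. exp (Cf * s) * v s) = 0"
        unfolding ev using Et[of "N1 + 1"] e by (simp add: e_def)
    qed (use N1 in simp)
    also have "integral {0..N1 + 1 + T} (\<lambda>t. exp (- \<rho> * t) * (p (c t) * v t))
        \<le> integral {0..N} (\<lambda>t. \<kappa> / e * indicat_real E t - (if t \<in> ?F then f t else 0))"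
      unfolding N_def[symmetric]
    proof (rule integral_le)
      have vm: "v \<in> borel_measurable lebesgue"
      proof -
        have "indicat_real E \<in> borel_measurable lebesgue" "indicat_real ?F \<in> borel_measurable lebesgue"
          using Em by (auto intro!: borel_measurable_indicator)
        then show ?thesis unfolding v_def using bm by simp
      qed
      have vb: "\<bar>v t\<bar> \<le> 1 / e + 1" for t
      proof -
        have "\<bar>indicat_real E t / e - indicat_real ?F t\<bar> \<le> 1 / e + 1"
          using e by (auto simp: indicator_def abs_le_iff)
        then have "b t * \<bar>indicat_real E t / e - indicat_real ?F t\<bar> \<le> 1 * (1 / e + 1)"
          using b[of t] by (intro mult_mono) auto
        then show ?thesis using b[of t] by (simp add: v_def abs_mult)
      qed
      show "(\<lambda>t. exp (- \<rho> * t) * (p (c t) * v t)) integrable_on {0..N}"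
        using weighted_integrable[OF cD(1,3,4) vm vb] by (auto simp: N_def absolutely_integrable_on_def)
      have "(\<lambda>t. if t \<in> ?F then f t else 0) integrable_on {0..N}" using hF by blast
      then show "(\<lambda>t. \<kappa> / e * indicat_real E t - (if t \<in> ?F then f t else 0)) integrable_on {0..N}"
        using EI(2)[of N] by (intro integrable_diff integrable_on_mult_right) (auto simp: absolutely_integrable_on_def)
      fix t assume t: "t \<in> {0..N}"
      have split: "exp (- \<rho> * t) * (p (c t) * v t) = f t * (indicat_real E t / e) - (if t \<in> ?F then f t else 0)"
        by (simp add: f_def v_def right_diff_distrib indicator_def)
      have "f t * (indicat_real E t / e) \<le> \<kappa> / e * indicat_real E t"
      proof (cases "t \<in> E")
        case True
        have "exp (- \<rho> * t) * (p (c t) * b t) \<le> 1 * (\<kappa> * 1)"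
          using True t rho_pos b[of t] pc[OF t] \<kappa> by (intro mult_mono) (auto simp: E_def)
        then show ?thesis using True e by (simp add: f_def divide_right_mono)
      qed simp
      then show "exp (- \<rho> * t) * (p (c t) * v t) \<le> \<kappa> / e * indicat_real E t - (if t \<in> ?F then f t else 0)"
        unfolding split by simp
    qed
    also have "\<dots> = \<kappa> - \<kappa>1"
    proof -
      have 2: "((\<lambda>t. \<kappa> / e * indicat_real E t) has_integral \<kappa> / e * e) {0..N}"
      proof (rule has_integral_mult_right)
        have "integral {0..N} (indicat_real E) = e"
          using EI(1)[of N] Et[of N] N by (simp add: e_def)
        then show "(indicat_real E has_integral e) {0..N}"
          using EI(2)[of N] by (auto simp: absolutely_integrable_on_def has_integral_iff)
      qed
      show ?thesis using integral_unique[OF has_integral_diff[OF 2 hF]] e by simp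
    qed
    finally show False using \<kappa>1 by (simp add: \<kappa>_def)
  qed
  then have "negligible E" using Em by (simp add: negligible_iff_measure)
  then have "AE t in half_line. t \<le> N1 \<longrightarrow> \<kappa> \<le> p (c t)"
    unfolding AE_half_line by (intro exI[of _ E]) (use N in \<open>auto simp: E_def not_less\<close>)
  then show ?thesis using \<kappa> by blast
qed

text \<open>Moving one unit of consumption from \<open>F\<close> to \<open>E\<close> inside a short
  interval cannot be profitable beyond the side effects \<open>K * (t - s)\<close>. So averages of
  the discounted marginal utility over two sets in the interval differ by at most that
  amount.\<close>

lemma discounted_marginal_lipschitz:
  assumes x: "optimal \<eta> x g" and N0: "0 \<le> N0" and c: "ctrl_version x g (N0 + T) \<delta> c"
  shows "\<exists>K Z. 0 \<le> K \<and> negligible Z \<and>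
    (\<forall>s\<in>{0..N0} - Z. \<forall>t\<in>{0..N0} - Z. \<bar>exp (- \<rho> * s) * p (c s) - exp (- \<rho> * t) * p (c t)\<bar> \<le> K * \<bar>s - t\<bar>)"
proof -
  have ax: "adm \<eta> x g" "fin x g" and V: "VF \<eta> = ereal (J x g)" using x by (auto simp: optimal_def)
  note cD = ctrl_versionD[OF c]
  obtain K where K: "0 \<le> K" and P: "\<And>s t q Q \<phi> \<phi>0 e. 0 \<le> s \<Longrightarrow> s \<le> t \<Longrightarrow> t \<le> N0 \<Longrightarrow> q \<in> borel_measurable lebesgue \<Longrightarrow> (\<forall>\<tau>. \<bar>q \<tau>\<bar> \<le> Q) \<Longrightarrow>
     (\<forall>\<tau>. \<tau> \<notin> {s..t} \<longrightarrow> q \<tau> = 0 \<and> \<phi> \<tau> = 0) \<Longrightarrow> (\<forall>\<tau>. \<bar>\<phi> \<tau>\<bar> \<le> 1) \<Longrightarrow> (\<forall>\<tau>\<ge>0. \<phi> \<tau> = \<phi>0 + integral {0..\<tau>} q) \<Longrightarrow> 0 < e \<Longrightarrow>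
     (\<exists>h1>0. \<forall>h. 0 < h \<and> h < h1 \<longrightarrow>
       ereal (J x g - h * (integral {0..N0 + T} (\<lambda>\<tau>. exp (- \<rho> * \<tau>) * (p (c \<tau>) * q \<tau>)) + K * (t - s) + e))
         \<le> VF (fst \<eta> + h * \<phi>0, snd \<eta>))"
    using local_perturbation[OF ax c N0] by blast
  define N where "N = N0 + T"
  have N: "0 \<le> N" "N0 \<le> N" using N0 T_pos by (auto simp: N_def)
  define m where "m t = exp (- \<rho> * t) * p (c t)" for t
  have mm: "m \<in> borel_measurable (lebesgue_on {0..N})"
  proof -
    have "(\<lambda>t. exp (- \<rho> * t)) \<in> borel_measurable (lebesgue_on {0..N})"
      by (intro continuous_imp_measurable_on_sets_lebesgue continuous_intros) auto
    then show ?thesis unfolding m_def N_def using p_ctrl_measurable[OF cD(1,3,4)] by (intro borel_measurable_times) auto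
  qed
  have "\<exists>Z. negligible Z \<and> (\<forall>s\<in>{0..N0} - Z. \<forall>t\<in>{0..N0} - Z. \<bar>m s - m t\<bar> \<le> K * \<bar>s - t\<bar>)"
  proof (rule AE_lipschitz_of_average_bound[OF _ K])
    have "(\<lambda>t. if t \<in> {0..N} then m t else 0) \<in> borel_measurable lebesgue" using mm by (intro borel_measurable_if_I) auto
    then have "(\<lambda>t. if t \<in> {0..N} then m t else 0) \<in> borel_measurable (lebesgue_on {0..N0})" by (rule measurable_restrict_space1)
    then show "m \<in> borel_measurable (lebesgue_on {0..N0})"
      by (rule measurable_cong[THEN iffD1, rotated]) (use N in auto)
    fix s t E F \<alpha> \<beta>
    assume s: "0 \<le> s" "s < t" "t \<le> N0" and Em: "E \<in> lmeasurable" and Fm: "F \<in> lmeasurable"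
      and sub: "E \<subseteq> {s..t}" "F \<subseteq> {s..t}" and pos: "0 < measure lebesgue E" "0 < measure lebesgue F"
      and \<alpha>: "\<And>\<tau>. \<tau> \<in> E \<Longrightarrow> \<alpha> \<le> m \<tau>" and \<beta>: "\<And>\<tau>. \<tau> \<in> F \<Longrightarrow> m \<tau> \<le> \<beta>"
    define e f where "e = measure lebesgue E" and "f = measure lebesgue F"
    have ef: "0 < e" "0 < f" using pos by (simp_all add: e_def f_def)
    note EI = integral_indicator_Int[OF Em] and FI = integral_indicator_Int[OF Fm]
    \<comment> \<open>Both parts have total mass 1, so the induced state change is bounded by 1 and
      is zero outside the interval.\<close>
    define q where "q \<tau> = indicat_real F \<tau> / f - indicat_real E \<tau> / e" for \<tau>
    define \<phi> where "\<phi> \<tau> = (if \<tau> < 0 then 0 else integral {0..\<tau>} q)" for \<tau>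
    have \<phi>_eq: "integral {0..\<tau>} q = measure lebesgue (F \<inter> {0..\<tau>}) / f - measure lebesgue (E \<inter> {0..\<tau>}) / e" for \<tau>
    proof -
      have "integral {0..\<tau>} q = integral {0..\<tau>} (\<lambda>s. indicat_real F s / f) - integral {0..\<tau>} (\<lambda>s. indicat_real E s / e)"
        unfolding q_def using EI(2)[of \<tau>] FI(2)[of \<tau>]
        by (intro Henstock_Kurzweil_Integration.integral_diff integrable_on_divide) (auto simp: absolutely_integrable_on_def)
      then show ?thesis using EI(1)[of \<tau>] FI(1)[of \<tau>] by simp
    qed
    have ratio: "0 \<le> measure lebesgue (F \<inter> {0..\<tau>}) / f" "measure lebesgue (F \<inter> {0..\<tau>}) / f \<le> 1"
      "0 \<le> measure lebesgue (E \<inter> {0..\<tau>}) / e" "measure lebesgue (E \<inter> {0..\<tau>}) / e \<le> 1" for \<tau>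
      using EI(3)[of \<tau>] FI(3)[of \<tau>] ef by (simp_all add: e_def f_def)
    have qm: "q \<in> borel_measurable lebesgue"
    proof -
      have "indicat_real E \<in> borel_measurable lebesgue" "indicat_real F \<in> borel_measurable lebesgue"
        using Em Fm by (auto intro!: borel_measurable_indicator)
      then show ?thesis unfolding q_def by simp
    qed
    have qb: "\<forall>\<tau>. \<bar>q \<tau>\<bar> \<le> 1 / f + 1 / e" using ef by (auto simp: q_def indicator_def abs_le_iff)
    have supp: "\<forall>\<tau>. \<tau> \<notin> {s..t} \<longrightarrow> q \<tau> = 0 \<and> \<phi> \<tau> = 0"
    proof (intro allI impI)
      fix \<tau> assume \<tau>: "\<tau> \<notin> {s..t}"
      then have q0: "q \<tau> = 0" using sub by (auto simp: q_def indicator_def)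
      consider "\<tau> < 0" | "0 \<le> \<tau>" "\<tau> < s" | "t < \<tau>" using \<tau> by fastforce
      then have "\<phi> \<tau> = 0"
      proof cases
        case 2
        then have "F \<inter> {0..\<tau>} = {}" "E \<inter> {0..\<tau>} = {}" using sub by fastforce+
        then show ?thesis by (simp add: \<phi>_def \<phi>_eq)
      next
        case 3
        then have "F \<inter> {0..\<tau>} = F" "E \<inter> {0..\<tau>} = E" using sub s by fastforce+
        then show ?thesis using ef by (simp add: \<phi>_def \<phi>_eq e_def f_def)
      qed (simp add: \<phi>_def)
      then show "q \<tau> = 0 \<and> \<phi> \<tau> = 0" using q0 by simp
    qed
    have \<phi>1: "\<forall>\<tau>. \<bar>\<phi> \<tau>\<bar> \<le> 1"
    proof
      fix \<tau> show "\<bar>\<phi> \<tau>\<bar> \<le> 1" using ratio[of \<tau>] by (simp add: \<phi>_def \<phi>_eq abs_le_iff)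
    qed
    have "0 \<le> integral {0..N} (\<lambda>\<tau>. exp (- \<rho> * \<tau>) * (p (c \<tau>) * q \<tau>)) + K * (t - s)"
    proof (rule perturbation_optimal[OF V])
      fix d :: real assume d: "0 < d"
      show "\<exists>h1>0. \<forall>h. 0 < h \<and> h < h1 \<longrightarrow>
         ereal (J x g - h * (integral {0..N} (\<lambda>\<tau>. exp (- \<rho> * \<tau>) * (p (c \<tau>) * q \<tau>)) + K * (t - s) + d))
         \<le> VF (fst \<eta> + h * 0, snd \<eta>)"
        unfolding N_def by (rule P[OF s(1) _ s(3) qm qb supp \<phi>1 _ d]) (use s in \<open>auto simp: \<phi>_def\<close>)
    qed
    moreover have "integral {0..N} (\<lambda>\<tau>. exp (- \<rho> * \<tau>) * (p (c \<tau>) * q \<tau>)) \<le> \<beta> - \<alpha>"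
    proof -
      have i1: "(\<lambda>\<tau>. \<beta> / f * indicat_real F \<tau>) integrable_on {0..N}"
        by (rule integrable_on_mult_right) (use FI(2)[of N] in \<open>simp add: absolutely_integrable_on_def\<close>)
      have i2: "(\<lambda>\<tau>. \<alpha> / e * indicat_real E \<tau>) integrable_on {0..N}"
        by (rule integrable_on_mult_right) (use EI(2)[of N] in \<open>simp add: absolutely_integrable_on_def\<close>)
      have "integral {0..N} (\<lambda>\<tau>. exp (- \<rho> * \<tau>) * (p (c \<tau>) * q \<tau>))
          \<le> integral {0..N} (\<lambda>\<tau>. \<beta> / f * indicat_real F \<tau> - \<alpha> / e * indicat_real E \<tau>)"
      proof (rule integral_le)
        show "(\<lambda>\<tau>. exp (- \<rho> * \<tau>) * (p (c \<tau>) * q \<tau>)) integrable_on {0..N}"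
          using weighted_integrable[OF cD(1,3,4) qm qb[rule_format]] by (auto simp: N_def absolutely_integrable_on_def)
        show "(\<lambda>\<tau>. \<beta> / f * indicat_real F \<tau> - \<alpha> / e * indicat_real E \<tau>) integrable_on {0..N}"
          by (rule integrable_diff[OF i1 i2])
        fix \<tau>
        have "m \<tau> * (indicat_real F \<tau> / f) \<le> \<beta> / f * indicat_real F \<tau>"
          using \<beta>[of \<tau>] ef by (auto simp: indicator_def divide_right_mono)
        moreover have "\<alpha> / e * indicat_real E \<tau> \<le> m \<tau> * (indicat_real E \<tau> / e)"
          using \<alpha>[of \<tau>] ef by (auto simp: indicator_def divide_right_mono)
        moreover have "exp (- \<rho> * \<tau>) * (p (c \<tau>) * q \<tau>) = m \<tau> * (indicat_real F \<tau> / f) - m \<tau> * (indicat_real E \<tau> / e)"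
          unfolding m_def q_def by (simp only: right_diff_distrib mult.assoc)
        ultimately show "exp (- \<rho> * \<tau>) * (p (c \<tau>) * q \<tau>) \<le> \<beta> / f * indicat_real F \<tau> - \<alpha> / e * indicat_real E \<tau>"
          by linarith
      qed
      also have "\<dots> = \<beta> / f * integral {0..N} (indicat_real F) - \<alpha> / e * integral {0..N} (indicat_real E)"
        by (simp only: Henstock_Kurzweil_Integration.integral_diff[OF i1 i2] Henstock_Kurzweil_Integration.integral_mult_right)
      also have "integral {0..N} (indicat_real F) = f"
      proof -
        have "F \<inter> {0..N} = F" using sub s N by fastforce
        then show ?thesis using FI(1)[of N] by (simp add: f_def)
      qed
      also have "integral {0..N} (indicat_real E) = e"
      proof -
        have "E \<inter> {0..N} = E" using sub s N by fastforce
        then show ?thesis using EI(1)[of N] by (simp add: e_def)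
      qed
      finally show ?thesis using ef by simp
    qed
    ultimately show "\<alpha> - \<beta> \<le> K * (t - s)" by linarith
  qed
  then show ?thesis using K unfolding m_def by blast
qed

text \<open>\<open>U1\<close> is bounded and \<open>p\<close> decreasing, so R p(2R) is at most the
  increment of \<open>U1\<close> from R to 2R, hence at most 2 B. This turns a lower bound on
  marginal utility into an upper bound on consumption.\<close>

lemma marginal_vanishes:
  assumes "0 < \<kappa>"
  shows "\<exists>R>0. \<forall>z\<ge>R. p z < \<kappa>"
proof -
  define R where "R = 2 * B / \<kappa> + 1"
  have R: "0 < R" using B(1) assms by (simp add: R_def add_pos_pos)
  obtain z where z: "R < z" "z < 2 * R" "U1 (2 * R) - U1 R = (2 * R - R) * p z"
    by (rule U1_MVT[of R "2 * R"]) (use R in auto)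
  have "R * p (2 * R) \<le> R * p z" using p_le[of z "2 * R"] z R by (intro mult_left_mono) auto
  also have "\<dots> \<le> 2 * B" using z(3) B(2)[of R] B(2)[of "2 * R"] R by simp
  also have "\<dots> < R * \<kappa>" using assms by (simp add: R_def field_simps)
  finally have "p (2 * R) < \<kappa>" using R by simp
  then show ?thesis using R p_le[of "2 * R"] by (intro exI[of _ "2 * R"]) fastforce
qed

text \<open>The second derivative of \<open>U1\<close> is negative and continuous, hence bounded
  away from 0 on compact intervals. This transfers Lipschitz continuity from \<open>p (c t)\<close>
  to \<open>c t\<close>.\<close>

lemma marginal_inverse_lipschitz:
  assumes "0 < \<delta>"
  shows "\<exists>\<nu>>0. \<forall>u\<in>{\<delta>..R}. \<forall>v\<in>{\<delta>..R}. \<nu> * \<bar>u - v\<bar> \<le> \<bar>p u - p v\<bar>"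
proof (cases "\<delta> \<le> R")
  case True
  have "continuous_on {\<delta>..R} (deriv p)"
    using U1_C2 assms by (auto simp: C2_pos_def intro: continuous_on_subset)
  then obtain z where z: "z \<in> {\<delta>..R}" "\<And>y. y \<in> {\<delta>..R} \<Longrightarrow> deriv p y \<le> deriv p z"
    using continuous_attains_sup[of "{\<delta>..R}" "deriv p"] True by auto
  define \<nu> where "\<nu> = - deriv p z"
  have \<nu>: "0 < \<nu>" using U1_deriv2_neg[of z] z assms by (simp add: \<nu>_def)
  have *: "\<nu> * (v - u) \<le> p u - p v" if uv: "u \<in> {\<delta>..R}" "v \<in> {\<delta>..R}" "u < v" for u v
  proof -
    obtain y where y: "u < y" "y < v" "p v - p u = (v - u) * deriv p y"
    proof -
      have "(p has_real_derivative deriv p w) (at w)" if "u \<le> w" for w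
        using DERIV_p[of w] assms uv that by simp
      then show ?thesis using MVT2[OF uv(3), of p "deriv p"] that by blast
    qed
    have "deriv p y \<le> - \<nu>" using z(2)[of y] y uv by (simp add: \<nu>_def)
    then have "(v - u) * deriv p y \<le> (v - u) * (- \<nu>)" using that by (intro mult_left_mono) auto
    then show ?thesis using y by (simp add: mult.commute)
  qed
  have "\<nu> * \<bar>u - v\<bar> \<le> \<bar>p u - p v\<bar>" if "u \<in> {\<delta>..R}" "v \<in> {\<delta>..R}" for u v
    using *[OF that] *[OF that(2,1)] by (cases u v rule: linorder_cases) auto
  then show ?thesis using \<nu> by blast
qed (intro exI[of _ 1], auto)

text \<open>Off a null set the control lies between \<open>\<delta>\<close> and \<open>R\<close>,
  and its discounted marginal utility is Lipschitz. Undoing the discount and inverting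
  \<open>p\<close> makes the control Lipschitz there, so it extends to the closure, which is the
  whole interval.\<close>

lemma ctrl_locally_continuous:
  assumes \<eta>: "pos_history \<eta>" and x: "optimal \<eta> x g" and N: "0 < N"
  shows "\<exists>f \<delta>. 0 < \<delta> \<and> continuous_on {0..N} f \<and> (AE t in half_line. t \<le> N \<longrightarrow> f t = ctrl x g t) \<and> (\<forall>t\<in>{0..N}. \<delta> \<le> f t)"
proof -
  have ax: "adm \<eta> x g" using x by (auto simp: optimal_def)
  obtain \<delta> where \<delta>: "0 < \<delta>" "AE t in half_line. t \<le> N + 1 + T \<longrightarrow> \<delta> \<le> ctrl x g t"
    using optimal_ctrl_lower_bound[OF \<eta> x, of "N + 1 + T"] N T_pos by auto
  define c where "c t = max \<delta> (ctrl x g t)" for t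
  have cae: "AE t in half_line. t \<le> N + 1 + T \<longrightarrow> c t = ctrl x g t"
    using \<delta>(2) by eventually_elim (auto simp: c_def)
  have cm: "c \<in> borel_measurable (lebesgue_on {0..M})" for M
  proof -
    have "ctrl x g \<in> borel_measurable (lebesgue_on {0..M})"
      using ctrl_absolutely_integrable[OF ax] by (auto intro: absolutely_integrable_imp_borel_measurable)
    then show ?thesis unfolding c_def by simp
  qed
  have cv1: "ctrl_version x g (N + 1 + T) \<delta> c"
    using cm cae \<delta>(1) by (simp add: ctrl_version_def c_def)
  have cae': "AE t in half_line. t \<le> N + T \<longrightarrow> c t = ctrl x g t"
    using cae by eventually_elim auto
  have cv2: "ctrl_version x g (N + T) \<delta> c"
    using cm cae' \<delta>(1) by (simp add: ctrl_version_def c_def)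
  have c\<delta>: "\<delta> \<le> c t" for t by (simp add: c_def)
  have N0: "0 \<le> N" using N by simp
  obtain \<kappa> where \<kappa>: "0 < \<kappa>" "AE t in half_line. t \<le> N \<longrightarrow> \<kappa> \<le> p (c t)"
    using marginal_lower_bound[OF x N0 cv1] by blast
  obtain K Z1 where K: "0 \<le> K" "negligible Z1"
    "\<And>s t. s \<in> {0..N} - Z1 \<Longrightarrow> t \<in> {0..N} - Z1 \<Longrightarrow> \<bar>exp (- \<rho> * s) * p (c s) - exp (- \<rho> * t) * p (c t)\<bar> \<le> K * \<bar>s - t\<bar>"
    using discounted_marginal_lipschitz[OF x N0 cv2] by blast
  obtain R where R: "0 < R" "\<And>z. R \<le> z \<Longrightarrow> p z < \<kappa>" using marginal_vanishes[OF \<kappa>(1)] by blast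
  obtain \<nu> where \<nu>: "0 < \<nu>" "\<And>u v. u \<in> {\<delta>..R} \<Longrightarrow> v \<in> {\<delta>..R} \<Longrightarrow> \<nu> * \<bar>u - v\<bar> \<le> \<bar>p u - p v\<bar>"
    using marginal_inverse_lipschitz[OF \<delta>(1), of R] by blast
  have "AE t in half_line. t \<le> N \<longrightarrow> c t = ctrl x g t \<and> \<kappa> \<le> p (c t)"
    using cae \<kappa>(2) by eventually_elim (use T_pos in auto)
  then obtain Z2 where Z2: "negligible Z2" "\<And>t. 0 \<le> t \<Longrightarrow> t \<notin> Z2 \<Longrightarrow> t \<le> N \<Longrightarrow> c t = ctrl x g t \<and> \<kappa> \<le> p (c t)"
    by (auto simp: AE_half_line)
  define Z where "Z = Z1 \<union> Z2"
  have Z: "negligible Z" using K(2) Z2(1) by (simp add: Z_def)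
  define M where "M = (\<rho> * exp (\<rho> * N) * p \<delta> + exp (\<rho> * N) * K) / \<nu>"
  have p\<delta>: "0 < p \<delta>" by (rule U1_deriv_pos[OF \<delta>(1)])
  have lip: "M-lipschitz_on ({0..N} - Z) c"
  proof (rule lipschitz_onI)
    show "0 \<le> M" using \<nu>(1) rho_pos p\<delta> K(1) by (simp add: M_def)
    fix s t assume s: "s \<in> {0..N} - Z" and t: "t \<in> {0..N} - Z"
    have cR: "c u \<in> {\<delta>..R}" if "u \<in> {0..N} - Z" for u
    proof -
      have "\<kappa> \<le> p (c u)" using Z2(2)[of u] that by (auto simp: Z_def)
      then show ?thesis using R(2)[of "c u"] c\<delta>[of u] by fastforce
    qed
    define m where "m u = exp (- \<rho> * u) * p (c u)" for u
    have pm: "p (c u) = exp (\<rho> * u) * m u" for u by (simp add: m_def mult.assoc[symmetric] exp_minus)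
    have ms: "\<bar>m s\<bar> \<le> p \<delta>"
    proof -
      have "0 \<le> p (c s)" "p (c s) \<le> p \<delta>"
        using U1_deriv_pos[of "c s"] p_le[OF \<delta>(1) c\<delta>[of s]] c\<delta>[of s] \<delta>(1) by auto
      moreover have "exp (- \<rho> * s) \<le> 1" using s rho_pos by simp
      ultimately have "exp (- \<rho> * s) * p (c s) \<le> 1 * p \<delta>" by (intro mult_mono) auto
      then show ?thesis using \<open>0 \<le> p (c s)\<close> by (simp add: m_def abs_mult)
    qed
    have "p (c s) - p (c t) = (exp (\<rho> * s) - exp (\<rho> * t)) * m s + exp (\<rho> * t) * (m s - m t)"
      by (simp add: pm algebra_simps)
    then have "\<bar>p (c s) - p (c t)\<bar> \<le> \<bar>exp (\<rho> * s) - exp (\<rho> * t)\<bar> * \<bar>m s\<bar> + exp (\<rho> * t) * \<bar>m s - m t\<bar>"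
      using abs_triangle_ineq[of "(exp (\<rho> * s) - exp (\<rho> * t)) * m s" "exp (\<rho> * t) * (m s - m t)"] by (simp add: abs_mult)
    also have "\<dots> \<le> (\<rho> * exp (\<rho> * N) * \<bar>s - t\<bar>) * p \<delta> + exp (\<rho> * N) * (K * \<bar>s - t\<bar>)"
      using s t ms exp_diff_le[OF rho_pos, of s N t] K(3)[of s t] rho_pos
      by (intro add_mono mult_mono) (auto simp: m_def Z_def)
    also have "\<dots> = (\<rho> * exp (\<rho> * N) * p \<delta> + exp (\<rho> * N) * K) * \<bar>s - t\<bar>" by (simp add: algebra_simps)
    also have "\<rho> * exp (\<rho> * N) * p \<delta> + exp (\<rho> * N) * K = M * \<nu>" using \<nu>(1) by (simp add: M_def)
    finally have "\<nu> * \<bar>c s - c t\<bar> \<le> (M * \<nu>) * \<bar>s - t\<bar>" using \<nu>(2)[OF cR[OF s] cR[OF t]] by linarith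
    then have "\<nu> * \<bar>c s - c t\<bar> \<le> \<nu> * (M * \<bar>s - t\<bar>)" by (simp only: mult_ac)
    then show "dist (c s) (c t) \<le> M * dist s t" using \<nu>(1) by (simp add: dist_real_def)
  qed
  obtain f where f: "M-lipschitz_on (closure ({0..N} - Z)) f" "\<And>t. t \<in> {0..N} - Z \<Longrightarrow> f t = c t"
    using lipschitz_extend_closure[OF lip] by blast
  have cl: "closure ({0..N} - Z) = {0..N}" by (rule closure_interval_minus_negligible[OF Z N])
  have fc: "continuous_on {0..N} f" using lipschitz_on_continuous_on[OF f(1)] by (simp add: cl)
  have "\<delta> \<le> f t" if "t \<in> {0..N}" for t
  proof -
    have "continuous_on (closure ({0..N} - Z)) f" "t \<in> closure ({0..N} - Z)" using fc that by (simp_all add: cl)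
    then show ?thesis by (rule continuous_ge_on_closure) (simp add: f(2) c\<delta>)
  qed
  moreover have "AE t in half_line. t \<le> N \<longrightarrow> f t = ctrl x g t"
    unfolding AE_half_line using Z f(2) Z2(2) by (intro exI[of _ Z]) (auto simp: Z_def)
  ultimately show ?thesis using fc \<delta>(1) by blast
qed

text \<open>Continuous versions on growing intervals agree almost everywhere on the smaller one,
  hence everywhere there, and can be glued.\<close>

lemma continuous_ctrl:
  assumes \<eta>: "pos_history \<eta>" and x: "optimal \<eta> x g"
  shows "\<exists>c. continuous_on {0..} c \<and> (\<forall>t\<ge>0. 0 < c t) \<and> (AE t in half_line. c t = ctrl x g t)"
proof -
  have "\<exists>f. continuous_on {0..real (Suc n)} f \<and> (AE t in half_line. t \<le> real (Suc n) \<longrightarrow> f t = ctrl x g t) \<and> (\<forall>t\<in>{0..real (Suc n)}. 0 < f t)" for n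
  proof -
    have "0 < real (Suc n)" by simp
    from ctrl_locally_continuous[OF \<eta> x this] show ?thesis by (metis order_less_le_trans)
  qed
  then obtain f where f: "\<And>n. continuous_on {0..real (Suc n)} (f n)"
    "\<And>n. AE t in half_line. t \<le> real (Suc n) \<longrightarrow> f n t = ctrl x g t" "\<And>n t. t \<in> {0..real (Suc n)} \<Longrightarrow> 0 < f n t"
    by metis
  have eq: "f n t = f k t" if "n \<le> k" "t \<in> {0..real (Suc n)}" for n k t
  proof -
    have "AE t in half_line. t \<le> real (Suc n) \<longrightarrow> f n t = f k t"
      using f(2)[of n] f(2)[of k] by eventually_elim (use that(1) in auto)
    then obtain Z where Z: "negligible Z" "\<And>t. 0 \<le> t \<Longrightarrow> t \<notin> Z \<Longrightarrow> t \<le> real (Suc n) \<Longrightarrow> f n t = f k t"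
      by (auto simp: AE_half_line)
    have cl: "closure ({0..real (Suc n)} - Z) = {0..real (Suc n)}"
      by (rule closure_interval_minus_negligible[OF Z(1)]) simp
    have "continuous_on {0..real (Suc n)} (\<lambda>t. f n t - f k t)"
      using that(1) by (intro continuous_intros f(1) continuous_on_subset[OF f(1)[of k]]) auto
    then have "continuous_on (closure ({0..real (Suc n)} - Z)) (\<lambda>t. f n t - f k t)" by (simp only: cl)
    then have "f n t - f k t = 0"
    proof (rule continuous_constant_on_closure)
      show "f n u - f k u = 0" if "u \<in> {0..real (Suc n)} - Z" for u using Z(2)[of u] that by simp
      show "t \<in> closure ({0..real (Suc n)} - Z)" using that(2) by (simp only: cl)
    qed
    then show ?thesis by simp
  qed
  define k where "k t = nat \<lceil>t\<rceil>" for t :: real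
  have k: "t \<le> real (Suc (k t))" for t unfolding k_def by linarith
  have kmono: "k s \<le> k t" if "s \<le> t" for s t unfolding k_def by (intro nat_mono ceiling_mono that)
  define c where "c t = f (k t) t" for t
  have ck: "c t = f (k N) t" if "0 \<le> t" "t \<le> N" for t N
    unfolding c_def using eq[OF kmono[OF that(2)], of t] k[of t] that by simp
  have "continuous_on {0..} c"
  proof (rule continuous_on_half_line)
    fix N
    have "continuous_on {0..N} (f (k N))" using k[of N] by (intro continuous_on_subset[OF f(1)]) auto
    then show "continuous_on {0..N} c" by (rule continuous_on_cong[THEN iffD1, rotated 2]) (auto simp: ck)
  qed
  moreover have "0 < c t" if "0 \<le> t" for t unfolding c_def using f(3) k[of t] that by simp
  moreover have "AE t in half_line. c t = ctrl x g t"
  proof -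
    have "AE t in half_line. \<forall>n. t \<le> real (Suc n) \<longrightarrow> f n t = ctrl x g t"
      unfolding AE_all_countable using f(2) by simp
    then show ?thesis by eventually_elim (use k in \<open>auto simp: c_def\<close>)
  qed
  ultimately show ?thesis by blast
qed

subsection \<open>The derivative of the value function and the feedback law\<close>

lemma VF_pair:
  assumes "snd \<eta> absolutely_integrable_on {-T..0}" "- \<infinity> < VF \<eta>"
  shows "\<exists>x g. adm \<eta> x g \<and> fin x g"
proof (rule ccontr)
  assume "\<not> ?thesis"
  then have "VF \<eta> \<le> ereal z" for z using VF_le[OF assms(1), of z] by blast
  then have "VF \<eta> = - \<infinity>" by (rule ereal_bot)
  then show False using assms(2) by simp
qed

text \<open>Midpoint concavity of the value function in the first variable, by averaging nearly
  optimal pairs. It turns lower bounds at one side of \<open>z\<close> into upper bounds at the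
  other.\<close>

lemma VF_midpoint:
  assumes i: "\<eta>1 absolutely_integrable_on {-T..0}" and V: "VF (z, \<eta>1) = ereal V"
    and lb: "- \<infinity> < VF (z + h, \<eta>1)" "- \<infinity> < VF (z - h, \<eta>1)"
  shows "real_of_ereal (VF (z + h, \<eta>1)) + real_of_ereal (VF (z - h, \<eta>1)) \<le> 2 * V"
proof (rule field_le_epsilon)
  fix e :: real assume e: "0 < e"
  obtain x1 g1 where 1: "adm (z + h, \<eta>1) x1 g1" "fin x1 g1" using VF_pair[of "(z + h, \<eta>1)"] lb(1) i by auto
  obtain x2 g2 where 2: "adm (z - h, \<eta>1) x2 g2" "fin x2 g2" using VF_pair[of "(z - h, \<eta>1)"] lb(2) i by auto
  have e2: "0 < e / 2" using e by simp
  obtain y1 k1 where y1: "adm (z + h, \<eta>1) y1 k1" "fin y1 k1" "real_of_ereal (VF (z + h, \<eta>1)) - e / 2 < J y1 k1"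
    using VF_real(3)[OF 1 e2] by blast
  obtain y2 k2 where y2: "adm (z - h, \<eta>1) y2 k2" "fin y2 k2" "real_of_ereal (VF (z - h, \<eta>1)) - e / 2 < J y2 k2"
    using VF_real(3)[OF 2 e2] by blast
  define y where "y t = 1/2 * y1 t + 1/2 * y2 t" for t
  define k where "k t = 1/2 * k1 t + 1/2 * k2 t" for t
  have u: "(0::real) \<le> 1/2" "(1/2 + 1/2 :: real) = 1" by simp_all
  have adm: "adm (1/2 * (z + h) + 1/2 * (z - h), \<eta>1) y k"
    unfolding y_def[abs_def] k_def[abs_def] by (rule adm_mix[OF y1(1) y2(1) u(1) u(1) u(2)])
  have fin: "fin y k"
    unfolding y_def[abs_def] k_def[abs_def] by (rule fin_mix[OF y1(1) y2(1) u(1) u(1) u(2) y1(2) y2(2)])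
  have J: "1/2 * J y1 k1 + 1/2 * J y2 k2 \<le> J y k"
    unfolding y_def[abs_def] k_def[abs_def] by (rule J_mix[OF y1(1) y2(1) u(1) u(1) u(2) y1(2) y2(2)])
  have "1/2 * (z + h) + 1/2 * (z - h) = z" by (simp add: field_simps)
  then have "adm (z, \<eta>1) y k" using adm by simp
  from VF_real(2)[OF this fin] have "J y k \<le> V" using V by simp
  then show "real_of_ereal (VF (z + h, \<eta>1)) + real_of_ereal (VF (z - h, \<eta>1)) \<le> 2 * V + e"
    using J y1(3) y2(3) by linarith
qed

text \<open>Shifting the initial state by \<open>\<sigma> h\<close> and returning to the optimal state within time \<open>\<epsilon>\<close>
  changes the payoff by an average of the discounted marginal utility over \<open>[0, \<epsilon>]\<close>, up to
  \<open>O(\<epsilon> h)\<close>. Hence the possible kinks of \<open>f0\<close> do not show in \<open>V\<close> as \<open>\<epsilon>\<close> tends to zero.\<close>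

lemma value_lower_slope:
  assumes x: "optimal \<eta> x g" and c: "continuous_on {0..} c" "\<And>t. 0 \<le> t \<Longrightarrow> 0 < c t"
      "AE t in half_line. c t = ctrl x g t"
    and \<sigma>: "\<bar>\<sigma>\<bar> = 1" and e: "0 < e"
  shows "\<exists>h1>0. \<forall>h. 0 < h \<and> h < h1 \<longrightarrow> ereal (J x g + h * (\<sigma> * p (c 0) - 3 * e)) \<le> VF (fst \<eta> + h * \<sigma>, snd \<eta>)"
proof -
  have ax: "adm \<eta> x g" "fin x g" using x by (auto simp: optimal_def)
  define N where "N = 1 + T"
  have N: "1 \<le> N" using T_pos by (simp add: N_def)
  have cN: "continuous_on {0..N} c" by (rule continuous_on_subset[OF c(1)]) auto
  obtain t0 where t0: "t0 \<in> {0..N}" "\<And>t. t \<in> {0..N} \<Longrightarrow> c t0 \<le> c t"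
    using continuous_attains_inf[OF _ _ cN] N by auto
  have cv: "ctrl_version x g (1 + T) (c t0) c"
    unfolding ctrl_version_def N_def[symmetric]
  proof (intro conjI ballI t0(2))
    show "c \<in> borel_measurable (lebesgue_on {0..N})" using cN by (intro continuous_imp_measurable_on_sets_lebesgue) auto
    show "AE t in half_line. t \<le> N \<longrightarrow> c t = ctrl x g t" using c(3) by eventually_elim simp
    show "0 < c t0" using c(2)[of t0] t0(1) by simp
  qed
  note cD = ctrl_versionD[OF cv]
  obtain K where K: "0 \<le> K" and P: "\<And>s t q Q \<phi> \<phi>0 e. 0 \<le> s \<Longrightarrow> s \<le> t \<Longrightarrow> t \<le> 1 \<Longrightarrow> q \<in> borel_measurable lebesgue \<Longrightarrow> (\<forall>\<tau>. \<bar>q \<tau>\<bar> \<le> Q) \<Longrightarrow>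
     (\<forall>\<tau>. \<tau> \<notin> {s..t} \<longrightarrow> q \<tau> = 0 \<and> \<phi> \<tau> = 0) \<Longrightarrow> (\<forall>\<tau>. \<bar>\<phi> \<tau>\<bar> \<le> 1) \<Longrightarrow> (\<forall>\<tau>\<ge>0. \<phi> \<tau> = \<phi>0 + integral {0..\<tau>} q) \<Longrightarrow> 0 < e \<Longrightarrow>
     (\<exists>h1>0. \<forall>h. 0 < h \<and> h < h1 \<longrightarrow>
       ereal (J x g - h * (integral {0..1 + T} (\<lambda>\<tau>. exp (- \<rho> * \<tau>) * (p (c \<tau>) * q \<tau>)) + K * (t - s) + e))
         \<le> VF (fst \<eta> + h * \<phi>0, snd \<eta>))"
    using local_perturbation[OF ax cv zero_le_one] by blast
  define m where "m t = exp (- \<rho> * t) * p (c t)" for t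
  have mc: "continuous_on {0..} m"
    unfolding m_def by (intro continuous_intros continuous_on_compose2[OF p_cont c(1)]) (use c(2) in auto)
  have m0: "m 0 = p (c 0)" by (simp add: m_def)
  obtain d where d: "0 < d" "\<And>t. 0 \<le> t \<Longrightarrow> t < d \<Longrightarrow> \<bar>m t - m 0\<bar> < e"
  proof -
    have "\<forall>e>0. \<exists>d>0. \<forall>t\<in>{0..}. dist t 0 < d \<longrightarrow> dist (m t) (m 0) < e"
      using mc unfolding continuous_on_iff by (rule bspec) simp
    then obtain d where d: "0 < d" "\<forall>t\<in>{0..}. dist t 0 < d \<longrightarrow> dist (m t) (m 0) < e" using e by blast
    have "\<bar>m t - m 0\<bar> < e" if "0 \<le> t" "t < d" for t
      using bspec[OF d(2), of t] that by (simp add: dist_real_def)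
    then show ?thesis by (rule that[OF d(1)])
  qed
  \<comment> \<open>The return time fits the horizon 1, keeps \<open>m\<close> within
    \<open>e\<close> of its initial value, and makes the side effects \<open>K * \<epsilon>\<close>
    at most \<open>e\<close>. With the slack of the perturbation these are the three
    \<open>e\<close> of the claim.\<close>
  define \<epsilon> where "\<epsilon> = min (min 1 (d / 2)) (e / (K + 1))"
  have \<epsilon>: "0 < \<epsilon>" "\<epsilon> \<le> 1" "\<epsilon> < d" "K * \<epsilon> \<le> e"
  proof -
    show "0 < \<epsilon>" using d(1) e K by (simp add: \<epsilon>_def)
    show "\<epsilon> \<le> 1" by (simp add: \<epsilon>_def)
    have "\<epsilon> \<le> d / 2" unfolding \<epsilon>_def by (rule min.coboundedI1) simp
    then show "\<epsilon> < d" using d(1) by linarith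
    have "\<epsilon> \<le> e / (K + 1)" by (simp add: \<epsilon>_def)
    then have "K * \<epsilon> \<le> K * (e / (K + 1))" using K by (rule mult_left_mono)
    also have "\<dots> \<le> e" using K e by (simp add: field_simps)
    finally show "K * \<epsilon> \<le> e" .
  qed
  have Im: "{0..\<epsilon>} \<in> lmeasurable" by simp
  note II = integral_indicator_Int[OF Im]
  \<comment> \<open>With this density \<open>\<phi>\<close> runs linearly from
    \<open>\<sigma>\<close> to 0 on the interval from 0 to \<open>\<epsilon>\<close>.\<close>
  define q where "q \<tau> = - \<sigma> / \<epsilon> * indicat_real {0..\<epsilon>} \<tau>" for \<tau>
  define \<phi> where "\<phi> \<tau> = (if \<tau> < 0 then 0 else \<sigma> + integral {0..\<tau>} q)" for \<tau>
  have \<phi>_eq: "\<sigma> + integral {0..\<tau>} q = \<sigma> * (1 - min \<epsilon> \<tau> / \<epsilon>)" if "0 \<le> \<tau>" for \<tau>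
  proof -
    have "{0..\<epsilon>} \<inter> {0..\<tau>} = {0..min \<epsilon> \<tau>}" by auto
    then have "integral {0..\<tau>} (indicat_real {0..\<epsilon>}) = min \<epsilon> \<tau>" using II(1)[of \<tau>] \<epsilon> that by simp
    moreover have "integral {0..\<tau>} q = - \<sigma> / \<epsilon> * integral {0..\<tau>} (indicat_real {0..\<epsilon>})"
      unfolding q_def[abs_def] by (rule Henstock_Kurzweil_Integration.integral_mult_right)
    ultimately show ?thesis by (simp add: right_diff_distrib)
  qed
  have qm: "q \<in> borel_measurable lebesgue"
  proof -
    have "indicat_real {0..\<epsilon>} \<in> borel_measurable lebesgue" by (intro borel_measurable_indicator) simp
    then show ?thesis unfolding q_def by simp
  qed
  have qb: "\<forall>\<tau>. \<bar>q \<tau>\<bar> \<le> 1 / \<epsilon>" using \<sigma> \<epsilon>(1) by (auto simp: q_def indicator_def)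
  have supp: "\<forall>\<tau>. \<tau> \<notin> {0..\<epsilon>} \<longrightarrow> q \<tau> = 0 \<and> \<phi> \<tau> = 0"
  proof (intro allI impI)
    fix \<tau> assume \<tau>: "\<tau> \<notin> {0..\<epsilon>}"
    show "q \<tau> = 0 \<and> \<phi> \<tau> = 0"
    proof (cases "\<tau> < 0")
      case False
      then have "min \<epsilon> \<tau> = \<epsilon>" using \<tau> by auto
      then show ?thesis using \<tau> False \<phi>_eq[of \<tau>] \<epsilon>(1) by (simp add: q_def \<phi>_def)
    qed (simp add: q_def \<phi>_def)
  qed
  have \<phi>1: "\<forall>\<tau>. \<bar>\<phi> \<tau>\<bar> \<le> 1"
  proof
    fix \<tau>
    show "\<bar>\<phi> \<tau>\<bar> \<le> 1"
    proof (cases "\<tau> < 0")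
      case False
      then have "0 \<le> min \<epsilon> \<tau> / \<epsilon>" "min \<epsilon> \<tau> / \<epsilon> \<le> 1" using \<epsilon>(1) by auto
      then have "\<bar>1 - min \<epsilon> \<tau> / \<epsilon>\<bar> \<le> 1" by (simp add: abs_le_iff)
      then show ?thesis using False \<sigma> \<phi>_eq[of \<tau>] by (simp add: \<phi>_def abs_mult)
    qed (simp add: \<phi>_def)
  qed
  have \<phi>I: "\<forall>\<tau>\<ge>0. \<phi> \<tau> = \<sigma> + integral {0..\<tau>} q" by (simp add: \<phi>_def)
  have I: "integral {0..1 + T} (\<lambda>\<tau>. exp (- \<rho> * \<tau>) * (p (c \<tau>) * q \<tau>)) \<le> - \<sigma> * m 0 + e"
  proof -
    have "integral {0..1 + T} (\<lambda>\<tau>. exp (- \<rho> * \<tau>) * (p (c \<tau>) * q \<tau>))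
        \<le> integral {0..1 + T} (\<lambda>\<tau>. (- \<sigma> * m 0 + e) / \<epsilon> * indicat_real {0..\<epsilon>} \<tau>)"
    proof (rule integral_le)
      show "(\<lambda>\<tau>. exp (- \<rho> * \<tau>) * (p (c \<tau>) * q \<tau>)) integrable_on {0..1 + T}"
        using weighted_integrable[OF cD(1,3,4) qm qb[rule_format]] by (auto simp: absolutely_integrable_on_def)
      show "(\<lambda>\<tau>. (- \<sigma> * m 0 + e) / \<epsilon> * indicat_real {0..\<epsilon>} \<tau>) integrable_on {0..1 + T}"
        by (rule integrable_on_mult_right) (use II(2)[of "1 + T"] in \<open>simp add: absolutely_integrable_on_def\<close>)
      fix \<tau> assume "\<tau> \<in> {0..1 + T}"
      show "exp (- \<rho> * \<tau>) * (p (c \<tau>) * q \<tau>) \<le> (- \<sigma> * m 0 + e) / \<epsilon> * indicat_real {0..\<epsilon>} \<tau>"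
      proof (cases "\<tau> \<in> {0..\<epsilon>}")
        case True
        have "\<bar>m \<tau> - m 0\<bar> < e" using d(2)[of \<tau>] True \<epsilon> by auto
        moreover have "\<sigma> = 1 \<or> \<sigma> = - 1" using \<sigma> by linarith
        ultimately have "- \<sigma> * m \<tau> \<le> - \<sigma> * m 0 + e" by auto
        then have "- \<sigma> * m \<tau> / \<epsilon> \<le> (- \<sigma> * m 0 + e) / \<epsilon>" using \<epsilon>(1) by (intro divide_right_mono) auto
        then show ?thesis using True by (simp add: q_def m_def mult_ac)
      qed (simp add: q_def)
    qed
    also have "\<dots> = (- \<sigma> * m 0 + e) / \<epsilon> * integral {0..1 + T} (indicat_real {0..\<epsilon>})"
      by (rule Henstock_Kurzweil_Integration.integral_mult_right)
    also have "integral {0..1 + T} (indicat_real {0..\<epsilon>}) = \<epsilon>"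
    proof -
      have "{0..\<epsilon>} \<inter> {0..1 + T} = {0..\<epsilon>}" using \<epsilon> T_pos by auto
      then show ?thesis using II(1)[of "1 + T"] \<epsilon>(1) by simp
    qed
    finally show ?thesis using \<epsilon>(1) by simp
  qed
  obtain h1 where h1: "0 < h1" "\<And>h. 0 < h \<Longrightarrow> h < h1 \<Longrightarrow>
       ereal (J x g - h * (integral {0..1 + T} (\<lambda>\<tau>. exp (- \<rho> * \<tau>) * (p (c \<tau>) * q \<tau>)) + K * (\<epsilon> - 0) + e))
         \<le> VF (fst \<eta> + h * \<sigma>, snd \<eta>)"
    using P[OF order_refl less_imp_le[OF \<epsilon>(1)] \<epsilon>(2) qm qb supp \<phi>1 \<phi>I e] by blast
  show ?thesis
  proof (rule exI[of _ h1], rule conjI[OF h1(1)], intro allI impI)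
    fix h assume h: "0 < h \<and> h < h1"
    have "h * (integral {0..1 + T} (\<lambda>\<tau>. exp (- \<rho> * \<tau>) * (p (c \<tau>) * q \<tau>)) + K * (\<epsilon> - 0) + e)
        \<le> h * (- (\<sigma> * p (c 0) - 3 * e))"
      using h I \<epsilon>(4) unfolding m0 by (intro mult_left_mono) auto
    moreover have "h * (- (\<sigma> * p (c 0) - 3 * e)) = - (h * (\<sigma> * p (c 0) - 3 * e))" by (rule mult_minus_right)
    ultimately have "ereal (J x g + h * (\<sigma> * p (c 0) - 3 * e))
        \<le> ereal (J x g - h * (integral {0..1 + T} (\<lambda>\<tau>. exp (- \<rho> * \<tau>) * (p (c \<tau>) * q \<tau>)) + K * (\<epsilon> - 0) + e))"
      unfolding ereal_less_eq(3) by linarith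
    also have "\<dots> \<le> VF (fst \<eta> + h * \<sigma>, snd \<eta>)" using h h1(2) by blast
    finally show "ereal (J x g + h * (\<sigma> * p (c 0) - 3 * e)) \<le> VF (fst \<eta> + h * \<sigma>, snd \<eta>)" .
  qed
qed

text \<open>Lower bounds on the value function are available for shifts of both signs. Midpoint
  concavity converts each into the matching upper bound on the opposite side, so both one-sided
  slopes equal \<open>p (c 0)\<close>.\<close>

lemma value_has_derivative:
  assumes x: "optimal \<eta> x g" and c: "continuous_on {0..} c" "\<And>t. 0 \<le> t \<Longrightarrow> 0 < c t"
      "AE t in half_line. c t = ctrl x g t"
  shows "((\<lambda>z. real_of_ereal (VF (z, snd \<eta>))) has_real_derivative p (c 0)) (at (fst \<eta>))"
proof -
  have ax: "adm \<eta> x g" "fin x g" and V: "VF \<eta> = ereal (J x g)" using x by (auto simp: optimal_def)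
  define v where "v z = real_of_ereal (VF (z, snd \<eta>))" for z
  have v0: "v (fst \<eta>) = J x g" using V by (simp add: v_def)
  have "((\<lambda>k. (v (fst \<eta> + k) - v (fst \<eta>)) / k) \<longlongrightarrow> p (c 0)) (at 0)"
  proof (rule tendstoI)
    fix e' :: real assume e': "0 < e'"
    define e where "e = e' / 4"
    have e: "0 < e" using e' by (simp add: e_def)
    obtain h1 where h1: "0 < h1" "\<And>h. 0 < h \<Longrightarrow> h < h1 \<Longrightarrow> ereal (J x g + h * (1 * p (c 0) - 3 * e)) \<le> VF (fst \<eta> + h * 1, snd \<eta>)"
      using value_lower_slope[OF x c _ e, of 1] by auto
    obtain h2 where h2: "0 < h2" "\<And>h. 0 < h \<Longrightarrow> h < h2 \<Longrightarrow> ereal (J x g + h * (- 1 * p (c 0) - 3 * e)) \<le> VF (fst \<eta> + h * - 1, snd \<eta>)"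
      using value_lower_slope[OF x c _ e, of "- 1"] by auto
    have main: "\<bar>v (fst \<eta> + k) - J x g - k * p (c 0)\<bar> \<le> 3 * e * \<bar>k\<bar>" if k: "k \<noteq> 0" "\<bar>k\<bar> < min h1 h2" for k
    proof -
      define h where "h = \<bar>k\<bar>"
      have h: "0 < h" "h < h1" "h < h2" using k by (auto simp: h_def)
      have up: "ereal (J x g + h * (p (c 0) - 3 * e)) \<le> VF (fst \<eta> + h, snd \<eta>)"
        and dn: "ereal (J x g + h * (- p (c 0) - 3 * e)) \<le> VF (fst \<eta> - h, snd \<eta>)"
        using h1(2)[OF h(1,2)] h2(2)[OF h(1,3)] by simp_all
      have lb: "- \<infinity> < VF (fst \<eta> + h, snd \<eta>)" "- \<infinity> < VF (fst \<eta> - h, snd \<eta>)"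
        using up dn by (auto intro: less_le_trans)
      have V': "VF (fst \<eta>, snd \<eta>) = ereal (J x g)" using V by simp
      have mid: "v (fst \<eta> + h) + v (fst \<eta> - h) \<le> 2 * J x g"
        unfolding v_def by (rule VF_midpoint[OF adm_D(6)[OF ax(1)] V' lb])
      have real: "VF (z, snd \<eta>) = ereal (v z)" if "- \<infinity> < VF (z, snd \<eta>)" for z
      proof -
        have "\<exists>y b. adm (z, snd \<eta>) y b \<and> fin y b" by (rule VF_pair) (use adm_D(6)[OF ax(1)] that in simp_all)
        then show ?thesis using VF_real(1) unfolding v_def by blast
      qed
      have up': "J x g + h * p (c 0) - 3 * e * h \<le> v (fst \<eta> + h)"
        using up unfolding real[OF lb(1)] by (simp add: algebra_simps)
      have dn': "J x g - h * p (c 0) - 3 * e * h \<le> v (fst \<eta> - h)"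
        using dn unfolding real[OF lb(2)] by (simp add: algebra_simps)
      show ?thesis
      proof (cases "0 < k")
        case True
        then have kh: "k = h" by (simp add: h_def)
        show ?thesis unfolding kh using up' dn' mid h(1) by (simp add: abs_le_iff)
      next
        case False
        then have kh: "k = - h" by (simp add: h_def)
        show ?thesis unfolding kh using up' dn' mid h(1) by (simp add: abs_le_iff)
      qed
    qed
    show "\<forall>\<^sub>F k in at 0. dist ((v (fst \<eta> + k) - v (fst \<eta>)) / k) (p (c 0)) < e'"
      unfolding eventually_at
    proof (intro exI[of _ "min h1 h2"] conjI ballI impI)
      show "0 < min h1 h2" using h1 h2 by simp
      fix k :: real assume k: "k \<noteq> 0 \<and> dist k 0 < min h1 h2"
      have "(v (fst \<eta> + k) - v (fst \<eta>)) / k - p (c 0) = (v (fst \<eta> + k) - J x g - k * p (c 0)) / k"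
        using k by (simp add: v0 field_simps)
      then have "\<bar>(v (fst \<eta> + k) - v (fst \<eta>)) / k - p (c 0)\<bar> = \<bar>v (fst \<eta> + k) - J x g - k * p (c 0)\<bar> / \<bar>k\<bar>"
        by (simp add: abs_divide)
      also have "\<dots> \<le> 3 * e" using main[of k] k by (simp add: divide_le_eq dist_real_def)
      also have "\<dots> < e'" using e' by (simp add: e_def)
      finally show "dist ((v (fst \<eta> + k) - v (fst \<eta>)) / k) (p (c 0)) < e'" by (simp add: dist_real_def)
    qed
  qed
  then show ?thesis unfolding v_def DERIV_def .
qed

text \<open>\<open>arg_max\<close> chooses some maximizer, so the maximizer has to be shown unique;
  strict monotonicity of \<open>p\<close> makes \<open>c\<close> beat every other level.\<close>

lemma arg_max_marginal:
  assumes c: "0 < c"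
  shows "arg_max (\<lambda>z. U1 z - z * p c) (\<lambda>z. 0 \<le> z) = c"
proof -
  have less: "U1 z - z * p c < U1 c - c * p c" if z: "0 \<le> z" "z \<noteq> c" for z
  proof (cases "z < c")
    case True
    obtain y where y: "z < y" "y < c" "U1 c - U1 z = (c - z) * p y" by (rule U1_MVT[OF z(1) True])
    have "(c - z) * p c < (c - z) * p y" using p_less[of y c] y z True by (intro mult_strict_left_mono) auto
    then show ?thesis using y(3) by (simp add: algebra_simps)
  next
    case False
    then have zc: "c < z" using z by simp
    obtain y where y: "c < y" "y < z" "U1 z - U1 c = (z - c) * p y" by (rule U1_MVT[OF less_imp_le[OF c] zc])
    have "(z - c) * p y < (z - c) * p c" using p_less[of c y] y c zc by (intro mult_strict_left_mono) auto
    then show ?thesis using y(3) by (simp add: algebra_simps)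
  qed
  show ?thesis
    unfolding arg_max_def is_arg_max_def
  proof (rule some_equality)
    show "0 \<le> c \<and> \<not> (\<exists>y. 0 \<le> y \<and> U1 c - c * p c < U1 y - y * p c)"
      using c less by (metis less_asym less_imp_le order_less_irrefl)
    fix z assume "0 \<le> z \<and> \<not> (\<exists>y. 0 \<le> y \<and> U1 z - z * p c < U1 y - y * p c)"
    then show "z = c" using less[of z] c by (meson less_imp_le)
  qed
qed

lemma feedback_optimal:
  assumes x: "optimal \<eta> x g" and c: "continuous_on {0..} c" "\<And>t. 0 \<le> t \<Longrightarrow> 0 < c t"
      "AE t in half_line. c t = ctrl x g t"
  shows "feedback T \<rho> r a f0 U1 U2 \<eta> = c 0"
proof -
  have "value_deriv T \<rho> r a f0 U1 U2 \<eta> = p (c 0)"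
    unfolding value_deriv_def by (rule DERIV_imp_deriv[OF value_has_derivative[OF x c]])
  then show ?thesis unfolding feedback_def using arg_max_marginal[OF c(2)[of 0]] by simp
qed

text \<open>The tail from \<open>t\<close> is optimal for \<open>segment x t\<close>, and its
  continuous control starts with \<open>c t\<close>; so the identity at time 0 applies at every
  time.\<close>

lemma feedback_along_optimal:
  assumes x: "optimal \<eta> x g" and c: "continuous_on {0..} c" "\<And>t. 0 \<le> t \<Longrightarrow> 0 < c t"
      "AE t in half_line. c t = ctrl x g t" and t: "0 \<le> t"
  shows "feedback T \<rho> r a f0 U1 U2 (segment x t) = c t"
proof -
  have "feedback T \<rho> r a f0 U1 U2 (segment x t) = c (0 + t)"
  proof (rule feedback_optimal[OF optimal_tail[OF x t]])
    show "continuous_on {0..} (\<lambda>s. c (s + t))"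
      by (intro continuous_on_compose2[OF c(1)] continuous_intros) (use t in auto)
    show "0 < c (s + t)" if "0 \<le> s" for s using c(2) that t by simp
    obtain Z where Z: "negligible Z" "\<And>s. 0 \<le> s \<Longrightarrow> s \<notin> Z \<Longrightarrow> c s = ctrl x g s"
      using c(3) by (auto simp: AE_half_line)
    have "negligible ((\<lambda>u. - t + u) ` Z)" by (rule negligible_translation[OF Z(1)])
    moreover have "c (s + t) = ctrl (\<lambda>s. x (s + t)) (\<lambda>s. g (s + t)) s" if s: "0 \<le> s" "s \<notin> (\<lambda>u. - t + u) ` Z" for s
    proof -
      have "s + t \<notin> Z"
      proof
        assume "s + t \<in> Z"
        then have "- t + (s + t) \<in> (\<lambda>u. - t + u) ` Z" by blast
        with s show False by simp
      qed
      then show ?thesis using Z(2)[of "s + t"] s t by (simp add: ctrl_def drift_shift)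
    qed
    ultimately show "AE s in half_line. c (s + t) = ctrl (\<lambda>s. x (s + t)) (\<lambda>s. g (s + t)) s"
      unfolding AE_half_line by blast
  qed
  then show ?thesis by simp
qed

lemma segment_L2:
  assumes x: "adm \<eta> x g" and \<eta>: "snd \<eta> \<in> L2 T" and t: "0 \<le> t"
  shows "snd (segment x t) \<in> L2 T"
proof -
  have u: "(\<lambda>\<xi>. (snd \<eta> \<xi>)\<^sup>2) absolutely_integrable_on {-T..0}"
    using \<eta> by (simp add: L2_def integrable_lebesgue_on_iff)
  have "hist (\<lambda>s. (x s)\<^sup>2)"
  proof (rule histI[OF u])
    show "(x s)\<^sup>2 = (snd \<eta> s)\<^sup>2" if "-T \<le> s" "s < 0" for s using trajD(1)[OF adm_D(1)[OF x] that] by simp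
    show "(\<lambda>s. (x s)\<^sup>2) absolutely_integrable_on {0..t}" for t
      by (intro absolutely_integrable_continuous_real continuous_intros continuous_on_subset[OF adm_D(5)[OF x]]) auto
  qed
  from hist_segment[OF this t] have "integrable (lebesgue_on {-T..0}) (\<lambda>\<xi>. (x (t + \<xi>))\<^sup>2)"
    by (simp add: integrable_lebesgue_on_iff)
  moreover have "(\<lambda>\<xi>. x (t + \<xi>)) \<in> borel_measurable (lebesgue_on {-T..0})"
    using hist_segment[OF adm_D(4)[OF x] t] by (auto intro: absolutely_integrable_imp_borel_measurable)
  ultimately show ?thesis by (simp add: L2_def segment_def)
qed

lemma closed_loop:
  assumes \<eta>: "\<eta> \<in> H_plus_plus T"
  shows "\<exists>x. closed_loop_solution T \<rho> r a f0 U1 U2 \<eta> x \<and> C1_half_line x \<and>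
             (\<forall>t\<ge>0. x t > 0 \<and> segment x t \<in> value_dom T \<rho> r a f0 U1 U2) \<and>
             (\<lambda>t. feedback T \<rho> r a f0 U1 U2 (segment x t)) \<in> admissible T r a f0 \<eta>"
proof -
  have \<eta>': "0 < fst \<eta>" "snd \<eta> \<in> L2 T" "AE \<xi> in lebesgue_on {-T..0}. 0 \<le> snd \<eta> \<xi>"
    using \<eta> by (auto simp: H_plus_plus_def)
  have \<eta>i: "snd \<eta> absolutely_integrable_on {-T..0}" by (rule L2_absolutely_integrable[OF \<eta>'(2)])
  have pos: "pos_history \<eta>" using \<eta>' \<eta>i by (simp add: pos_history_def)
  obtain x g where x: "optimal \<eta> x g" using exists_optimal[OF pos] by blast
  have ax: "adm \<eta> x g" using x by (simp add: optimal_def)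
  obtain c where c: "continuous_on {0..} c" "\<And>t. 0 \<le> t \<Longrightarrow> 0 < c t" "AE t in half_line. c t = ctrl x g t"
    using continuous_ctrl[OF pos x] by blast
  let ?fb = "\<lambda>t. feedback T \<rho> r a f0 U1 U2 (segment x t)"
  have fb: "?fb t = c t" if "0 \<le> t" for t by (rule feedback_along_optimal[OF x c that])
  have xp: "0 < x t" if "0 \<le> t" for t by (rule adm_D(2)[OF ax that])
  \<comment> \<open>The density is replaced by its continuous version, equal almost everywhere, so
    that the state becomes differentiable at every time with continuous derivative.\<close>
  define x' where "x' t = D x t - c t" for t
  have x'c: "continuous_on {0..} x'"
    unfolding x'_def by (intro continuous_intros c(1) continuous_on_drift adm_D[OF ax])
  have traj: "traj \<eta> x x'"
  proof (rule traj_cong_AE[OF traj_ctrl[OF ax]])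
    show "AE t in half_line. x' t = D x t - ctrl x g t"
      using c(3) by eventually_elim (simp add: x'_def)
  qed
  have deriv: "(x has_real_derivative x' t) (at t within {0..})" if t: "0 \<le> t" for t
  proof -
    have "continuous_on {0..t + 1} x'" by (rule continuous_on_subset[OF x'c]) auto
    from integral_has_real_derivative[OF this, of t]
    have "((\<lambda>s. fst \<eta> + integral {0..s} x') has_real_derivative x' t) (at t within {0..t + 1})"
      using t by (auto intro!: derivative_eq_intros)
    moreover have "at t within {0..t + 1} = at t within {0..}"
      by (rule at_within_nhd[of _ "{..<t + 1}"]) auto
    ultimately have "((\<lambda>s. fst \<eta> + integral {0..s} x') has_real_derivative x' t) (at t within {0..})" by simp
    then show ?thesis
      by (rule has_field_derivative_transform_within[where d = 1]) (use t trajD(4)[OF traj] in auto)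
  qed
  have "closed_loop_solution T \<rho> r a f0 U1 U2 \<eta> x"
    unfolding closed_loop_solution_def using trajD(1,5)[OF traj] deriv fb by (simp add: x'_def)
  moreover have "C1_half_line x" unfolding C1_half_line_def using deriv x'c by blast
  moreover have "segment x t \<in> value_dom T \<rho> r a f0 U1 U2" if t: "0 \<le> t" for t
  proof -
    have "segment x t \<in> H_plus T"
      using xp[OF t] segment_L2[OF ax \<eta>'(2) t] by (simp add: H_plus_def segment_def)
    moreover have "- \<infinity> < VF (segment x t)" using optimal_tail[OF x t] by (simp add: optimal_def)
    ultimately show ?thesis by (simp add: value_dom_def)
  qed
  moreover have "?fb \<in> admissible T r a f0 \<eta>"
  proof -
    have "traj \<eta> x (\<lambda>t. D x t - ?fb t)"
    proof (rule traj_cong_AE[OF traj])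
      show "AE t in half_line. D x t - ?fb t = x' t"
        using AE_half_line_nonneg by eventually_elim (simp add: x'_def fb)
    qed
    then have st: "state T r a f0 \<eta> ?fb t = x t" if "0 \<le> t" for t
      by (rule state_eq[OF \<eta>i]) (use that T_pos in simp)
    have "?fb absolutely_integrable_on {0..t}" for t
    proof (rule absolutely_integrable_spike[OF _ negligible_empty])
      show "c absolutely_integrable_on {0..t}"
        by (rule absolutely_integrable_continuous_real[OF continuous_on_subset[OF c(1)]]) auto
    qed (simp add: fb)
    then show ?thesis
      unfolding admissible_def using fb c(2) st xp by (simp add: integrable_lebesgue_on_iff less_imp_le)
  qed
  ultimately show ?thesis using xp by blast
qed

end

section \<open>Reduction of the theorem to the control problem\<close>

lemma W12_continuous:
  assumes "u \<in> W12 T"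
  shows "continuous_on {-T..0} u"
proof -
  obtain w where w: "w \<in> L2 T" "\<And>\<xi>. \<xi> \<in> {-T..0} \<Longrightarrow> u \<xi> = u (-T) + integral\<^sup>L (lebesgue_on {-T..\<xi>}) w"
    using assms unfolding W12_def mem_Collect_eq by blast
  have "integrable (lebesgue_on {-T..0}) w"
    using L2_absolutely_integrable[OF w(1)] by (simp add: integrable_lebesgue_on_iff)
  then have "continuous_on {-T..0} (\<lambda>\<xi>. u (-T) + integral\<^sup>L (lebesgue_on {-T..\<xi>}) w)"
    by (intro continuous_intros indefinite_integral_continuous_real)
  then show ?thesis by (rule continuous_on_eq) (rule w(2)[symmetric])
qed

theorem proposition3p11:
  fixes T \<rho> r Cf :: real
    and a U1 U2 :: "real \<Rightarrow> real"
    and f0 :: "real \<Rightarrow> real \<Rightarrow> real"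
    and \<eta> :: "real \<times> (real \<Rightarrow> real)"
  assumes "T > 0" and "\<rho> > 0" and "r > 0"
    and a_W12: "a \<in> W12 T"
    and a_nonneg: "\<forall>\<xi>\<in>{-T..0}. 0 \<le> a \<xi>"
    and a_left: "a (-T) = 0"
    and f0_concave: "concave_on ({0..} \<times> UNIV) (\<lambda>(x, y). f0 x y)"
    and f0_mono: "\<forall>x\<ge>0. mono (f0 x)"
    and f0_Lipschitz: "Cf-lipschitz_on ({0..} \<times> UNIV) (\<lambda>(x, y). f0 x y)"
    and f0_pos: "\<forall>y>0. f0 0 y > 0"
    and U1_cont: "continuous_on {0..} U1"
    and U1_C2: "C2_pos U1"
    and U1_bounded: "bounded (U1 ` {0..})"
    and U1_deriv_pos: "\<forall>x>0. deriv U1 x > 0"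
    and U1_deriv_0: "filterlim (deriv U1) at_top (at_right 0)"
    and U1_deriv2_neg: "\<forall>x>0. deriv (deriv U1) x < 0"
    and U2_cont: "continuous_on {0<..} U2"
    and U2_mono: "mono_on {0<..} U2"
    and U2_concave: "concave_on {0<..} U2"
    and U2_bdd: "bdd_above (U2 ` {0<..})"
    and U2_int: "ext_integral {0..} (\<lambda>t. exp (- \<rho> * t) * U2 (exp (- Cf * t))) > -\<infinity>"
    and U2_not_int: "\<forall>\<delta>>0. ext_integral {0<..\<delta>} U2 = -\<infinity>"
    and a_mass: "\<forall>\<epsilon>. 0 < \<epsilon> \<and> \<epsilon> \<le> T \<longrightarrow> integral\<^sup>L (lebesgue_on {-\<epsilon>..0}) a > 0"
    and \<eta>: "\<eta> \<in> H_plus_plus T"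
  shows "\<exists>x. closed_loop_solution T \<rho> r a f0 U1 U2 \<eta> x \<and> C1_half_line x \<and>
             (\<forall>t\<ge>0. x t > 0 \<and> segment x t \<in> value_dom T \<rho> r a f0 U1 U2) \<and>
             (\<lambda>t. feedback T \<rho> r a f0 U1 U2 (segment x t)) \<in> admissible T r a f0 \<eta>"
proof -
  \<comment> \<open>Positivity is assumed only for y > 0; Lipschitz continuity carries the weak
    inequality to the limit y = 0.\<close>
  have zero: "0 \<le> f0 0 0"
  proof (rule field_le_epsilon)
    fix e :: real assume e: "0 < e"
    have C: "0 \<le> Cf" by (rule lipschitz_on_nonneg[OF f0_Lipschitz])
    define y where "y = e / (Cf + 1)"
    have y: "0 < y" using e C by (simp add: y_def)
    have "Cf * y \<le> e" using C e by (simp add: y_def field_simps)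
    moreover have "\<bar>f0 0 y - f0 0 0\<bar> \<le> Cf * y"
      using lipschitz_onD[OF f0_Lipschitz, of "(0, y)" "(0, 0)"] y by (simp add: dist_prod_def dist_real_def)
    moreover have "0 < f0 0 y" using f0_pos y by simp
    ultimately show "0 \<le> f0 0 0 + e" by linarith
  qed
  have "control_problem T r Cf a f0 \<rho> U1 U2"
  proof
    show "continuous_on {-T..0} a" by (rule W12_continuous[OF a_W12])
  qed (use assms zero in auto)
  then show ?thesis using \<eta> by (rule control_problem.closed_loop)
qed

end
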